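(* Let $n\ge 2$ and let $I_n$ be the Coxeter group with two generators $g_1,g_2$ and relations $g_1^2=g_2^2=1$, $(g_1g_2)^n=1$ (so $I_n$ is isomorphic to the dihedral group of order $2n$). Then every diagram for $I_n$ is homotopic to the empty diagram.
   Context: Diagrams. Assign to each of the generators $g_1,g_2$ its own color. A diagram for $I_n$ is a finite planar graph (multiple edges allowed), together with finitely many disjoint embedded circles (closed edges without vertices), drawn in the plane and considered up to planar isotopy, such that every edge and circle is colored by $g_1$ or $g_2$, and every vertex has degree $2n$ with incident edges alternating cyclically between the colors of $g_1$ and $g_2$. The empty diagram has no vertices, edges or circles. Homotopy. Two diagrams are homotopic if one can be transformed into the other by finitely many of the following moves and their inverses, each replacing the part of the diagram inside a closed disc and leaving the rest unchanged. (1) Circle relation: remove a circle of any color whose interior is empty. (2) Bridge relation: if the disc meets the diagram in exactly two disjoint arcs of the same color, replace them by the other pair of disjoint arcs joining the same four boundary points. (3) Cancellation of pairs: the picture consisting of $n$ strands of alternating colors $g_1,g_2$ entering from the bottom into a vertex of degree $2n$, whose $n$ upper edges are exactly the $n$ lower edges of a second vertex of degree $2n$, from which $n$ strands leave at the top, may be replaced by $n$ parallel vertical strands (for either choice of the leftmost color). (For general Coxeter groups there are additional relations attached to triples of generators; there are none for $I_n$.) *)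

theory Defs
  imports "HOL-Analysis.Analysis"
begin

text \<open>
  The plane is \<open>complex\<close>. The two generators of \<open>I\<^sub>n\<close> serve as the two colors; the group enters
  the notion of a diagram only through them and the exponent \<open>n\<close> of the relation
  \<open>(g\<^sub>1 g\<^sub>2)\<^sup>n = 1\<close>, which fixes the degree \<open>2 n\<close> of the vertices.
\<close>

datatype gen = G1 | G2

fun other :: "gen \<Rightarrow> gen" where
  "other G1 = G2"
| "other G2 = G1"


subsection \<open>Diagrams\<close>

text \<open>
  Edges and circles are closed point sets together with their color; an edge contains its end
  vertices. Parallel edges are different point sets.
\<close>

record diagram =
  verts :: "complex set"
  edges :: "(gen \<times> complex set) set"
  circles :: "(gen \<times> complex set) set"

definition empty_diagram :: diagram where
  "empty_diagram = \<lparr>verts = {}, edges = {}, circles = {}\<rparr>"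

definition strands :: "diagram \<Rightarrow> gen \<Rightarrow> complex set" where
  "strands D c = \<Union> {A. (c, A) \<in> edges D \<union> circles D}"

definition map_diagram :: "(complex \<Rightarrow> complex) \<Rightarrow> diagram \<Rightarrow> diagram" where
  "map_diagram f D =
     \<lparr>verts = f ` verts D,
      edges = (\<lambda>(c, A). (c, f ` A)) ` edges D,
      circles = (\<lambda>(c, A). (c, f ` A)) ` circles D\<rparr>"

definition polygonal :: "complex set \<Rightarrow> bool" where
  "polygonal A \<longleftrightarrow> (\<exists>S. finite S \<and> A = (\<Union>(a, b)\<in>S. closed_segment a b))"

text \<open>A \<open>simple_path\<close> may be closed, so loops at a vertex are included.\<close>

definition is_edge :: "complex set \<Rightarrow> complex set \<Rightarrow> bool" where
  "is_edge V A \<longleftrightarrow>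
     (\<exists>g. simple_path g \<and> path_image g = A \<and>
          pathstart g \<in> V \<and> pathfinish g \<in> V \<and> A \<inter> V = {pathstart g, pathfinish g})"

definition is_circle :: "complex set \<Rightarrow> complex set \<Rightarrow> bool" where
  "is_circle V A \<longleftrightarrow>
     (\<exists>g. simple_path g \<and> path_image g = A \<and> pathfinish g = pathstart g \<and> A \<inter> V = {})"

text \<open>
  For a polygonal drawing the part of the diagram close to a vertex \<open>v\<close> consists of straight
  rays; there are \<open>2 n\<close> of them (a loop contributes two), in counterclockwise order of their
  angles \<open>\<theta> 0 < \<dots> < \<theta> (2 n - 1) < \<theta> 0 + 2 \<pi>\<close>, with alternating colors.
\<close>

definition alternating_at :: "nat \<Rightarrow> diagram \<Rightarrow> complex \<Rightarrow> bool" where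
  "alternating_at n D v \<longleftrightarrow>
     (\<exists>\<epsilon>>0. \<exists>\<theta> :: nat \<Rightarrow> real.
        (\<forall>i j. i < j \<and> j < 2 * n \<longrightarrow> \<theta> i < \<theta> j \<and> \<theta> j < \<theta> i + 2 * pi) \<and>
        (\<forall>c. strands D c \<inter> ball v \<epsilon> =
              {v + of_real r * cis (\<theta> k) | r k.
                 0 \<le> r \<and> r < \<epsilon> \<and> k < 2 * n \<and> (even k \<longleftrightarrow> c = G1)}))"

definition polygonal_diagram :: "nat \<Rightarrow> diagram \<Rightarrow> bool" where
  "polygonal_diagram n D \<longleftrightarrow>
     finite (verts D) \<and> finite (edges D) \<and> finite (circles D) \<and>
     (\<forall>(c, A) \<in> edges D. is_edge (verts D) A \<and> polygonal A) \<and>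
     (\<forall>(c, A) \<in> circles D. is_circle (verts D) A \<and> polygonal A) \<and>
     (\<forall>x \<in> edges D \<union> circles D. \<forall>y \<in> edges D \<union> circles D.
        x \<noteq> y \<longrightarrow> snd x \<inter> snd y \<subseteq> verts D) \<and>
     (\<forall>v \<in> verts D. alternating_at n D v)"

text \<open>
  Edges and circles of a diagram are arbitrary simple curves. By the Schoenflies theorem, every
  finite graph (with circles) embedded in the plane by simple curves is carried to a polygonal
  one by a homeomorphism of the plane, so the following comprises all drawings; passing to the
  polygonal picture gives a meaning to the cyclic order of the edges around a vertex. Alternation
  does not depend on the choice of the homeomorphism, nor on its orientation.
\<close>

definition is_diagram :: "nat \<Rightarrow> diagram \<Rightarrow> bool" where
  "is_diagram n D \<longleftrightarrow>
     (\<exists>f f' P. homeomorphism UNIV UNIV f f' \<and> polygonal_diagram n P \<and> D = map_diagram f P)"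


subsection \<open>Planar isotopy\<close>

definition planar_isotopic :: "diagram \<Rightarrow> diagram \<Rightarrow> bool" where
  "planar_isotopic D D' \<longleftrightarrow>
     (\<exists>H :: real \<times> complex \<Rightarrow> complex.
        continuous_on ({0..1} \<times> UNIV) H \<and>
        (\<forall>t\<in>{0..1}. \<exists>k. homeomorphism UNIV UNIV (\<lambda>z. H (t, z)) k) \<and>
        (\<forall>z. H (0, z) = z) \<and>
        D' = map_diagram (\<lambda>z. H (1, z)) D)"


subsection \<open>Moves\<close>

text \<open>
  A diagram is determined by its vertices and the point sets of its two colors, so the moves
  inside a disc are described in terms of these.
\<close>

definition closed_disc :: "complex set \<Rightarrow> bool" where
  "closed_disc K \<longleftrightarrow> K homeomorphic cball (0 :: complex) 1"

definition same_outside :: "complex set \<Rightarrow> diagram \<Rightarrow> diagram \<Rightarrow> bool" where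
  "same_outside K D D' \<longleftrightarrow>
     verts D - K = verts D' - K \<and> (\<forall>c. strands D c - K = strands D' c - K)"

definition circle_move :: "diagram \<Rightarrow> diagram \<Rightarrow> bool" where
  "circle_move D D' \<longleftrightarrow>
     (\<exists>c A. (c, A) \<in> circles D \<and>
        inside A \<inter> (verts D \<union> strands D G1 \<union> strands D G2) = {} \<and>
        D' = D\<lparr>circles := circles D - {(c, A)}\<rparr>)"

definition arc_across :: "complex set \<Rightarrow> complex \<Rightarrow> complex \<Rightarrow> complex set \<Rightarrow> bool" where
  "arc_across K p q A \<longleftrightarrow>
     (\<exists>g. arc g \<and> path_image g = A \<and> pathstart g = p \<and> pathfinish g = q) \<and>
     A \<subseteq> K \<and> A \<inter> frontier K = {p, q}"

definition bridge_move :: "diagram \<Rightarrow> diagram \<Rightarrow> bool" where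
  "bridge_move D D' \<longleftrightarrow>
     (\<exists>K c p q r s A B A' B'.
        closed_disc K \<and> same_outside K D D' \<and>
        arc_across K p q A \<and> arc_across K r s B \<and> A \<inter> B = {} \<and>
        arc_across K q r A' \<and> arc_across K s p B' \<and> A' \<inter> B' = {} \<and>
        verts D \<inter> K = {} \<and> strands D c \<inter> K = A \<union> B \<and> strands D (other c) \<inter> K = {} \<and>
        verts D' \<inter> K = {} \<and> strands D' c \<inter> K = A' \<union> B' \<and> strands D' (other c) \<inter> K = {})"

text \<open>
  The model picture for the cancellation of pairs lives in the rectangle
  \<open>[0, n + 1] \<times> [0, 4]\<close>. The \<open>i\<close>-th strand from the left enters at \<open>(i, 0)\<close> and leaves at
  \<open>(i, 4)\<close>, for \<open>1 \<le> i \<le> n\<close>; the \<open>i\<close>-th middle edge joins the two vertices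
  \<open>((n + 1)/2, 1)\<close> and \<open>((n + 1)/2, 3)\<close> through \<open>(i, 2)\<close>. Alternation at the vertices forces its
  color to be the other one than that of the \<open>i\<close>-th strand. The leftmost strand has color \<open>c\<close>.
\<close>

definition strand_color :: "gen \<Rightarrow> nat \<Rightarrow> gen" where
  "strand_color c i = (if odd i then c else other c)"

definition model_rect :: "nat \<Rightarrow> complex set" where
  "model_rect n = {z. 0 \<le> Re z \<and> Re z \<le> real n + 1 \<and> 0 \<le> Im z \<and> Im z \<le> 4}"

definition lower_vertex :: "nat \<Rightarrow> complex" where
  "lower_vertex n = Complex ((real n + 1) / 2) 1"

definition upper_vertex :: "nat \<Rightarrow> complex" where
  "upper_vertex n = Complex ((real n + 1) / 2) 3"

definition pair_picture :: "nat \<Rightarrow> gen \<Rightarrow> gen \<Rightarrow> complex set" where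
  "pair_picture n c d =
     (\<Union>i \<in> {i \<in> {1..n}. strand_color c i = d}.
        closed_segment (Complex (real i) 0) (lower_vertex n) \<union>
        closed_segment (upper_vertex n) (Complex (real i) 4)) \<union>
     (\<Union>i \<in> {i \<in> {1..n}. other (strand_color c i) = d}.
        closed_segment (lower_vertex n) (Complex (real i) 2) \<union>
        closed_segment (Complex (real i) 2) (upper_vertex n))"

definition parallel_picture :: "nat \<Rightarrow> gen \<Rightarrow> gen \<Rightarrow> complex set" where
  "parallel_picture n c d =
     (\<Union>i \<in> {i \<in> {1..n}. strand_color c i = d}.
        closed_segment (Complex (real i) 0) (Complex (real i) 4))"

definition cancel_move :: "nat \<Rightarrow> diagram \<Rightarrow> diagram \<Rightarrow> bool" where
  "cancel_move n D D' \<longleftrightarrow>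
     (\<exists>K \<phi> \<phi>' c.
        homeomorphism (model_rect n) K \<phi> \<phi>' \<and> same_outside K D D' \<and>
        verts D \<inter> K = \<phi> ` {lower_vertex n, upper_vertex n} \<and>
        (\<forall>d. strands D d \<inter> K = \<phi> ` pair_picture n c d) \<and>
        verts D' \<inter> K = {} \<and>
        (\<forall>d. strands D' d \<inter> K = \<phi> ` parallel_picture n c d))"


subsection \<open>Homotopy\<close>

definition move :: "nat \<Rightarrow> diagram \<Rightarrow> diagram \<Rightarrow> bool" where
  "move n D D' \<longleftrightarrow>
     is_diagram n D \<and> is_diagram n D' \<and>
     (planar_isotopic D D' \<or> circle_move D D' \<or> bridge_move D D' \<or> cancel_move n D D')"

definition homotopic :: "nat \<Rightarrow> diagram \<Rightarrow> diagram \<Rightarrow> bool" where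
  "homotopic n = equivclp (move n)"

end

theory Submission
  imports Defs
begin

text \<open>
  Induction on the number of vertices. Without vertices, innermost circles are removed one by one.
  Otherwise alternation forbids that all edges are loops, so some edge joins two different vertices.
  A piecewise affine homeomorphism of the plane makes this edge the segment from \<open>-1\<close> to \<open>1\<close> and
  brings the other half-edges at its two ends into a standard position in a large rectangle. The
  \<open>n - 1\<close> pairs of half-edges of equal color on the upper side of the segment are then reconnected by
  bridge moves, the innermost pair first. Now \<open>n\<close> parallel edges join the two vertices, which cancel.
\<close>

subsection \<open>Plane homeomorphisms\<close>

text \<open>Alternation is defined through straight rays, so all diagrams are kept polygonal and all
  changes of coordinates piecewise affine. The latter need not be isotopies and may reverse the
  orientation: a homeomorphism of the plane carries moves to moves and fixes the empty diagram, so
  null-homotopies can be pulled back. The moves speak of the point sets of the colors, whereas a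
  diagram lists edges and circles. Reconnecting strands changes which arcs make up an edge and may
  split off a circle; this is handled once, by cutting at the boundary of the disc, exchanging the
  inner pieces and gluing again. A bridge disc may contain nothing but its two arcs. The half-edges
  are therefore squeezed into strands close to the imaginary axis that spread more the farther they
  are from the edge, so that a trapezoid separates one pair from the others. With
  \<open>\<eta> = 1 / (4 * n^2)\<close> the slanted legs of the \<open>j\<close>-th pair enter its
  trapezoid above the lower side at height \<open>j - 1/2\<close>. Alternation enters twice: in the
  parity count for loops, and in giving the two fans the same colors at the same positions.\<close>

lemma strands_map: "strands (map_diagram f D) c = f ` strands D c"
  by (auto simp: strands_def map_diagram_def image_iff; force)

lemma verts_map [simp]: "verts (map_diagram f D) = f ` verts D"
  by (simp add: map_diagram_def)

lemma map_diagram_comp: "map_diagram f (map_diagram g D) = map_diagram (f \<circ> g) D"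
  by (simp add: map_diagram_def image_image case_prod_unfold comp_def)

lemma map_diagram_cong: "(\<And>z. f z = g z) \<Longrightarrow> map_diagram f D = map_diagram g D"
  by (simp add: map_diagram_def)

lemma map_diagram_id: "(\<And>z. f z = z) \<Longrightarrow> map_diagram f D = D"
  by (simp add: map_diagram_def case_prod_unfold)

lemma map_diagram_empty [simp]: "map_diagram f empty_diagram = empty_diagram"
  by (simp add: map_diagram_def empty_diagram_def)

definition plane_homeo :: "(complex \<Rightarrow> complex) \<Rightarrow> bool" where
  "plane_homeo f \<longleftrightarrow> (\<exists>g. homeomorphism UNIV UNIV f g)"

lemma plane_homeoE:
  assumes "plane_homeo f"
  obtains g where "homeomorphism UNIV UNIV f g" "\<And>z. f (g z) = z" "\<And>z. g (f z) = z"
    "continuous_on UNIV f" "continuous_on UNIV g" "bij f" "plane_homeo g"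
proof -
  from assms obtain g where g: "homeomorphism UNIV UNIV f g"
    unfolding plane_homeo_def by blast
  then have "\<And>z. f (g z) = z" "\<And>z. g (f z) = z" "continuous_on UNIV f" "continuous_on UNIV g"
    by (auto simp: homeomorphism_def)
  moreover from this have "bij f" by (metis bijI')
  moreover have "plane_homeo g" using g homeomorphism_symD plane_homeo_def by blast
  ultimately show ?thesis using that g by blast
qed

lemma plane_homeo_bij: "plane_homeo f \<Longrightarrow> bij f"
  by (metis plane_homeoE)

lemma plane_homeo_cont: "plane_homeo f \<Longrightarrow> continuous_on S f"
  by (metis plane_homeoE continuous_on_subset subset_UNIV)

lemma plane_homeo_comp: "plane_homeo f \<Longrightarrow> plane_homeo g \<Longrightarrow> plane_homeo (f \<circ> g)"
  unfolding plane_homeo_def by (meson homeomorphism_compose)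

lemma plane_homeo_open: "plane_homeo f \<Longrightarrow> open U \<Longrightarrow> open (f ` U)"
  by (metis (no_types, lifting) homeomorphism_imp_open_map open_openin plane_homeo_def subtopology_UNIV)

lemma plane_homeo_bounded: "plane_homeo f \<Longrightarrow> bounded S \<Longrightarrow> bounded (f ` S)"
  by (meson bounded_subset closure_subset compact_closure compact_continuous_image
      compact_imp_bounded image_mono plane_homeo_cont)

lemma plane_homeo_interior:
  assumes "plane_homeo f" shows "interior (f ` S) = f ` interior S"
proof -
  have *: "f ` interior S \<subseteq> interior (f ` S)" if "plane_homeo f" for f S
    by (simp add: that image_mono interior_maximal interior_subset plane_homeo_open)
  from assms obtain g where g: "\<And>z. f (g z) = z" "\<And>z. g (f z) = z" "plane_homeo g"
    by (metis plane_homeoE)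
  have "g ` interior (f ` S) \<subseteq> interior (g ` f ` S)" by (rule *[OF g(3)])
  also have "g ` f ` S = S" using g by (force simp: image_image)
  finally have "f ` g ` interior (f ` S) \<subseteq> f ` interior S" by (rule image_mono)
  moreover have "f ` g ` X = X" for X using g by (force simp: image_image)
  ultimately show ?thesis using *[OF assms, of S] by auto
qed

lemma plane_homeo_frontier:
  assumes "plane_homeo f" shows "frontier (f ` S) = f ` frontier S"
proof -
  have b: "bij f" using assms plane_homeo_bij by blast
  have "frontier X = - interior X - interior (- X)" for X :: "complex set"
    by (auto simp: frontier_def closure_interior)
  then show ?thesis
    using b plane_homeo_interior[OF assms] bij_image_Compl_eq[OF b]
    by (metis image_set_diff bij_is_inj)
qed

text \<open>\<open>inside\<close> is defined by boundedness of components of the complement. The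
  component of \<open>f z\<close> pulls back into the component of \<open>z\<close>, and a plane
  homeomorphism maps bounded sets to bounded sets.\<close>

lemma plane_homeo_inside_subset:
  assumes "plane_homeo f" shows "f ` inside S \<subseteq> inside (f ` S)"
proof
  fix w assume "w \<in> f ` inside S"
  then obtain z where z: "z \<in> inside S" "w = f z" by blast
  obtain g where g: "\<And>z. f (g z) = z" "\<And>z. g (f z) = z" "plane_homeo g" "bij f"
    using assms by (metis plane_homeoE)
  let ?C = "connected_component_set (- f ` S) (f z)"
  have zS: "z \<notin> S" "bounded (connected_component_set (- S) z)"
    using z by (auto simp: inside_def)
  have fz: "f z \<in> - f ` S" using zS(1) g(2) by (metis ComplI imageE)
  have "connected (g ` ?C)"
    by (meson connected_connected_component connected_continuous_image g(3) plane_homeo_cont)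
  moreover have "z \<in> g ` ?C" using fz g(2) by (metis connected_component_refl_eq image_eqI mem_Collect_eq)
  moreover have "g ` ?C \<subseteq> - S"
  proof
    fix x assume "x \<in> g ` ?C"
    then have "f x \<in> ?C" using g by auto
    then have "f x \<in> - f ` S" using connected_component_subset by blast
    then show "x \<in> - S" by auto
  qed
  ultimately have "g ` ?C \<subseteq> connected_component_set (- S) z"
    by (simp add: connected_component_maximal)
  then have "bounded (g ` ?C)" using zS(2) bounded_subset by blast
  then have "bounded (f ` g ` ?C)" using plane_homeo_bounded assms by blast
  moreover have "f ` g ` ?C = ?C" using g by (force simp: image_image)
  ultimately show "w \<in> inside (f ` S)" using fz z by (auto simp: inside_def)
qed

lemma plane_homeo_inside:
  assumes "plane_homeo f" shows "inside (f ` S) = f ` inside S"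
proof
  obtain g where g: "\<And>z. f (g z) = z" "\<And>z. g (f z) = z" "plane_homeo g"
    using assms by (metis plane_homeoE)
  have "g ` inside (f ` S) \<subseteq> inside (g ` f ` S)" using plane_homeo_inside_subset g by blast
  also have "g ` f ` S = S" using g by (force simp: image_image)
  finally have "f ` g ` inside (f ` S) \<subseteq> f ` inside S" by (rule image_mono)
  moreover have "f ` g ` X = X" for X using g by (force simp: image_image)
  ultimately show "inside (f ` S) \<subseteq> f ` inside S" by simp
qed (rule plane_homeo_inside_subset[OF assms])

section \<open>Transport of diagrams and moves along plane homeomorphisms\<close>

lemma map_is_diagram:
  assumes "plane_homeo f" "is_diagram n D"
  shows "is_diagram n (map_diagram f D)"
proof -
  from assms(2) obtain h h' P where h: "homeomorphism UNIV UNIV h h'" "polygonal_diagram n P"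
    "D = map_diagram h P" unfolding is_diagram_def by blast
  from assms(1) obtain g where "homeomorphism UNIV UNIV f g" unfolding plane_homeo_def by blast
  then have "homeomorphism UNIV UNIV (f \<circ> h) (h' \<circ> g)"
    using h(1) homeomorphism_compose by blast
  then show ?thesis using h map_diagram_comp unfolding is_diagram_def by blast
qed

lemma polygonal_is_diagram: "polygonal_diagram n D \<Longrightarrow> is_diagram n D"
  unfolding is_diagram_def
  by (metis homeomorphism_ident map_diagram_id)

text \<open>The isotopy is conjugated by \<open>f\<close>: the conjugate again starts at the
  identity, and at time \<open>1\<close> it carries the image of \<open>D\<close> to the image of
  \<open>D'\<close>.\<close>

lemma map_planar_isotopic:
  assumes "plane_homeo f" "planar_isotopic D D'"
  shows "planar_isotopic (map_diagram f D) (map_diagram f D')"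
proof -
  obtain g where g: "homeomorphism UNIV UNIV f g" "\<And>z. f (g z) = z" "\<And>z. g (f z) = z"
     "continuous_on UNIV f" "continuous_on UNIV g"
    using assms(1) by (metis plane_homeoE)
  obtain H :: "real \<times> complex \<Rightarrow> complex" where H: "continuous_on ({0..1} \<times> UNIV) H"
    "\<And>t. t\<in>{0..1} \<Longrightarrow> \<exists>k. homeomorphism UNIV UNIV (\<lambda>z. H (t, z)) k"
    "\<And>z. H (0, z) = z" "D' = map_diagram (\<lambda>z. H (1, z)) D"
    using assms(2) unfolding planar_isotopic_def by blast
  define H' where "H' = (\<lambda>p. f (H (fst p, g (snd p))))"
  have "continuous_on ({0..1} \<times> UNIV) (\<lambda>p. H (fst p, g (snd p)))"
    by (rule continuous_on_compose2[OF H(1)])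
      (auto intro!: continuous_intros continuous_on_compose2[OF g(5)])
  then have 1: "continuous_on ({0..1} \<times> UNIV) H'"
    unfolding H'_def by (rule continuous_on_compose2[OF g(4)]) auto
  have 2: "\<exists>k. homeomorphism UNIV UNIV (\<lambda>z. H' (t, z)) k" if t: "t \<in> {0..1}" for t
  proof -
    obtain k where "homeomorphism UNIV UNIV (\<lambda>z. H (t, z)) k" using H(2) t by blast
    then have "homeomorphism UNIV UNIV (f \<circ> ((\<lambda>z. H (t, z)) \<circ> g)) ((f \<circ> k) \<circ> g)"
      using g(1) homeomorphism_compose homeomorphism_symD by metis
    then show ?thesis by (auto simp: H'_def comp_def)
  qed
  show ?thesis unfolding planar_isotopic_def
    by (rule exI[of _ H'])
      (use 1 2 in \<open>auto simp: H'_def H(3) g(2,3) map_diagram_comp H(4) comp_def\<close>)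
qed

lemma map_same_outside:
  assumes "bij f" "same_outside K D D'"
  shows "same_outside (f ` K) (map_diagram f D) (map_diagram f D')"
  using assms unfolding same_outside_def
  by (simp add: strands_map bij_is_inj flip: image_set_diff)

lemma map_circle_move:
  assumes f: "plane_homeo f" and m: "circle_move D D'"
  shows "circle_move (map_diagram f D) (map_diagram f D')"
proof -
  have b: "inj f" using f plane_homeo_bij bij_is_inj by blast
  obtain c A where A: "(c, A) \<in> circles D"
        "inside A \<inter> (verts D \<union> strands D G1 \<union> strands D G2) = {}"
        "D' = D\<lparr>circles := circles D - {(c, A)}\<rparr>"
    using m unfolding circle_move_def by blast
  have inj: "inj (\<lambda>(c::gen, A). (c, f ` A))" using b by (auto simp: inj_def inj_image_eq_iff)
  have 1: "(c, f ` A) \<in> circles (map_diagram f D)" using A(1) by (force simp: map_diagram_def)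
  have 2: "map_diagram f D' = (map_diagram f D)\<lparr>circles := circles (map_diagram f D) - {(c, f ` A)}\<rparr>"
    using image_set_diff[OF inj, of "circles D" "{(c, A)}"] by (simp add: map_diagram_def A(3))
  have "inside (f ` A) \<inter> (verts (map_diagram f D) \<union> strands (map_diagram f D) G1 \<union> strands (map_diagram f D) G2)
     = f ` (inside A \<inter> (verts D \<union> strands D G1 \<union> strands D G2))"
    by (simp add: strands_map plane_homeo_inside[OF f] image_Int[OF b] image_Un)
  then show ?thesis unfolding circle_move_def using 1 2 A(2) by auto
qed

lemma map_arc_across:
  assumes f: "plane_homeo f" and m: "arc_across K p q A"
  shows "arc_across (f ` K) (f p) (f q) (f ` A)"
proof -
  have b: "inj f" using f plane_homeo_bij bij_is_inj by blast
  obtain g where g: "arc g" "path_image g = A" "pathstart g = p" "pathfinish g = q"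
    using m unfolding arc_across_def by blast
  have "simple_path (f \<circ> g)"
    by (metis arc_imp_simple_path b f g(1) inj_on_subset plane_homeo_cont simple_path_continuous_image top_greatest)
  then have "arc (f \<circ> g)" using g b m by (simp add: arc_simple_path pathstart_compose pathfinish_compose inj_eq)
  moreover have "path_image (f \<circ> g) = f ` A" using g path_image_compose by blast
  moreover have "f ` A \<inter> frontier (f ` K) = {f p, f q}"
    using m b by (simp add: plane_homeo_frontier[OF f] arc_across_def flip: image_Int)
  ultimately show ?thesis using g m unfolding arc_across_def
    by (metis image_mono pathfinish_compose pathstart_compose)
qed

lemma map_bridge_move:
  assumes f: "plane_homeo f" and m: "bridge_move D D'"
  shows "bridge_move (map_diagram f D) (map_diagram f D')"
proof -
  have b: "inj f" "bij f" using f plane_homeo_bij bij_is_inj by blast+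
  obtain K c p q r s A B A' B' where h:
        "closed_disc K" "same_outside K D D'"
        "arc_across K p q A" "arc_across K r s B" "A \<inter> B = {}"
        "arc_across K q r A'" "arc_across K s p B'" "A' \<inter> B' = {}"
        "verts D \<inter> K = {}" "strands D c \<inter> K = A \<union> B" "strands D (other c) \<inter> K = {}"
        "verts D' \<inter> K = {}" "strands D' c \<inter> K = A' \<union> B'" "strands D' (other c) \<inter> K = {}"
    using m unfolding bridge_move_def by auto
  have "K homeomorphic f ` K"
    using f unfolding plane_homeo_def homeomorphic_def by (metis homeomorphism_of_subsets homeomorphism_def top_greatest subset_UNIV)
  then have cd: "closed_disc (f ` K)" using h(1) unfolding closed_disc_def
    using homeomorphic_trans homeomorphic_sym by blast
  have d: "f ` A \<inter> f ` B = {}" "f ` A' \<inter> f ` B' = {}"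
    using h(5,8) image_Int[OF b(1)] by (metis image_empty)+
  have e: "verts (map_diagram f D) \<inter> f ` K = {}" "verts (map_diagram f D') \<inter> f ` K = {}"
     "strands (map_diagram f D) (other c) \<inter> f ` K = {}" "strands (map_diagram f D') (other c) \<inter> f ` K = {}"
    unfolding verts_map strands_map image_Int[OF b(1), symmetric] h(9-14) by simp_all
  have k: "strands (map_diagram f D) c \<inter> f ` K = f ` A \<union> f ` B"
     "strands (map_diagram f D') c \<inter> f ` K = f ` A' \<union> f ` B'"
    unfolding strands_map image_Int[OF b(1), symmetric] h(9-14) image_Un by simp_all
  note facts = cd map_same_outside[OF b(2) h(2)] map_arc_across[OF f h(3)] map_arc_across[OF f h(4)]
      map_arc_across[OF f h(6)] map_arc_across[OF f h(7)] d e k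
  show ?thesis unfolding bridge_move_def
    apply (rule exI[of _ "f ` K"], rule exI[of _ c])
    apply (rule exI[of _ "f p"], rule exI[of _ "f q"], rule exI[of _ "f r"], rule exI[of _ "f s"])
    apply (rule exI[of _ "f ` A"], rule exI[of _ "f ` B"], rule exI[of _ "f ` A'"], rule exI[of _ "f ` B'"])
    by (intro conjI) (fact facts)+
qed

text \<open>The disc of a cancellation is parametrised by an arbitrary homeomorphism from the model
  rectangle, so it suffices to compose this parametrisation with \<open>f\<close>.\<close>

lemma map_cancel_move:
  assumes f: "plane_homeo f" and m: "cancel_move n D D'"
  shows "cancel_move n (map_diagram f D) (map_diagram f D')"
proof -
  have b: "inj f" "bij f" using f plane_homeo_bij bij_is_inj by blast+
  obtain g where g: "homeomorphism UNIV UNIV f g"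
    using f unfolding plane_homeo_def by blast
  obtain K \<phi> \<phi>' c where h:
        "homeomorphism (model_rect n) K \<phi> \<phi>'" "same_outside K D D'"
        "verts D \<inter> K = \<phi> ` {lower_vertex n, upper_vertex n}"
        "\<forall>d. strands D d \<inter> K = \<phi> ` pair_picture n c d"
        "verts D' \<inter> K = {}"
        "\<forall>d. strands D' d \<inter> K = \<phi> ` parallel_picture n c d"
    using m unfolding cancel_move_def by (elim exE conjE) (rule that)
  have "homeomorphism K (f ` K) f g"
    using g by (meson homeomorphism_of_subsets homeomorphism_def subset_UNIV subset_refl)
  then have hm: "homeomorphism (model_rect n) (f ` K) (f \<circ> \<phi>) (\<phi>' \<circ> g)"
    using h(1) homeomorphism_compose by blast
  have v: "verts (map_diagram f D) \<inter> f ` K = (f \<circ> \<phi>) ` {lower_vertex n, upper_vertex n}"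
     "verts (map_diagram f D') \<inter> f ` K = {}"
    unfolding verts_map image_Int[OF b(1), symmetric] h(3) h(5) by (simp_all add: image_comp)
  have s: "\<forall>d. strands (map_diagram f D) d \<inter> f ` K = (f \<circ> \<phi>) ` pair_picture n c d"
     "\<forall>d. strands (map_diagram f D') d \<inter> f ` K = (f \<circ> \<phi>) ` parallel_picture n c d"
    unfolding strands_map image_Int[OF b(1), symmetric] h(4)[rule_format] h(6)[rule_format]
    by (simp_all add: image_comp)
  show ?thesis unfolding cancel_move_def
    by (intro exI conjI) (fact hm map_same_outside[OF b(2) h(2)] v s)+
qed

lemma map_move:
  assumes "plane_homeo f" "move n D D'"
  shows "move n (map_diagram f D) (map_diagram f D')"
  using assms unfolding move_def
  by (metis map_bridge_move map_cancel_move map_circle_move map_is_diagram map_planar_isotopic)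

lemma map_homotopic:
  assumes "plane_homeo f" "homotopic n D D'"
  shows "homotopic n (map_diagram f D) (map_diagram f D')"
  using assms(2) unfolding homotopic_def
proof (induction rule: equivclp_induct)
  case base then show ?case by simp
next
  case (step y z)
  then show ?case
    by (meson assms(1) map_move equivclp_into_equivclp)
qed

abbreviation null_homotopic :: "nat \<Rightarrow> diagram \<Rightarrow> bool" where
  "null_homotopic n D \<equiv> homotopic n D empty_diagram"

text \<open>This turns every plane homeomorphism into a legitimate change of coordinates: the
  null-homotopy of the image is transported back by the inverse, which fixes the empty diagram. No
  isotopy from \<open>f\<close> to the identity is involved, so \<open>f\<close> may reverse the
  orientation.\<close>

lemma null_homotopic_map:
  assumes "plane_homeo f" "null_homotopic n (map_diagram f D)"
  shows "null_homotopic n D"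
proof -
  obtain g where g: "\<And>z. g (f z) = z" "plane_homeo g" using assms(1) by (metis plane_homeoE)
  then have "null_homotopic n (map_diagram g (map_diagram f D))"
    using map_homotopic[OF g(2) assms(2)] by simp
  then show ?thesis using map_diagram_id[of "g \<circ> f"] g(1) by (simp add: map_diagram_comp)
qed

lemma null_homotopic_move:
  assumes "move n D D'" "null_homotopic n D'"
  shows "null_homotopic n D"
  using assms unfolding homotopic_def
  by (meson equivclp_trans r_into_equivclp)

subsection \<open>Piecewise affine maps\<close>

text \<open>The pieces may overlap and need not be polyhedra. Closedness lets continuity be glued;
  convexity makes a segment meet a piece in a segment and makes the map conical near each point. The
  closure properties below then cover any formula built from \<open>max\<close>, \<open>min\<close>,
  absolute values and linear terms.\<close>

definition pw_affine :: "(complex \<Rightarrow> 'b::euclidean_space) \<Rightarrow> bool" where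
  "pw_affine h \<longleftrightarrow> (\<exists>F. finite F \<and> \<Union>F = UNIV \<and>
     (\<forall>T\<in>F. closed T \<and> convex T \<and> (\<exists>g c. linear g \<and> (\<forall>z\<in>T. h z = g z + c))))"

lemma pw_affineE:
  assumes "pw_affine h"
  obtains F where "finite F" "\<Union>F = UNIV" "\<And>T. T \<in> F \<Longrightarrow> closed T" "\<And>T. T \<in> F \<Longrightarrow> convex T"
    "\<And>T. T \<in> F \<Longrightarrow> \<exists>g c. linear g \<and> (\<forall>z\<in>T. h z = g z + c)"
  using assms unfolding pw_affine_def by (elim exE conjE) (rule that, auto)

lemma pw_affine_linear: "linear g \<Longrightarrow> pw_affine (\<lambda>z. g z + c)"
  unfolding pw_affine_def by (intro exI[of _ "{UNIV}"]) auto

lemma pw_affine_const [intro]: "pw_affine (\<lambda>z. c)"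
  using pw_affine_linear[of "\<lambda>z. 0" c] by (simp add: linear_zero)

lemma pw_affine_Re [intro]: "pw_affine Re" and pw_affine_Im [intro]: "pw_affine Im"
  using pw_affine_linear[of Re 0] pw_affine_linear[of Im 0]
  by (simp_all add: bounded_linear_Re bounded_linear_Im bounded_linear.linear)

lemma pw_affine_id [intro]: "pw_affine (\<lambda>z. z)"
  using pw_affine_linear[of "\<lambda>z. z" 0] by (simp add: linear_ident)

lemma pw_affine_linear_comp:
  assumes "linear L" "pw_affine h" shows "pw_affine (\<lambda>z. L (h z))"
proof -
  obtain F where F: "finite F" "\<Union>F = UNIV" "\<And>T. T \<in> F \<Longrightarrow> closed T" "\<And>T. T \<in> F \<Longrightarrow> convex T"
    "\<And>T. T \<in> F \<Longrightarrow> \<exists>g c. linear g \<and> (\<forall>z\<in>T. h z = g z + c)" by (rule pw_affineE[OF assms(2)]) (rule that; simp)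
  have "\<exists>g c. linear g \<and> (\<forall>z\<in>T. L (h z) = g z + c)" if T: "T \<in> F" for T
  proof -
    obtain g c where g: "linear g" "\<forall>z\<in>T. h z = g z + c" using F(5) T by blast
    have "linear (L \<circ> g)" using g(1) assms(1) linear_compose by blast
    moreover have "\<forall>z\<in>T. L (h z) = (L \<circ> g) z + L c" using g(2) linear_add[OF assms(1)] by simp
    ultimately show ?thesis by blast
  qed
  then show ?thesis unfolding pw_affine_def using F(1-4) by (intro exI[of _ F]) auto
qed

text \<open>On the common refinement by pairwise intersections both maps are affine. Together with
  \<open>pw_affine_linear_comp\<close> this yields closure under every operation that is linear in
  the pair.\<close>

lemma pw_affine_Pair:
  assumes "pw_affine h" "pw_affine k" shows "pw_affine (\<lambda>z. (h z, k z))"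
proof -
  obtain F where F: "finite F" "\<Union>F = UNIV" "\<And>T. T \<in> F \<Longrightarrow> closed T" "\<And>T. T \<in> F \<Longrightarrow> convex T"
    "\<And>T. T \<in> F \<Longrightarrow> \<exists>g c. linear g \<and> (\<forall>z\<in>T. h z = g z + c)" by (rule pw_affineE[OF assms(1)]) (rule that; simp)
  obtain E where E: "finite E" "\<Union>E = UNIV" "\<And>T. T \<in> E \<Longrightarrow> closed T" "\<And>T. T \<in> E \<Longrightarrow> convex T"
    "\<And>T. T \<in> E \<Longrightarrow> \<exists>g c. linear g \<and> (\<forall>z\<in>T. k z = g z + c)" by (rule pw_affineE[OF assms(2)]) (rule that; simp)
  let ?G = "(\<lambda>(T, T'). T \<inter> T') ` (F \<times> E)"
  have "\<exists>g c. linear g \<and> (\<forall>z\<in>T \<inter> T'. (h z, k z) = g z + c)" if T: "T \<in> F" "T' \<in> E" for T T'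
  proof -
    obtain g c where g: "linear g" "\<forall>z\<in>T. h z = g z + c" using F(5) T by blast
    obtain g' c' where g': "linear g'" "\<forall>z\<in>T'. k z = g' z + c'" using E(5) T by blast
    have "linear (\<lambda>z. (g z, g' z))"
      using g(1) g'(1) by (simp add: linear_iff)
    then show ?thesis using g g' by (intro exI[of _ "\<lambda>z. (g z, g' z)"] exI[of _ "(c, c')"]) auto
  qed
  moreover have "finite ?G" using F E by auto
  moreover have "\<Union>?G = UNIV" using F(2) E(2) by fastforce
  ultimately show ?thesis unfolding pw_affine_def using F(3,4) E(3,4)
    by (intro exI[of _ ?G]) (auto intro: closed_Int convex_Int)
qed

lemma pw_affine_bilift:
  assumes "linear (\<lambda>p. L (fst p) (snd p))" "pw_affine h" "pw_affine k"
  shows "pw_affine (\<lambda>z. L (h z) (k z))"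
  using pw_affine_linear_comp[OF assms(1) pw_affine_Pair[OF assms(2,3)]] by simp

lemma pw_affine_add [intro]: "pw_affine h \<Longrightarrow> pw_affine k \<Longrightarrow> pw_affine (\<lambda>z. h z + k z)"
  by (rule pw_affine_bilift) (auto simp: linear_iff algebra_simps)

lemma pw_affine_diff [intro]: "pw_affine h \<Longrightarrow> pw_affine k \<Longrightarrow> pw_affine (\<lambda>z. h z - k z)"
  by (rule pw_affine_bilift) (auto simp: linear_iff algebra_simps)

lemma pw_affine_Complex [intro]: "pw_affine h \<Longrightarrow> pw_affine k \<Longrightarrow> pw_affine (\<lambda>z. Complex (h z) (k z))"
  by (rule pw_affine_bilift) (auto simp: linear_iff complex_eq_iff)

lemma pw_affine_minus [intro]: "pw_affine h \<Longrightarrow> pw_affine (\<lambda>z. - h z)"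
  by (rule pw_affine_linear_comp) (auto simp: linear_iff)

lemma pw_affine_mult [intro]:
  fixes h :: "complex \<Rightarrow> real" shows "pw_affine h \<Longrightarrow> pw_affine (\<lambda>z. c * h z)"
  by (rule pw_affine_linear_comp) (auto simp: linear_iff algebra_simps)

lemma pw_affine_divide [intro]:
  fixes h :: "complex \<Rightarrow> real" shows "pw_affine h \<Longrightarrow> pw_affine (\<lambda>z. h z / c)"
  by (rule pw_affine_linear_comp) (auto simp: linear_iff field_simps add_divide_distrib)

lemma pw_affine_scaleR [intro]: "pw_affine h \<Longrightarrow> pw_affine (\<lambda>z. h z *\<^sub>R d)"
  by (rule pw_affine_linear_comp) (auto simp: linear_iff algebra_simps)

text \<open>Each piece is cut along the zero set of \<open>h\<close>; both halves stay closed and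
  convex, being intersections with preimages of half-lines under the linear part.\<close>

lemma pw_affine_max0:
  assumes "pw_affine h" shows "pw_affine (\<lambda>z. max 0 (h z :: real))"
proof -
  obtain F where F: "finite F" "\<Union>F = UNIV" "\<And>T. T \<in> F \<Longrightarrow> closed T" "\<And>T. T \<in> F \<Longrightarrow> convex T"
    "\<And>T. T \<in> F \<Longrightarrow> \<exists>g c. linear g \<and> (\<forall>z\<in>T. h z = g z + c)" by (rule pw_affineE[OF assms]) (rule that; simp)
  let ?G = "(\<lambda>T. {z\<in>T. 0 \<le> h z}) ` F \<union> (\<lambda>T. {z\<in>T. h z \<le> 0}) ` F"
  have *: "closed {z\<in>T. 0 \<le> h z} \<and> closed {z\<in>T. h z \<le> 0} \<and> convex {z\<in>T. 0 \<le> h z} \<and> convex {z\<in>T. h z \<le> 0}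
     \<and> (\<exists>g c. linear g \<and> (\<forall>z\<in>{z\<in>T. 0 \<le> h z}. max 0 (h z) = g z + c))
     \<and> (\<exists>g c. linear g \<and> (\<forall>z\<in>{z\<in>T. h z \<le> 0}. max 0 (h z) = g z + c))" if T: "T \<in> F" for T
  proof -
    obtain g c where g: "linear g" "\<forall>z\<in>T. h z = g z + c" using F(5) T by blast
    have c: "continuous_on UNIV g" using g(1) by (simp add: linear_continuous_on linear_linear)
    have e: "{z\<in>T. 0 \<le> h z} = T \<inter> g -` {- c..}" "{z\<in>T. h z \<le> 0} = T \<inter> g -` {..- c}"
      using g(2) by auto
    have "closed (g -` {- c..})" "closed (g -` {..- c})"
      using c by (auto intro!: closed_vimage simp: continuous_on_eq_continuous_at)
    moreover have "convex (g -` {- c..})" "convex (g -` {..- c})"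
      using g(1) by (auto intro!: convex_linear_vimage)
    moreover have "\<forall>z\<in>{z\<in>T. 0 \<le> h z}. max 0 (h z) = g z + c" using g(2) by auto
    moreover have "\<forall>z\<in>{z\<in>T. h z \<le> 0}. max 0 (h z) = (\<lambda>z. 0) z + 0" using g(2) by auto
    moreover have "linear (\<lambda>z::complex. 0::real)" by (simp add: linear_zero)
    ultimately show ?thesis unfolding e using F(3,4)[OF T] g(1)
      by (intro conjI closed_Int convex_Int) (assumption | blast)+
  qed
  have "finite ?G" using F by auto
  moreover have "\<Union>?G = UNIV"
  proof -
    have "z \<in> \<Union>?G" for z
    proof -
      obtain T where "T \<in> F" "z \<in> T" using F(2) by blast
      then show ?thesis by (cases "0 \<le> h z") auto
    qed
    then show ?thesis by blast
  qed
  ultimately show ?thesis unfolding pw_affine_def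
    by (intro exI[of _ ?G]) (use * in \<open>auto simp only: Un_iff image_iff\<close>)
qed

lemma pw_affine_max [intro]:
  fixes h k :: "complex \<Rightarrow> real"
  assumes "pw_affine h" "pw_affine k" shows "pw_affine (\<lambda>z. max (h z) (k z))"
proof -
  have "pw_affine (\<lambda>z. h z + max 0 (k z - h z))"
    by (intro pw_affine_add pw_affine_max0 pw_affine_diff assms)
  moreover have "h z + max 0 (k z - h z) = max (h z) (k z)" for z by (simp add: max_def)
  ultimately show ?thesis by simp
qed

lemma pw_affine_min [intro]:
  fixes h k :: "complex \<Rightarrow> real"
  assumes "pw_affine h" "pw_affine k" shows "pw_affine (\<lambda>z. min (h z) (k z))"
proof -
  have "pw_affine (\<lambda>z. - max (- h z) (- k z))" by (intro pw_affine_minus pw_affine_max assms)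
  then show ?thesis by (simp add: minus_max_eq_min)
qed

lemma pw_affine_abs [intro]:
  fixes h :: "complex \<Rightarrow> real"
  assumes "pw_affine h" shows "pw_affine (\<lambda>z. \<bar>h z\<bar>)"
proof -
  have "pw_affine (\<lambda>z. max (h z) (- h z))" by (intro pw_affine_minus pw_affine_max assms)
  moreover have "max (h z) (- h z) = \<bar>h z\<bar>" for z by linarith
  ultimately show ?thesis by simp
qed

lemma pw_affine_continuous:
  assumes "pw_affine h" shows "continuous_on S h"
proof -
  obtain F where F: "finite F" "\<Union>F = UNIV" "\<And>T. T \<in> F \<Longrightarrow> closed T" "\<And>T. T \<in> F \<Longrightarrow> convex T"
    "\<And>T. T \<in> F \<Longrightarrow> \<exists>g c. linear g \<and> (\<forall>z\<in>T. h z = g z + c)" by (rule pw_affineE[OF assms]) (rule that; simp)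
  have "continuous_on T h" if T: "T \<in> F" for T
  proof -
    obtain g c where g: "linear g" "\<forall>z\<in>T. h z = g z + c" using F(5)[OF T] by blast
    have "continuous_on T (\<lambda>z. g z + c)"
      using g(1) by (intro continuous_intros) (simp add: linear_continuous_on linear_linear)
    then show ?thesis using g(2) by (simp cong: continuous_on_cong)
  qed
  then have "continuous_on (\<Union>T\<in>F. T) h" using F(1,3) by (intro continuous_on_closed_Union) auto
  then show ?thesis using F(2) by (metis continuous_on_subset image_ident subset_UNIV)
qed

section \<open>Polygonal sets and their images\<close>

lemma polygonal_empty [simp]: "polygonal {}"
  unfolding polygonal_def by (intro exI[of _ "{}"]) auto

lemma polygonal_segment [simp]: "polygonal (closed_segment a b)"
  unfolding polygonal_def by (intro exI[of _ "{(a, b)}"]) auto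

lemma polygonal_Un:
  assumes "polygonal A" "polygonal B" shows "polygonal (A \<union> B)"
proof -
  obtain S T where "finite S" "A = (\<Union>(a, b)\<in>S. closed_segment a b)"
    "finite T" "B = (\<Union>(a, b)\<in>T. closed_segment a b)" using assms unfolding polygonal_def by blast
  then show ?thesis unfolding polygonal_def by (intro exI[of _ "S \<union> T"]) auto
qed

lemma polygonal_UN: "finite I \<Longrightarrow> (\<And>i. i \<in> I \<Longrightarrow> polygonal (A i)) \<Longrightarrow> polygonal (\<Union>i\<in>I. A i)"
  by (induction rule: finite_induct) (auto intro: polygonal_Un)

lemma polygonal_Union: "finite I \<Longrightarrow> (\<And>A. A \<in> I \<Longrightarrow> polygonal A) \<Longrightarrow> polygonal (\<Union>I)"
  using polygonal_UN[of I "\<lambda>A. A"] by simp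

lemma polygonal_compact: "polygonal A \<Longrightarrow> compact A"
  unfolding polygonal_def by (auto intro!: compact_UN)

lemma polygonal_closed: "polygonal A \<Longrightarrow> closed A"
  by (simp add: polygonal_compact compact_imp_closed)

text \<open>A segment meets a closed convex piece in a compact convex collinear set, which is again
  a segment unless empty, and an affine map takes it to a segment.\<close>

lemma polygonal_image:
  assumes h: "pw_affine (h :: complex \<Rightarrow> complex)" and A: "polygonal A" shows "polygonal (h ` A)"
proof -
  obtain F where F: "finite F" "\<Union>F = UNIV" "\<And>T. T \<in> F \<Longrightarrow> closed T" "\<And>T. T \<in> F \<Longrightarrow> convex T"
    "\<And>T. T \<in> F \<Longrightarrow> \<exists>g c. linear g \<and> (\<forall>z\<in>T. h z = g z + c)" by (rule pw_affineE[OF h]) (rule that; simp)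
  have 1: "polygonal (h ` (closed_segment a b \<inter> T))" if T: "T \<in> F" for a b T
  proof (cases "closed_segment a b \<inter> T = {}")
    case False
    have "compact (closed_segment a b \<inter> T)" "convex (closed_segment a b \<inter> T)" "collinear (closed_segment a b \<inter> T)"
      using F(3,4) T by (auto intro: convex_Int collinear_subset[OF collinear_closed_segment])
    then obtain x y where xy: "closed_segment a b \<inter> T = closed_segment x y"
      using False compact_convex_collinear_segment by metis
    obtain g c where g: "linear g" "\<forall>z\<in>T. h z = g z + c" using F(5) T by blast
    have "h ` closed_segment x y = (\<lambda>z. z + c) ` g ` closed_segment x y"
      using g(2) xy by (auto simp: image_image intro!: image_cong)
    also have "\<dots> = closed_segment (g x + c) (g y + c)"
      using closed_segment_linear_image[OF g(1), of x y] closed_segment_translation[of c "g x" "g y"]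
      by (simp add: add.commute image_image)
    finally show ?thesis using xy by simp
  qed simp
  obtain S where S: "finite S" "A = (\<Union>(a, b)\<in>S. closed_segment a b)" using A unfolding polygonal_def by blast
  have "h ` A = (\<Union>(a, b)\<in>S. \<Union>T\<in>F. h ` (closed_segment a b \<inter> T))"
  proof -
    have "h ` closed_segment a b = (\<Union>T\<in>F. h ` (closed_segment a b \<inter> T))" for a b
      using F(2) by blast
    then show ?thesis unfolding S(2) by (simp add: image_UN case_prod_unfold)
  qed
  then show ?thesis using S(1) F(1) 1 by (auto intro!: polygonal_UN)
qed

text \<open>Near \<open>v\<close> the map is positively homogeneous about \<open>v\<close>. This is
  the local form needed for vertices: germs of straight rays at \<open>v\<close> go to germs of
  straight rays at \<open>h v\<close>.\<close>

definition conical_at :: "(complex \<Rightarrow> complex) \<Rightarrow> complex \<Rightarrow> bool" where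
  "conical_at h v \<longleftrightarrow>
     (\<exists>\<epsilon>>0. \<forall>u t. norm u < \<epsilon> \<longrightarrow> 0 \<le> t \<longrightarrow> t \<le> 1 \<longrightarrow> h (v + t *\<^sub>R u) = h v + t *\<^sub>R (h (v + u) - h v))"

text \<open>A small ball around \<open>v\<close> misses all pieces that do not contain
  \<open>v\<close>. A piece containing \<open>v\<close> and \<open>v + u\<close> contains the
  segment between them, and the map is affine there.\<close>

lemma pw_affine_conical:
  assumes h: "pw_affine h" shows "conical_at h v"
proof -
  obtain F where F: "finite F" "\<Union>F = UNIV" "\<And>T. T \<in> F \<Longrightarrow> closed T" "\<And>T. T \<in> F \<Longrightarrow> convex T"
    "\<And>T. T \<in> F \<Longrightarrow> \<exists>g c. linear g \<and> (\<forall>z\<in>T. h z = g z + c)" by (rule pw_affineE[OF h]) (rule that; simp)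
  have "closed (\<Union>{T\<in>F. v \<notin> T})" using F(1,3) by auto
  then have "open (- \<Union>{T\<in>F. v \<notin> T})" by blast
  then obtain \<epsilon> where e: "\<epsilon> > 0" "ball v \<epsilon> \<subseteq> - \<Union>{T\<in>F. v \<notin> T}"
    by (metis (no_types, lifting) ComplI UnionE mem_Collect_eq open_contains_ball)
  have "h (v + t *\<^sub>R u) = h v + t *\<^sub>R (h (v + u) - h v)" if "norm u < \<epsilon>" "0 \<le> t" "t \<le> 1" for u t
  proof -
    have "v + u \<in> ball v \<epsilon>" using that(1) by (simp add: dist_norm)
    then obtain T where T: "T \<in> F" "v + u \<in> T" "v \<in> T" using F(2) e(2) by blast
    have "v + t *\<^sub>R u = (1 - t) *\<^sub>R v + t *\<^sub>R (v + u)" by (simp add: algebra_simps)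
    then have "v + t *\<^sub>R u \<in> T" using F(4)[OF T(1)] T(2,3) that by (simp add: convex_alt)
    moreover obtain g c where g: "linear g" "\<forall>z\<in>T. h z = g z + c" using F(5) T by blast
    ultimately show ?thesis using T by (simp add: linear_add linear_scale)
  qed
  then show ?thesis unfolding conical_at_def using e(1) by blast
qed

section \<open>Criteria for homeomorphisms of the plane\<close>

lemma plane_homeoI:
  assumes "continuous_on UNIV h" "inj h" "\<And>w. \<exists>z. h z = w"
  shows "plane_homeo h"
proof -
  have r: "range h = UNIV" using assms(3) by (metis surjI surj_def)
  \<comment> \<open>Continuity of the inverse is invariance of domain.\<close>
  have "continuous_on (range h) (inv h)"
    by (rule continuous_on_inverse_open[OF open_UNIV assms(1)]) (simp_all add: assms(2))
  then have "homeomorphism UNIV UNIV h (inv h)"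
    unfolding homeomorphism_def using r assms(1,2) inj_imp_surj_inv[OF assms(2)] surj_f_inv_f[OF r]
    by simp
  then show ?thesis unfolding plane_homeo_def by blast
qed

text \<open>On each line in the direction \<open>d\<close> the map is \<open>t + \<phi>\<close>,
  which by the bound increases at least at rate \<open>1 - \<kappa> > 0\<close>; hence it is a
  bijection of the line. The bound is one-sided, so the amount of the shift may increase arbitrarily
  fast along \<open>d\<close>.\<close>

lemma plane_homeo_shift:
  fixes \<phi> :: "complex \<Rightarrow> real" and d :: complex
  assumes c: "continuous_on UNIV \<phi>" and k: "\<kappa> < 1"
    and m: "\<And>z s. s \<ge> 0 \<Longrightarrow> \<phi> (z + s *\<^sub>R d) \<ge> \<phi> z - \<kappa> * s"
  shows "plane_homeo (\<lambda>z. z + \<phi> z *\<^sub>R d)"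
proof -
  let ?h = "\<lambda>z. z + \<phi> z *\<^sub>R d"
  have ch: "continuous_on UNIV ?h" by (intro continuous_intros c)
  have *: "s = 0" if "s \<ge> 0" "?h z = ?h (z + s *\<^sub>R d)" "d \<noteq> 0" for z s
  proof -
    have "\<phi> z *\<^sub>R d = (s + \<phi> (z + s *\<^sub>R d)) *\<^sub>R d" using that(2) by (simp add: algebra_simps)
    then have "\<phi> z = s + \<phi> (z + s *\<^sub>R d)" using that(3) by simp
    then have "s \<le> \<kappa> * s" using m[OF that(1), of z] by simp
    then have "(1 - \<kappa>) * s \<le> 0" by (simp add: algebra_simps)
    then show ?thesis using k that(1) by (simp add: mult_le_0_iff)
  qed
  have inj: "inj ?h"
  proof (rule injI)
    fix z w assume e: "?h z = ?h w"
    show "z = w"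
    proof (cases "d = 0")
      case False
      define s where "s = \<phi> z - \<phi> w"
      have w: "w = z + s *\<^sub>R d" using e by (simp add: s_def algebra_simps)
      have z: "z = w + (- s) *\<^sub>R d" using w by simp
      show ?thesis
      proof (cases "s \<ge> 0")
        case True then show ?thesis using *[of s z] e False w by simp
      next
        case f: False then show ?thesis using *[of "- s" w] e False z by simp
      qed
    qed (use e in simp)
  qed
  have surj: "\<exists>z. ?h z = w" for w
  proof -
    define F where "F t = t + \<phi> (w + t *\<^sub>R d)" for t
    have cF: "continuous_on S F" for S unfolding F_def
      by (intro continuous_intros continuous_on_compose2[OF c]) auto
    \<comment> \<open>Since \<open>F\<close> grows at rate at least \<open>1 - \<kappa>\<close>, it
      changes sign between \<open>- T\<close> and \<open>T\<close>; a zero \<open>t\<close> of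
      \<open>F\<close> yields the preimage \<open>w + t *\<^sub>R d\<close> of
      \<open>w\<close>.\<close>
    define T where "T = \<bar>F 0\<bar> / (1 - \<kappa>)"
    have T: "T \<ge> 0" "(1 - \<kappa>) * T = \<bar>F 0\<bar>" using k by (auto simp: T_def)
    have "F T \<ge> F 0 + (1 - \<kappa>) * T" using m[OF T(1), of w] by (simp add: F_def algebra_simps)
    then have 1: "F T \<ge> 0" using T(2) by linarith
    have "F 0 \<ge> F (- T) + (1 - \<kappa>) * T" using m[OF T(1), of "w + (- T) *\<^sub>R d"] by (simp add: F_def algebra_simps)
    then have 2: "F (- T) \<le> 0" using T(2) by linarith
    obtain t where "F t = 0" using IVT'[of F "- T" 0 T] 1 2 T(1) cF by auto
    then have "\<phi> (w + t *\<^sub>R d) = - t" by (simp add: F_def)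
    then have "?h (w + t *\<^sub>R d) = w" by simp
    then show ?thesis by blast
  qed
  show ?thesis by (rule plane_homeoI[OF ch inj surj])
qed

lemma plane_homeo_affine:
  assumes "a \<noteq> 0" shows "plane_homeo (\<lambda>z. a * z + b)"
proof -
  have "w \<in> range (\<lambda>z. a * z + b)" "w \<in> range (\<lambda>z. (z - b) / a)" for w
    using assms by (auto intro: range_eqI[of _ _ "(w - b) / a"] range_eqI[of _ _ "a * w + b"])
  then have "(\<lambda>z. a * z + b) ` UNIV = UNIV" "(\<lambda>z. (z - b) / a) ` UNIV = UNIV"
    by blast+
  then have "homeomorphism UNIV UNIV (\<lambda>z. a * z + b) (\<lambda>z. (z - b) / a)"
    unfolding homeomorphism_def using assms by (auto intro!: continuous_intros)
  then show ?thesis unfolding plane_homeo_def by blast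
qed

lemma pw_affine_affine: "pw_affine (\<lambda>z. a * z + b)"
  by (rule pw_affine_linear) (simp add: linear_iff algebra_simps)

section \<open>Stars: the straight rays at a vertex\<close>

definition star :: "nat \<Rightarrow> diagram \<Rightarrow> complex \<Rightarrow> real \<Rightarrow> (nat \<Rightarrow> real) \<Rightarrow> bool" where
  "star n D v \<epsilon> \<theta> \<longleftrightarrow> \<epsilon> > 0 \<and> (\<forall>i j. i < j \<and> j < 2 * n \<longrightarrow> \<theta> i < \<theta> j \<and> \<theta> j < \<theta> i + 2 * pi) \<and>
        (\<forall>c. strands D c \<inter> ball v \<epsilon> =
              {v + of_real r * cis (\<theta> k) | r k.
                 0 \<le> r \<and> r < \<epsilon> \<and> k < 2 * n \<and> (even k \<longleftrightarrow> c = G1)})"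

lemma alternating_at_star: "alternating_at n D v \<longleftrightarrow> (\<exists>\<epsilon> \<theta>. star n D v \<epsilon> \<theta>)"
  unfolding alternating_at_def star_def by blast

lemma star_mono: "star n D v \<epsilon> \<theta> \<Longrightarrow> i < j \<Longrightarrow> j < 2 * n \<Longrightarrow> \<theta> i < \<theta> j \<and> \<theta> j < \<theta> i + 2 * pi"
  and star_pos: "star n D v \<epsilon> \<theta> \<Longrightarrow> 0 < \<epsilon>"
  and star_eq: "star n D v \<epsilon> \<theta> \<Longrightarrow> strands D c \<inter> ball v \<epsilon> =
              {v + of_real r * cis (\<theta> k) | r k.
                 0 \<le> r \<and> r < \<epsilon> \<and> k < 2 * n \<and> (even k \<longleftrightarrow> c = G1)}"
  unfolding star_def by simp_all

lemma star_shrink: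
  assumes s: "star n D v \<epsilon>0 \<theta>" and "0 < \<epsilon>" "\<epsilon> \<le> \<epsilon>0"
  shows "star n D v \<epsilon> \<theta>"
proof -
  have "strands D c \<inter> ball v \<epsilon> =
              {v + of_real r * cis (\<theta> k) | r k.
                 0 \<le> r \<and> r < \<epsilon> \<and> k < 2 * n \<and> (even k \<longleftrightarrow> c = G1)}" (is "_ = ?R") for c
  proof -
    have "strands D c \<inter> ball v \<epsilon> = strands D c \<inter> ball v \<epsilon>0 \<inter> ball v \<epsilon>" using assms by auto
    also have "\<dots> = ?R" unfolding star_eq[OF s] using assms(2,3) by (force simp: dist_norm norm_mult)
    finally show ?thesis .
  qed
  then show ?thesis using s assms(2) unfolding star_def by blast
qed

lemma dist_of_real_cis [simp]: "dist w (w + of_real r * cis a) = \<bar>r\<bar>"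
  by (simp add: dist_norm norm_mult)

lemma polygonal_diagramI:
  assumes "finite (verts D)" "finite (edges D)" "finite (circles D)"
     "\<And>c A. (c, A) \<in> edges D \<Longrightarrow> is_edge (verts D) A" "\<And>c A. (c, A) \<in> edges D \<Longrightarrow> polygonal A"
     "\<And>c A. (c, A) \<in> circles D \<Longrightarrow> is_circle (verts D) A" "\<And>c A. (c, A) \<in> circles D \<Longrightarrow> polygonal A"
     "\<And>x y. x \<in> edges D \<union> circles D \<Longrightarrow> y \<in> edges D \<union> circles D \<Longrightarrow> x \<noteq> y \<Longrightarrow> snd x \<inter> snd y \<subseteq> verts D"
     "\<And>v. v \<in> verts D \<Longrightarrow> alternating_at n D v"
   shows "polygonal_diagram n D"
  unfolding polygonal_diagram_def
proof (intro conjI ballI impI)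
  show "case x of (c, A) \<Rightarrow> is_edge (verts D) A \<and> polygonal A" if "x \<in> edges D" for x
    using assms(4,5) that by (cases x) simp
  show "case x of (c, A) \<Rightarrow> is_circle (verts D) A \<and> polygonal A" if "x \<in> circles D" for x
    using assms(6,7) that by (cases x) simp
qed (auto simp: assms(1,2,3,9) intro: assms(8)[THEN subsetD])

lemma polygonal_diagramD:
  assumes D: "polygonal_diagram n D"
  shows "finite (verts D)" "finite (edges D)" "finite (circles D)"
     "\<And>c A. (c, A) \<in> edges D \<Longrightarrow> is_edge (verts D) A" "\<And>c A. (c, A) \<in> edges D \<Longrightarrow> polygonal A"
     "\<And>c A. (c, A) \<in> circles D \<Longrightarrow> is_circle (verts D) A" "\<And>c A. (c, A) \<in> circles D \<Longrightarrow> polygonal A"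
     "\<And>x y. x \<in> edges D \<union> circles D \<Longrightarrow> y \<in> edges D \<union> circles D \<Longrightarrow> x \<noteq> y \<Longrightarrow> snd x \<inter> snd y \<subseteq> verts D"
     "\<And>v. v \<in> verts D \<Longrightarrow> alternating_at n D v"
  using D unfolding polygonal_diagram_def by auto

lemma cis_eqD: "cis a = cis b \<Longrightarrow> \<bar>a - b\<bar> < 2 * pi \<Longrightarrow> a = b"
proof -
  assume a: "cis a = cis b" "\<bar>a - b\<bar> < 2 * pi"
  then have "cis (a - b) = 1" by (metis cis_divide cis_neq_zero divide_self)
  then have "cos (a - b) = 1" by (metis cis.sel(1) one_complex.sel(1))
  then obtain k :: int where k: "a - b = k * (2 * pi)" using cos_one_2pi_int by auto
  with a(2) have "\<bar>of_int k * (2 * pi)\<bar> < 1 * (2 * pi)" by simp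
  then have "\<bar>real_of_int k\<bar> < 1" by (simp add: abs_mult)
  then have "k = 0" by linarith
  then show "a = b" using k by simp
qed

text \<open>
  The angle of the image of the ray at angle \<open>\<theta>\<close> lifts to a continuous function of \<open>\<theta>\<close> that is
  injective modulo \<open>2 \<pi>\<close>, hence monotone: the cyclic order is preserved or reversed.
\<close>

lemma conical_angles:
  assumes h: "plane_homeo h" and c: "conical_at h v"
  obtains \<epsilon>0 where "\<epsilon>0 > 0"
    "\<And>\<epsilon> a. 0 < \<epsilon> \<Longrightarrow> \<epsilon> \<le> \<epsilon>0 \<Longrightarrow>
      \<exists>\<alpha> \<rho>. (\<forall>\<theta>. 0 < \<rho> \<theta> \<and> (\<forall>r. 0 \<le> r \<longrightarrow> r \<le> \<epsilon> \<longrightarrow> h (v + of_real r * cis \<theta>) = h v + of_real (r / \<epsilon> * \<rho> \<theta>) * cis (\<alpha> \<theta>)))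
       \<and> ((\<forall>x y. a \<le> x \<longrightarrow> x < y \<longrightarrow> y < a + 2 * pi \<longrightarrow> \<alpha> x < \<alpha> y \<and> \<alpha> y < \<alpha> x + 2 * pi)
         \<or> (\<forall>x y. a \<le> x \<longrightarrow> x < y \<longrightarrow> y < a + 2 * pi \<longrightarrow> \<alpha> y < \<alpha> x \<and> \<alpha> x < \<alpha> y + 2 * pi))"
proof -
  have inj: "inj h" using h plane_homeo_bij bij_is_inj by blast
  obtain \<epsilon>1 where e: "\<epsilon>1 > 0" "\<And>u t. norm u < \<epsilon>1 \<Longrightarrow> 0 \<le> t \<Longrightarrow> t \<le> 1 \<Longrightarrow> h (v + t *\<^sub>R u) = h v + t *\<^sub>R (h (v + u) - h v)"
    using c unfolding conical_at_def by blast
  show ?thesis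
  proof (rule that[of "\<epsilon>1 / 2"])
    show "\<epsilon>1 / 2 > 0" using e by simp
    fix \<epsilon> a :: real
    assume \<epsilon>: "0 < \<epsilon>" "\<epsilon> \<le> \<epsilon>1 / 2"
    define \<Gamma> where "\<Gamma> \<theta> = h (v + of_real \<epsilon> * cis \<theta>) - h v" for \<theta>
    have G0: "\<Gamma> \<theta> \<noteq> 0" for \<theta>
      using inj \<epsilon>(1) by (auto simp: \<Gamma>_def dest!: injD)
    have Gr: "h (v + of_real r * cis \<theta>) = h v + of_real (r / \<epsilon>) * \<Gamma> \<theta>" if "0 \<le> r" "r \<le> \<epsilon>" for r \<theta>
      using e(2)[of "of_real \<epsilon> * cis \<theta>" "r / \<epsilon>"] \<epsilon> that
      by (simp add: norm_mult \<Gamma>_def scaleR_conv_of_real)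
    have "continuous_on UNIV \<Gamma>" unfolding \<Gamma>_def
      by (intro continuous_intros continuous_on_compose2[OF plane_homeo_cont[OF h, of UNIV]]) auto
    \<comment> \<open>The real line is contractible, so the nowhere vanishing curve
      \<open>\<Gamma>\<close> has a continuous logarithm; its imaginary part is the lifted
      angle.\<close>
    then obtain g where g: "continuous_on UNIV g" "\<And>\<theta>. \<Gamma> \<theta> = exp (g \<theta>)"
      using continuous_logarithm_on_contractible[of UNIV \<Gamma>] G0 contractible_UNIV by (metis UNIV_I)
    define \<alpha> where "\<alpha> \<theta> = Im (g \<theta>)" for \<theta>
    define \<rho> where "\<rho> \<theta> = exp (Re (g \<theta>))" for \<theta>
    have G: "\<Gamma> \<theta> = of_real (\<rho> \<theta>) * cis (\<alpha> \<theta>)" for \<theta>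
      unfolding g(2) \<alpha>_def \<rho>_def by (subst exp_eq_polar) simp
    have \<rho>: "0 < \<rho> \<theta>" for \<theta> by (simp add: \<rho>_def)
    have c\<alpha>: "continuous_on S \<alpha>" for S unfolding \<alpha>_def
      by (intro continuous_intros continuous_on_subset[OF g(1)]) auto
    \<comment> \<open>Equal image angles put the image of the end of one ray on the image of the
      other ray, provided that it is the nearer one; this explains the assumption on
      \<open>\<rho>\<close>. Injectivity of \<open>h\<close> then identifies the rays.\<close>
    have main: "cis \<theta> = cis \<theta>'" if "cis (\<alpha> \<theta>) = cis (\<alpha> \<theta>')" "\<rho> \<theta> \<le> \<rho> \<theta>'" for \<theta> \<theta>'
    proof -
      define t where "t = \<rho> \<theta> / \<rho> \<theta>'"
      have t: "0 < t" "t \<le> 1" using that(2) \<rho>[of \<theta>] \<rho>[of \<theta>'] by (auto simp: t_def)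
      have "\<Gamma> \<theta> = of_real t * \<Gamma> \<theta>'" unfolding G using that(1) \<rho>[of \<theta>'] by (simp add: t_def)
      then have "h (v + of_real \<epsilon> * cis \<theta>) = h (v + of_real (t * \<epsilon>) * cis \<theta>')"
        using Gr[of "t * \<epsilon>" \<theta>'] Gr[of \<epsilon> \<theta>] t \<epsilon> by (simp add: mult_le_cancel_right1)
      then have *: "of_real \<epsilon> * cis \<theta> = of_real (t * \<epsilon>) * cis \<theta>'" using inj by (auto dest!: injD)
      then have "norm (of_real \<epsilon> * cis \<theta>) = norm (of_real (t * \<epsilon>) * cis \<theta>')" by (rule arg_cong)
      then have "t = 1" using \<epsilon> t by (simp add: norm_mult)
      then show ?thesis using * \<epsilon> by simp
    qed
    have injm: "\<theta> = \<theta>'" if "cis (\<alpha> \<theta>) = cis (\<alpha> \<theta>')" "\<bar>\<theta> - \<theta>'\<bar> < 2 * pi" for \<theta> \<theta>'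
    proof (cases "\<rho> \<theta> \<le> \<rho> \<theta>'")
      case True then show ?thesis using main that cis_eqD by blast
    next
      case False
      then have "cis \<theta>' = cis \<theta>" using main[of \<theta>' \<theta>] that(1) by simp
      then show ?thesis using cis_eqD that(2) by metis
    qed
    let ?I = "{a..<a + 2 * pi}"
    have "inj_on \<alpha> ?I"
    proof (rule inj_onI)
      fix x y assume "x \<in> ?I" "y \<in> ?I" "\<alpha> x = \<alpha> y"
      then show "x = y" using injm[of x y] by auto
    qed
    moreover have "is_interval ?I" by (simp add: is_interval_co)
    ultimately have mono: "strict_mono_on ?I \<alpha> \<or> strict_antimono_on ?I \<alpha>"
      using injective_eq_monotone_map[of ?I \<alpha>] c\<alpha> by blast
    have cis2: "cis (x + 2 * pi) = cis x" "cis (x - 2 * pi) = cis x" for x using cis_multiple_2pi[of 1] by (simp_all flip: cis_mult cis_divide)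
    \<comment> \<open>A difference of \<open>2 * pi\<close> or more would, by the intermediate value
      theorem, produce a point between \<open>x\<close> and \<open>y\<close>, different from
      \<open>x\<close>, whose image angle is that of \<open>x\<close> modulo
      \<open>2 * pi\<close>.\<close>
    have bd: "\<bar>\<alpha> x - \<alpha> y\<bar> < 2 * pi" if xy: "a \<le> x" "x < y" "y < a + 2 * pi" for x y
    proof (rule ccontr)
      assume "\<not> \<bar>\<alpha> x - \<alpha> y\<bar> < 2 * pi"
      then consider "\<alpha> x + 2 * pi \<le> \<alpha> y" | "\<alpha> y \<le> \<alpha> x - 2 * pi" by linarith
      then show False
      proof cases
        case 1
        then obtain z where "x \<le> z" "z \<le> y" "\<alpha> z = \<alpha> x + 2 * pi"
          using IVT'[of \<alpha> x "\<alpha> x + 2 * pi" y] xy c\<alpha> 1 by (smt (verit) pi_gt_zero)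
        then show False using injm[of z x] cis2 xy by auto
      next
        case 2
        then obtain z where "x \<le> z" "z \<le> y" "\<alpha> z = \<alpha> x - 2 * pi"
          using IVT2'[of \<alpha> y "\<alpha> x - 2 * pi" x] xy c\<alpha> 2 by (smt (verit) pi_gt_zero)
        then show False using injm[of z x] cis2 xy by auto
      qed
    qed
    have 1: "(\<forall>x y. a \<le> x \<longrightarrow> x < y \<longrightarrow> y < a + 2 * pi \<longrightarrow> \<alpha> x < \<alpha> y \<and> \<alpha> y < \<alpha> x + 2 * pi)
         \<or> (\<forall>x y. a \<le> x \<longrightarrow> x < y \<longrightarrow> y < a + 2 * pi \<longrightarrow> \<alpha> y < \<alpha> x \<and> \<alpha> x < \<alpha> y + 2 * pi)"
      using mono
    proof
      assume m: "strict_mono_on ?I \<alpha>"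
      have "\<alpha> x < \<alpha> y \<and> \<alpha> y < \<alpha> x + 2 * pi" if "a \<le> x" "x < y" "y < a + 2 * pi" for x y
        using monotone_onD[OF m, of x y] bd[OF that] that by auto
      then show ?thesis by blast
    next
      assume m: "strict_antimono_on ?I \<alpha>"
      have "\<alpha> y < \<alpha> x \<and> \<alpha> x < \<alpha> y + 2 * pi" if "a \<le> x" "x < y" "y < a + 2 * pi" for x y
        using monotone_onD[OF m, of x y] bd[OF that] that by auto
      then show ?thesis by blast
    qed
    have 2: "h (v + of_real r * cis \<theta>) = h v + of_real (r / \<epsilon> * \<rho> \<theta>) * cis (\<alpha> \<theta>)" if "0 \<le> r" "r \<le> \<epsilon>" for r \<theta>
      using Gr[OF that] by (simp add: G)
    show "\<exists>\<alpha> \<rho>. (\<forall>\<theta>. 0 < \<rho> \<theta> \<and> (\<forall>r. 0 \<le> r \<longrightarrow> r \<le> \<epsilon> \<longrightarrow> h (v + of_real r * cis \<theta>) = h v + of_real (r / \<epsilon> * \<rho> \<theta>) * cis (\<alpha> \<theta>)))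
       \<and> ((\<forall>x y. a \<le> x \<longrightarrow> x < y \<longrightarrow> y < a + 2 * pi \<longrightarrow> \<alpha> x < \<alpha> y \<and> \<alpha> y < \<alpha> x + 2 * pi)
         \<or> (\<forall>x y. a \<le> x \<longrightarrow> x < y \<longrightarrow> y < a + 2 * pi \<longrightarrow> \<alpha> y < \<alpha> x \<and> \<alpha> x < \<alpha> y + 2 * pi))"
      by (intro exI[of _ \<alpha>] exI[of _ \<rho>] conjI allI impI) (rule \<rho>, rule 2, assumption+, rule 1)
  qed
qed

text \<open>By \<open>conical_angles\<close> the rays at \<open>v\<close> go to rays at
  \<open>h v\<close> whose cyclic order is kept or reversed. Alternation survives a reversal because
  the number \<open>2 * n\<close> of rays is even.\<close>

lemma alternating_map:
  assumes h: "plane_homeo h" and c: "conical_at h v" and alt: "alternating_at n D v"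
  shows "alternating_at n (map_diagram h D) (h v)"
proof -
  have inj: "inj h" using h plane_homeo_bij bij_is_inj by blast
  obtain \<epsilon>1 \<theta> where t1: "star n D v \<epsilon>1 \<theta>" using alt alternating_at_star by blast
  note t = star_pos[OF t1] star_mono[OF t1] star_eq[OF star_shrink[OF t1]]
  obtain \<epsilon>2 where e2: "\<epsilon>2 > 0"
    "\<And>\<epsilon> a. 0 < \<epsilon> \<Longrightarrow> \<epsilon> \<le> \<epsilon>2 \<Longrightarrow>
      \<exists>\<alpha> \<rho>. (\<forall>\<theta>. 0 < \<rho> \<theta> \<and> (\<forall>r. 0 \<le> r \<longrightarrow> r \<le> \<epsilon> \<longrightarrow> h (v + of_real r * cis \<theta>) = h v + of_real (r / \<epsilon> * \<rho> \<theta>) * cis (\<alpha> \<theta>)))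
       \<and> ((\<forall>x y. a \<le> x \<longrightarrow> x < y \<longrightarrow> y < a + 2 * pi \<longrightarrow> \<alpha> x < \<alpha> y \<and> \<alpha> y < \<alpha> x + 2 * pi)
         \<or> (\<forall>x y. a \<le> x \<longrightarrow> x < y \<longrightarrow> y < a + 2 * pi \<longrightarrow> \<alpha> y < \<alpha> x \<and> \<alpha> x < \<alpha> y + 2 * pi))"
    using conical_angles[OF h c] by blast
  define \<epsilon> where "\<epsilon> = min \<epsilon>1 \<epsilon>2"
  have \<epsilon>: "0 < \<epsilon>" "\<epsilon> \<le> \<epsilon>1" "\<epsilon> \<le> \<epsilon>2" using t(1) e2(1) by (auto simp: \<epsilon>_def)
  obtain \<alpha> \<rho> where a: "\<And>\<theta>. 0 < \<rho> \<theta>"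
    "\<And>\<theta> r. 0 \<le> r \<Longrightarrow> r \<le> \<epsilon> \<Longrightarrow> h (v + of_real r * cis \<theta>) = h v + of_real (r / \<epsilon> * \<rho> \<theta>) * cis (\<alpha> \<theta>)"
    "((\<forall>x y. \<theta> 0 \<le> x \<longrightarrow> x < y \<longrightarrow> y < \<theta> 0 + 2 * pi \<longrightarrow> \<alpha> x < \<alpha> y \<and> \<alpha> y < \<alpha> x + 2 * pi)
         \<or> (\<forall>x y. \<theta> 0 \<le> x \<longrightarrow> x < y \<longrightarrow> y < \<theta> 0 + 2 * pi \<longrightarrow> \<alpha> y < \<alpha> x \<and> \<alpha> x < \<alpha> y + 2 * pi))"
    using e2(2)[OF \<epsilon>(1,3), of "\<theta> 0"] by blast
  have "open (h ` ball v \<epsilon>)" "h v \<in> h ` ball v \<epsilon>"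
    using plane_homeo_open[OF h] \<epsilon> by auto
  then obtain \<delta> where d: "\<delta> > 0" "ball (h v) \<delta> \<subseteq> h ` ball v \<epsilon>" by (meson open_contains_ball)
  \<comment> \<open>The image of the sphere of radius \<open>\<epsilon>\<close> lies outside the
    image of the open ball, so no image ray ends at a distance less than
    \<open>\<delta>\<close>.\<close>
  have \<delta>\<rho>: "\<delta> \<le> \<rho> x" for x
  proof (rule ccontr)
    assume "\<not> \<delta> \<le> \<rho> x"
    then have "h v + of_real (\<rho> x) * cis (\<alpha> x) \<in> ball (h v) \<delta>"
      using a(1)[of x] by (simp add: dist_norm norm_mult)
    moreover have "h (v + of_real \<epsilon> * cis x) = h v + of_real (\<rho> x) * cis (\<alpha> x)" using a(2)[of \<epsilon> x] \<epsilon> by simp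
    ultimately have "h (v + of_real \<epsilon> * cis x) \<in> h ` ball v \<epsilon>" using d(2) by (metis subsetD)
    then have "v + of_real \<epsilon> * cis x \<in> ball v \<epsilon>" using inj_image_mem_iff[OF inj] by blast
    then show False using \<epsilon> by (simp add: dist_norm norm_mult)
  qed
  have str: "strands (map_diagram h D) c \<inter> ball (h v) \<delta> =
              {h v + of_real r * cis (\<alpha> (\<theta> k)) | r k.
                 0 \<le> r \<and> r < \<delta> \<and> k < 2 * n \<and> (even k \<longleftrightarrow> c = G1)}" (is "?L = ?R") for c
  proof
    show "?L \<subseteq> ?R"
    proof
      fix w assume w: "w \<in> ?L"
      then obtain z where z: "z \<in> strands D c" "w = h z" by (auto simp: strands_map)
      have "h z \<in> h ` ball v \<epsilon>" using w d(2) z by auto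
      then have "z \<in> strands D c \<inter> ball v \<epsilon>" using z inj_image_mem_iff[OF inj] by blast
      then obtain r k where rk: "z = v + of_real r * cis (\<theta> k)" "0 \<le> r" "r < \<epsilon>" "k < 2 * n" "even k \<longleftrightarrow> c = G1"
        unfolding t(3)[OF \<epsilon>(1,2)] by blast
      have weq: "w = h v + of_real (r / \<epsilon> * \<rho> (\<theta> k)) * cis (\<alpha> (\<theta> k))" using a(2)[of r "\<theta> k"] rk z by simp
      have pos: "0 \<le> r / \<epsilon> * \<rho> (\<theta> k)" using rk \<epsilon> a(1)[of "\<theta> k"] by simp
      have "dist (h v) w < \<delta>" using w by simp
      then have "r / \<epsilon> * \<rho> (\<theta> k) < \<delta>" using pos unfolding weq dist_of_real_cis by linarith
      then show "w \<in> ?R" using weq pos rk by blast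
    qed
    show "?R \<subseteq> ?L"
    proof
      fix w assume "w \<in> ?R"
      then obtain r k where rk: "w = h v + of_real r * cis (\<alpha> (\<theta> k))" "0 \<le> r" "r < \<delta>" "k < 2 * n" "even k \<longleftrightarrow> c = G1"
        by blast
      define s where "s = r * \<epsilon> / \<rho> (\<theta> k)"
      have s: "0 \<le> s" "s < \<epsilon>" using rk \<delta>\<rho>[of "\<theta> k"] a(1)[of "\<theta> k"] \<epsilon>
        by (auto simp: s_def field_simps)
      have "s / \<epsilon> * \<rho> (\<theta> k) = r" using a(1)[of "\<theta> k"] \<epsilon> by (simp add: s_def)
      then have "w = h (v + of_real s * cis (\<theta> k))" using a(2)[of s "\<theta> k"] s rk(1) by simp
      moreover have "v + of_real s * cis (\<theta> k) \<in> strands D c \<inter> ball v \<epsilon>"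
        unfolding t(3)[OF \<epsilon>(1,2)] using s rk by blast
      moreover have "w \<in> ball (h v) \<delta>" using rk by (simp add: dist_norm norm_mult)
      ultimately show "w \<in> ?L" by (auto simp: strands_map)
    qed
  qed
  have rng: "\<theta> 0 \<le> \<theta> k" "\<theta> k < \<theta> 0 + 2 * pi" if "k < 2 * n" for k
    using t(2)[of 0 k] that by (cases "k = 0"; force)+
  show ?thesis using a(3)
  proof
    assume m: "\<forall>x y. \<theta> 0 \<le> x \<longrightarrow> x < y \<longrightarrow> y < \<theta> 0 + 2 * pi \<longrightarrow> \<alpha> x < \<alpha> y \<and> \<alpha> y < \<alpha> x + 2 * pi"
    have "\<alpha> (\<theta> i) < \<alpha> (\<theta> j) \<and> \<alpha> (\<theta> j) < \<alpha> (\<theta> i) + 2 * pi" if "i < j" "j < 2 * n" for i j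
      using m rng[of i] rng[of j] t(2)[of i j] that by simp
    then show ?thesis unfolding alternating_at_def using d(1) str
      by (intro exI[of _ \<delta>] exI[of _ "\<lambda>k. \<alpha> (\<theta> k)"] conjI allI) auto
  next
    assume m: "\<forall>x y. \<theta> 0 \<le> x \<longrightarrow> x < y \<longrightarrow> y < \<theta> 0 + 2 * pi \<longrightarrow> \<alpha> y < \<alpha> x \<and> \<alpha> x < \<alpha> y + 2 * pi"
    have mm: "\<alpha> (\<theta> j) < \<alpha> (\<theta> i) \<and> \<alpha> (\<theta> i) < \<alpha> (\<theta> j) + 2 * pi" if "i < j" "j < 2 * n" for i j
      using m rng[of i] rng[of j] t(2)[of i j] that by simp
    \<comment> \<open>Ray \<open>0\<close> stays first after its angle is lowered by
      \<open>2 * pi\<close>; the others are listed backwards. The new index \<open>2 * n - k\<close>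
      has the parity of \<open>k\<close>, so the colors fit.\<close>
    define \<beta> where "\<beta> k = (if k = 0 then \<alpha> (\<theta> 0) - 2 * pi else \<alpha> (\<theta> (2 * n - k)))" for k
    have b: "\<beta> i < \<beta> j \<and> \<beta> j < \<beta> i + 2 * pi" if "i < j" "j < 2 * n" for i j
    proof (cases "i = 0")
      case True then show ?thesis using mm[of 0 "2 * n - j"] that by (auto simp: \<beta>_def)
    next
      case False then show ?thesis using mm[of "2 * n - j" "2 * n - i"] that by (auto simp: \<beta>_def)
    qed
    have cb: "cis (\<beta> k) = cis (\<alpha> (\<theta> (if k = 0 then 0 else 2 * n - k)))" for k
      by (simp add: \<beta>_def flip: cis_divide)
    have "{h v + of_real r * cis (\<beta> k) | r k. 0 \<le> r \<and> r < \<delta> \<and> k < 2 * n \<and> (even k \<longleftrightarrow> c = G1)}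
        = {h v + of_real r * cis (\<alpha> (\<theta> k)) | r k. 0 \<le> r \<and> r < \<delta> \<and> k < 2 * n \<and> (even k \<longleftrightarrow> c = G1)}"
       (is "?B = ?A") for c
    proof (intro set_eqI iffI)
      fix w assume "w \<in> ?B"
      then obtain r k where rk: "w = h v + of_real r * cis (\<beta> k)" "0 \<le> r" "r < \<delta>" "k < 2 * n" "even k \<longleftrightarrow> c = G1"
        by blast
      let ?k = "if k = 0 then 0 else 2 * n - k"
      have "?k < 2 * n" "even ?k \<longleftrightarrow> c = G1" using rk by auto
      moreover have "w = h v + of_real r * cis (\<alpha> (\<theta> ?k))" using rk(1) cb[of k] by simp
      ultimately show "w \<in> ?A" using rk(2,3) by blast
    next
      fix w assume "w \<in> ?A"
      then obtain r k where rk: "w = h v + of_real r * cis (\<alpha> (\<theta> k))" "0 \<le> r" "r < \<delta>" "k < 2 * n" "even k \<longleftrightarrow> c = G1"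
        by blast
      let ?k = "if k = 0 then 0 else 2 * n - k"
      have k: "?k < 2 * n" "even ?k \<longleftrightarrow> c = G1" "(if ?k = 0 then 0 else 2 * n - ?k) = k" using rk by auto
      have "w = h v + of_real r * cis (\<beta> ?k)" using cb[of ?k] rk(1) unfolding k(3) by simp
      then show "w \<in> ?B" using rk(2,3) k(1,2) by blast
    qed
    then show ?thesis unfolding alternating_at_def using d(1) str b
      by (intro exI[of _ \<delta>] exI[of _ \<beta>] conjI allI) auto
  qed
qed

lemma is_edge_map:
  assumes h: "plane_homeo h" and e: "is_edge V A" shows "is_edge (h ` V) (h ` A)"
proof -
  have b: "inj h" using h plane_homeo_bij bij_is_inj by blast
  obtain g where g: "simple_path g" "path_image g = A" "pathstart g \<in> V" "pathfinish g \<in> V"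
     "A \<inter> V = {pathstart g, pathfinish g}" using e unfolding is_edge_def by blast
  have "simple_path (h \<circ> g)"
    by (metis b h g(1) inj_on_subset plane_homeo_cont simple_path_continuous_image top_greatest)
  moreover have "h ` A \<inter> h ` V = {h (pathstart g), h (pathfinish g)}"
    using g(5) image_Int[OF b] by (metis image_insert image_empty)
  ultimately show ?thesis unfolding is_edge_def using g
    by (intro exI[of _ "h \<circ> g"]) (auto simp: path_image_compose pathstart_compose pathfinish_compose)
qed

lemma is_circle_map:
  assumes h: "plane_homeo h" and e: "is_circle V A" shows "is_circle (h ` V) (h ` A)"
proof -
  have b: "inj h" using h plane_homeo_bij bij_is_inj by blast
  obtain g where g: "simple_path g" "path_image g = A" "pathfinish g = pathstart g"
     "A \<inter> V = {}" using e unfolding is_circle_def by blast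
  have "simple_path (h \<circ> g)"
    by (metis b h g(1) inj_on_subset plane_homeo_cont simple_path_continuous_image top_greatest)
  moreover have "h ` A \<inter> h ` V = {}" using g(4) image_Int[OF b] by (metis image_empty)
  ultimately show ?thesis unfolding is_circle_def using g
    by (intro exI[of _ "h \<circ> g"]) (auto simp: path_image_compose pathstart_compose pathfinish_compose)
qed

lemma polygonal_map:
  assumes h: "plane_homeo h" "pw_affine h" and D: "polygonal_diagram n D"
  shows "polygonal_diagram n (map_diagram h D)"
proof -
  have b: "inj h" using h plane_homeo_bij bij_is_inj by blast
  note D' = polygonal_diagramD[OF D]
  let ?D = "map_diagram h D" let ?m = "\<lambda>(c::gen, A). (c, h ` A)"
  have e: "edges ?D = ?m ` edges D" "circles ?D = ?m ` circles D" by (simp_all add: map_diagram_def)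
  have 0: "snd x \<inter> snd y \<subseteq> verts ?D" if xy: "x \<in> edges ?D \<union> circles ?D" "y \<in> edges ?D \<union> circles ?D" "x \<noteq> y" for x y
  proof -
    obtain x' y' where x': "x' \<in> edges D \<union> circles D" "x = ?m x'" "y' \<in> edges D \<union> circles D" "y = ?m y'"
      using xy(1,2) unfolding e by (metis (no_types, lifting) image_Un image_iff)
    then have "snd x' \<inter> snd y' \<subseteq> verts D" using D'(8) xy(3) by blast
    then have "h ` snd x' \<inter> h ` snd y' \<subseteq> h ` verts D" by (metis image_Int[OF b] image_mono)
    then show ?thesis using x' by (simp add: case_prod_unfold)
  qed
  have 1: "is_edge (verts ?D) A" "polygonal A" if "(c, A) \<in> edges ?D" for c A
    using that D'(4,5) is_edge_map[OF h(1)] polygonal_image[OF h(2)] unfolding e by auto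
  have 2: "is_circle (verts ?D) A" "polygonal A" if "(c, A) \<in> circles ?D" for c A
    using that D'(6,7) is_circle_map[OF h(1)] polygonal_image[OF h(2)] unfolding e by auto
  have 3: "alternating_at n ?D w" if "w \<in> verts ?D" for w
    using that D'(9) alternating_map[OF h(1) pw_affine_conical[OF h(2)]] by auto
  have 4: "finite (verts ?D)" "finite (edges ?D)" "finite (circles ?D)"
    unfolding e using D'(1-3) by auto
  show ?thesis by (rule polygonal_diagramI[OF 4 1 2 0 3])
qed

subsection \<open>Cutting and joining edges\<close>

text \<open>A single color class, with the color dropped. The set \<open>X\<close> may contain
  points through which no listed curve passes, so points can be added to it and removed from it
  while the curves are cut and glued.\<close>

definition graph :: "complex set \<Rightarrow> complex set set \<Rightarrow> complex set set \<Rightarrow> bool" where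
  "graph X E C \<longleftrightarrow> finite E \<and> finite C \<and> (\<forall>A\<in>E. is_edge X A) \<and> (\<forall>A\<in>C. is_circle X A) \<and>
     (\<forall>A\<in>E \<union> C. \<forall>B\<in>E \<union> C. A \<noteq> B \<longrightarrow> A \<inter> B \<subseteq> X)"

text \<open>An edge meets \<open>X\<close> exactly in its end points, so meeting it in the single
  point \<open>y\<close> says that the edge is a loop, which counts twice.\<close>

definition ends :: "complex set \<Rightarrow> complex set \<Rightarrow> complex \<Rightarrow> nat" where
  "ends X A y = (if y \<in> A then if A \<inter> X = {y} then 2 else 1 else 0)"

definition deg :: "complex set \<Rightarrow> complex set set \<Rightarrow> complex \<Rightarrow> nat" where
  "deg X E y = (\<Sum>A\<in>E. ends X A y)"

lemma graphD:
  assumes "graph X E C"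
  shows "finite E" "finite C" "\<And>A. A \<in> E \<Longrightarrow> is_edge X A" "\<And>A. A \<in> C \<Longrightarrow> is_circle X A"
    "\<And>A B. A \<in> E \<union> C \<Longrightarrow> B \<in> E \<union> C \<Longrightarrow> A \<noteq> B \<Longrightarrow> A \<inter> B \<subseteq> X"
  using assms unfolding graph_def by auto

lemma graphI:
  assumes "finite E" "finite C" "\<And>A. A \<in> E \<Longrightarrow> is_edge X A" "\<And>A. A \<in> C \<Longrightarrow> is_circle X A"
    "\<And>A B. A \<in> E \<union> C \<Longrightarrow> B \<in> E \<union> C \<Longrightarrow> A \<noteq> B \<Longrightarrow> A \<inter> B \<subseteq> X"
  shows "graph X E C"
  unfolding graph_def by (intro conjI ballI impI assms(1,2)) (rule assms(3-5); assumption)+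

lemma is_edgeE:
  assumes "is_edge X A"
  obtains g where "simple_path g" "path_image g = A" "pathstart g \<in> X" "pathfinish g \<in> X"
    "A \<inter> X = {pathstart g, pathfinish g}"
  using assms unfolding is_edge_def by blast

lemma path_image_minus_ends:
  assumes "simple_path g" "path_image g \<inter> X = {pathstart g, pathfinish g}"
  shows "path_image g - X = g ` {0<..<1}"
  using simple_path_endless[OF assms(1)] assms(2) by blast

text \<open>Removing the end points leaves the image of the open interval, a connected and dense
  part of the edge. An edge can thus be recovered from its inner part by closure, which is how edges
  are later identified from bare point sets.\<close>

lemma edge_minus:
  assumes "is_edge X A"
  shows "connected (A - X)" "A - X \<noteq> {}" "closure (A - X) = A" "compact A" "A \<inter> X \<noteq> {}"
proof -
  obtain g where g: "simple_path g" "path_image g = A" "A \<inter> X = {pathstart g, pathfinish g}"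
    using assms is_edgeE by metis
  have e: "A - X = g ` {0<..<1}" using path_image_minus_ends g by blast
  have p: "path g" using g simple_path_imp_path by blast
  show "connected (A - X)" unfolding e
    using p by (intro connected_continuous_image) (auto simp: path_def intro: continuous_on_subset)
  show "A - X \<noteq> {}" unfolding e by (simp add: image_is_empty)
  show cA: "compact A" using g compact_path_image p by blast
  have "g ` closure {0<..<1} \<subseteq> closure (g ` {0<..<1})"
    by (rule image_closure_subset) (use p in \<open>auto simp: path_def closure_subset\<close>)
  then have "A \<subseteq> closure (A - X)" unfolding e using g(2) by (simp add: path_image_def)
  moreover have "closure (A - X) \<subseteq> A" using cA by (simp add: closure_minimal compact_imp_closed)
  ultimately show "closure (A - X) = A" by blast
  show "A \<inter> X \<noteq> {}" using g by auto
qed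

lemma circle_minus:
  assumes "is_circle X A"
  shows "connected (A - X)" "A - X \<noteq> {}" "closure (A - X) = A" "compact A" "A \<inter> X = {}" "A - X = A"
proof -
  obtain g where g: "simple_path g" "path_image g = A" "A \<inter> X = {}"
    using assms unfolding is_circle_def by blast
  show "A \<inter> X = {}" by fact
  show e: "A - X = A" using g by blast
  have p: "path g" using g simple_path_imp_path by blast
  show "connected (A - X)" "A - X \<noteq> {}" "compact A" "closure (A - X) = A" unfolding e
    using p g(2) connected_path_image[OF p] compact_path_image[OF p] closure_closed[OF compact_imp_closed, of A]
    by auto
qed

lemma graph_minus:
  assumes "graph X E C" "A \<in> E \<union> C"
  shows "connected (A - X)" "A - X \<noteq> {}" "closure (A - X) = A" "compact A" "closed A"
proof -
  have "is_edge X A \<or> is_circle X A" using assms graphD by blast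
  then show "connected (A - X)" "A - X \<noteq> {}" "closure (A - X) = A" and c: "compact A"
    by (metis edge_minus(1) circle_minus(1), metis edge_minus(2) circle_minus(2),
        metis edge_minus(3) circle_minus(3), metis edge_minus(4) circle_minus(4))
  show "closed A" using c by (rule compact_imp_closed)
qed

lemma graph_unique:
  assumes "graph X E C" "A \<in> E \<union> C" "B \<in> E \<union> C" "x \<in> A" "x \<in> B" "x \<notin> X" shows "A = B"
  using graphD(5)[OF assms(1-3)] assms(4-6) by blast

lemma ends_insert: "x \<notin> A \<Longrightarrow> ends (insert x X) A y = ends X A y"
  and ends_remove: "x \<notin> A \<Longrightarrow> ends (X - {x}) A y = ends X A y"
  by (auto simp: ends_def)

lemma is_edge_insert: "x \<notin> A \<Longrightarrow> is_edge X A \<Longrightarrow> is_edge (insert x X) A"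
  and is_circle_insert: "x \<notin> A \<Longrightarrow> is_circle X A \<Longrightarrow> is_circle (insert x X) A"
  by (auto simp: is_edge_def is_circle_def)

text \<open>The curve is cut at the parameter of \<open>x\<close>. The additivity of
  \<open>ends\<close> at the old vertices also covers loops, both of whose halves end at the same
  old vertex.\<close>

lemma subdivide_edge:
  assumes A: "is_edge X A" and x: "x \<in> A" "x \<notin> X"
  obtains A1 A2 where "is_edge (insert x X) A1" "is_edge (insert x X) A2" "A = A1 \<union> A2" "A1 \<inter> A2 \<subseteq> insert x X"
    "A1 \<noteq> A2" "x \<in> A1" "x \<in> A2"
    "ends (insert x X) A1 x = 1" "ends (insert x X) A2 x = 1"
    "\<And>y. y \<in> X \<Longrightarrow> ends (insert x X) A1 y + ends (insert x X) A2 y = ends X A y"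
proof -
  obtain g where g: "simple_path g" "path_image g = A" "A \<inter> X = {pathstart g, pathfinish g}"
    "pathstart g \<in> X" "pathfinish g \<in> X"
    using A is_edgeE by metis
  then obtain t where t: "0 \<le> t" "t \<le> 1" "g t = x" using x unfolding path_image_def by auto
  have "t \<noteq> 0" "t \<noteq> 1" using t g x by (auto simp: pathstart_def pathfinish_def)
  with t have t01: "0 < t" "t < 1" by auto
  have inj: "s = s' \<or> s = 0 \<and> s' = 1 \<or> s = 1 \<and> s' = 0" if "s \<in> {0..1}" "s' \<in> {0..1}" "g s = g s'" for s s'
    using g(1) that unfolding simple_path_def loop_free_def by blast
  have x01: "g 0 \<noteq> x" "g 1 \<noteq> x" using inj[of 0 t] inj[of 1 t] t t01 by auto
  define A1 where "A1 = g ` {0..t}"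
  define A2 where "A2 = g ` {t..1}"
  have A12: "A = A1 \<union> A2" unfolding A1_def A2_def g(2)[symmetric] path_image_def
    using t01 by (auto simp flip: image_Un simp: ivl_disj_un_two_touch)
  \<comment> \<open>Only the two end parameters of a simple path can share a value, so each half
    reaches the far end of the path exactly when the edge is a loop.\<close>
  have mem: "g s \<in> A1 \<longleftrightarrow> s \<le> t \<or> (s = 1 \<and> g 0 = g 1)" "g s \<in> A2 \<longleftrightarrow> s \<ge> t \<or> (s = 0 \<and> g 0 = g 1)" if "s \<in> {0..1}" for s
  proof -
    show "g s \<in> A1 \<longleftrightarrow> s \<le> t \<or> (s = 1 \<and> g 0 = g 1)"
    proof
      assume "g s \<in> A1"
      then obtain s' where "s' \<in> {0..t}" "g s = g s'" unfolding A1_def by blast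
      then show "s \<le> t \<or> (s = 1 \<and> g 0 = g 1)" using inj[of s s'] that t01 by auto
    qed (use that t01 in \<open>auto simp: A1_def intro: image_eqI[of _ _ s] image_eqI[of _ _ 0]\<close>)
    show "g s \<in> A2 \<longleftrightarrow> s \<ge> t \<or> (s = 0 \<and> g 0 = g 1)"
    proof
      assume "g s \<in> A2"
      then obtain s' where "s' \<in> {t..1}" "g s = g s'" unfolding A2_def by blast
      then show "s \<ge> t \<or> (s = 0 \<and> g 0 = g 1)" using inj[of s s'] that t01 by auto
    qed (use that t01 in \<open>auto simp: A2_def intro: image_eqI[of _ _ s] image_eqI[of _ _ 1]\<close>)
  qed
  have X: "A \<inter> X = {g 0, g 1}" "g 0 \<in> X" "g 1 \<in> X" using g by (auto simp: pathstart_def pathfinish_def)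
  have m: "g 0 \<in> A1" "g 1 \<in> A2" "g 1 \<in> A1 \<longleftrightarrow> g 0 = g 1" "g 0 \<in> A2 \<longleftrightarrow> g 0 = g 1" "x \<in> A1" "x \<in> A2"
    using mem[of 0] mem[of 1] mem[of t] t t01 by auto
  have z: "z = g 0 \<or> z = g 1" if "z \<in> A1 \<or> z \<in> A2" "z \<in> X" for z using X(1) A12 that by blast
  have "w \<in> {g 0, x}" if "w \<in> A1 \<inter> insert x X" for w using z[of w] m(3) that by auto
  then have AX1: "A1 \<inter> insert x X = {g 0, x}" using X(2) m(1,5) by blast
  have "w \<in> {x, g 1}" if "w \<in> A2 \<inter> insert x X" for w using z[of w] m(4) that by auto
  then have AX2: "A2 \<inter> insert x X = {x, g 1}" using X(3) m(2,6) by blast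
  have "simple_path (subpath 0 t g)" "simple_path (subpath t 1 g)"
    using t01 by (auto intro!: simple_path_subpath[OF g(1)])
  then have e1: "is_edge (insert x X) A1" and e2: "is_edge (insert x X) A2"
    unfolding is_edge_def using AX1 AX2 X t t01
    by (intro exI[of _ "subpath 0 t g"] exI[of _ "subpath t 1 g"];
        simp add: path_image_subpath A1_def A2_def)+
  have i: "A1 \<inter> A2 \<subseteq> insert x X"
  proof
    fix z assume z: "z \<in> A1 \<inter> A2"
    then obtain s where "s \<in> {0..t}" "z = g s" by (auto simp: A1_def)
    with z mem(2)[of s] t01 t X show "z \<in> insert x X" by force
  qed
  have ne: "A1 \<noteq> A2"
    using mem[of "t / 2"] t01 by (auto simp: A1_def)
  have ex: "ends (insert x X) A1 x = 1" "ends (insert x X) A2 x = 1"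
    using m x01 AX1 AX2 by (auto simp: ends_def)
  have ey: "ends (insert x X) A1 y + ends (insert x X) A2 y = ends X A y" if y: "y \<in> X" for y
  proof -
    have yx: "y \<noteq> x" using y x by blast
    have "y \<in> A \<longleftrightarrow> y = g 0 \<or> y = g 1" using X y by blast
    moreover have "y \<in> A1 \<longleftrightarrow> y = g 0" "y \<in> A2 \<longleftrightarrow> y = g 1" using AX1 AX2 y yx by blast+
    ultimately show ?thesis unfolding ends_def AX1 AX2 X using yx by auto
  qed
  show ?thesis by (rule that[OF e1 e2 A12 i ne m(5,6) ex ey])
qed

text \<open>A point on a circle turns the circle into a loop, and a point on an edge splits the
  edge. In both cases the curves cover the same set as before.\<close>

lemma subdivide:
  assumes G: "graph X E C" and x: "x \<in> \<Union>(E \<union> C)" "x \<notin> X"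
  obtains E' C' where "graph (insert x X) E' C'" "\<Union>(E' \<union> C') = \<Union>(E \<union> C)"
    "deg (insert x X) E' x = 2" "\<And>y. y \<in> X \<Longrightarrow> deg (insert x X) E' y = deg X E y"
proof -
  note G' = graphD[OF G]
  obtain A where A: "A \<in> E \<union> C" "x \<in> A" using x by blast
  have u: "x \<notin> B" if "B \<in> E \<union> C" "B \<noteq> A" for B
    using graph_unique[OF G _ A(1)] that A x by blast
  show ?thesis
  proof (cases "A \<in> C")
    case True
    obtain g where g: "simple_path g" "path_image g = A" "pathfinish g = pathstart g" "A \<inter> X = {}"
      using G'(4)[OF True] unfolding is_circle_def by blast
    obtain t where t: "t \<in> {0..1}" "g t = x" using A g unfolding path_image_def by auto
    \<comment> \<open>Shifting the parametrisation moves the base point of the circle to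
      \<open>x\<close>.\<close>
    have "is_edge (insert x X) A"
      unfolding is_edge_def
    proof (intro exI conjI)
      show "simple_path (shiftpath t g)" using g t simple_path_shiftpath by auto
      show "path_image (shiftpath t g) = A" using g t path_image_shiftpath by metis
      show "pathstart (shiftpath t g) \<in> insert x X" "pathfinish (shiftpath t g) \<in> insert x X"
         "A \<inter> insert x X = {pathstart (shiftpath t g), pathfinish (shiftpath t g)}"
        using t g(3,4) A by (auto simp: pathstart_shiftpath pathfinish_shiftpath)
    qed
    moreover have int: "B \<inter> B' \<subseteq> insert x X"
      if "B \<in> insert A E \<union> (C - {A})" "B' \<in> insert A E \<union> (C - {A})" "B \<noteq> B'" for B B'
      using G'(5)[of B B'] that True by blast
    moreover have AE: "A \<notin> E" using True G'(3,4) edge_minus(5) circle_minus(5) by blast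
    moreover from AE have uE: "x \<notin> B" if "B \<in> E" for B using u that by auto
    ultimately have gr: "graph (insert x X) (insert A E) (C - {A})"
      unfolding graph_def using G'(1-4) uE u True is_edge_insert is_circle_insert int
      by (intro conjI ballI impI) auto
    have un: "\<Union>(insert A E \<union> (C - {A})) = \<Union>(E \<union> C)" using True by auto
    have eq: "(\<Sum>B\<in>E. ends (insert x X) B y) = deg X E y" for y
      unfolding deg_def using u AE by (intro sum.cong) (auto intro!: ends_insert)
    have d: "deg (insert x X) (insert A E) y = ends (insert x X) A y + deg X E y" for y
      unfolding deg_def using G'(1) AE eq by (simp add: deg_def)
    have "deg X E x = 0" unfolding deg_def using u AE by (intro sum.neutral) (auto simp: ends_def)
    then have "deg (insert x X) (insert A E) x = 2" using d A g(4) by (simp add: ends_def)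
    moreover have "deg (insert x X) (insert A E) y = deg X E y" if "y \<in> X" for y
      using d that g(4) by (auto simp: ends_def)
    ultimately show ?thesis using that gr un by blast
  next
    case False
    then have AE: "A \<in> E" using A by blast
    obtain A1 A2 where s: "is_edge (insert x X) A1" "is_edge (insert x X) A2" "A = A1 \<union> A2" "A1 \<inter> A2 \<subseteq> insert x X"
    "A1 \<noteq> A2" "x \<in> A1" "x \<in> A2"
    "ends (insert x X) A1 x = 1" "ends (insert x X) A2 x = 1"
    "\<And>y. y \<in> X \<Longrightarrow> ends (insert x X) A1 y + ends (insert x X) A2 y = ends X A y"
      using subdivide_edge[OF G'(3)[OF AE] A(2) x(2)] by metis
    let ?E = "insert A1 (insert A2 (E - {A}))"
    have ni: "A1 \<notin> E - {A}" "A2 \<notin> E - {A}" using u s(6,7) by auto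
    have "B \<inter> B' \<subseteq> insert x X" if B: "B \<in> ?E \<union> C" "B' \<in> ?E \<union> C" "B \<noteq> B'" for B B'
    proof -
      let ?p = "\<lambda>B. if B = A1 \<or> B = A2 then A else B"
      have p: "?p B \<in> E \<union> C" "?p B' \<in> E \<union> C" "B \<subseteq> ?p B" "B' \<subseteq> ?p B'" using B AE s(3) by auto
      show ?thesis
      proof (cases "?p B = ?p B'")
        case True
        have "x \<notin> B" if "B \<in> E \<union> C" "B \<noteq> A" for B using u that by blast
        then have "B \<in> {A1, A2} \<and> B' \<in> {A1, A2}" using True B False s(3,6,7) by (auto split: if_splits)
        then show ?thesis using s(4) B(3) by auto
      next
        case False
        then have "?p B \<inter> ?p B' \<subseteq> X" using G'(5) p by blast
        then show ?thesis using p by blast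
      qed
    qed
    note int = this
    have eE: "is_edge (insert x X) B" if "B \<in> ?E" for B
      using that s(1,2) is_edge_insert[OF u G'(3)] by blast
    have eC: "is_circle (insert x X) B" if "B \<in> C" for B
      using that False is_circle_insert[OF u G'(4)] by blast
    have "finite ?E" using G'(1) by simp
    then have gr: "graph (insert x X) ?E C" by (rule graphI[OF _ G'(2) eE eC int])
    have un: "\<Union>(?E \<union> C) = \<Union>(E \<union> C)" using s(3) AE by auto
    have eq: "(\<Sum>B\<in>E - {A}. ends (insert x X) B y) = (\<Sum>B\<in>E - {A}. ends X B y)" for y
      using u by (intro sum.cong) (auto intro!: ends_insert)
    have d: "deg (insert x X) ?E y = ends (insert x X) A1 y + ends (insert x X) A2 y + (\<Sum>B\<in>E - {A}. ends X B y)" for y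
      unfolding deg_def using G'(1) ni s(5) eq[of y] by simp
    have d': "deg X E y = ends X A y + (\<Sum>B\<in>E - {A}. ends X B y)" for y
      unfolding deg_def using G'(1) AE by (rule sum.remove)
    have "(\<Sum>B\<in>E - {A}. ends X B x) = 0" using u by (intro sum.neutral) (auto simp: ends_def)
    then have "deg (insert x X) ?E x = 2" using d s(8,9) by simp
    moreover have "deg (insert x X) ?E y = deg X E y" if "y \<in> X" for y
      using d d' that s(10) by simp
    ultimately show ?thesis using that gr un by blast
  qed
qed

lemma subdivide_finite:
  assumes "finite Y" and G: "graph X E C" and "Y \<subseteq> \<Union>(E \<union> C)" "Y \<inter> X = {}"
  shows "\<exists>E' C'. graph (X \<union> Y) E' C' \<and> \<Union>(E' \<union> C') = \<Union>(E \<union> C) \<and> (\<forall>y\<in>Y. deg (X \<union> Y) E' y = 2)"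
  using assms(1,3,4)
proof (induction)
  case empty then show ?case using G by auto
next
  case (insert x Y)
  then obtain E' C' where h: "graph (X \<union> Y) E' C'" "\<Union>(E' \<union> C') = \<Union>(E \<union> C)" "\<forall>y\<in>Y. deg (X \<union> Y) E' y = 2"
    by auto
  have "x \<in> \<Union>(E' \<union> C')" "x \<notin> X \<union> Y" using h(2) insert by auto
  then obtain E'' C'' where k: "graph (insert x (X \<union> Y)) E'' C''" "\<Union>(E'' \<union> C'') = \<Union>(E' \<union> C')"
    "deg (insert x (X \<union> Y)) E'' x = 2" "\<And>y. y \<in> X \<union> Y \<Longrightarrow> deg (insert x (X \<union> Y)) E'' y = deg (X \<union> Y) E' y"
    using subdivide[OF h(1)] by metis
  then show ?case using h(2,3) by (intro exI[of _ E''] exI[of _ C'']) auto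
qed

text \<open>Neither edge is a loop at \<open>x\<close>, but their other ends may coincide. The union
  can then be a loop, which is why the concatenation is in general only a simple path and not an
  arc.\<close>

lemma join_edges:
  assumes A: "is_edge X A" "x \<in> A \<inter> X" "A \<inter> X \<noteq> {x}" and B: "is_edge X B" "x \<in> B \<inter> X" "B \<inter> X \<noteq> {x}"
    and AB: "A \<inter> B \<subseteq> X" "A \<noteq> B"
  shows "is_edge (X - {x}) (A \<union> B)"
    "\<And>y. y \<in> X - {x} \<Longrightarrow> ends (X - {x}) (A \<union> B) y = ends X A y + ends X B y"
proof -
  have *: "\<exists>g. arc g \<and> path_image g = A \<and> pathfinish g = x \<and> A \<inter> X = {pathstart g, x} \<and> pathstart g \<noteq> x \<and> pathstart g \<in> X"
    if A: "is_edge X A" "x \<in> A \<inter> X" "A \<inter> X \<noteq> {x}" for A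
  proof -
    obtain g where g: "simple_path g" "path_image g = A" "A \<inter> X = {pathstart g, pathfinish g}"
      "pathstart g \<in> X" "pathfinish g \<in> X"
      using A is_edgeE by metis
    have "arc g" using g A(2,3) by (auto simp: arc_simple_path)
    consider "x = pathfinish g" | "x = pathstart g" using g(3) A(2) by blast
    then show ?thesis
    proof cases
      case 1 then show ?thesis using g \<open>arc g\<close> A(3) by (intro exI[of _ g]) auto
    next
      case 2 then show ?thesis using g \<open>arc g\<close> A(3)
        by (intro exI[of _ "reversepath g"]) (auto simp: arc_reversepath)
    qed
  qed
  obtain g where g: "arc g" "path_image g = A" "pathfinish g = x" "A \<inter> X = {pathstart g, x}" "pathstart g \<noteq> x" "pathstart g \<in> X"
    using *[OF A] by blast
  obtain h' where h': "arc h'" "path_image h' = B" "pathfinish h' = x" "B \<inter> X = {pathstart h', x}" "pathstart h' \<noteq> x" "pathstart h' \<in> X"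
    using *[OF B] by blast
  define h where "h = reversepath h'"
  have h: "arc h" "path_image h = B" "pathstart h = x" "B \<inter> X = {x, pathfinish h}" "pathfinish h \<noteq> x" "pathfinish h \<in> X"
    using h' by (auto simp: h_def arc_reversepath)
  have ABX: "A \<inter> B = (A \<inter> X) \<inter> (B \<inter> X)" using AB by blast
  have "simple_path (g +++ h)"
  proof (cases "pathstart g = pathfinish h")
    case True
    then show ?thesis using g h ABX by (intro simple_path_join_loop) auto
  next
    case False
    then have "arc (g +++ h)" using g h ABX by (intro arc_join) auto
    then show ?thesis by (rule arc_imp_simple_path)
  qed
  moreover have "path_image (g +++ h) = A \<union> B" using g h by (simp add: path_image_join)
  moreover have i: "(A \<union> B) \<inter> (X - {x}) = {pathstart g, pathfinish h}" using g(4,5) h(4,5) by blast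
  ultimately show "is_edge (X - {x}) (A \<union> B)"
    unfolding is_edge_def using g h by (intro exI[of _ "g +++ h"]) auto
  fix y assume y: "y \<in> X - {x}"
  have "y \<in> A \<longleftrightarrow> y = pathstart g" "y \<in> B \<longleftrightarrow> y = pathfinish h" using y g(4) h(4) by blast+
  then show "ends (X - {x}) (A \<union> B) y = ends X A y + ends X B y"
    unfolding ends_def i g(4) h(4) using y g(5) h(5) by (auto simp: doubleton_eq_iff)
qed

text \<open>Degree two leaves two possibilities: a single loop at \<open>x\<close>, which becomes a
  circle once \<open>x\<close> is forgotten, or two different edges that are no loops at
  \<open>x\<close> and are joined there.\<close>

lemma merge:
  assumes G: "graph X E C" and x: "x \<in> X" "deg X E x = 2"
  obtains E' C' where "graph (X - {x}) E' C'" "\<Union>(E' \<union> C') = \<Union>(E \<union> C)"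
    "\<And>y. y \<in> X - {x} \<Longrightarrow> deg (X - {x}) E' y = deg X E y"
proof -
  note G' = graphD[OF G]
  have circ: "x \<notin> A" if "A \<in> C" for A using G'(4)[OF that] circle_minus(5) x by blast
  have erem: "is_edge (X - {x}) A" if A: "is_edge X A" "x \<notin> A" for A
  proof -
    obtain g where g: "simple_path g" "path_image g = A" "A \<inter> X = {pathstart g, pathfinish g}"
      "pathstart g \<in> X" "pathfinish g \<in> X"
      using A(1) is_edgeE by metis
    have "pathstart g \<noteq> x" "pathfinish g \<noteq> x" using g(2) A(2) pathstart_in_path_image pathfinish_in_path_image by metis+
    moreover have "A \<inter> (X - {x}) = A \<inter> X" using A(2) by blast
    ultimately show ?thesis unfolding is_edge_def using g by (intro exI[of _ g]) simp
  qed
  have crem: "is_circle (X - {x}) A" if "is_circle X A" for A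
    using that unfolding is_circle_def by blast
  show ?thesis
  proof (cases "\<exists>A\<in>E. A \<inter> X = {x}")
    case True
    then obtain A where A: "A \<in> E" "A \<inter> X = {x}" by blast
    have "deg X E x = ends X A x + (\<Sum>B\<in>E - {A}. ends X B x)"
      unfolding deg_def using G'(1) A(1) by (rule sum.remove)
    moreover have "ends X A x = 2" using A(2) by (auto simp: ends_def)
    ultimately have "(\<Sum>B\<in>E - {A}. ends X B x) = 0" using x by simp
    then have u: "x \<notin> B" if "B \<in> E" "B \<noteq> A" for B
      using that G'(1) by (auto simp: ends_def split: if_splits)
    obtain g where g: "simple_path g" "path_image g = A" "A \<inter> X = {pathstart g, pathfinish g}"
      using G'(3)[OF A(1)] is_edgeE by metis
    have ps: "pathstart g = x" "pathfinish g = x" using A(2) g(3) by (metis insertI1 insertI2 singletonD)+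
    have cA: "is_circle (X - {x}) A"
      unfolding is_circle_def using g ps A(2) by (intro exI[of _ g]) auto
    have int: "B \<inter> B' \<subseteq> X - {x}" if B: "B \<in> (E - {A}) \<union> insert A C" "B' \<in> (E - {A}) \<union> insert A C" "B \<noteq> B'" for B B'
    proof -
      have "B \<inter> B' \<subseteq> X" using G'(5)[of B B'] B A(1) by auto
      moreover have "x \<notin> B \<or> x \<notin> B'" using B u circ by auto
      ultimately show ?thesis by blast
    qed
    have eE: "is_edge (X - {x}) B" if "B \<in> E - {A}" for B using that u erem[OF G'(3)] by blast
    have eC: "is_circle (X - {x}) B" if "B \<in> insert A C" for B using that cA crem[OF G'(4)] by blast
    have "finite (E - {A})" "finite (insert A C)" using G'(1,2) by simp_all
    then have gr: "graph (X - {x}) (E - {A}) (insert A C)" by (rule graphI[OF _ _ eE eC int])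
    have un: "\<Union>((E - {A}) \<union> insert A C) = \<Union>(E \<union> C)" using A by auto
    have "deg (X - {x}) (E - {A}) y = deg X E y" if y: "y \<in> X - {x}" for y
    proof -
      have "deg X E y = ends X A y + (\<Sum>B\<in>E - {A}. ends X B y)"
        unfolding deg_def using G'(1) A(1) by (rule sum.remove)
      moreover have "ends X A y = 0" using A(2) y by (auto simp: ends_def)
      moreover have "(\<Sum>B\<in>E - {A}. ends X B y) = deg (X - {x}) (E - {A}) y"
        unfolding deg_def using u by (intro sum.cong) (auto simp: ends_remove)
      ultimately show ?thesis by simp
    qed
    then show ?thesis using that gr un by blast
  next
    case False
    then have e1: "ends X A x = (if x \<in> A then 1 else 0)" if "A \<in> E" for A using that by (auto simp: ends_def)
    have "deg X E x = (\<Sum>A\<in>E. if x \<in> A then 1 else 0)" unfolding deg_def using e1 by (intro sum.cong) auto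
    also have "\<dots> = card {A\<in>E. x \<in> A}" using G'(1) by (simp add: sum.If_cases Int_def)
    finally have "card {A\<in>E. x \<in> A} = 2" using x by simp
    then obtain A B where AB: "{A\<in>E. x \<in> A} = {A, B}" "A \<noteq> B" by (meson card_2_iff)
    then have AB': "A \<in> E" "B \<in> E" "x \<in> A" "x \<in> B" by auto
    have u: "x \<notin> D" if "D \<in> E \<union> C" "D \<noteq> A" "D \<noteq> B" for D using AB that circ by blast
    have "A \<inter> X \<noteq> {x}" "B \<inter> X \<noteq> {x}" "A \<inter> B \<subseteq> X" using False AB' G'(5) AB(2) by auto
    then have j: "is_edge (X - {x}) (A \<union> B)"
      "\<And>y. y \<in> X - {x} \<Longrightarrow> ends (X - {x}) (A \<union> B) y = ends X A y + ends X B y"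
      using join_edges[of X A x B] G'(3) AB' AB(2) x by blast+
    let ?E = "insert (A \<union> B) (E - {A, B})"
    have ni: "A \<union> B \<notin> E - {A, B}" using u AB' by blast
    have int: "D \<inter> D' \<subseteq> X - {x}" if D: "D \<in> ?E \<union> C" "D' \<in> ?E \<union> C" "D \<noteq> D'" for D D'
    proof -
      have **: "(A \<union> B) \<inter> D \<subseteq> X - {x}" if "D \<in> E \<union> C" "D \<noteq> A" "D \<noteq> B" for D
        using G'(5)[of A D] G'(5)[of B D] that AB' u[OF that] by auto
      have nC: "A \<notin> C" "B \<notin> C" using circ AB' by auto
      show ?thesis
      proof (cases "D = A \<union> B")
        case True
        then show ?thesis using **[of D'] D nC by auto
      next
        case f: False
        show ?thesis
        proof (cases "D' = A \<union> B")
          case True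
          then show ?thesis using **[of D] D nC by auto
        next
          case False
          have d: "D \<in> E \<union> C" "D \<noteq> A" "D \<noteq> B" "D' \<in> E \<union> C" using f False D(1,2) nC by blast+
          then have "x \<notin> D" using u by blast
          then show ?thesis using G'(5)[OF d(1,4) D(3)] by blast
        qed
      qed
    qed
    have eE: "is_edge (X - {x}) D" if "D \<in> ?E" for D using that u j(1) erem[OF G'(3)] by blast
    have "finite ?E" using G'(1) by simp
    then have gr: "graph (X - {x}) ?E C" by (rule graphI[OF _ G'(2) eE crem[OF G'(4)] int])
    have un: "\<Union>(?E \<union> C) = \<Union>(E \<union> C)" using AB' by auto
    have "deg (X - {x}) ?E y = deg X E y" if y: "y \<in> X - {x}" for y
    proof -
      have "deg X E y = ends X A y + ends X B y + (\<Sum>D\<in>E - {A, B}. ends X D y)"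
      proof -
        have "deg X E y = ends X A y + (\<Sum>D\<in>E - {A}. ends X D y)"
          unfolding deg_def using G'(1) AB'(1) by (rule sum.remove)
        moreover have "(\<Sum>D\<in>E - {A}. ends X D y) = ends X B y + (\<Sum>D\<in>E - {A} - {B}. ends X D y)"
          using G'(1) AB' AB(2) by (intro sum.remove) auto
        moreover have "E - {A} - {B} = E - {A, B}" by blast
        ultimately show ?thesis by simp
      qed
      moreover have "(\<Sum>D\<in>E - {A, B}. ends X D y) = (\<Sum>D\<in>E - {A, B}. ends (X - {x}) D y)"
        using u by (intro sum.cong) (auto simp: ends_remove)
      ultimately show ?thesis using j(2)[OF y] G'(1) ni unfolding deg_def by simp
    qed
    then show ?thesis using that gr un by blast
  qed
qed

lemma merge_finite:
  assumes "finite Y" and G: "graph X E C" and "Y \<subseteq> X" "\<forall>y\<in>Y. deg X E y = 2"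
  shows "\<exists>E' C'. graph (X - Y) E' C' \<and> \<Union>(E' \<union> C') = \<Union>(E \<union> C)"
  using assms
proof (induction arbitrary: X E C)
  case empty then show ?case by auto
next
  case (insert x Y)
  obtain E' C' where h: "graph (X - {x}) E' C'" "\<Union>(E' \<union> C') = \<Union>(E \<union> C)"
    "\<And>y. y \<in> X - {x} \<Longrightarrow> deg (X - {x}) E' y = deg X E y"
    using merge[OF insert.prems(1), of x] insert.prems by (metis insertCI subsetD)
  have Y: "Y \<subseteq> X - {x}" using insert by auto
  moreover have "\<forall>y\<in>Y. deg (X - {x}) E' y = 2"
  proof
    fix y assume "y \<in> Y"
    then show "deg (X - {x}) E' y = 2" using h(3)[of y] insert.prems Y by auto
  qed
  ultimately obtain E'' C'' where "graph (X - {x} - Y) E'' C''" "\<Union>(E'' \<union> C'') = \<Union>(E' \<union> C')"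
    using insert.IH[OF h(1)] by blast
  moreover have "X - {x} - Y = X - insert x Y" by blast
  ultimately show ?case using h(2) by metis
qed

subsection \<open>Replacing the part of a diagram in a disc\<close>

lemma connected_in_one:
  assumes "connected P" "closed A" "closed B" "P \<subseteq> A \<union> B" "P \<inter> A \<inter> B = {}" "P \<inter> A \<noteq> {}"
  shows "P \<subseteq> A"
proof -
  have "A \<inter> P = {} \<or> B \<inter> P = {}"
    using connected_closedD[OF assms(1) _ _ assms(2,3)] assms(4,5) by blast
  then show ?thesis using assms by blast
qed

lemma is_edge_infinite: "is_edge X A \<Longrightarrow> \<not> A \<subseteq> X"
  using edge_minus(2) by blast

lemma is_edge_cong: "is_edge X A \<Longrightarrow> A \<inter> X = A \<inter> X' \<Longrightarrow> is_edge X' A"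
  unfolding is_edge_def by (metis Int_iff pathfinish_in_path_image pathstart_in_path_image)

lemma ends_cong: "A \<inter> X = A \<inter> X' \<Longrightarrow> ends X A y = ends X' A y"
  unfolding ends_def by simp

lemma deg_nonzeroD: "deg X E y \<noteq> 0 \<Longrightarrow> \<exists>A\<in>E. y \<in> A"
  unfolding deg_def by (metis ends_def sum.not_neutral_contains_not_neutral)

text \<open>The boundary points \<open>Y\<close> are made vertices of degree two, so that no edge
  passes through the boundary of \<open>K\<close>. The edges inside must be the given
  \<open>old\<close> ones; they are exchanged for \<open>new\<close>, which again contributes degree
  one at each boundary point, and the points \<open>Y\<close> are forgotten. Edges and circles of
  the result thus exist although only its point set is described.\<close>

lemma replace_graph:
  assumes G: "graph V E C" and S: "S = \<Union>(E \<union> C)"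
    and K: "closed K" and Y: "Y = S \<inter> frontier K" "finite Y" "V \<inter> frontier K = {}"
    and old: "finite old" "\<And>A. A \<in> old \<Longrightarrow> is_edge (V \<union> Y) A"
      "\<And>A B. A \<in> old \<Longrightarrow> B \<in> old \<Longrightarrow> A \<noteq> B \<Longrightarrow> A \<inter> B \<subseteq> V \<union> Y" "S \<inter> K = \<Union>old"
      "\<And>y. y \<in> Y \<Longrightarrow> deg (V \<union> Y) old y = 1"
    and new: "finite new" "\<And>A. A \<in> new \<Longrightarrow> is_edge Y A" "\<And>A. A \<in> new \<Longrightarrow> A \<subseteq> K"
      "\<And>A B. A \<in> new \<Longrightarrow> B \<in> new \<Longrightarrow> A \<noteq> B \<Longrightarrow> A \<inter> B \<subseteq> Y"
      "\<And>y. y \<in> Y \<Longrightarrow> deg Y new y = 1"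
  shows "\<exists>E' C'. graph (V - K) E' C' \<and> \<Union>(E' \<union> C') = (S - K) \<union> \<Union>new"
proof -
  have YV: "Y \<inter> V = {}" "Y \<subseteq> S" "Y \<subseteq> K" using Y K by (auto simp: frontier_def)
  define X where "X = V \<union> Y"
  obtain E1 C1 where G1: "graph X E1 C1" "\<Union>(E1 \<union> C1) = S" "\<And>y. y \<in> Y \<Longrightarrow> deg X E1 y = 2"
    using subdivide_finite[OF Y(2) G] YV(1,2) S unfolding X_def by metis
  note g1 = graphD[OF G1(1)]
  have old_K: "A \<subseteq> K" "A \<subseteq> S" if "A \<in> old" for A using old(4) that by blast+
  \<comment> \<open>The inner part of an edge is connected and meets no other edge. So
    \<open>A\<close> and the subdivided curve \<open>A1\<close> through one of its inner points have
    the same inner part, hence the same closure.\<close>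
  have old_in: "A \<in> E1" if A: "A \<in> old" for A
  proof -
    have eA: "is_edge X A" using old(2)[OF A] X_def by simp
    note mA = edge_minus[OF eA]
    obtain z where z: "z \<in> A - X" using mA(2) by blast
    then have "z \<in> \<Union>(E1 \<union> C1)" using old_K(2)[OF A] G1(2) by blast
    then obtain A1 where A1: "A1 \<in> E1 \<union> C1" "z \<in> A1" by blast
    note m1 = graph_minus[OF G1(1) A1(1)]
    have 1: "A - X \<subseteq> A1"
    proof (rule connected_in_one[OF mA(1)])
      show "closed A1" by (rule m1(5))
      show "closed (\<Union>(E1 \<union> C1 - {A1}))"
        using g1(1,2) graph_minus(5)[OF G1(1)] by (intro closed_Union) auto
      show "A - X \<subseteq> A1 \<union> \<Union>(E1 \<union> C1 - {A1})" using old_K(2)[OF A] G1(2) by blast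
      show "(A - X) \<inter> A1 \<inter> \<Union>(E1 \<union> C1 - {A1}) = {}" using g1(5) A1(1) by blast
      show "(A - X) \<inter> A1 \<noteq> {}" using z A1 by blast
    qed
    \<comment> \<open>The part of \<open>A1\<close> that might leave \<open>K\<close> is covered by
      \<open>closure (- K)\<close>, which meets \<open>A\<close> only in boundary points; those
      belong to \<open>X\<close>.\<close>
    have 2: "A1 - X \<subseteq> A"
    proof (rule connected_in_one[OF m1(1)])
      show "closed A" using mA(4) by (rule compact_imp_closed)
      have "closed (\<Union>(old - {A}))"
        using old(1) edge_minus(4)[OF old(2)] by (intro closed_Union) (auto intro: compact_imp_closed)
      then show "closed (\<Union>(old - {A}) \<union> closure (- K))" by (intro closed_Un) auto
      show "A1 - X \<subseteq> A \<union> (\<Union>(old - {A}) \<union> closure (- K))"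
      proof
        fix w assume w: "w \<in> A1 - X"
        show "w \<in> A \<union> (\<Union>(old - {A}) \<union> closure (- K))"
        proof (cases "w \<in> K")
          case True
          then have "w \<in> \<Union>old" using w A1(1) G1(2) old(4) by blast
          then show ?thesis by blast
        next
          case False
          then show ?thesis using closure_subset[of "- K"] by blast
        qed
      qed
      show "(A1 - X) \<inter> A \<inter> (\<Union>(old - {A}) \<union> closure (- K)) = {}"
      proof -
        have "A \<inter> \<Union>(old - {A}) \<subseteq> X" using old(3)[OF A] X_def by blast
        moreover have "A \<inter> closure (- K) \<subseteq> Y"
          using old_K[OF A] Y(1) K by (auto simp: frontier_closures)
        ultimately show ?thesis using X_def by blast
      qed
      show "(A1 - X) \<inter> A \<noteq> {}" using z A1 by blast
    qed
    have "A1 - X = A - X" using 1 2 by blast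
    then have "A1 = A" using m1(3) mA(3) by (metis (no_types))
    moreover have "A \<notin> C1" using mA(5) circle_minus(5)[OF g1(4)] by metis
    ultimately show ?thesis using A1(1) by simp
  qed
  have outer: "A \<inter> K \<subseteq> Y" if A: "A \<in> (E1 - old) \<union> C1" for A
  proof -
    have AE: "A \<in> E1 \<union> C1" using A by blast
    have nold: "A \<notin> old"
      using A old_in graph_minus(2)[OF G1(1)] g1(3,4) edge_minus(5) circle_minus(5) by blast
    have 1: "(A - X) \<inter> K = {}"
    proof (rule ccontr)
      assume "(A - X) \<inter> K \<noteq> {}"
      then obtain w where w: "w \<in> A" "w \<notin> X" "w \<in> K" by blast
      then have "w \<in> \<Union>old" using AE G1(2) old(4) by blast
      then obtain B where B: "B \<in> old" "w \<in> B" by blast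
      then have "A = B" using graph_unique[OF G1(1) AE, of B w] old_in w by blast
      then show False using nold B by blast
    qed
    \<comment> \<open>A point of \<open>A\<close> in \<open>K\<close> but not in \<open>Y\<close>
      would be interior to \<open>K\<close>, and then \<open>A - X\<close>, being dense in
      \<open>A\<close>, would enter \<open>K\<close>.\<close>
    show ?thesis
    proof
      fix w assume w: "w \<in> A \<inter> K"
      show "w \<in> Y"
      proof (rule ccontr)
        assume wY: "w \<notin> Y"
        then have "w \<in> S" "w \<notin> frontier K" using w AE G1(2) Y(1) by blast+
        then have "w \<in> interior K" using w K by (simp add: frontier_def)
        moreover have "w \<in> closure (A - X)" using w graph_minus(3)[OF G1(1) AE] by simp
        ultimately have "interior K \<inter> (A - X) \<noteq> {}"
          using open_Int_closure_eq_empty[OF open_interior, of K "A - X"] by blast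
        then show False using 1 interior_subset by blast
      qed
    qed
  qed
  define X' where "X' = (V - K) \<union> Y"
  have AX: "A \<inter> X = A \<inter> X'" if "A \<in> (E1 - old) \<union> C1" for A
    using outer[OF that] unfolding X_def X'_def by blast
  have NX: "A \<inter> Y = A \<inter> X'" if "A \<in> new" for A
    using new(3)[OF that] unfolding X'_def by blast
  have newY: "A \<subseteq> K" "\<not> A \<subseteq> Y" if "A \<in> new" for A
    using new(3)[OF that] is_edge_infinite[OF new(2)[OF that]] by auto
  have disj: "(E1 - old) \<inter> new = {}"
  proof -
    have False if A: "A \<in> E1 - old" "A \<in> new" for A
      using outer[of A] newY[OF A(2)] A(1) by (simp add: Int_absorb2)
    then show ?thesis by blast
  qed
  have eE: "is_edge X' A" if "A \<in> (E1 - old) \<union> new" for A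
    using that is_edge_cong[OF g1(3) AX] is_edge_cong[OF new(2) NX] by blast
  have eC: "is_circle X' A" if "A \<in> C1" for A
    using g1(4)[OF that] AX[of A] that unfolding is_circle_def by auto
  have int: "A \<inter> B \<subseteq> X'" if AB: "A \<in> (E1 - old) \<union> new \<union> C1" "B \<in> (E1 - old) \<union> new \<union> C1" "A \<noteq> B" for A B
  proof (cases "A \<in> new")
    case True
    show ?thesis
    proof (cases "B \<in> new")
      case True then show ?thesis using \<open>A \<in> new\<close> new(4) AB(3) X'_def by blast
    next
      case False then show ?thesis using True newY(1) outer[of B] AB(2) X'_def by blast
    qed
  next
    case False
    show ?thesis
    proof (cases "B \<in> new")
      case True then show ?thesis using False newY(1) outer[of A] AB(1) X'_def by blast
    next
      case f: False
      then have "A \<inter> B \<subseteq> X" using g1(5) AB False by blast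
      then show ?thesis using AX[of A] AB(1) False by blast
    qed
  qed
  have "finite ((E1 - old) \<union> new)" using g1(1) new(1) by simp
  then have G2: "graph X' ((E1 - old) \<union> new) C1" by (rule graphI[OF _ g1(2) eE eC int])
  \<comment> \<open>Of the degree two after subdivision, one is taken by \<open>old\<close>; the
    outer pieces keep degree one, and \<open>new\<close> restores two.\<close>
  have d2: "deg X' ((E1 - old) \<union> new) y = 2" if y: "y \<in> Y" for y
  proof -
    have "deg X E1 y = deg X (E1 - old) y + deg X old y"
      unfolding deg_def using g1(1) old_in by (intro sum.subset_diff) auto
    then have "deg X (E1 - old) y = 1" using G1(3)[OF y] old(5)[OF y] X_def by simp
    moreover have "deg X (E1 - old) y = deg X' (E1 - old) y"
      unfolding deg_def by (intro sum.cong refl ends_cong AX) simp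
    moreover have "deg Y new y = deg X' new y"
      unfolding deg_def by (intro sum.cong refl ends_cong NX)
    ultimately show ?thesis using new(5)[OF y] disj g1(1) new(1)
      unfolding deg_def by (simp add: sum.union_disjoint)
  qed
  have "Y \<subseteq> X'" by (auto simp: X'_def)
  then obtain E' C' where G3: "graph (X' - Y) E' C'" "\<Union>(E' \<union> C') = \<Union>((E1 - old) \<union> new \<union> C1)"
    using merge_finite[OF Y(2) G2] d2 by blast
  have "X' - Y = V - K" using YV X'_def by blast
  moreover have "\<Union>((E1 - old) \<union> new \<union> C1) = (S - K) \<union> \<Union>new"
  proof
    have "Y \<subseteq> \<Union>new"
    proof
      fix y assume "y \<in> Y"
      then have "deg Y new y \<noteq> 0" using new(5) by simp
      then show "y \<in> \<Union>new" using deg_nonzeroD by blast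
    qed
    then show "\<Union>((E1 - old) \<union> new \<union> C1) \<subseteq> (S - K) \<union> \<Union>new"
      using outer G1(2) by blast
    show "(S - K) \<union> \<Union>new \<subseteq> \<Union>((E1 - old) \<union> new \<union> C1)"
      using G1(2) old_K(1) by blast
  qed
  ultimately show ?thesis using G3 by auto
qed

text \<open>An open segment free of points of \<open>A \<inter> B\<close> lies in \<open>A\<close>
  or misses it, by connectedness; otherwise the segment is split at such a point, which lowers their
  number in both halves. This makes it possible to see that the edges found by regluing are
  polygonal, although only their union is known.\<close>

lemma polygonal_part:
  assumes "polygonal (A \<union> B)" "closed A" "closed B" "finite (A \<inter> B)"
  shows "polygonal A"
proof -
  have seg: "polygonal (closed_segment a b \<inter> A)"
    if "closed_segment a b \<subseteq> A \<union> B" "card (open_segment a b \<inter> (A \<inter> B)) = k" for a b k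
    using that
  proof (induction k arbitrary: a b rule: less_induct)
    case (less k)
    show ?case
    proof (cases "open_segment a b \<inter> (A \<inter> B) = {}")
      case True
      have sub: "open_segment a b \<subseteq> A \<union> B" using less(2) segment_open_subset_closed by blast
      have cases: "open_segment a b \<subseteq> A \<or> open_segment a b \<inter> A = {}"
        using connected_in_one[OF convex_connected[OF convex_open_segment] assms(2,3) sub] True by blast
      have fin: "polygonal F" if "F \<subseteq> {a, b}" for F
      proof -
        have "F = (\<Union>x\<in>F. closed_segment x x)" by simp
        moreover have "finite F" using that finite_subset by blast
        ultimately show ?thesis using polygonal_UN[of F "\<lambda>x. closed_segment x x"] polygonal_segment by metis
      qed
      show ?thesis
      proof (cases "open_segment a b \<subseteq> A \<and> a \<noteq> b")
        case True
        then have "closure (open_segment a b) \<subseteq> A" using assms(2) closure_minimal by blast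
        then have "closed_segment a b \<subseteq> A" using True by simp
        then show ?thesis by (simp add: Int_absorb2)
      next
        case False
        then have "closed_segment a b \<inter> A \<subseteq> {a, b}" using cases
          by (auto simp: closed_segment_eq_open)
        then show ?thesis by (rule fin)
      qed
    next
      case False
      then obtain x where x: "x \<in> open_segment a b" "x \<in> A \<inter> B" by blast
      have un: "closed_segment a b = closed_segment a x \<union> closed_segment x b"
        using x(1) Un_closed_segment segment_open_subset_closed by blast
      have sub: "open_segment a x \<subseteq> open_segment a b - {x}" "open_segment x b \<subseteq> open_segment a b - {x}"
      proof -
        have "open_segment a x \<subseteq> open_segment a b" "open_segment x b \<subseteq> open_segment a b"
          using x(1) by (simp_all add: subset_open_segment open_closed_segment)
        moreover have "x \<notin> open_segment a x" "x \<notin> open_segment x b" by (simp_all add: open_segment_def)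
        ultimately show "open_segment a x \<subseteq> open_segment a b - {x}" "open_segment x b \<subseteq> open_segment a b - {x}"
          by blast+
      qed
      have "card (open_segment a x \<inter> (A \<inter> B)) < k" "card (open_segment x b \<inter> (A \<inter> B)) < k"
        unfolding less(3)[symmetric] using sub x assms(4)
        by (auto intro!: psubset_card_mono)
      then have "polygonal (closed_segment a x \<inter> A)" "polygonal (closed_segment x b \<inter> A)"
        using less(1)[OF _ _ refl] less(2) unfolding un by blast+
      then show ?thesis unfolding un Int_Un_distrib2 by (rule polygonal_Un)
    qed
  qed
  obtain S where S: "finite S" "A \<union> B = (\<Union>(a, b)\<in>S. closed_segment a b)"
    using assms(1) unfolding polygonal_def by blast
  have "A = (\<Union>p\<in>S. (case p of (a, b) \<Rightarrow> closed_segment a b \<inter> A))"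
    using S(2) by auto
  moreover have "polygonal (\<Union>p\<in>S. (case p of (a, b) \<Rightarrow> closed_segment a b \<inter> A))"
    using S seg[OF _ refl] by (intro polygonal_UN) auto
  ultimately show ?thesis by simp
qed

lemma polygonal_strands:
  assumes "polygonal_diagram n D" shows "polygonal (strands D c)"
proof -
  note d = polygonal_diagramD[OF assms]
  have "{A. (c, A) \<in> edges D \<union> circles D} = snd ` {x \<in> edges D \<union> circles D. fst x = c}" by force
  then have "finite {A. (c, A) \<in> edges D \<union> circles D}" using d(2,3) by simp
  then show ?thesis unfolding strands_def using d(5,7) by (intro polygonal_Union) auto
qed

lemma diagram_graph:
  assumes D: "polygonal_diagram n D"
  shows "graph (verts D) {A. (c, A) \<in> edges D} {A. (c, A) \<in> circles D}"
    "strands D c = \<Union>({A. (c, A) \<in> edges D} \<union> {A. (c, A) \<in> circles D})"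
proof -
  note d = polygonal_diagramD[OF D]
  have "{A. (c, A) \<in> F} = snd ` {x \<in> F. fst x = c}" for F :: "(gen \<times> complex set) set" by force
  then have fin: "finite {A. (c, A) \<in> edges D}" "finite {A. (c, A) \<in> circles D}" using d(2,3) by simp_all
  show "graph (verts D) {A. (c, A) \<in> edges D} {A. (c, A) \<in> circles D}"
  proof (rule graphI[OF fin])
    fix A B assume "A \<in> {A. (c, A) \<in> edges D} \<union> {A. (c, A) \<in> circles D}"
      "B \<in> {A. (c, A) \<in> edges D} \<union> {A. (c, A) \<in> circles D}" "A \<noteq> B"
    then show "A \<inter> B \<subseteq> verts D" using d(8)[of "(c, A)" "(c, B)"] by auto
  qed (use d(4,6) in auto)
  show "strands D c = \<Union>({A. (c, A) \<in> edges D} \<union> {A. (c, A) \<in> circles D})"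
    unfolding strands_def by blast
qed

lemma strands_inter:
  assumes D: "polygonal_diagram n D"
  shows "strands D c \<inter> strands D (other c) \<subseteq> verts D"
proof
  fix z assume "z \<in> strands D c \<inter> strands D (other c)"
  then obtain A B where "(c, A) \<in> edges D \<union> circles D" "z \<in> A" "(other c, B) \<in> edges D \<union> circles D" "z \<in> B"
    unfolding strands_def by blast
  moreover have "c \<noteq> other c" by (cases c) auto
  ultimately show "z \<in> verts D" using polygonal_diagramD(8)[OF D, of "(c, A)" "(other c, B)"] by auto
qed

text \<open>The replacement is carried out for each color separately. The results fit together
  because outside \<open>K\<close> the colors met only in vertices, and inside \<open>K\<close> the
  new pieces of different colors are disjoint. Around a remaining vertex nothing changes, since it
  has a neighbourhood that misses the closed set \<open>K\<close>.\<close>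

lemma replace_diagram:
  fixes Y :: "gen \<Rightarrow> complex set" and old new :: "gen \<Rightarrow> complex set set"
  assumes D: "polygonal_diagram n D" and K: "closed K"
    and Y: "\<And>c. Y c = strands D c \<inter> frontier K" "\<And>c. finite (Y c)" "verts D \<inter> frontier K = {}"
    and old: "\<And>c. finite (old c)" "\<And>c A. A \<in> old c \<Longrightarrow> is_edge (verts D \<union> Y c) A"
      "\<And>c A B. A \<in> old c \<Longrightarrow> B \<in> old c \<Longrightarrow> A \<noteq> B \<Longrightarrow> A \<inter> B \<subseteq> verts D \<union> Y c"
      "\<And>c. strands D c \<inter> K = \<Union>(old c)"
      "\<And>c y. y \<in> Y c \<Longrightarrow> deg (verts D \<union> Y c) (old c) y = 1"
    and new: "\<And>c. finite (new c)" "\<And>c A. A \<in> new c \<Longrightarrow> is_edge (Y c) A" "\<And>c A. A \<in> new c \<Longrightarrow> A \<subseteq> K"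
      "\<And>c A B. A \<in> new c \<Longrightarrow> B \<in> new c \<Longrightarrow> A \<noteq> B \<Longrightarrow> A \<inter> B \<subseteq> Y c"
      "\<And>c y. y \<in> Y c \<Longrightarrow> deg (Y c) (new c) y = 1"
      "\<And>c A. A \<in> new c \<Longrightarrow> polygonal A"
      "\<Union>(new G1) \<inter> \<Union>(new G2) = {}"
  shows "\<exists>D'. polygonal_diagram n D' \<and> verts D' = verts D - K \<and>
           (\<forall>c. strands D' c = (strands D c - K) \<union> \<Union>(new c))"
proof -
  define S where "S c = (strands D c - K) \<union> \<Union>(new c)" for c
  have "\<exists>E' C'. graph (verts D - K) E' C' \<and> \<Union>(E' \<union> C') = S c" for c
    unfolding S_def
    by (rule replace_graph[OF diagram_graph[OF D, of c] K Y(1,2,3) old(1) old(2) old(3) old(4) old(5) new(1) new(2) new(3) new(4) new(5)]) assumption+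
  then obtain E C where EC: "\<And>c. graph (verts D - K) (E c) (C c)" "\<And>c. \<Union>(E c \<union> C c) = S c"
    by metis
  define D' where "D' = \<lparr>verts = verts D - K, edges = {(c, A). A \<in> E c}, circles = {(c, A). A \<in> C c}\<rparr>"
  have sel: "verts D' = verts D - K" "edges D' = {(c, A). A \<in> E c}" "circles D' = {(c, A). A \<in> C c}"
    by (simp_all add: D'_def)
  have str: "strands D' c = S c" for c using EC(2)[of c] by (auto simp: strands_def sel)
  have V: "finite (verts D)" using polygonal_diagramD(1)[OF D] .
  have Ynew: "Y c \<subseteq> \<Union>(new c)" for c
  proof
    fix y assume "y \<in> Y c"
    then have "deg (Y c) (new c) y \<noteq> 0" using new(5) by simp
    then show "y \<in> \<Union>(new c)" using deg_nonzeroD by blast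
  qed
  have pS: "polygonal (S c)" for c
  proof -
    let ?A = "strands D c \<inter> closure (- K)" let ?B = "strands D c \<inter> K"
    have cl: "closed (strands D c)" using polygonal_strands[OF D] polygonal_closed by blast
    have AB: "?A \<union> ?B = strands D c" using closure_subset[of "- K"] by blast
    have iAB: "?A \<inter> ?B = Y c" using Y(1) K by (auto simp: frontier_closures)
    have "polygonal ?A"
      by (rule polygonal_part[of ?A ?B])
        (use AB polygonal_strands[OF D] iAB Y(2) cl K in \<open>auto intro: closed_Int\<close>)
    moreover have "S c = ?A \<union> \<Union>(new c)"
      using iAB Ynew[of c] closure_subset[of "- K"] unfolding S_def by blast
    moreover have "polygonal (\<Union>(new c))" using new(1,6) by (intro polygonal_Union)
    ultimately show ?thesis using polygonal_Un by simp
  qed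
  \<comment> \<open>The new edges come without a description, but each is a closed part of the
    polygonal set \<open>S c\<close> and meets the rest of it in finitely many points.\<close>
  have pA: "polygonal A" if A: "A \<in> E c \<union> C c" for A c
  proof (rule polygonal_part)
    note g = graphD[OF EC(1)[of c]]
    have "A \<union> \<Union>(E c \<union> C c - {A}) = S c" using EC(2)[of c] A by blast
    then show "polygonal (A \<union> \<Union>(E c \<union> C c - {A}))" using pS by simp
    show "closed A" using graph_minus(5)[OF EC(1) A] .
    show "closed (\<Union>(E c \<union> C c - {A}))"
      using g(1,2) graph_minus(5)[OF EC(1)] by (intro closed_Union) auto
    have "A \<inter> \<Union>(E c \<union> C c - {A}) \<subseteq> verts D" using g(5) A by blast
    then show "finite (A \<inter> \<Union>(E c \<union> C c - {A}))" using V finite_subset by blast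
  qed
  have SS: "S c \<inter> S (other c) \<subseteq> verts D - K" for c
  proof -
    have "\<Union>(new c) \<inter> \<Union>(new (other c)) = {}" using new(7) by (cases c) auto
    then show ?thesis using strands_inter[OF D, of c] new(3) unfolding S_def by blast
  qed
  have fin: "finite {(c, A). A \<in> F c}" if "\<And>c. finite (F c)" for F :: "gen \<Rightarrow> complex set set"
  proof -
    have "{(c, A). A \<in> F c} \<subseteq> Pair G1 ` F G1 \<union> Pair G2 ` F G2" by (auto intro: gen.exhaust)
    then show ?thesis using that finite_subset by (metis finite_UnI finite_imageI)
  qed
  have "polygonal_diagram n D'"
  proof (rule polygonal_diagramI)
    show "finite (verts D')" using V sel by simp
    show "finite (edges D')" "finite (circles D')" using fin graphD(1,2)[OF EC(1)] sel by simp_all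
    show "is_edge (verts D') A" "polygonal A" if "(c, A) \<in> edges D'" for c A
      using that graphD(3)[OF EC(1)] pA sel by auto
    show "is_circle (verts D') A" "polygonal A" if "(c, A) \<in> circles D'" for c A
      using that graphD(4)[OF EC(1)] pA sel by auto
    show "snd x \<inter> snd y \<subseteq> verts D'" if xy: "x \<in> edges D' \<union> circles D'" "y \<in> edges D' \<union> circles D'" "x \<noteq> y" for x y
    proof -
      obtain c A c' B where x: "x = (c, A)" "y = (c', B)" by (cases x, cases y) blast
      have AB: "A \<in> E c \<union> C c" "B \<in> E c' \<union> C c'" using xy x sel by auto
      show ?thesis
      proof (cases "c = c'")
        case True
        then show ?thesis using graphD(5)[OF EC(1)] AB xy x sel by auto
      next
        case False
        then have "c' = other c" by (cases c; cases c') auto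
        then have "A \<subseteq> S c" "B \<subseteq> S (other c)" using AB EC(2) by blast+
          then show ?thesis using SS[of c] x sel by auto
      qed
    qed
    fix v assume v: "v \<in> verts D'"
    then have v': "v \<in> verts D" "v \<in> - K" using sel by auto
    obtain \<epsilon> \<theta> where st: "star n D v \<epsilon> \<theta>"
      using polygonal_diagramD(9)[OF D v'(1)] alternating_at_star by blast
    obtain \<delta> where d: "\<delta> > 0" "ball v \<delta> \<subseteq> - K" using v'(2) K by (meson open_Compl open_contains_ball)
    define r where "r = min \<epsilon> \<delta>"
    have r: "0 < r" "r \<le> \<epsilon>" "ball v r \<subseteq> - K" using d star_pos[OF st] by (auto simp: r_def)
    have eq: "strands D' c \<inter> ball v r = strands D c \<inter> ball v r" for c
      unfolding str S_def using r(3) new(3) by blast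
    have "star n D' v r \<theta>" using star_shrink[OF st r(1,2)] unfolding star_def eq .
    then show "alternating_at n D' v" using alternating_at_star by blast
  qed
  then show ?thesis using sel str S_def by (intro exI[of _ D']) simp
qed

subsection \<open>Diagrams without vertices\<close>

lemma Jordan:
  fixes a :: "real \<Rightarrow> complex"
  assumes a: "simple_path a" "pathfinish a = pathstart a" "path_image a = A"
  shows "open (inside A)" "connected (inside A)" "open (outside A)" "connected (outside A)"
    "bounded (inside A)" "\<not> bounded (outside A)" "inside A \<inter> outside A = {}"
    "inside A \<union> outside A = - A" "frontier (inside A) = A" "frontier (outside A) = A"
  using Jordan_inside_outside[OF a(1,2)] unfolding a(3) by simp_all

text \<open>\<open>A\<close> together with its outside is connected, unbounded and disjoint from
  \<open>B\<close>, so it lies outside \<open>B\<close>. The inclusion is strict because the curve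
  \<open>B\<close> lies inside \<open>A\<close> but not in its own inside.\<close>

lemma inside_mono_Jordan:
  fixes a b :: "real \<Rightarrow> complex"
  assumes a: "simple_path a" "pathfinish a = pathstart a" "path_image a = A"
    and b: "simple_path b" "pathfinish b = pathstart b" "path_image b = B" and BA: "B \<subseteq> inside A"
  shows "inside B \<subset> inside A"
proof -
  note Ja = Jordan[OF a]
  note Jb = Jordan[OF b]
  have cl: "closure (outside A) = outside A \<union> A"
    using Ja(10) closure_Un_frontier[of "outside A"] by simp
  have con: "connected (outside A \<union> A)" using connected_imp_connected_closure[OF Ja(4)] cl by simp
  have sub: "outside A \<union> A \<subseteq> - B" using BA Ja(7,8) by blast
  have "outside A \<union> A \<subseteq> outside B"
  proof (rule ccontr)
    assume "\<not> ?thesis"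
    then obtain z where z: "z \<in> outside A \<union> A" "z \<in> inside B" using sub Jb(8) by blast
    have "outside A \<union> A \<subseteq> inside B"
    proof -
      have "(outside A \<union> A) \<inter> outside B = {} \<or> (outside A \<union> A) \<inter> inside B = {}"
        using connectedD[OF con Jb(3,1)] Jb(7,8) sub by blast
      then show ?thesis using z sub Jb(8) by blast
    qed
    then have "bounded (outside A)" using bounded_subset[OF Jb(5)] by blast
    then show False using Ja(6) by blast
  qed
  then have "inside B \<subseteq> inside A" using Ja(7,8) Jb(7,8) by blast
  moreover have "B \<noteq> {}" using b(3) path_image_nonempty by blast
  then have "inside B \<noteq> inside A" using BA inside_no_overlap[of B] by blast
  ultimately show ?thesis by blast
qed

lemma null_homotopic_no_verts:
  assumes "polygonal_diagram n D" "verts D = {}"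
  shows "null_homotopic n D"
  using assms
proof (induction "card (circles D)" arbitrary: D)
  case 0
  note d = polygonal_diagramD[OF 0(2)]
  have "circles D = {}" using 0(1) d(3) by simp
  moreover have "edges D = {}"
  proof (rule ccontr)
    assume "edges D \<noteq> {}"
    then obtain c A where "(c, A) \<in> edges D" by auto
    then show False using d(4) edge_minus(5) 0(3) by blast
  qed
  ultimately have "D = empty_diagram" using 0(3) by (simp add: empty_diagram_def)
  then show ?case by (simp add: homotopic_def)
next
  case (Suc k)
  note d = polygonal_diagramD[OF Suc(3)]
  have e: "edges D = {}"
  proof (rule ccontr)
    assume "edges D \<noteq> {}"
    then obtain c A where "(c, A) \<in> edges D" by auto
    then show False using d(4) edge_minus(5) Suc(4) by blast
  qed
  let ?I = "(\<lambda>x. inside (snd x)) ` circles D"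
  have "finite ?I" "?I \<noteq> {}" using d(3) Suc(2) by (auto simp: card_gt_0_iff)
  then obtain m where m: "m \<in> ?I" "\<And>m'. m' \<in> ?I \<Longrightarrow> \<not> m' \<subset> m"
    using finite_has_minimal[of ?I] by (metis less_le_not_le)
  then obtain c A where A: "(c, A) \<in> circles D" "m = inside A" by auto
  have path: "\<exists>g. simple_path g \<and> pathfinish g = pathstart g \<and> path_image g = B" if "(c', B) \<in> circles D" for c' B
    using d(6)[OF that] unfolding is_circle_def by blast
  \<comment> \<open>A circle that enters the inside of \<open>A\<close> cannot cross
    \<open>A\<close>, so it lies there entirely and has a smaller inside, against
    minimality.\<close>
  have empty: "inside A \<inter> B = {}" if B: "(c', B) \<in> circles D" for c' B
  proof (rule ccontr)
    assume ne: "inside A \<inter> B \<noteq> {}"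
    obtain a where a: "simple_path a" "pathfinish a = pathstart a" "path_image a = A" using path[OF A(1)] by blast
    obtain b where b: "simple_path b" "pathfinish b = pathstart b" "path_image b = B" using path[OF B] by blast
    note J = Jordan[OF a]
    have "(c, A) \<noteq> (c', B)" using ne inside_no_overlap[of A] by blast
    then have dis: "A \<inter> B = {}" using d(8)[of "(c, A)" "(c', B)"] A B Suc(4) by auto
    have "connected B" using b connected_simple_path_image by blast
    then have "B \<inter> inside A = {} \<or> B \<inter> outside A = {}"
      using connectedD[OF _ J(1,3), of B] J(7,8) dis by blast
    then have "B \<subseteq> inside A" using ne J(8) dis by blast
    then have "inside B \<subset> m" using inside_mono_Jordan[OF a b] A(2) by simp
    moreover have "inside B \<in> ?I" using B by (intro image_eqI[of _ _ "(c', B)"]) simp_all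
    ultimately show False using m(2) by blast
  qed
  define D' where "D' = D\<lparr>circles := circles D - {(c, A)}\<rparr>"
  have sel: "verts D' = verts D" "edges D' = edges D" "circles D' = circles D - {(c, A)}" by (simp_all add: D'_def)
  have p: "polygonal_diagram n D'"
  proof (rule polygonal_diagramI, unfold sel)
    show "finite (verts D)" "finite (edges D)" "finite (circles D - {(c, A)})" using d(1-3) by simp_all
    show "is_edge (verts D) B" "polygonal B" if "(c', B) \<in> edges D" for c' B using d(4,5) that by blast+
    show "is_circle (verts D) B" "polygonal B" if "(c', B) \<in> circles D - {(c, A)}" for c' B using d(6,7) that by blast+
    show "snd x \<inter> snd y \<subseteq> verts D" if "x \<in> edges D \<union> (circles D - {(c, A)})"
      "y \<in> edges D \<union> (circles D - {(c, A)})" "x \<noteq> y" for x y using d(8)[OF _ _ that(3)] that(1,2) by blast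
    show "alternating_at n D' v" if "v \<in> verts D" for v using that Suc(4) by simp
  qed
  have "circle_move D D'" unfolding circle_move_def
    using A(1) empty e Suc(4) by (intro exI[of _ c] exI[of _ A]) (auto simp: D'_def strands_def)
  then have "move n D D'" unfolding move_def using p Suc(3) polygonal_is_diagram by blast
  moreover have "null_homotopic n D'"
    using Suc(1)[of D'] Suc(2,4) p sel A(1) d(3) by simp
  ultimately show ?case by (rule null_homotopic_move)
qed

subsection \<open>Existence of an edge that is not a loop\<close>

definition ray :: "complex \<Rightarrow> real \<Rightarrow> real \<Rightarrow> complex set" where
  "ray v \<epsilon> a = {v + of_real r * cis a | r. 0 < r \<and> r < \<epsilon>}"

lemma ray_image: "ray v \<epsilon> a = (\<lambda>r. v + of_real r * cis a) ` {0<..<\<epsilon>}"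
  by (auto simp: ray_def)

lemma connected_ray: "connected (ray v \<epsilon> a)"
  unfolding ray_image by (intro connected_continuous_image continuous_intros) auto

lemma ray_inject:
  assumes "v + of_real r * cis a = v + of_real s * cis b" "0 < r" "0 < s" "\<bar>a - b\<bar> < 2 * pi"
  shows "a = b" "r = s"
proof -
  have eq: "of_real r * cis a = of_real s * cis b" using assms(1) by simp
  then have "norm (of_real r * cis a) = norm (of_real s * cis b)" by (rule arg_cong)
  then show "r = s" using assms(2,3) by (simp add: norm_mult)
  then have "cis a = cis b" using eq assms(2) by simp
  then show "a = b" using cis_eqD assms(4) by blast
qed

lemma star_angle_diff:
  assumes "star n D v \<epsilon> \<theta>" "i < 2 * n" "j < 2 * n" shows "\<bar>\<theta> i - \<theta> j\<bar> < 2 * pi" "\<theta> i = \<theta> j \<longleftrightarrow> i = j"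
  using star_mono[OF assms(1), of i j] star_mono[OF assms(1), of j i] assms(2,3)
  by (cases i j rule: linorder_cases; auto)+

lemma star_rays:
  assumes s: "star n D v \<epsilon> \<theta>"
  shows "strands D c \<inter> (ball v \<epsilon> - {v}) = (\<Union>k\<in>{k. k < 2 * n \<and> (even k \<longleftrightarrow> c = G1)}. ray v \<epsilon> (\<theta> k))"
proof -
  have "strands D c \<inter> (ball v \<epsilon> - {v}) = {v + of_real r * cis (\<theta> k) | r k.
                 0 \<le> r \<and> r < \<epsilon> \<and> k < 2 * n \<and> (even k \<longleftrightarrow> c = G1)} - {v}"
    using star_eq[OF s, of c] by blast
  also have "\<dots> = (\<Union>k\<in>{k. k < 2 * n \<and> (even k \<longleftrightarrow> c = G1)}. ray v \<epsilon> (\<theta> k))"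
    by (force simp: ray_def order_le_less)
  finally show ?thesis .
qed

lemma ray_disjoint:
  assumes s: "star n D v \<epsilon> \<theta>" "i < 2 * n" "j < 2 * n" "i \<noteq> j"
  shows "ray v \<epsilon> (\<theta> i) \<inter> ray v \<epsilon> (\<theta> j) = {}"
proof -
  have False if "v + of_real r * cis (\<theta> i) = v + of_real s * cis (\<theta> j)" "0 < r" "0 < s" for r s
    using ray_inject(1)[OF that star_angle_diff(1)[OF s(1-3)]] star_angle_diff(2)[OF s(1-3)] s(4) by blast
  then show ?thesis unfolding ray_def by blast
qed

text \<open>An initial stretch of the path stays near \<open>v\<close> and avoids it, so it runs in
  the union of the open rays and, being connected, in one of them. Conversely it covers a beginning
  of that ray, because its distance from \<open>v\<close> takes all small values.\<close>

lemma path_end_ray: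
  assumes g: "continuous_on {0..1::real} g" "g 0 = v" "\<And>t. 0 < t \<Longrightarrow> t < 1 \<Longrightarrow> g t \<noteq> v"
    and R: "finite I" "\<And>i j. i \<in> I \<Longrightarrow> j \<in> I \<Longrightarrow> i \<noteq> j \<Longrightarrow> \<bar>\<theta> i - \<theta> j\<bar> < 2 * pi \<and> \<theta> i \<noteq> \<theta> j"
    and sub: "g ` {0<..<1} \<inter> ball v \<epsilon> \<subseteq> (\<Union>k\<in>I. ray v \<epsilon> (\<theta> k))" and e: "0 < \<epsilon>"
  obtains k \<delta> \<rho> where "k \<in> I" "0 < \<delta>" "\<delta> \<le> 1/2" "0 < \<rho>" "\<rho> \<le> \<epsilon>" "g ` {0<..<\<delta>} \<subseteq> ray v \<epsilon> (\<theta> k)"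
    "ray v \<rho> (\<theta> k) \<subseteq> g ` {0<..<\<delta>}"
proof -
  have "\<exists>d>0. \<forall>t\<in>{0..1}. dist t 0 < d \<longrightarrow> dist (g t) (g 0) < \<epsilon>"
    using g(1) e unfolding continuous_on_iff by (meson atLeastAtMost_iff order_refl zero_le_one)
  then obtain d where d: "d > 0" "\<And>t. t \<in> {0..1} \<Longrightarrow> dist t 0 < d \<Longrightarrow> dist (g t) v < \<epsilon>"
    using g(2) by auto
  define \<delta> where "\<delta> = min d (1/2)"
  have \<delta>: "0 < \<delta>" "\<delta> \<le> 1/2" "\<delta> \<le> d" using d by (auto simp: \<delta>_def)
  let ?P = "g ` {0<..<\<delta>}"
  have PB: "?P \<subseteq> ball v \<epsilon> - {v}"
    using d(2) \<delta> g(3) by (force simp: dist_commute)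
  have PR: "?P \<subseteq> (\<Union>k\<in>I. ray v \<epsilon> (\<theta> k))" using sub PB \<delta> by fastforce
  have cP: "connected ?P"
    by (intro connected_continuous_image continuous_on_subset[OF g(1)]) (use \<delta> in auto)
  have Rp: "\<exists>r\<ge>0. z = v + of_real r * cis (\<theta> k)" if "z \<in> ray v \<epsilon> (\<theta> k)" for z k
    using that unfolding ray_def by force
  \<comment> \<open>Closed segments replace the rays, since the connectedness argument needs closed
    sets; two of them share at most \<open>v\<close>, which the path avoids.\<close>
  define L where "L k = (\<lambda>r. v + of_real r * cis (\<theta> k)) ` {0..\<epsilon>}" for k
  have cL: "closed (L k)" for k unfolding L_def
    by (intro compact_imp_closed compact_continuous_image continuous_intros) auto
  have RL: "ray v \<epsilon> (\<theta> k) \<subseteq> L k" for k unfolding ray_def L_def by auto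
  have LR: "L k \<inter> L j \<subseteq> {v}" if kj: "k \<in> I" "j \<in> I" "k \<noteq> j" for k j
  proof
    fix z assume "z \<in> L k \<inter> L j"
    then obtain r s where rs: "0 \<le> r" "0 \<le> s" "z = v + of_real r * cis (\<theta> k)" "z = v + of_real s * cis (\<theta> j)"
      unfolding L_def by auto
    show "z \<in> {v}"
    proof (cases "r = 0 \<or> s = 0")
      case False
      then have "\<theta> k = \<theta> j" using ray_inject(1)[of v r "\<theta> k" s "\<theta> j"] rs R(2)[OF kj] by auto
      then show ?thesis using R(2)[OF kj] by simp
    qed (use rs in auto)
  qed
  have "g (\<delta>/2) \<in> ?P" using \<delta> by auto
  then obtain k where k: "k \<in> I" "g (\<delta>/2) \<in> ray v \<epsilon> (\<theta> k)" using PR by blast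
  have PL: "?P \<subseteq> L k"
  proof (rule connected_in_one[OF cP cL])
    show "closed (\<Union>j\<in>I - {k}. L j)" using R(1) cL by auto
    show "?P \<subseteq> L k \<union> (\<Union>j\<in>I - {k}. L j)" using PR RL by blast
    show "?P \<inter> L k \<inter> (\<Union>j\<in>I - {k}. L j) = {}" using LR k(1) PB by blast
    show "?P \<inter> L k \<noteq> {}" using \<open>g (\<delta>/2) \<in> ?P\<close> k(2) RL by blast
  qed
  have P1: "?P \<subseteq> ray v \<epsilon> (\<theta> k)"
  proof
    fix z assume z: "z \<in> ?P"
    then have "z \<in> L k" using PL by blast
    then obtain r where r: "z = v + of_real r * cis (\<theta> k)" "0 \<le> r" unfolding L_def by auto
    have "z \<noteq> v" "dist v z < \<epsilon>" using PB z by auto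
    then have "0 < r" "r < \<epsilon>" using r by (auto simp: order_le_less)
    then show "z \<in> ray v \<epsilon> (\<theta> k)" using r(1) unfolding ray_def by blast
  qed
  define \<rho> where "\<rho> = dist v (g (\<delta>/2))"
  have \<rho>: "0 < \<rho>" "\<rho> \<le> \<epsilon>" using PB \<open>g (\<delta>/2) \<in> ?P\<close> by (auto simp: \<rho>_def)
  have "ray v \<rho> (\<theta> k) \<subseteq> ?P"
  proof
    fix z assume "z \<in> ray v \<rho> (\<theta> k)"
    then obtain r where r: "0 < r" "r < \<rho>" "z = v + of_real r * cis (\<theta> k)" unfolding ray_def by blast
    have "continuous_on {0..\<delta>/2} (\<lambda>t. dist v (g t))"
      by (intro continuous_intros continuous_on_subset[OF g(1)]) (use \<delta> in auto)
    then obtain t where t: "0 \<le> t" "t \<le> \<delta>/2" "dist v (g t) = r"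
      using IVT'[of "\<lambda>t. dist v (g t)" 0 r "\<delta>/2"] r \<delta> g(2) by (auto simp: \<rho>_def)
    have "t \<noteq> 0" using t r g(2) by auto
    then have tP: "t \<in> {0<..<\<delta>}" using t \<delta> by auto
    then obtain s where s: "g t = v + of_real s * cis (\<theta> k)" "0 < s" using P1 unfolding ray_def by blast
    then have "s = r" using t(3) by simp
    then have "z = g t" using s r by simp
    then show "z \<in> ?P" using tP by blast
  qed
  then show ?thesis using that[OF k(1) \<delta>(1,2) \<rho> P1] by blast
qed

text \<open>With no second vertex in the ball, a ray of the star, taken without \<open>v\<close>,
  contains no vertex at all and so belongs to a single curve of the diagram.\<close>

definition isolated_star :: "nat \<Rightarrow> diagram \<Rightarrow> complex \<Rightarrow> real \<Rightarrow> (nat \<Rightarrow> real) \<Rightarrow> bool" where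
  "isolated_star n D v \<epsilon> \<theta> \<longleftrightarrow> star n D v \<epsilon> \<theta> \<and> v \<in> verts D \<and> verts D \<inter> ball v \<epsilon> = {v}"

lemma isolated_star_exists:
  assumes D: "polygonal_diagram n D" and v: "v \<in> verts D"
  obtains \<epsilon> \<theta> where "isolated_star n D v \<epsilon> \<theta>"
proof -
  obtain \<epsilon>0 \<theta> where s: "star n D v \<epsilon>0 \<theta>"
    using polygonal_diagramD(9)[OF D v] alternating_at_star by blast
  obtain d where d: "d > 0" "\<And>x. x \<in> verts D \<Longrightarrow> x \<noteq> v \<Longrightarrow> d \<le> dist v x"
    using finite_set_avoid[OF polygonal_diagramD(1)[OF D], of v] by metis
  define \<epsilon> where "\<epsilon> = min \<epsilon>0 d"
  have e: "0 < \<epsilon>" "\<epsilon> \<le> \<epsilon>0" using star_pos[OF s] d(1) by (auto simp: \<epsilon>_def)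
  have "verts D \<inter> ball v \<epsilon> = {v}" using v d(2) e(1) by (force simp: \<epsilon>_def)
  then show ?thesis using that star_shrink[OF s e] v unfolding isolated_star_def by blast
qed

lemma ray_in_ball: "ray v \<epsilon> a \<subseteq> ball v \<epsilon> - {v}"
  unfolding ray_def by auto

text \<open>The ray is connected and free of vertices, and different curves of the diagram meet only
  in vertices. One common point therefore puts the whole ray on \<open>A\<close>, with the color of
  \<open>A\<close>.\<close>

lemma ray_owner:
  assumes D: "polygonal_diagram n D" and s: "isolated_star n D v \<epsilon> \<theta>"
    and A: "(c, A) \<in> edges D \<union> circles D" and j: "j < 2 * n" and ne: "ray v \<epsilon> (\<theta> j) \<inter> A \<noteq> {}"
  shows "even j \<longleftrightarrow> c = G1" "ray v \<epsilon> (\<theta> j) \<subseteq> A"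
proof -
  define c' where "c' = (if even j then G1 else G2)"
  have c': "even j \<longleftrightarrow> c' = G1" by (simp add: c'_def)
  have st: "star n D v \<epsilon> \<theta>" "verts D \<inter> ball v \<epsilon> = {v}" using s unfolding isolated_star_def by blast+
  have RS: "ray v \<epsilon> (\<theta> j) \<subseteq> strands D c'" using star_rays[OF st(1), of c'] j c' by blast
  have RV: "ray v \<epsilon> (\<theta> j) \<inter> verts D = {}" using ray_in_ball st(2) by blast
  have AS: "A \<subseteq> strands D c" using A unfolding strands_def by blast
  have cc: "c' = c"
  proof (rule ccontr)
    assume "c' \<noteq> c"
    then have "c = other c'" by (cases c; cases c') auto
    then show False using ne RS RV AS strands_inter[OF D, of c'] by blast
  qed
  then show "even j \<longleftrightarrow> c = G1" using c' by simp
  note G = diagram_graph[OF D, of c]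
  have A': "A \<in> {A. (c, A) \<in> edges D} \<union> {A. (c, A) \<in> circles D}" using A by blast
  show "ray v \<epsilon> (\<theta> j) \<subseteq> A"
  proof (rule connected_in_one[OF connected_ray])
    show "closed A" using graph_minus(5)[OF G(1) A'] .
    show "closed (\<Union>({A. (c, A) \<in> edges D} \<union> {A. (c, A) \<in> circles D} - {A}))"
      using graphD(1,2)[OF G(1)] graph_minus(5)[OF G(1)] by (intro closed_Union) auto
    show "ray v \<epsilon> (\<theta> j) \<subseteq> A \<union> \<Union>({A. (c, A) \<in> edges D} \<union> {A. (c, A) \<in> circles D} - {A})"
      using RS cc G(2) by blast
    have "A \<inter> \<Union>({A. (c, A) \<in> edges D} \<union> {A. (c, A) \<in> circles D} - {A}) \<subseteq> verts D"
      using graphD(5)[OF G(1)] A' by blast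
    then show "ray v \<epsilon> (\<theta> j) \<inter> A \<inter> \<Union>({A. (c, A) \<in> edges D} \<union> {A. (c, A) \<in> circles D} - {A}) = {}"
      using RV by blast
    show "ray v \<epsilon> (\<theta> j) \<inter> A \<noteq> {}" by (rule ne)
  qed
qed

text \<open>The curve that carries the ray is closed as a set and hence contains \<open>v\<close>,
  which excludes a circle.\<close>

lemma ray_owner_exists:
  assumes D: "polygonal_diagram n D" and s: "isolated_star n D v \<epsilon> \<theta>" and j: "j < 2 * n"
  obtains c A where "(c, A) \<in> edges D" "ray v \<epsilon> (\<theta> j) \<subseteq> A" "v \<in> A" "even j \<longleftrightarrow> c = G1"
proof -
  define c where "c = (if even j then G1 else G2)"
  have c: "even j \<longleftrightarrow> c = G1" by (simp add: c_def)
  have st: "star n D v \<epsilon> \<theta>" "verts D \<inter> ball v \<epsilon> = {v}" "v \<in> verts D" using s unfolding isolated_star_def by blast+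
  have e: "0 < \<epsilon>" using star_pos[OF st(1)] .
  have RS: "ray v \<epsilon> (\<theta> j) \<subseteq> strands D c" using star_rays[OF st(1), of c] j c by blast
  have "v + of_real (\<epsilon>/2) * cis (\<theta> j) \<in> ray v \<epsilon> (\<theta> j)" unfolding ray_def using e by (intro CollectI exI[of _ "\<epsilon>/2"]) simp
  then obtain A where A: "(c, A) \<in> edges D \<union> circles D" "ray v \<epsilon> (\<theta> j) \<inter> A \<noteq> {}"
    using RS unfolding strands_def by blast
  have sub: "ray v \<epsilon> (\<theta> j) \<subseteq> A" using ray_owner(2)[OF D s A(1) j A(2)] .
  have "A \<in> {A. (c, A) \<in> edges D} \<union> {A. (c, A) \<in> circles D}" using A(1) by blast
  then have cl: "closed A" using graph_minus(5)[OF diagram_graph(1)[OF D]] by blast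
  have "(\<lambda>r. v + of_real r * cis (\<theta> j)) ` closure {0<..<\<epsilon>} \<subseteq> closure (ray v \<epsilon> (\<theta> j))"
    unfolding ray_image by (intro image_closure_subset continuous_intros) (auto simp: closure_subset)
  then have "v \<in> closure (ray v \<epsilon> (\<theta> j))" using e by (force simp: image_subset_iff)
  then have v: "v \<in> A" using sub cl closure_minimal by blast
  then have "(c, A) \<notin> circles D"
    using polygonal_diagramD(6)[OF D] circle_minus(5) st(3) by blast
  then show ?thesis using that A(1) sub v c by blast
qed

text \<open>Near each of its two ends the loop runs along one ray, and these rays differ because the
  path is injective. The remaining middle part is compact and avoids \<open>v\<close>, so it
  contains no points of a third ray close to \<open>v\<close>.\<close>

lemma loop_two_rays:
  assumes D: "polygonal_diagram n D" and s: "isolated_star n D v \<epsilon> \<theta>"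
    and A: "(c, A) \<in> edges D" "A \<inter> verts D = {v}"
  obtains k l where "k < 2 * n" "l < 2 * n" "k \<noteq> l"
    "\<And>j. j < 2 * n \<Longrightarrow> ray v \<epsilon> (\<theta> j) \<inter> A \<noteq> {} \<longleftrightarrow> j = k \<or> j = l"
proof -
  have st: "star n D v \<epsilon> \<theta>" "verts D \<inter> ball v \<epsilon> = {v}" "v \<in> verts D" using s unfolding isolated_star_def by blast+
  have e: "0 < \<epsilon>" using star_pos[OF st(1)] .
  obtain g where g: "simple_path g" "path_image g = A" "A \<inter> verts D = {pathstart g, pathfinish g}"
    using polygonal_diagramD(4)[OF D A(1)] is_edgeE by metis
  have gv: "g 0 = v" "g 1 = v" using g(3) A(2) by (auto simp: pathstart_def pathfinish_def)
  have gc: "continuous_on {0..1} g" using g(1) simple_path_imp_path path_def by blast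
  have inj: "t = t' \<or> t = 0 \<and> t' = 1 \<or> t = 1 \<and> t' = 0" if "t \<in> {0..1}" "t' \<in> {0..1}" "g t = g t'" for t t'
    using g(1) that unfolding simple_path_def loop_free_def by blast
  have gnv: "g t \<noteq> v" if "0 < t" "t < 1" for t using inj[of t 0] gv that by auto
  define I where "I = {k. k < 2 * n \<and> (even k \<longleftrightarrow> c = G1)}"
  have I: "finite I" "\<And>i j. i \<in> I \<Longrightarrow> j \<in> I \<Longrightarrow> i \<noteq> j \<Longrightarrow> \<bar>\<theta> i - \<theta> j\<bar> < 2 * pi \<and> \<theta> i \<noteq> \<theta> j"
    using star_angle_diff[OF st(1)] by (auto simp: I_def)
  have AS: "A \<subseteq> strands D c" using A(1) unfolding strands_def by blast
  have "g ` {0<..<1} \<subseteq> A - {v}" using g(2) gnv unfolding path_image_def by force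
  then have sub: "g ` {0<..<1} \<inter> ball v \<epsilon> \<subseteq> (\<Union>k\<in>I. ray v \<epsilon> (\<theta> k))"
    using star_rays[OF st(1), of c] AS unfolding I_def by blast
  obtain k \<delta> \<rho> where k: "k \<in> I" "0 < \<delta>" "\<delta> \<le> 1/2" "0 < \<rho>" "\<rho> \<le> \<epsilon>" "g ` {0<..<\<delta>} \<subseteq> ray v \<epsilon> (\<theta> k)"
    "ray v \<rho> (\<theta> k) \<subseteq> g ` {0<..<\<delta>}"
    using path_end_ray[OF gc gv(1) gnv I sub e] by blast
  \<comment> \<open>Running backwards brings the second end of the loop to parameter
    \<open>0\<close>.\<close>
  define h where "h t = g (1 - t)" for t
  have hc: "continuous_on {0..1} h" unfolding h_def
    by (intro continuous_on_compose2[OF gc] continuous_intros) auto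
  have "h ` {0<..<1} = g ` (\<lambda>t. 1 - t) ` {0<..<1}" by (simp add: h_def image_image)
  moreover have "(\<lambda>t::real. 1 - t) ` {0<..<1} = {0<..<1}" by (force simp: image_iff intro: bexI[of _ "1 - _"])
  ultimately have him: "h ` {0<..<1} = g ` {0<..<1}" by simp
  have sub': "h ` {0<..<1} \<inter> ball v \<epsilon> \<subseteq> (\<Union>k\<in>I. ray v \<epsilon> (\<theta> k))" using sub him by simp
  have hnv: "h t \<noteq> v" if "0 < t" "t < 1" for t using gnv that by (simp add: h_def)
  have hv: "h 0 = v" by (simp add: h_def gv)
  obtain l \<delta>' \<rho>' where l: "l \<in> I" "0 < \<delta>'" "\<delta>' \<le> 1/2" "0 < \<rho>'" "\<rho>' \<le> \<epsilon>" "h ` {0<..<\<delta>'} \<subseteq> ray v \<epsilon> (\<theta> l)"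
    "ray v \<rho>' (\<theta> l) \<subseteq> h ` {0<..<\<delta>'}"
    using path_end_ray[OF hc hv hnv I sub' e] by blast
  have kl: "k \<noteq> l"
  proof
    assume kl: "k = l"
    define r where "r = min \<rho> \<rho>' / 2"
    have r: "0 < r" "r < \<rho>" "r < \<rho>'" using k(4) l(4) by (auto simp: r_def)
    define z where "z = v + of_real r * cis (\<theta> k)"
    have "z \<in> ray v \<rho> (\<theta> k)" "z \<in> ray v \<rho>' (\<theta> l)" unfolding ray_def z_def kl using r by auto
    then obtain t t' where t: "t \<in> {0<..<\<delta>}" "z = g t" "t' \<in> {0<..<\<delta>'}" "z = h t'" using k(7) l(7) by blast
    then show False using inj[of t "1 - t'"] k(3) l(3) by (auto simp: h_def)
  qed
  have kl2: "k < 2 * n" "l < 2 * n" using k(1) l(1) by (auto simp: I_def)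
  have ncl: "closed (g ` {\<delta>..1-\<delta>'})"
    by (intro compact_imp_closed compact_continuous_image continuous_on_subset[OF gc]) (use k l in auto)
  have "g t \<noteq> v" if "t \<in> {\<delta>..1-\<delta>'}" for t using gnv[of t] that k(2) l(2) by simp
  then have "v \<notin> g ` {\<delta>..1-\<delta>'}" by blast
  then obtain r where r: "r > 0" "ball v r \<subseteq> - g ` {\<delta>..1-\<delta>'}"
    using ncl by (meson ComplI open_Compl open_contains_ball)
  have "j = k \<or> j = l" if j: "j < 2 * n" "ray v \<epsilon> (\<theta> j) \<inter> A \<noteq> {}" for j
  proof -
    have sj: "ray v \<epsilon> (\<theta> j) \<subseteq> A" using ray_owner(2)[OF D s _ j] A(1) by blast
    define q where "q = min \<epsilon> r / 2"
    have q: "0 < q" "q < \<epsilon>" "q < r" using e r by (auto simp: q_def)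
    define z where "z = v + of_real q * cis (\<theta> j)"
    have z: "z \<in> ray v \<epsilon> (\<theta> j)" "z \<in> ball v r" unfolding ray_def z_def using q by auto
    then have "z \<in> path_image g" using sj g(2) by blast
    then obtain t where t: "0 \<le> t" "t \<le> 1" "z = g t" unfolding path_image_def by auto
    have "z \<noteq> v" using z(1) ray_in_ball by blast
    then have "t \<noteq> 0" "t \<noteq> 1" using t(3) gv by auto
    moreover have "\<not> (\<delta> \<le> t \<and> t \<le> 1 - \<delta>')" using r(2) z(2) t(3) by auto
    ultimately consider "t \<in> {0<..<\<delta>}" | "1 - t \<in> {0<..<\<delta>'}" using t by force
    then show ?thesis
    proof cases
      case 1
      then have "z \<in> ray v \<epsilon> (\<theta> k)" using k(6) t(3) by blast
      then show ?thesis using ray_disjoint[OF st(1) j(1) kl2(1)] z(1) by blast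
    next
      case 2
      then have "h (1 - t) \<in> ray v \<epsilon> (\<theta> l)" using l(6) by blast
      then have "z \<in> ray v \<epsilon> (\<theta> l)" using t(3) by (simp add: h_def)
      then show ?thesis using ray_disjoint[OF st(1) j(1) kl2(2)] z(1) by blast
    qed
  qed
  moreover have "ray v \<epsilon> (\<theta> k) \<inter> A \<noteq> {}"
  proof -
    have "g (\<delta>/2) \<in> ray v \<epsilon> (\<theta> k)" using k(2,6) by auto
    moreover have "g (\<delta>/2) \<in> A" using g(2) k(2,3) unfolding path_image_def by auto
    ultimately show ?thesis by blast
  qed
  moreover have "ray v \<epsilon> (\<theta> l) \<inter> A \<noteq> {}"
  proof -
    have "h (\<delta>'/2) \<in> ray v \<epsilon> (\<theta> l)" using l(2,6) by auto
    moreover have "h (\<delta>'/2) \<in> A" using g(2) l(2,3) unfolding path_image_def h_def by auto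
    ultimately show ?thesis by blast
  qed
  ultimately show ?thesis using that[OF kl2 kl] by blast
qed

section \<open>The two sectors between the ends of a loop\<close>

definition sector :: "complex \<Rightarrow> real \<Rightarrow> real \<Rightarrow> real \<Rightarrow> complex set" where
  "sector v \<epsilon> a b = (\<lambda>(r, t). v + of_real r * cis t) ` ({0<..<\<epsilon>} \<times> {a<..<b})"

lemma connected_sector: "connected (sector v \<epsilon> a b)"
  unfolding sector_def case_prod_unfold
  by (intro connected_continuous_image continuous_intros connected_Times) auto

lemma ray_sector: "a < t \<Longrightarrow> t < b \<Longrightarrow> ray v \<epsilon> t \<subseteq> sector v \<epsilon> a b"
  unfolding ray_def sector_def by force

lemma ball_sectors:
  assumes "a < b" "b < a + 2 * pi"
  shows "ball v \<epsilon> - {v} \<subseteq> sector v \<epsilon> a b \<union> sector v \<epsilon> b (a + 2 * pi) \<union> ray v \<epsilon> a \<union> ray v \<epsilon> b"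
proof
  fix z assume z: "z \<in> ball v \<epsilon> - {v}"
  \<comment> \<open>After rotation by \<open>- a\<close> the function \<open>Arg2pi\<close> measures
    the angle from the direction \<open>a\<close>, with values from \<open>0\<close> up to but not
    including \<open>2 * pi\<close>.\<close>
  define u where "u = (z - v) * cis (- a)"
  have "u = of_real (cmod u) * cis (Arg2pi u)"
    using Arg2pi_eq[of u] by (simp add: cis_conv_exp mult.commute)
  then have "u * cis a = of_real (cmod u) * (cis (Arg2pi u) * cis a)" by (metis mult.assoc)
  then have "z - v = of_real (cmod u) * cis (a + Arg2pi u)"
    by (simp add: u_def cis_mult add.commute mult.assoc)
  then have zeq: "z = v + of_real (cmod u) * cis (a + Arg2pi u)" by (simp add: algebra_simps)
  have r: "0 < cmod u" "cmod u < \<epsilon>" using z by (auto simp: u_def norm_mult dist_norm norm_minus_commute)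
  have t: "a \<le> a + Arg2pi u" "a + Arg2pi u < a + 2 * pi" using Arg2pi[of u] by auto
  consider "a + Arg2pi u = a" | "a + Arg2pi u = b" | "a < a + Arg2pi u \<and> a + Arg2pi u < b" | "b < a + Arg2pi u"
    using t by linarith
  then show "z \<in> sector v \<epsilon> a b \<union> sector v \<epsilon> b (a + 2 * pi) \<union> ray v \<epsilon> a \<union> ray v \<epsilon> b"
  proof cases
    case 1 then show ?thesis using zeq r unfolding ray_def by auto
  next
    case 2 then show ?thesis using zeq r unfolding ray_def by auto
  next
    case 3 then show ?thesis using zeq r unfolding sector_def by force
  next
    case 4 then show ?thesis using zeq r t unfolding sector_def by force
  qed
qed

lemma sector_ray_disjoint:
  assumes "\<And>t. a < t \<Longrightarrow> t < b \<Longrightarrow> \<bar>t - x\<bar> < 2 * pi \<and> t \<noteq> x"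
  shows "sector v \<epsilon> a b \<inter> ray v \<epsilon> x = {}"
proof -
  have False if "v + of_real r * cis t = v + of_real s * cis x" "0 < r" "0 < s" "a < t" "t < b" for r s t
    using ray_inject(1)[OF that(1-3)] assms[OF that(4,5)] by blast
  then show ?thesis unfolding sector_def ray_def by force
qed

text \<open>
  If all edges were loops, then a loop at \<open>v\<close> would separate the half-edges at \<open>v\<close> into two
  sectors; each sector is a union of pairs belonging to the same loop, although it contains an odd
  number of half-edges because the colors alternate.
\<close>

lemma nonloop_edge_exists:
  assumes D: "polygonal_diagram n D" and n: "n \<ge> 2" and ne: "verts D \<noteq> {}"
  shows "\<exists>c A. (c, A) \<in> edges D \<and> (\<forall>v. A \<inter> verts D \<noteq> {v})"
proof (rule ccontr)
  assume "\<not> ?thesis"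
  then have loops: "\<exists>v. A \<inter> verts D = {v}" if "(c, A) \<in> edges D" for c A using that by blast
  obtain v where v: "v \<in> verts D" using ne by blast
  obtain \<epsilon> \<theta> where s: "isolated_star n D v \<epsilon> \<theta>" using isolated_star_exists[OF D v] by blast
  have st: "star n D v \<epsilon> \<theta>" "verts D \<inter> ball v \<epsilon> = {v}" using s unfolding isolated_star_def by blast+
  have e: "0 < \<epsilon>" using star_pos[OF st(1)] .
  have "\<exists>x. x \<in> edges D \<and> ray v \<epsilon> (\<theta> j) \<subseteq> snd x \<and> snd x \<inter> verts D = {v} \<and> (even j \<longleftrightarrow> fst x = G1)" if j: "j < 2 * n" for j
  proof -
    obtain c A where A: "(c, A) \<in> edges D" "ray v \<epsilon> (\<theta> j) \<subseteq> A" "v \<in> A" "even j \<longleftrightarrow> c = G1"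
      using ray_owner_exists[OF D s j] by blast
    obtain w where "A \<inter> verts D = {w}" using loops[OF A(1)] by blast
    moreover have "v \<in> A \<inter> verts D" using A(3) v by blast
    ultimately have "A \<inter> verts D = {v}" by auto
    then show ?thesis using A by (intro exI[of _ "(c, A)"]) simp
  qed
  then obtain own where own: "\<And>j. j < 2 * n \<Longrightarrow> own j \<in> edges D" "\<And>j. j < 2 * n \<Longrightarrow> ray v \<epsilon> (\<theta> j) \<subseteq> snd (own j)"
    "\<And>j. j < 2 * n \<Longrightarrow> snd (own j) \<inter> verts D = {v}" "\<And>j. j < 2 * n \<Longrightarrow> even j \<longleftrightarrow> fst (own j) = G1"
    by metis
  have ray_ne: "ray v \<epsilon> a \<noteq> {}" for a using e unfolding ray_image by auto
  \<comment> \<open>Since all edges are assumed to be loops, \<open>own\<close> takes each of its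
    values on exactly two half-edges at \<open>v\<close>.\<close>
  have fiber: "\<exists>k l. k < 2 * n \<and> l < 2 * n \<and> k \<noteq> l \<and> (\<forall>j<2 * n. own j = own i \<longleftrightarrow> j = k \<or> j = l) \<and>
      (\<forall>j<2 * n. ray v \<epsilon> (\<theta> j) \<inter> snd (own i) \<noteq> {} \<longleftrightarrow> j = k \<or> j = l)" if i: "i < 2 * n" for i
  proof -
    obtain c A where cA: "own i = (c, A)" by (cases "own i")
    have A: "(c, A) \<in> edges D" "A \<inter> verts D = {v}" using own(1,3)[OF i] cA by auto
    obtain k l where kl: "k < 2 * n" "l < 2 * n" "k \<noteq> l"
      "\<And>j. j < 2 * n \<Longrightarrow> ray v \<epsilon> (\<theta> j) \<inter> A \<noteq> {} \<longleftrightarrow> j = k \<or> j = l"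
      using loop_two_rays[OF D s A] by blast
    have "own j = own i \<longleftrightarrow> ray v \<epsilon> (\<theta> j) \<inter> A \<noteq> {}" if j: "j < 2 * n" for j
    proof
      assume "own j = own i"
      then show "ray v \<epsilon> (\<theta> j) \<inter> A \<noteq> {}" using own(2)[OF j] cA ray_ne[of "\<theta> j"] by auto
    next
      assume "ray v \<epsilon> (\<theta> j) \<inter> A \<noteq> {}"
      then have "ray v \<epsilon> (\<theta> j) \<subseteq> A" using ray_owner(2)[OF D s _ j, of c A] A(1) by blast
      then have "ray v \<epsilon> (\<theta> j) \<subseteq> snd (own j) \<inter> snd (own i)" using own(2)[OF j] cA by simp
      moreover have "ray v \<epsilon> (\<theta> j) \<inter> verts D = {}" using ray_in_ball st(2) by blast
      ultimately have "\<not> snd (own j) \<inter> snd (own i) \<subseteq> verts D" using ray_ne[of "\<theta> j"] by blast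
      then show "own j = own i" using polygonal_diagramD(8)[OF D, of "own j" "own i"] own(1)[OF j] own(1)[OF i] by blast
    qed
    then show ?thesis using kl cA by (intro exI[of _ k] exI[of _ l]) simp
  qed
  have n0: "0 < 2 * n" using n by simp
  define J where "J = snd (own 0)"
  obtain k0 l0 where kl0: "k0 < 2 * n" "l0 < 2 * n" "k0 \<noteq> l0" "\<forall>j<2 * n. own j = own 0 \<longleftrightarrow> j = k0 \<or> j = l0"
      "\<forall>j<2 * n. ray v \<epsilon> (\<theta> j) \<inter> snd (own 0) \<noteq> {} \<longleftrightarrow> j = k0 \<or> j = l0"
    using fiber[OF n0] by blast
  have "k0 = 0 \<or> l0 = 0" using kl0(4)[rule_format, OF n0] by simp
  then obtain l where l: "0 < l" "l < 2 * n" "\<And>j. j < 2 * n \<Longrightarrow> own j = own 0 \<longleftrightarrow> j = 0 \<or> j = l"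
     "\<And>j. j < 2 * n \<Longrightarrow> ray v \<epsilon> (\<theta> j) \<inter> J \<noteq> {} \<longleftrightarrow> j = 0 \<or> j = l"
    using kl0 unfolding J_def by (metis gr0I)
  have "own l = own 0" using l(2,3) by simp
  \<comment> \<open>Both half-edges of the loop have its color, and the parity of an index
    determines the color.\<close>
  then have evl: "even l" using own(4)[OF l(2)] own(4)[OF n0] by simp
  have th: "\<theta> 0 < \<theta> l" "\<theta> l < \<theta> 0 + 2 * pi" using star_mono[OF st(1) l(1,2)] by auto
  obtain g where g: "simple_path g" "path_image g = J" "J \<inter> verts D = {pathstart g, pathfinish g}"
    using polygonal_diagramD(4)[OF D, of "fst (own 0)" J] own(1)[OF n0] is_edgeE unfolding J_def by (metis prod.collapse)
  have JV: "J \<inter> verts D = {v}" using own(3)[OF n0] by (simp add: J_def)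
  have gl: "pathfinish g = pathstart g" using g(3) JV by (metis insertI1 insertI2 singletonD)
  note Jo = Jordan[OF g(1) gl g(2)]
  define S1 where "S1 = sector v \<epsilon> (\<theta> 0) (\<theta> l)"
  define S2 where "S2 = sector v \<epsilon> (\<theta> l) (\<theta> 0 + 2 * pi)"
  have JB: "J \<inter> (ball v \<epsilon> - {v}) \<subseteq> ray v \<epsilon> (\<theta> 0) \<union> ray v \<epsilon> (\<theta> l)"
  proof
    fix z assume z: "z \<in> J \<inter> (ball v \<epsilon> - {v})"
    have "J \<subseteq> strands D (fst (own 0))" using own(1)[OF n0] unfolding J_def strands_def by force
    then have "z \<in> strands D (fst (own 0)) \<inter> (ball v \<epsilon> - {v})" using z by blast
    then obtain j where "j < 2 * n" "z \<in> ray v \<epsilon> (\<theta> j)" unfolding star_rays[OF st(1)] by blast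
    then show "z \<in> ray v \<epsilon> (\<theta> 0) \<union> ray v \<epsilon> (\<theta> l)" using l(4) z by blast
  qed
  have SB: "sector v \<epsilon> a b \<subseteq> ball v \<epsilon> - {v}" for a b unfolding sector_def by auto
  have S1J: "S1 \<inter> J = {}"
  proof -
    have "S1 \<inter> ray v \<epsilon> (\<theta> 0) = {}" "S1 \<inter> ray v \<epsilon> (\<theta> l) = {}"
      unfolding S1_def by (rule sector_ray_disjoint; use th in force)+
    then show ?thesis using JB SB unfolding S1_def by blast
  qed
  have S2J: "S2 \<inter> J = {}"
  proof -
    have "S2 \<inter> ray v \<epsilon> (\<theta> 0) = {}" "S2 \<inter> ray v \<epsilon> (\<theta> l) = {}"
      unfolding S2_def by (rule sector_ray_disjoint; use th in force)+
    then show ?thesis using JB SB unfolding S2_def by blast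
  qed
  have r0: "ray v \<epsilon> (\<theta> 0) \<subseteq> J" "ray v \<epsilon> (\<theta> l) \<subseteq> J"
    using own(2)[OF n0] own(2)[OF l(2)] \<open>own l = own 0\<close> by (simp_all add: J_def)
  have vJ: "v \<in> J" using JV by blast
  have cover: "ball v \<epsilon> - J \<subseteq> S1 \<union> S2"
    using ball_sectors[OF th, of v \<epsilon>] r0 vJ unfolding S1_def S2_def by blast
  have side: "X \<subseteq> inside J \<or> X \<subseteq> outside J" if "connected X" "X \<inter> J = {}" for X
    using connectedD[OF that(1) Jo(1,3)] Jo(7,8) that(2) by blast
  \<comment> \<open>Every point of a Jordan curve is a limit of both sides, so the ball contains
    points of both. As the two sectors cover the ball outside the loop, they must lie on different
    sides.\<close>
  have meet: "ball v \<epsilon> \<inter> inside J \<noteq> {}" "ball v \<epsilon> \<inter> outside J \<noteq> {}"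
  proof -
    have "v \<in> closure (inside J)" "v \<in> closure (outside J)"
      using Jo(9,10) vJ unfolding frontier_def by blast+
    then show "ball v \<epsilon> \<inter> inside J \<noteq> {}" "ball v \<epsilon> \<inter> outside J \<noteq> {}"
      using e open_Int_closure_eq_empty[OF open_ball] centre_in_ball by blast+
  qed
  have S12: "S1 \<subseteq> inside J \<or> S1 \<subseteq> outside J" "S2 \<subseteq> inside J \<or> S2 \<subseteq> outside J"
    using side[OF connected_sector] S1J S2J unfolding S1_def S2_def by blast+
  obtain P Q where PQ: "S1 \<subseteq> P" "S2 \<subseteq> Q" "P \<inter> Q = {}" "P = inside J \<or> P = outside J"
  proof (cases "S1 \<subseteq> inside J")
    case True
    then have "\<not> S2 \<subseteq> inside J" using meet(2) cover Jo(7,8) by blast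
    then show ?thesis using True S12 Jo(7) by (intro that[of "inside J" "outside J"]) auto
  next
    case False
    then have "S1 \<subseteq> outside J" using S12 by blast
    moreover then have "\<not> S2 \<subseteq> outside J" using meet(1) cover Jo(7,8) by blast
    moreover have "outside J \<inter> inside J = {}" using Jo(7) by blast
    ultimately show ?thesis using S12 by (intro that[of "outside J" "inside J"]) auto
  qed
  define M where "M = {0<..<l}"
  have M: "j < 2 * n" "0 < j" "j < l" if "j \<in> M" for j using that l(2) by (auto simp: M_def)
  have mono: "\<theta> i < \<theta> j" if "i < j" "j < 2 * n" for i j using star_mono[OF st(1) that] by blast
  \<comment> \<open>A loop starting in the first sector cannot return in the second one: without
    \<open>v\<close> it is connected and misses \<open>J\<close>, so it stays on one side.\<close>
  have closedM: "j' \<in> M" if j: "j \<in> M" and j': "j' < 2 * n" "own j' = own j" for j j'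
  proof (rule ccontr)
    assume nM: "j' \<notin> M"
    have jn: "own j \<noteq> own 0" using l(3)[OF M(1)[OF j]] M[OF j] by auto
    then have "j' \<noteq> 0" "j' \<noteq> l" using j'(2) \<open>own l = own 0\<close> by metis+
    then have jl: "l < j'" using nM by (auto simp: M_def)
    define B where "B = snd (own j)"
    have BV: "B \<inter> verts D = {v}" using own(3)[OF M(1)[OF j]] by (simp add: B_def)
    have "B \<inter> J \<subseteq> verts D"
      using polygonal_diagramD(8)[OF D, of "own j" "own 0"] own(1)[OF M(1)[OF j]] own(1)[OF n0] jn
      unfolding B_def J_def by blast
    then have BJ: "(B - {v}) \<inter> J = {}" using BV by blast
    have "is_edge (verts D) B" using polygonal_diagramD(4)[OF D, of "fst (own j)" B] own(1)[OF M(1)[OF j]]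
      unfolding B_def by simp
    then have "connected (B - verts D)" by (rule edge_minus(1))
    moreover have "B - verts D = B - {v}" using BV by blast
    ultimately have "connected (B - {v})" by simp
    then have sd: "B - {v} \<subseteq> inside J \<or> B - {v} \<subseteq> outside J" using side BJ by blast
    have rj: "ray v \<epsilon> (\<theta> j) \<subseteq> B - {v}" "ray v \<epsilon> (\<theta> j') \<subseteq> B - {v}"
      using own(2)[OF M(1)[OF j]] own(2)[OF j'(1)] j'(2) ray_in_ball unfolding B_def by fastforce+
    have "ray v \<epsilon> (\<theta> j) \<subseteq> P"
      using ray_sector[of "\<theta> 0" "\<theta> j" "\<theta> l" v \<epsilon>] mono[of 0 j] mono[of j l] M[OF j] l(2) PQ(1) unfolding S1_def by blast
    moreover have "ray v \<epsilon> (\<theta> j') \<subseteq> Q"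
      using ray_sector[of "\<theta> l" "\<theta> j'" "\<theta> 0 + 2 * pi" v \<epsilon>] mono[of l j'] star_mono[OF st(1), of 0 j'] jl j'(1) PQ(2) unfolding S2_def by force
    ultimately show False using rj sd PQ(3,4) Jo(7) ray_ne[of "\<theta> j"] ray_ne[of "\<theta> j'"] by blast
  qed
  have "card {j \<in> M. own j = x} = 2" if x: "x \<in> own ` M" for x
  proof -
    obtain i where i: "i \<in> M" "x = own i" using x by blast
    obtain k k' where kk: "k < 2 * n" "k' < 2 * n" "k \<noteq> k'" "\<forall>j<2 * n. own j = own i \<longleftrightarrow> j = k \<or> j = k'"
      using fiber[OF M(1)[OF i(1)]] by blast
    have "{j \<in> M. own j = x} = {k, k'}"
      using kk closedM[OF i(1)] M(1) i(2) by blast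
    then show ?thesis using kk(3) by simp
  qed
  then have "(\<Sum>x\<in>own ` M. card {j \<in> M. own j = x}) = 2 * card (own ` M)" by simp
  moreover have "card M = (\<Sum>x\<in>own ` M. card {j \<in> M. own j = x})"
    using sum.image_gen[of M "\<lambda>_. 1 :: nat" own] by (simp add: M_def)
  moreover have "card M = l - 1" by (simp add: M_def)
  ultimately have "even (l - 1)" by simp
  then show False using evl l(1) by simp
qed

subsection \<open>Straightening an edge\<close>

text \<open>The number counts the segments. Simplicity is built in: the first segment meets the
  remaining arc only in their common vertex. The recursion suits an induction that removes one
  corner at a time.\<close>

primrec polyarc :: "nat \<Rightarrow> complex \<Rightarrow> complex \<Rightarrow> complex set \<Rightarrow> bool" where
  "polyarc 0 v w A \<longleftrightarrow> v = w \<and> A = {w}"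
| "polyarc (Suc k) v w A \<longleftrightarrow> (\<exists>p A'. v \<noteq> p \<and> polyarc k p w A' \<and> A = closed_segment v p \<union> A' \<and>
     closed_segment v p \<inter> A' = {p})"

lemma polyarc_compact: "polyarc k v w A \<Longrightarrow> compact A \<and> v \<in> A \<and> w \<in> A"
  by (induction k arbitrary: v A) auto

text \<open>The inverse of \<open>g\<close> takes each of the finitely many segments to an interval
  of parameters. Between neighbouring end points of these intervals the arc stays on one segment, so
  the end points divide it into straight pieces.\<close>

lemma arc_polyarc:
  assumes g: "arc g" and p: "polygonal (path_image g)"
  obtains k where "polyarc (Suc k) (pathstart g) (pathfinish g) (path_image g)"
proof -
  obtain S where S: "finite S" "path_image g = (\<Union>(a, b)\<in>S. closed_segment a b)"
    using p unfolding polygonal_def by blast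
  obtain h where hom: "homeomorphism {0..1} (path_image g) g h" using homeomorphism_arc[OF g] by blast
  have gh: "g (h z) = z" "h z \<in> {0..1}" if "z \<in> path_image g" for z
    using hom that unfolding homeomorphism_def by auto
  have image_subset: "g ` X \<subseteq> Y" if XY: "Y \<subseteq> path_image g" "X \<subseteq> h ` Y" for X Y
  proof
    fix z assume "z \<in> g ` X"
    then obtain y where "y \<in> Y" "z = g (h y)" using XY(2) by blast
    then show "z \<in> Y" using gh(1) XY(1) by auto
  qed
  have hg: "h (g t) = t" if "t \<in> {0..1}" for t using hom that unfolding homeomorphism_def by auto
  have ch: "continuous_on (path_image g) h" and cg: "continuous_on {0..1} g"
    using hom unfolding homeomorphism_def by auto
  have "\<exists>\<alpha> \<beta>. h ` closed_segment (fst s) (snd s) = {\<alpha>..\<beta>}" if s: "s \<in> S" for s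
  proof -
    have "closed_segment (fst s) (snd s) \<subseteq> path_image g" using S(2) s by (cases s) auto
    then have "continuous_on (closed_segment (fst s) (snd s)) h" using ch continuous_on_subset by blast
    then have "connected (h ` closed_segment (fst s) (snd s))" "compact (h ` closed_segment (fst s) (snd s))"
      by (auto intro: connected_continuous_image compact_continuous_image)
    then show ?thesis using connected_compact_interval_1 by blast
  qed
  then obtain \<alpha> \<beta> where ab: "\<And>s. s \<in> S \<Longrightarrow> h ` closed_segment (fst s) (snd s) = {\<alpha> s..\<beta> s}" by metis
  define T where "T = {0, 1} \<union> (\<alpha> ` S \<union> \<beta> ` S) \<inter> {0..1}"
  have T: "finite T" "T \<subseteq> {0..1}" using S(1) by (auto simp: T_def)
  have main: "\<exists>k. polyarc k (g t) (g 1) (g ` {t..1}) \<and> (t < 1 \<longrightarrow> k \<noteq> 0)" if "t \<in> T" for t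
    using that
  proof (induction "card {t'\<in>T. t < t'}" arbitrary: t rule: less_induct)
    case less
    have t01: "0 \<le> t" "t \<le> 1" using less(2) T(2) by auto
    show ?case
    proof (cases "t = 1")
      case True
      then show ?thesis by (intro exI[of _ 0]) simp
    next
      case False
      then have ne: "{t'\<in>T. t < t'} \<noteq> {}" using t01 by (auto simp: T_def)
      define u where "u = Min {t'\<in>T. t < t'}"
      have u: "u \<in> T" "t < u" using Min_in[OF _ ne] T(1) by (auto simp: u_def)
      have umin: "u \<le> t'" if "t' \<in> T" "t < t'" for t' using that T(1) by (auto simp: u_def)
      have u1: "u \<le> 1" using u T(2) by auto
      have "card {t'\<in>T. u < t'} < card {t'\<in>T. t < t'}"
        using u T(1) by (intro psubset_card_mono) auto
      then obtain k where k: "polyarc k (g u) (g 1) (g ` {u..1})" using less(1) u(1) by blast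
      \<comment> \<open>The segment through \<open>g m\<close> has a parameter interval containing
        \<open>m\<close>. No end point of an interval lies strictly between the neighbours
        \<open>t\<close> and \<open>u\<close>, so this interval contains all of
        \<open>{t..u}\<close>.\<close>
      define m where "m = (t + u) / 2"
      have m: "t < m" "m < u" "m \<in> {0..1}" using u(2) t01 u1 by (auto simp: m_def)
      then have "g m \<in> path_image g" by (auto simp: path_image_def)
      then obtain s where s: "s \<in> S" "g m \<in> closed_segment (fst s) (snd s)" using S(2) by auto
      then have mm: "m \<in> {\<alpha> s..\<beta> s}" using ab[OF s(1)] hg[OF m(3)] by (metis imageI)
      have sub: "closed_segment (fst s) (snd s) \<subseteq> path_image g" using S(2) s(1) by (cases s) auto
      have "h ` closed_segment (fst s) (snd s) \<subseteq> {0..1}" using gh(2) sub by blast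
      then have "{\<alpha> s..\<beta> s} \<subseteq> {0..1}" using ab[OF s(1)] by simp
      then have abT: "\<alpha> s \<in> T" "\<beta> s \<in> T" using mm s(1) by (auto simp: T_def)
      have "\<alpha> s \<le> t" using umin[OF abT(1)] mm m by force
      moreover have "u \<le> \<beta> s" using umin[OF abT(2)] mm m by force
      ultimately have "{t..u} \<subseteq> h ` closed_segment (fst s) (snd s)" using ab[OF s(1)] by auto
      then have gseg: "g ` {t..u} \<subseteq> closed_segment (fst s) (snd s)"
        using image_subset[OF sub] by blast
      have cgu: "continuous_on {t..u} g" using cg t01 u1 by (auto intro: continuous_on_subset)
      have "g ` {t..u} \<noteq> {}" "compact (g ` {t..u})" "connected (g ` {t..u})" "collinear (g ` {t..u})"
        using u(2) cgu gseg by (auto intro!: connected_continuous_image compact_continuous_image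
            collinear_subset[OF collinear_closed_segment])
      \<comment> \<open>The image of \<open>{t..u}\<close> is compact, connected and collinear,
        hence a segment; the two inclusions that follow identify its ends as \<open>g t\<close> and
        \<open>g u\<close>.\<close>
      then obtain x y where xy: "g ` {t..u} = closed_segment x y"
        using compact_convex_collinear_segment_alt by metis
      have "g t \<in> closed_segment x y" "g u \<in> closed_segment x y" using u(2) by (auto simp flip: xy)
      then have 1: "closed_segment (g t) (g u) \<subseteq> g ` {t..u}" unfolding xy by (simp add: subset_closed_segment)
      have segpi: "closed_segment (g t) (g u) \<subseteq> path_image g"
        using 1 image_mono[of "{t..u}" "{0..1}" g] t01 u1 unfolding path_image_def by auto
      have "connected (h ` closed_segment (g t) (g u))"
        using segpi ch by (intro connected_continuous_image) (auto intro: continuous_on_subset)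
      moreover have "t \<in> h ` closed_segment (g t) (g u)" "u \<in> h ` closed_segment (g t) (g u)"
        using imageI[of "g t" "closed_segment (g t) (g u)" h] imageI[of "g u" "closed_segment (g t) (g u)" h]
          hg[of t] hg[of u] t01 u u1 by auto
      ultimately have "{t..u} \<subseteq> h ` closed_segment (g t) (g u)" by (meson connected_contains_Icc)
      then have 2: "g ` {t..u} \<subseteq> closed_segment (g t) (g u)"
        using image_subset[OF segpi] by blast
      have seg: "closed_segment (g t) (g u) = g ` {t..u}" using 1 2 by blast
      have inj: "a = b" if "g a = g b" "a \<in> {0..1}" "b \<in> {0..1}" for a b using that hg by metis
      have "closed_segment (g t) (g u) \<inter> g ` {u..1} = {g u}"
      proof -
        have "z = g u" if z: "z \<in> g ` {t..u}" "z \<in> g ` {u..1}" for z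
        proof -
          obtain a b where "a \<in> {t..u}" "b \<in> {u..1}" "z = g a" "z = g b" using z by blast
          then have "a = b" using inj[of a b] t01 u1 by auto
          then show ?thesis using \<open>a \<in> {t..u}\<close> \<open>b \<in> {u..1}\<close> \<open>z = g a\<close> by auto
        qed
        moreover have "g u \<in> g ` {t..u}" "g u \<in> g ` {u..1}" using u u1 by auto
        ultimately show ?thesis unfolding seg by blast
      qed
      moreover have "g ` {t..1} = closed_segment (g t) (g u) \<union> g ` {u..1}"
        unfolding seg using u(2) u1 by (simp flip: image_Un add: ivl_disj_un_two_touch)
      moreover have "g t \<noteq> g u" using inj[of t u] t01 u u1 by auto
      ultimately have "polyarc (Suc k) (g t) (g 1) (g ` {t..1})"
        using k by (simp only: polyarc.simps) blast
      then show ?thesis by blast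
    qed
  qed
  have "0 \<in> T" by (simp add: T_def)
  then obtain k where "polyarc k (g 0) (g 1) (g ` {0..1})" "k \<noteq> 0" using main[of 0] by auto
  then show ?thesis using that[of "k - 1"] by (simp add: pathstart_def pathfinish_def path_image_def)
qed

lemma polyarc_affine:
  assumes "a \<noteq> 0" "polyarc k v w A"
  shows "polyarc k (a * v + b) (a * w + b) ((\<lambda>z. a * z + b) ` A)"
  using assms(2)
proof (induction k arbitrary: v A)
  case 0 then show ?case by simp
next
  case (Suc k)
  let ?f = "\<lambda>z. a * z + b"
  obtain p A' where p: "v \<noteq> p" "polyarc k p w A'" "A = closed_segment v p \<union> A'" "closed_segment v p \<inter> A' = {p}"
    using Suc(2) by auto
  have inj: "inj ?f" using assms(1) by (auto simp: inj_def)
  have lin: "linear ((*) a)" by (simp add: linear_iff algebra_simps)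
  have "?f ` closed_segment v p = (\<lambda>z. b + z) ` ((*) a ` closed_segment v p)"
    by (simp add: image_image add.commute)
  then have seg: "?f ` closed_segment v p = closed_segment (?f v) (?f p)"
    unfolding closed_segment_linear_image[OF lin, symmetric]
    using closed_segment_translation[of b "a * v" "a * p"] by (simp add: add.commute)
  have "closed_segment (?f v) (?f p) \<inter> ?f ` A' = {?f p}"
    unfolding seg[symmetric] image_Int[OF inj, symmetric] p(4) by simp
  moreover have "?f ` A = closed_segment (?f v) (?f p) \<union> ?f ` A'" unfolding p(3) image_Un seg ..
  moreover have "?f v \<noteq> ?f p" using p(1) assms(1) by simp
  ultimately show ?case using Suc(1)[OF p(2)] by (simp only: polyarc.simps) blast
qed

text \<open>
  The corner \<open>1\<close> of the polygon \<open>0, 1, q, \<dots>\<close> is removed by a homeomorphism supported in a thin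
  convex quadrilateral around the segment from \<open>0\<close> to \<open>1\<close> that has \<open>1\<close> on its boundary: it moves
  \<open>0\<close> to a point \<open>b\<close> on the extension of the segment from \<open>q\<close> to \<open>1\<close>.
\<close>

lemma straighten_corner:
  assumes P: "polyarc (Suc (Suc k)) 0 w A" and A: "A = closed_segment 0 1 \<union> A'" "polyarc (Suc k) 1 w A'"
     "closed_segment 0 1 \<inter> A' = {1}"
  obtains h where "plane_homeo h" "pw_affine h" "polyarc (Suc k) (h 0) (h w) (h ` A)"
proof -
  obtain q A'' where q: "1 \<noteq> q" "polyarc k q w A''" "A' = closed_segment 1 q \<union> A''" "closed_segment 1 q \<inter> A'' = {q}"
    using A(2) by auto
  have cA: "compact A''" "q \<in> A''" "w \<in> A''" using polyarc_compact[OF q(2)] by auto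
  have seg01: "closed_segment 0 (1::complex) = {z. Im z = 0 \<and> 0 \<le> Re z \<and> Re z \<le> 1}"
    by (auto simp: closed_segment_def complex_eq_iff scaleR_conv_of_real)
  have dis: "closed_segment 0 1 \<inter> A'' = {}"
  proof -
    have "1 \<notin> A''" using q(1,4) by (metis IntI ends_in_segment(1) singletonD)
    moreover have "closed_segment 0 1 \<inter> A'' \<subseteq> {1}" using equalityD1[OF A(3)] q(3) by blast
    ultimately show ?thesis by blast
  qed
  \<comment> \<open>The slanted side of the quadrilateral lies on a line through \<open>1\<close>:
    \<open>Re z + la * Im z\<close> is \<open>0\<close> at \<open>0\<close>, \<open>1\<close> at
    \<open>1\<close> and larger at \<open>q\<close>. Such a line is missing only if \<open>q\<close>
    is real and to the left of \<open>1\<close>, where the second segment would run back along the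
    first.\<close>
  have "\<exists>la. (Re q - 1) + la * Im q > 0"
  proof (cases "Im q = 0")
    case False
    then show ?thesis by (intro exI[of _ "(1 + \<bar>Re q - 1\<bar>) / Im q"]) simp
  next
    case True
    have "Re q > 1"
    proof (rule ccontr)
      assume "\<not> Re q > 1"
      moreover have "Re q \<noteq> 1" using True q(1) by (auto simp: complex_eq_iff)
      ultimately have lt: "Re q < 1" by simp
      define r where "r = max (Re q) 0"
      define t where "t = (1 - r) / (1 - Re q)"
      have t: "0 \<le> t" "t \<le> 1" "t * (1 - Re q) = 1 - r" using lt by (auto simp: t_def r_def divide_le_eq)
      have "complex_of_real r = (1 - t) *\<^sub>R 1 + t *\<^sub>R q"
        using t(3) True by (simp add: complex_eq_iff algebra_simps)
      then have "complex_of_real r \<in> closed_segment 1 q" using t(1,2) unfolding closed_segment_def by blast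
      moreover have "complex_of_real r \<in> closed_segment 0 1" unfolding seg01 using lt by (auto simp: r_def)
      ultimately have "complex_of_real r = 1" using A(3) q(3) by blast
      then show False using lt by (auto simp: r_def max_def split: if_splits)
    qed
    then show ?thesis by (intro exI[of _ 0]) simp
  qed
  then obtain la where lam: "(Re q - 1) + la * Im q > 0" by blast
  obtain \<delta> where \<delta>: "\<delta> > 0" "\<And>x y. x \<in> closed_segment 0 1 \<Longrightarrow> y \<in> A'' \<Longrightarrow> \<delta> \<le> dist x y"
    using separate_compact_closed[OF compact_segment compact_imp_closed[OF cA(1)] dis] by metis
  \<comment> \<open>Half-width of the quadrilateral. Its interior points are at distance less than
    \<open>(2 + \<bar>la\<bar>) * \<tau>\<close> from the segment, so \<open>A''\<close> is
    avoided.\<close>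
  define \<tau> where "\<tau> = \<delta> / (2 * (2 + \<bar>la\<bar>))"
  have \<tau>: "\<tau> > 0" "(2 + \<bar>la\<bar>) * \<tau> < \<delta>"
  proof -
    have p: "0 < 2 + \<bar>la\<bar>" by simp
    show "\<tau> > 0" using p \<delta>(1) by (simp add: \<tau>_def)
    have "(2 + \<bar>la\<bar>) * \<tau> = \<delta> / 2" using p by (simp add: \<tau>_def divide_simps)
    then show "(2 + \<bar>la\<bar>) * \<tau> < \<delta>" using \<delta>(1) by simp
  qed
  \<comment> \<open>Small enough for the target \<open>b\<close> to lie in the strip of half-width
    \<open>\<tau>\<close> and to the right of the imaginary axis.\<close>
  define s where "s = min \<tau> 1 / (2 * (1 + cmod (q - 1)))"
  have s: "s > 0" "s * cmod (q - 1) < \<tau>" "s * cmod (q - 1) < 1"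
  proof -
    have p: "0 < 1 + cmod (q - 1)" by (simp add: add_pos_nonneg)
    show "s > 0" using \<tau>(1) p by (simp add: s_def)
    have "s * cmod (q - 1) \<le> s * (1 + cmod (q - 1))" using \<open>s > 0\<close> by simp
    also have "\<dots> = min \<tau> 1 / 2" using p by (simp add: s_def divide_simps)
    finally show "s * cmod (q - 1) < \<tau>" "s * cmod (q - 1) < 1" using \<tau>(1) by linarith+
  qed
  define b where "b = 1 - s *\<^sub>R (q - 1)"
  have b: "Re b + la * Im b < 1" "\<bar>Im b\<bar> < \<tau>" "0 < Re b"
  proof -
    have "s * (Re q - 1 + la * Im q) > 0" using s(1) lam by simp
    then show "Re b + la * Im b < 1" by (simp add: b_def algebra_simps)
    have "\<bar>Im b\<bar> = s * \<bar>Im (q - 1)\<bar>" using s(1) by (simp add: b_def abs_mult)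
    also have "\<dots> \<le> s * cmod (q - 1)" using s(1) abs_Im_le_cmod[of "q - 1"] by simp
    finally show "\<bar>Im b\<bar> < \<tau>" using s(2) by simp
    have "s * Re (q - 1) \<le> s * cmod (q - 1)" using s(1) complex_Re_le_cmod[of "q - 1"] by simp
    then show "0 < Re b" using s(3) by (simp add: b_def)
  qed
  \<comment> \<open>The gauge of the quadrilateral, whose interior is \<open>\<mu> z < 1\<close>. On
    the segment from \<open>0\<close> to \<open>1\<close> its value at \<open>x\<close> is
    \<open>x\<close>, so the shift by \<open>1 - \<mu> z\<close> times \<open>b\<close> takes this
    segment affinely to the one from \<open>b\<close> to \<open>1\<close>.\<close>
  define \<mu> where "\<mu> z = max (Re z + la * Im z) (max (\<bar>Im z\<bar> / \<tau>) (- Re z / \<tau>))" for z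
  define h where "h z = z + max 0 (1 - \<mu> z) *\<^sub>R b" for z
  have pw: "pw_affine (\<lambda>z. max 0 (1 - \<mu> z))" unfolding \<mu>_def
    by (intro pw_affine_max pw_affine_const pw_affine_diff pw_affine_add pw_affine_mult pw_affine_divide
        pw_affine_abs pw_affine_minus pw_affine_Re pw_affine_Im)
  have h1: "pw_affine h" unfolding h_def by (intro pw_affine_add pw_affine_id pw_affine_scaleR pw)
  \<comment> \<open>Along the direction \<open>b\<close> the first two terms of \<open>\<mu>\<close>
    grow at most at rate \<open>\<kappa>\<close>, and the third decreases because
    \<open>Re b > 0\<close>; so the shift meets the criterion of
    \<open>plane_homeo_shift\<close>.\<close>
  define \<kappa> where "\<kappa> = max 0 (max (Re b + la * Im b) (\<bar>Im b\<bar> / \<tau>))"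
  have \<kappa>: "\<kappa> < 1" "0 \<le> \<kappa>" using b \<tau>(1) by (auto simp: \<kappa>_def)
  have h2: "plane_homeo h" unfolding h_def
  proof (rule plane_homeo_shift[OF pw_affine_continuous[OF pw] \<kappa>(1)])
    fix z and t :: real assume t: "0 \<le> t"
    have "\<mu> (z + t *\<^sub>R b) \<le> \<mu> z + \<kappa> * t"
    proof -
      have "Re (z + t *\<^sub>R b) + la * Im (z + t *\<^sub>R b) = (Re z + la * Im z) + (Re b + la * Im b) * t"
        by (simp add: algebra_simps)
      also have "\<dots> \<le> \<mu> z + \<kappa> * t"
        using t by (intro add_mono mult_right_mono) (auto simp: \<mu>_def \<kappa>_def)
      finally have 1: "Re (z + t *\<^sub>R b) + la * Im (z + t *\<^sub>R b) \<le> \<mu> z + \<kappa> * t" .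
      have "\<bar>Im (z + t *\<^sub>R b)\<bar> / \<tau> \<le> \<bar>Im z\<bar> / \<tau> + \<bar>Im b\<bar> / \<tau> * t"
        using t \<tau>(1) abs_triangle_ineq[of "Im z" "t * Im b"] by (simp add: field_simps abs_mult)
      also have "\<dots> \<le> \<mu> z + \<kappa> * t"
        using t by (intro add_mono mult_right_mono) (auto simp: \<mu>_def \<kappa>_def)
      finally have 2: "\<bar>Im (z + t *\<^sub>R b)\<bar> / \<tau> \<le> \<mu> z + \<kappa> * t" .
      have "- Re (z + t *\<^sub>R b) / \<tau> \<le> - Re z / \<tau>"
        using t \<tau>(1) b(3) by (simp add: field_simps)
      also have "\<dots> \<le> \<mu> z + \<kappa> * t" using t \<kappa>(2) by (simp add: \<mu>_def le_max_iff_disj add_increasing2)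
      finally have 3: "- Re (z + t *\<^sub>R b) / \<tau> \<le> \<mu> z + \<kappa> * t" .
      show ?thesis using 1 2 3 by (simp add: \<mu>_def)
    qed
    then show "max 0 (1 - \<mu> z) - \<kappa> * t \<le> max 0 (1 - \<mu> (z + t *\<^sub>R b))"
      using t \<kappa>(2) by (smt (verit) mult_nonneg_nonneg)
  qed
  have id: "h z = z" if "\<mu> z \<ge> 1" for z using that by (simp add: h_def)
  have idA: "h z = z" if z: "z \<in> A''" for z
  proof (rule ccontr)
    assume "h z \<noteq> z"
    then have "\<mu> z < 1" using id by force
    then have k: "Re z + la * Im z < 1" "\<bar>Im z\<bar> < \<tau>" "- Re z < \<tau>" using \<tau>(1) by (auto simp: \<mu>_def field_simps)
    define x where "x = max 0 (min 1 (Re z))"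
    have "\<bar>la * Im z\<bar> \<le> \<bar>la\<bar> * \<tau>" using k(2) by (simp add: abs_mult mult_left_mono)
    then have "\<bar>Re z - x\<bar> \<le> (1 + \<bar>la\<bar>) * \<tau>" using k \<tau>(1)
      by (simp add: x_def max_def min_def algebra_simps) (smt (verit) mult_nonneg_nonneg abs_ge_zero)
    moreover have "cmod (z - of_real x) \<le> \<bar>Re z - x\<bar> + \<bar>Im z\<bar>" using cmod_le[of "z - of_real x"] by simp
    ultimately have "cmod (z - of_real x) < \<delta>" using k(2) \<tau>(2) by (simp add: algebra_simps)
    moreover have "complex_of_real x \<in> closed_segment 0 1" unfolding seg01 by (auto simp: x_def)
    ultimately show False using \<delta>(2)[of "of_real x" z] z by (simp add: dist_norm norm_minus_commute)
  qed
  have idq: "h z = z" if z: "z \<in> closed_segment 1 q" for z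
  proof -
    obtain u where u: "0 \<le> u" "z = (1 - u) *\<^sub>R 1 + u *\<^sub>R q" using z unfolding closed_segment_def by blast
    have "Re z = 1 - u + u * Re q" "Im z = u * Im q" using u(2) by simp_all
    then have "Re z + la * Im z = 1 + u * ((Re q - 1) + la * Im q)" by (simp add: algebra_simps)
    then have "Re z + la * Im z \<ge> 1" using u(1) lam by simp
    then show ?thesis by (intro id) (simp add: \<mu>_def)
  qed
  have h0: "h (of_real x) = of_real x + (1 - x) *\<^sub>R b" if "0 \<le> x" "x \<le> 1" for x
  proof -
    have "- x / \<tau> \<le> 0" using that \<tau>(1) by (simp add: field_simps)
    then have "\<mu> (of_real x) = x" using that by (simp add: \<mu>_def max_def)
    then show ?thesis using that by (simp add: h_def)
  qed
  have him: "h ` closed_segment 0 1 = closed_segment b 1"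
  proof -
    have s1: "closed_segment 0 1 = complex_of_real ` {0..1}"
      unfolding seg01 by (auto simp: complex_eq_iff image_iff intro!: bexI[of _ "Re _"])
    have s2: "closed_segment b 1 = (\<lambda>x. of_real x + (1 - x) *\<^sub>R b) ` {0..1}"
      unfolding closed_segment_def by (auto simp: scaleR_conv_of_real image_iff algebra_simps Bex_def)
    show ?thesis unfolding s1 s2 image_image using h0 by (intro image_cong) auto
  qed
  have "h ` closed_segment 1 q = (\<lambda>z. z) ` closed_segment 1 q" "h ` A'' = (\<lambda>z. z) ` A''"
    using idq idA by (intro image_cong; simp)+
  then have himA: "h ` A = closed_segment b 1 \<union> closed_segment 1 q \<union> A''" "h ` A'' = A''"
    unfolding A(1) q(3) image_Un him by auto
  have "1 \<in> closed_segment b q"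
    unfolding closed_segment_def
  proof (intro CollectI exI[of _ "s / (1 + s)"] conjI)
    show "1 = (1 - s / (1 + s)) *\<^sub>R b + (s / (1 + s)) *\<^sub>R q"
      using s(1) by (simp add: b_def complex_eq_iff field_simps)
  qed (use s(1) in auto)
  then have un: "closed_segment b 1 \<union> closed_segment 1 q = closed_segment b q" by (rule Un_closed_segment)
  have "closed_segment b 1 \<inter> A'' = h ` (closed_segment 0 1 \<inter> A'')"
    using image_Int[OF bij_is_inj[OF plane_homeo_bij[OF h2]]] him himA(2) by metis
  then have "closed_segment b q \<inter> A'' = {q}" using dis q(4) un by auto
  moreover have "b \<noteq> q"
  proof
    assume "b = q"
    then have "(1 + s) *\<^sub>R (q - 1) = 0" by (simp add: b_def algebra_simps)
    then show False using q(1) s(1) by simp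
  qed
  ultimately have "polyarc (Suc k) b w (h ` A)" using q(2) himA un by (simp only: polyarc.simps) blast
  moreover have "h 0 = b" using h0[of 0] by simp
  moreover have "h w = w" using idA cA(3) by simp
  ultimately show ?thesis using that h1 h2 by simp
qed

lemma edges_map: "(c, A) \<in> edges D \<Longrightarrow> (c, f ` A) \<in> edges (map_diagram f D)"
  by (force simp: map_diagram_def)

text \<open>Each step first maps the initial segment affinely to the one from \<open>0\<close> to
  \<open>1\<close>, where \<open>straighten_corner\<close> merges it with the next one. A single
  remaining segment is brought to its final position by an affine map.\<close>

lemma straighten_edge:
  assumes "polygonal_diagram n D" "(c, A) \<in> edges D" "polyarc (Suc k) v w A"
  shows "\<exists>f. plane_homeo f \<and> polygonal_diagram n (map_diagram f D) \<and>
     f v = -1 \<and> f w = 1 \<and> f ` A = closed_segment (-1) 1"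
  using assms
proof (induction k arbitrary: D A v w)
  case 0
  then have A: "v \<noteq> w" "A = closed_segment v w" by auto
  define a where "a = 2 / (w - v)"
  define b where "b = - 1 - a * v"
  let ?f = "\<lambda>z. a * z + b"
  have a: "a \<noteq> 0" using A by (simp add: a_def)
  have "a * (w - v) = 2" using A(1) by (metis a_def eq_iff_diff_eq_0 nonzero_eq_divide_eq)
  then have fv: "?f v = -1" "?f w = 1" by (simp_all add: b_def algebra_simps)
  have "polyarc (Suc 0) (?f v) (?f w) (?f ` A)" by (rule polyarc_affine[OF a 0(3)])
  then have "?f ` A = closed_segment (-1) 1" unfolding fv by auto
  then show ?case using plane_homeo_affine[OF a] polygonal_map[OF plane_homeo_affine[OF a] pw_affine_affine 0(1)] fv
    by (intro exI[of _ ?f]) blast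
next
  case (Suc k)
  obtain p A' where p: "v \<noteq> p" "polyarc (Suc k) p w A'" "A = closed_segment v p \<union> A'" "closed_segment v p \<inter> A' = {p}"
    using Suc(4) by (auto simp only: polyarc.simps)
  define a where "a = 1 / (p - v)"
  define b where "b = - a * v"
  let ?f = "\<lambda>z. a * z + b"
  have a: "a \<noteq> 0" using p by (simp add: a_def)
  have "a * (p - v) = 1" using p(1) by (metis a_def eq_iff_diff_eq_0 nonzero_eq_divide_eq)
  then have fv: "?f v = 0" "?f p = 1" by (simp_all add: b_def algebra_simps)
  have ph: "plane_homeo ?f" by (rule plane_homeo_affine[OF a])
  have inj: "inj ?f" using bij_is_inj[OF plane_homeo_bij[OF ph]] .
  have "polyarc (Suc 0) (?f v) (?f p) (?f ` closed_segment v p)"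
    by (rule polyarc_affine[OF a]) (use p(1) in auto)
  then have seg: "?f ` closed_segment v p = closed_segment 0 1" unfolding fv by auto
  obtain h where h: "plane_homeo h" "pw_affine h" "polyarc (Suc k) (h 0) (h (?f w)) (h ` ?f ` A)"
  proof (rule straighten_corner)
    show "polyarc (Suc (Suc k)) 0 (?f w) (?f ` A)" using polyarc_affine[OF a Suc(4), of b] fv by simp
    show "?f ` A = closed_segment 0 1 \<union> ?f ` A'" unfolding p(3) image_Un seg ..
    show "polyarc (Suc k) 1 (?f w) (?f ` A')" using polyarc_affine[OF a p(2), of b] fv by simp
    show "closed_segment 0 1 \<inter> ?f ` A' = {1}"
      unfolding seg[symmetric] image_Int[OF inj, symmetric] p(4) using fv by simp
  qed
  let ?g = "\<lambda>z. h (?f z)"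
  have pg: "plane_homeo ?g" using plane_homeo_comp[OF h(1) ph] by (simp add: comp_def)
  have m: "map_diagram ?g D = map_diagram h (map_diagram ?f D)" by (simp add: map_diagram_comp comp_def)
  have pD: "polygonal_diagram n (map_diagram ?g D)"
    unfolding m by (intro polygonal_map h ph pw_affine_affine Suc(2))
  have "(c, ?g ` A) \<in> edges (map_diagram ?g D)" by (rule edges_map[OF Suc(3)])
  moreover have "polyarc (Suc k) (?g v) (?g w) (?g ` A)" using h(3) fv by (simp add: image_image)
  ultimately obtain f where f: "plane_homeo f" "polygonal_diagram n (map_diagram f (map_diagram ?g D))"
     "f (?g v) = -1" "f (?g w) = 1" "f ` ?g ` A = closed_segment (-1) 1"
    using Suc(1)[OF pD] by blast
  have pf: "plane_homeo (f \<circ> ?g)" by (rule plane_homeo_comp[OF f(1) pg])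
  have pD2: "polygonal_diagram n (map_diagram (f \<circ> ?g) D)" using f(2) unfolding map_diagram_comp .
  show ?case using pf pD2 f(3-5) by (intro exI[of _ "f \<circ> ?g"]) (simp only: comp_def image_image)
qed

subsection \<open>Normal form of the two ends of a straight edge\<close>

text \<open>A horizontal shift by \<open>M\<close> times \<open>Re z\<close>, cut off at
  \<open>- \<bar>Im z\<bar>\<close> and \<open>\<bar>Im z\<bar>\<close>. It fixes the real line and
  commutes with \<open>z \<mapsto> - z\<close>. Near \<open>-1\<close> it moves points to the left
  by \<open>M * \<bar>Im z\<bar>\<close> and so tilts every ray that is not horizontal to the left;
  near \<open>1\<close> the same happens to the right.\<close>

definition push :: "real \<Rightarrow> complex \<Rightarrow> complex" where
  "push M z = z + (M * max (- \<bar>Im z\<bar>) (min (Re z) \<bar>Im z\<bar>)) *\<^sub>R 1"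

lemma push_homeo: "M \<ge> 0 \<Longrightarrow> plane_homeo (push M)" and push_pw_affine: "pw_affine (push M)"
proof -
  have pw: "pw_affine (\<lambda>z. M * max (- \<bar>Im z\<bar>) (min (Re z) \<bar>Im z\<bar>))"
    by (intro pw_affine_mult pw_affine_max pw_affine_minus pw_affine_abs pw_affine_min pw_affine_Re pw_affine_Im)
  show "pw_affine (push M)" unfolding push_def by (intro pw_affine_add pw_affine_id pw_affine_scaleR pw)
  show "plane_homeo (push M)" if M: "M \<ge> 0" unfolding push_def
  proof (rule plane_homeo_shift[OF pw_affine_continuous[OF pw]])
    show "(0::real) < 1" by simp
    fix z :: complex and s :: real assume "0 \<le> s"
    then have "max (- \<bar>Im z\<bar>) (min (Re z) \<bar>Im z\<bar>) \<le> max (- \<bar>Im (z + s *\<^sub>R 1)\<bar>) (min (Re (z + s *\<^sub>R 1)) \<bar>Im (z + s *\<^sub>R 1)\<bar>)"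
      by simp
    then show "M * max (- \<bar>Im z\<bar>) (min (Re z) \<bar>Im z\<bar>) - 0 * s
        \<le> M * max (- \<bar>Im (z + s *\<^sub>R 1)\<bar>) (min (Re (z + s *\<^sub>R 1)) \<bar>Im (z + s *\<^sub>R 1)\<bar>)"
      using mult_left_mono[OF _ M] by simp
  qed
qed

lemma push_real: "Im z = 0 \<Longrightarrow> push M z = z"
  by (simp add: push_def)

lemma push_neg: "push M (- z) = - push M z"
proof -
  have "max (- \<bar>Im z\<bar>) (min (- Re z) \<bar>Im z\<bar>) = - max (- \<bar>Im z\<bar>) (min (Re z) \<bar>Im z\<bar>)"
    by (smt (verit))
  then show ?thesis by (simp add: push_def complex_eq_iff)
qed

lemma push_left:
  assumes "\<bar>Im z\<bar> \<le> - Re z" shows "push M z = Complex (Re z - M * \<bar>Im z\<bar>) (Im z)"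
proof -
  have "max (- \<bar>Im z\<bar>) (min (Re z) \<bar>Im z\<bar>) = - \<bar>Im z\<bar>" using assms by (smt (verit))
  then show ?thesis by (simp add: push_def complex_eq_iff)
qed

text \<open>All half-edges at \<open>-1\<close> leave into the half-plane \<open>Re z < -1\<close>,
  apart from what lies on the real line to the right, where the straight edge is.\<close>

definition leftgoing :: "diagram \<Rightarrow> bool" where
  "leftgoing D \<longleftrightarrow> (\<exists>\<epsilon>>0. \<forall>c. \<forall>z\<in>strands D c \<inter> ball (-1) \<epsilon>. Re z < -1 \<or> (Im z = 0 \<and> Re z \<ge> -1))"

text \<open>A direction \<open>(cos, sin)\<close> at \<open>-1\<close> becomes
  \<open>(cos - M * \<bar>sin\<bar>, sin)\<close>, which points to the left for large
  \<open>M\<close> unless it is horizontal. The result is stated for all large \<open>M\<close> so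
  that one value can serve both ends of the edge.\<close>

lemma push_leftgoing:
  assumes D: "polygonal_diagram n D" and v: "-1 \<in> verts D"
  shows "\<exists>M0\<ge>0. \<forall>M\<ge>M0. leftgoing (map_diagram (push M) D)"
proof -
  obtain \<epsilon>0 \<theta> where s0: "star n D (-1) \<epsilon>0 \<theta>"
    using polygonal_diagramD(9)[OF D v] alternating_at_star by blast
  \<comment> \<open>Radius \<open>1/2\<close> keeps the ball in the region
    \<open>\<bar>Im z\<bar> \<le> - Re z\<close>, where \<open>push_left\<close> gives the map
    explicitly.\<close>
  define \<epsilon> where "\<epsilon> = min \<epsilon>0 (1/2)"
  have e: "0 < \<epsilon>" "\<epsilon> \<le> \<epsilon>0" "\<epsilon> \<le> 1/2" using star_pos[OF s0] by (auto simp: \<epsilon>_def)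
  have s: "star n D (-1) \<epsilon> \<theta>" using star_shrink[OF s0 e(1,2)] .
  \<comment> \<open>Larger than every \<open>1 / \<bar>sin (\<theta> k)\<bar>\<close>; horizontal
    rays contribute \<open>1 / 0 = 0\<close>.\<close>
  define M0 where "M0 = 1 + (\<Sum>k<2*n. 1 / \<bar>sin (\<theta> k)\<bar>)"
  have M0: "M0 \<ge> 0" unfolding M0_def by (intro add_nonneg_nonneg sum_nonneg) auto
  have M0k: "cos (\<theta> k) < M0 * \<bar>sin (\<theta> k)\<bar>" if "k < 2 * n" "sin (\<theta> k) \<noteq> 0" for k
  proof -
    have "1 / \<bar>sin (\<theta> k)\<bar> \<le> (\<Sum>k<2*n. 1 / \<bar>sin (\<theta> k)\<bar>)"
      using that by (intro member_le_sum) auto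
    then have "1 / \<bar>sin (\<theta> k)\<bar> < M0" by (simp add: M0_def)
    then have "1 < M0 * \<bar>sin (\<theta> k)\<bar>" using that(2) by (simp add: divide_less_eq)
    then show ?thesis using cos_le_one[of "\<theta> k"] by linarith
  qed
  have "leftgoing (map_diagram (push M) D)" if M: "M \<ge> M0" for M
  proof -
    have ph: "plane_homeo (push M)" using push_homeo M M0 by simp
    have "open (push M ` ball (-1) \<epsilon>)" using plane_homeo_open[OF ph] by simp
    moreover have "-1 \<in> push M ` ball (-1) \<epsilon>" using push_real[of "-1"] e(1) by (intro image_eqI[of _ _ "-1"]) auto
    ultimately obtain \<delta> where d: "\<delta> > 0" "ball (-1) \<delta> \<subseteq> push M ` ball (-1) \<epsilon>" by (meson open_contains_ball)
    have "Re w < -1 \<or> (Im w = 0 \<and> Re w \<ge> -1)" if w: "w \<in> strands (map_diagram (push M) D) c \<inter> ball (-1) \<delta>" for c w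
    proof -
      have inj: "inj (push M)" using bij_is_inj[OF plane_homeo_bij[OF ph]] .
      obtain z where z: "z \<in> strands D c" "w = push M z" using w by (auto simp: strands_map)
      have "push M z \<in> push M ` ball (-1) \<epsilon>" using w d(2) z(2) by blast
      then have "z \<in> strands D c \<inter> ball (-1) \<epsilon>" using z(1) inj_image_mem_iff[OF inj] by blast
      then obtain r k where rk: "z = -1 + of_real r * cis (\<theta> k)" "0 \<le> r" "r < \<epsilon>" "k < 2 * n"
        unfolding star_eq[OF s] by blast
      have zc: "Re z = -1 + r * cos (\<theta> k)" "Im z = r * sin (\<theta> k)" using rk(1) by simp_all
      have "\<bar>r * cos (\<theta> k)\<bar> \<le> r" "\<bar>r * sin (\<theta> k)\<bar> \<le> r" using rk(2) by (simp_all add: abs_mult mult_left_le)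
      then have "\<bar>Im z\<bar> \<le> - Re z" using zc rk(3) e(3) by linarith
      then have wc: "Re w = -1 + r * (cos (\<theta> k) - M * \<bar>sin (\<theta> k)\<bar>)" "Im w = r * sin (\<theta> k)"
        unfolding z(2) using push_left[of z M] zc rk(2) by (simp_all add: algebra_simps abs_mult)
      consider "r = 0" | "r > 0" "sin (\<theta> k) \<noteq> 0" | "r > 0" "sin (\<theta> k) = 0" using rk(2) by fastforce
      then show ?thesis
      proof cases
        case 1 then show ?thesis using wc by simp
      next
        case 2
        have "M0 * \<bar>sin (\<theta> k)\<bar> \<le> M * \<bar>sin (\<theta> k)\<bar>" using M by (simp add: mult_right_mono)
        then have "cos (\<theta> k) - M * \<bar>sin (\<theta> k)\<bar> < 0" using M0k[OF rk(4) 2(2)] by linarith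
        then have "r * (cos (\<theta> k) - M * \<bar>sin (\<theta> k)\<bar>) < 0" using 2(1) by (simp add: mult_pos_neg)
        then show ?thesis using wc by simp
      next
        case 3
        show ?thesis
        proof (cases "cos (\<theta> k) \<ge> 0")
          case True then show ?thesis using 3 wc by simp
        next
          case False then have "r * cos (\<theta> k) < 0" using 3 by (simp add: mult_pos_neg)
          then show ?thesis using 3 wc by simp
        qed
      qed
    qed
    then show ?thesis unfolding leftgoing_def using d(1) by blast
  qed
  then show ?thesis using M0 by blast
qed

section \<open>Fans of straight half-edges at the two ends\<close>

definition leftray :: "real \<Rightarrow> complex set" where
  "leftray a = {z. Re z \<le> -1 \<and> Im z = a * (-1 - Re z)}"

text \<open>The slope is measured away from the vertex, as in \<open>leftray\<close>. The two
  families are mirror images in the imaginary axis, and larger \<open>a\<close> means higher in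
  both.\<close>

definition rightray :: "real \<Rightarrow> complex set" where
  "rightray a = {z. Re z \<ge> 1 \<and> Im z = a * (Re z - 1)}"

definition axis :: "gen \<Rightarrow> gen \<Rightarrow> complex set" where
  "axis c0 c = (if c = c0 then closed_segment (-1) 1 else {})"

text \<open>In the increasing order of slopes, index \<open>0\<close> is the lowest half-edge and
  \<open>2 * n - 2\<close> the highest. Both are neighbours of the edge in the cyclic order and both
  indices are even, so even indices carry the color opposite to that of the edge.\<close>

definition fan_color :: "gen \<Rightarrow> nat \<Rightarrow> gen" where
  "fan_color c0 k = (if even k then other c0 else c0)"

definition fan :: "nat \<Rightarrow> gen \<Rightarrow> (nat \<Rightarrow> complex set) \<Rightarrow> gen \<Rightarrow> complex set" where
  "fan n c0 R c = (\<Union>k\<in>{k. k < 2 * n - 1 \<and> fan_color c0 k = c}. R k)"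

lemma axis_eq: "closed_segment (-1) (1::complex) = {z. Im z = 0 \<and> \<bar>Re z\<bar> \<le> 1}"
proof -
  have "z \<in> closed_segment (-1) 1" if "Im z = 0" "\<bar>Re z\<bar> \<le> 1" for z :: complex
    unfolding closed_segment_def
  proof (intro CollectI exI[of _ "(1 + Re z) / 2"] conjI)
    show "z = (1 - (1 + Re z) / 2) *\<^sub>R (-1) + ((1 + Re z) / 2) *\<^sub>R 1"
      using that(1) by (simp add: complex_eq_iff)
  qed (use that(2) in auto)
  moreover have "Im z = 0 \<and> \<bar>Re z\<bar> \<le> 1" if zs: "z \<in> closed_segment (-1) 1" for z :: complex
  proof -
    obtain u where u: "0 \<le> u" "u \<le> 1" "z = (1 - u) *\<^sub>R (-1) + u *\<^sub>R 1" using zs unfolding closed_segment_def by blast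
    then have "Re z = 2 * u - 1" "Im z = 0" by simp_all
    then show ?thesis using u by (simp add: abs_le_iff)
  qed
  ultimately show ?thesis by blast
qed

lemma leftray_polar:
  assumes "cos p < 0"
  shows "leftray (- tan p) \<inter> ball (-1) \<epsilon> = {-1 + of_real r * cis p | r. 0 \<le> r \<and> r < \<epsilon>}"
proof (intro set_eqI iffI)
  fix z assume z: "z \<in> leftray (- tan p) \<inter> ball (-1) \<epsilon>"
  define r where "r = (-1 - Re z) / (- cos p)"
  have r: "0 \<le> r" using z assms unfolding r_def by (intro divide_nonneg_pos) (auto simp: leftray_def)
  have "r * cos p = Re z + 1" using assms by (simp add: r_def field_simps)
  moreover have "r * sin p = Im z" using z assms by (simp add: r_def leftray_def tan_def field_simps)
  ultimately have eq: "z = -1 + of_real r * cis p" by (simp add: complex_eq_iff)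
  have "dist (-1) z < \<epsilon>" using z by simp
  then have "r < \<epsilon>" using eq r dist_of_real_cis[of "-1" r p] by simp
  then show "z \<in> {-1 + of_real r * cis p | r. 0 \<le> r \<and> r < \<epsilon>}" using eq r by blast
next
  fix z assume "z \<in> {-1 + of_real r * cis p | r. 0 \<le> r \<and> r < \<epsilon>}"
  then obtain r where r: "z = -1 + of_real r * cis p" "0 \<le> r" "r < \<epsilon>" by blast
  have "r * cos p \<le> 0" using r(2) assms by (simp add: mult_nonneg_nonpos)
  then have "z \<in> leftray (- tan p)" using assms r(1) by (simp add: leftray_def tan_def)
  moreover have "z \<in> ball (-1) \<epsilon>" using r dist_of_real_cis[of "-1" r p] by simp
  ultimately show "z \<in> leftray (- tan p) \<inter> ball (-1) \<epsilon>" by blast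
qed

text \<open>A negative cosine confines the angles to the interval from \<open>pi / 2\<close> to
  \<open>3 * pi / 2\<close>, which is one branch of the tangent.\<close>

lemma tan_mono_left:
  assumes "0 < p" "p < q" "q < 2 * pi" "cos p < 0" "cos q < 0" shows "tan p < tan q"
proof -
  have *: "pi / 2 < x \<and> x < 3 * pi / 2" if x: "0 < x" "x < 2 * pi" "cos x < 0" for x
  proof (rule ccontr)
    assume "\<not> ?thesis"
    then consider "x \<le> pi / 2" | "3 * pi / 2 \<le> x" by linarith
    then show False
    proof cases
      case 1 then show False using cos_ge_zero[of x] x by simp
    next
      case 2
      have "cos (x - 2 * pi) \<ge> 0" using 2 x by (intro cos_ge_zero) auto
      then show False using x cos_periodic[of "x - 2 * pi"] by simp
    qed
  qed
  have "tan (p - pi) < tan (q - pi)"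
    using *[of p] *[of q] assms by (intro tan_monotone) auto
  then show ?thesis using tan_periodic_pi[of "p - pi"] tan_periodic_pi[of "q - pi"] by simp
qed

text \<open>The cyclic order at \<open>-1\<close> is cut open at the edge and listed
  counterclockwise from there. As the remaining rays point to the left, their slopes are given by
  the tangent and decrease along this list.\<close>

lemma left_fan:
  assumes D: "polygonal_diagram n D" and v: "-1 \<in> verts D" and n: "n \<ge> 1"
    and e: "(c0, closed_segment (-1) 1) \<in> edges D" and lg: "leftgoing D"
  obtains \<epsilon> a where "0 < \<epsilon>" "\<epsilon> \<le> 1" "strict_mono_on {..<2 * n - 1} a"
    "\<And>c. strands D c \<inter> ball (-1) \<epsilon> = (axis c0 c \<union> fan n c0 (\<lambda>k. leftray (a k)) c) \<inter> ball (-1) \<epsilon>"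
proof -
  obtain \<epsilon>0 \<theta> where s0: "star n D (-1) \<epsilon>0 \<theta>"
    using polygonal_diagramD(9)[OF D v] alternating_at_star by blast
  obtain \<epsilon>1 where e1: "\<epsilon>1 > 0" "\<And>c z. z \<in> strands D c \<inter> ball (-1) \<epsilon>1 \<Longrightarrow> Re z < -1 \<or> (Im z = 0 \<and> Re z \<ge> -1)"
    using lg unfolding leftgoing_def by blast
  define \<epsilon> where "\<epsilon> = min \<epsilon>0 (min \<epsilon>1 1)"
  have ep: "0 < \<epsilon>" "\<epsilon> \<le> \<epsilon>0" "\<epsilon> \<le> \<epsilon>1" "\<epsilon> \<le> 1" using star_pos[OF s0] e1(1) by (auto simp: \<epsilon>_def)
  have s: "star n D (-1) \<epsilon> \<theta>" using star_shrink[OF s0 ep(1,2)] .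
  \<comment> \<open>A point of the edge close to \<open>-1\<close> lies on some ray \<open>j\<close>
    of the star, which identifies the edge among the rays.\<close>
  have "closed_segment (-1) 1 \<subseteq> strands D c0" using e unfolding strands_def by blast
  moreover have "Complex (-1 + \<epsilon>/2) 0 \<in> closed_segment (-1) 1" unfolding axis_eq using ep by (simp add: abs_le_iff)
  ultimately have "Complex (-1 + \<epsilon>/2) 0 \<in> strands D c0" by blast
  moreover have "Complex (-1 + \<epsilon>/2) 0 = -1 + of_real (\<epsilon>/2) * cis 0" by (simp add: complex_eq_iff)
  ultimately have "-1 + of_real (\<epsilon>/2) * cis 0 \<in> strands D c0" by metis
  then have "-1 + of_real (\<epsilon>/2) * cis 0 \<in> strands D c0 \<inter> ball (-1) \<epsilon>" using ep by (simp add: dist_norm)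
  then obtain r j where j: "-1 + of_real (\<epsilon>/2) * cis 0 = -1 + of_real r * cis (\<theta> j)" "0 \<le> r" "j < 2 * n" "even j \<longleftrightarrow> c0 = G1"
    unfolding star_eq[OF s] by blast
  have j1: "cis (\<theta> j) = 1"
  proof -
    have eq: "of_real (\<epsilon>/2) = of_real r * cis (\<theta> j)" using j(1) by simp
    then have "cmod (of_real (\<epsilon>/2)) = cmod (of_real r * cis (\<theta> j))" by (rule arg_cong)
    then have "\<epsilon>/2 = r" using j(2) ep(1) by (simp add: norm_mult)
    then show ?thesis using eq ep(1) by simp
  qed
  \<comment> \<open>\<open>idx i\<close> is \<open>j + 1 + i\<close> modulo \<open>2 * n\<close>,
    and \<open>p i\<close> is the angle of that ray counted from the edge, between \<open>0\<close>
    and \<open>2 * pi\<close>. Wrapping around respects parities, since \<open>2 * n\<close> is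
    even.\<close>
  define idx where "idx i = (if j + 1 + i < 2 * n then j + 1 + i else j + 1 + i - 2 * n)" for i
  define p where "p i = (if j + 1 + i < 2 * n then \<theta> (j + 1 + i) - \<theta> j else \<theta> (j + 1 + i - 2 * n) + 2 * pi - \<theta> j)" for i
  have cisp: "cis (p i) = cis (\<theta> (idx i))" for i
    using j1 by (auto simp: p_def idx_def simp flip: cis_divide cis_mult)
  have idx: "idx i < 2 * n" "even (idx i) \<longleftrightarrow> (if even i then odd j else even j)" if "i < 2 * n - 1" for i
    using that j(3) by (auto simp: idx_def)
  have idx_onto: "\<exists>i<2 * n - 1. k = idx i" if "k < 2 * n" "k \<noteq> j" for k
  proof (cases "j < k")
    case True then show ?thesis using that by (intro exI[of _ "k - j - 1"]) (auto simp: idx_def)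
  next
    case False then show ?thesis using that j(3) by (intro exI[of _ "k + 2 * n - j - 1"]) (auto simp: idx_def)
  qed
  have pmono: "p i < p i'" if i: "i < i'" "i' < 2 * n - 1" for i i'
  proof -
    consider "j + 1 + i' < 2 * n" | "j + 1 + i < 2 * n" "\<not> j + 1 + i' < 2 * n" | "\<not> j + 1 + i < 2 * n" using i by linarith
    then show ?thesis
    proof cases
      case 1 then show ?thesis using star_mono[OF s, of "j + 1 + i" "j + 1 + i'"] i by (simp add: p_def)
    next
      case 2 then show ?thesis using star_mono[OF s, of "j + 1 + i' - 2 * n" "j + 1 + i"] i j(3) by (simp add: p_def)
    next
      case 3 then show ?thesis using star_mono[OF s, of "j + 1 + i - 2 * n" "j + 1 + i' - 2 * n"] i j(3) by (simp add: p_def)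
    qed
  qed
  have prange: "0 < p i" "p i < 2 * pi" if i: "i < 2 * n - 1" for i
  proof -
    have "0 < p i \<and> p i < 2 * pi"
    proof (cases "j + 1 + i < 2 * n")
      case True then show ?thesis using star_mono[OF s, of j "j + 1 + i"] by (simp add: p_def)
    next
      case False then show ?thesis using star_mono[OF s, of "j + 1 + i - 2 * n" j] i j(3) by (simp add: p_def)
    qed
    then show "0 < p i" "p i < 2 * pi" by auto
  qed
  have pcos: "cos (p i) < 0" if i: "i < 2 * n - 1" for i
  proof -
    define c where "c = (if even (idx i) then G1 else G2)"
    have "-1 + of_real (\<epsilon>/2) * cis (\<theta> (idx i)) \<in> strands D c \<inter> ball (-1) \<epsilon>"
      unfolding star_eq[OF s] using ep idx(1)[OF i]
      by (intro CollectI exI[of _ "\<epsilon>/2"] exI[of _ "idx i"]) (auto simp: c_def)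
    then have "-1 + of_real (\<epsilon>/2) * cis (p i) \<in> strands D c \<inter> ball (-1) \<epsilon>1"
      using ep(3) cisp by auto
    then have or: "Re (-1 + of_real (\<epsilon>/2) * cis (p i)) < -1 \<or>
        Im (-1 + of_real (\<epsilon>/2) * cis (p i)) = 0 \<and> Re (-1 + of_real (\<epsilon>/2) * cis (p i)) \<ge> -1"
      by (rule e1(2))
    \<comment> \<open>The only direction allowed by \<open>leftgoing\<close> that does not point to
      the left is that of the edge, and \<open>0 < p i < 2 * pi\<close> excludes it.\<close>
    show ?thesis
    proof (rule ccontr)
      assume "\<not> cos (p i) < 0"
      then have c0: "cos (p i) \<ge> 0" by simp
      then have "\<epsilon> * cos (p i) \<ge> 0" using ep by simp
      then have "sin (p i) = 0" using or ep by auto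
      moreover then have "cos (p i) = 1 \<or> cos (p i) = -1" using sin_zero_abs_cos_one by fastforce
      ultimately have "cis (p i) = cis 0" using c0 by (auto simp: complex_eq_iff)
      then show False using cis_eqD[of "p i" 0] prange[OF i] by auto
    qed
  qed
  \<comment> \<open>Reversing the list makes the slopes increase; \<open>2 * n - 2 - k\<close> has
    the parity of \<open>k\<close>, so the coloring is unaffected.\<close>
  define a where "a k = - tan (p (2 * n - 2 - k))" for k
  have am: "strict_mono_on {..<2 * n - 1} a"
  proof (rule strict_mono_onI)
    fix k l assume kl: "k \<in> {..<2 * n - 1}" "l \<in> {..<2 * n - 1}" "k < l"
    have "tan (p (2 * n - 2 - l)) < tan (p (2 * n - 2 - k))"
      using kl n by (intro tan_mono_left prange pcos pmono) auto
    then show "a k < a l" by (simp add: a_def)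
  qed
  have main: "strands D c \<inter> ball (-1) \<epsilon> = (axis c0 c \<union> fan n c0 (\<lambda>k. leftray (a k)) c) \<inter> ball (-1) \<epsilon>" for c
  proof -
    have raya: "leftray (a k) \<inter> ball (-1) \<epsilon> = {-1 + of_real r * cis (\<theta> (idx (2 * n - 2 - k))) | r. 0 \<le> r \<and> r < \<epsilon>}"
      if "k < 2 * n - 1" for k
      unfolding a_def cisp[symmetric] using that by (intro leftray_polar pcos) auto
    have axisa: "closed_segment (-1) 1 \<inter> ball (-1) \<epsilon> = {-1 + of_real r * cis (\<theta> j) | r. 0 \<le> r \<and> r < \<epsilon>}"
    proof (intro set_eqI iffI)
      fix z :: complex assume z: "z \<in> closed_segment (-1) 1 \<inter> ball (-1) \<epsilon>"
      then have "z = -1 + of_real (1 + Re z) * cis (\<theta> j)" "0 \<le> 1 + Re z"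
        unfolding axis_eq using j1 by (auto simp: complex_eq_iff)
      moreover then have "1 + Re z < \<epsilon>" using z dist_of_real_cis[of "-1" "1 + Re z" "\<theta> j"] by simp
      ultimately show "z \<in> {-1 + of_real r * cis (\<theta> j) | r. 0 \<le> r \<and> r < \<epsilon>}" by blast
    next
      fix z assume "z \<in> {-1 + of_real r * cis (\<theta> j) | r. 0 \<le> r \<and> r < \<epsilon>}"
      then obtain r where r: "z = -1 + of_real r" "0 \<le> r" "r < \<epsilon>" using j1 by auto
      then show "z \<in> closed_segment (-1) 1 \<inter> ball (-1) \<epsilon>"
        unfolding axis_eq using ep(4) by (auto simp: dist_norm)
    qed
    have c0c: "fan_color c0 k = c \<longleftrightarrow> (even (idx (2 * n - 2 - k)) \<longleftrightarrow> c = G1)" if k: "k < 2 * n - 1" for k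
    proof -
      have "even (2 * n - 2 - k) \<longleftrightarrow> even k" using k by auto
      then have "even (idx (2 * n - 2 - k)) \<longleftrightarrow> (if even k then odd j else even j)" using idx(2)[of "2 * n - 2 - k"] k by auto
      then show ?thesis using j(4) by (cases c; cases c0) (auto simp: fan_color_def)
    qed
    have "strands D c \<inter> ball (-1) \<epsilon> = (\<Union>k\<in>{k. k < 2 * n \<and> (even k \<longleftrightarrow> c = G1)}. {-1 + of_real r * cis (\<theta> k) | r. 0 \<le> r \<and> r < \<epsilon>})"
      unfolding star_eq[OF s] by blast
    also have "\<dots> = (if c = c0 then {-1 + of_real r * cis (\<theta> j) | r. 0 \<le> r \<and> r < \<epsilon>} else {}) \<union>
        (\<Union>k\<in>{k. k < 2 * n - 1 \<and> fan_color c0 k = c}. {-1 + of_real r * cis (\<theta> (idx (2 * n - 2 - k))) | r. 0 \<le> r \<and> r < \<epsilon>})"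
      (is "?L = ?R")
    proof
      show "?L \<subseteq> ?R"
      proof
        fix z assume "z \<in> ?L"
        then obtain k r where k: "k < 2 * n" "even k \<longleftrightarrow> c = G1" "z = -1 + of_real r * cis (\<theta> k)" "0 \<le> r" "r < \<epsilon>" by blast
        show "z \<in> ?R"
        proof (cases "k = j")
          case True
          then have "c = c0" using k(2) j(4) by (cases c; cases c0) auto
          then show ?thesis using k True by auto
        next
          case False
          then obtain i where i: "i < 2 * n - 1" "k = idx i" using idx_onto k(1) by blast
          define l where "l = 2 * n - 2 - i"
          have l: "l < 2 * n - 1" "i = 2 * n - 2 - l" using i(1) by (auto simp: l_def)
          then have "fan_color c0 l = c" using c0c[OF l(1)] k(2) i(2) by simp
          then show ?thesis using k l i(2) by blast
        qed
      qed
      show "?R \<subseteq> ?L"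
      proof
        fix z assume "z \<in> ?R"
        then consider r where "c = c0" "z = -1 + of_real r * cis (\<theta> j)" "0 \<le> r" "r < \<epsilon>"
          | k r where "k < 2 * n - 1" "fan_color c0 k = c" "z = -1 + of_real r * cis (\<theta> (idx (2 * n - 2 - k)))" "0 \<le> r" "r < \<epsilon>"
          by (auto split: if_splits)
        then show "z \<in> ?L"
        proof cases
          case 1 then show ?thesis using j(3,4) by blast
        next
          case 2
          moreover have "idx (2 * n - 2 - k) < 2 * n" using idx(1)[of "2 * n - 2 - k"] 2(1) by auto
          ultimately show ?thesis using c0c[OF 2(1)] by blast
        qed
      qed
    qed
    also have "\<dots> = (axis c0 c \<union> fan n c0 (\<lambda>k. leftray (a k)) c) \<inter> ball (-1) \<epsilon>"
    proof -
      let ?K = "{k. k < 2 * n - 1 \<and> fan_color c0 k = c}"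
      have "fan n c0 (\<lambda>k. leftray (a k)) c \<inter> ball (-1) \<epsilon> = (\<Union>k\<in>?K. leftray (a k) \<inter> ball (-1) \<epsilon>)"
        unfolding fan_def by blast
      also have "\<dots> = (\<Union>k\<in>?K. {-1 + of_real r * cis (\<theta> (idx (2 * n - 2 - k))) | r. 0 \<le> r \<and> r < \<epsilon>})"
        by (intro SUP_cong refl raya) simp
      finally have f: "fan n c0 (\<lambda>k. leftray (a k)) c \<inter> ball (-1) \<epsilon> = \<dots>" .
      have "axis c0 c \<inter> ball (-1) \<epsilon> = (if c = c0 then {-1 + of_real r * cis (\<theta> j) | r. 0 \<le> r \<and> r < \<epsilon>} else {})"
        unfolding axis_def using axisa by simp
      then show ?thesis unfolding Int_Un_distrib2 f by simp
    qed
    finally show ?thesis .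
  qed
  show ?thesis by (rule that[OF ep(1,4) am main])
qed

section \<open>Diagrams that are known near the straight edge\<close>

definition two_fans :: "nat \<Rightarrow> gen \<Rightarrow> (nat \<Rightarrow> real) \<Rightarrow> (nat \<Rightarrow> real) \<Rightarrow> gen \<Rightarrow> complex set" where
  "two_fans n c0 a a' c = axis c0 c \<union> fan n c0 (\<lambda>k. leftray (a k)) c \<union> fan n c0 (\<lambda>k. rightray (a' k)) c"

text \<open>The neighbourhood \<open>U\<close> surrounds the whole edge and not just its ends, since
  the disc of the later cancellation encloses the edge and must contain no strand besides the known
  ones.\<close>

definition fan_state :: "nat \<Rightarrow> gen \<Rightarrow> diagram \<Rightarrow> (nat \<Rightarrow> real) \<Rightarrow> (nat \<Rightarrow> real) \<Rightarrow> complex set \<Rightarrow> bool" where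
  "fan_state n c0 D a a' U \<longleftrightarrow> polygonal_diagram n D \<and> open U \<and> closed_segment (-1) 1 \<subseteq> U \<and>
     verts D \<inter> U = {-1, 1} \<and> (\<forall>c. strands D c \<inter> U = two_fans n c0 a a' c \<inter> U) \<and>
     strict_mono_on {..<2 * n - 1} a \<and> strict_mono_on {..<2 * n - 1} a'"

lemma plane_homeo_uminus: "plane_homeo (\<lambda>z. - z)" and pw_affine_uminus: "pw_affine (\<lambda>z. - z :: complex)"
  using plane_homeo_affine[of "-1" 0] pw_affine_minus[OF pw_affine_id] by simp_all

lemma uminus_segment: "(\<lambda>z. - z) ` closed_segment (-1) (1::complex) = closed_segment (-1) 1"
proof -
  have "(\<lambda>z. - z) ` X = {z. - z \<in> X}" for X :: "complex set" by force
  then show ?thesis by (simp add: axis_eq)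
qed

text \<open>The half-turn exchanges the two families of rays and changes the sign of the slopes, so
  their order is reversed; \<open>2 * n - 2 - k\<close> has the parity of \<open>k\<close>, which
  preserves the colors.\<close>

lemma fan_reflect:
  assumes n: "n \<ge> 1"
  shows "- z \<in> axis c0 c \<union> fan n c0 (\<lambda>k. leftray (b k)) c \<longleftrightarrow>
     z \<in> axis c0 c \<union> fan n c0 (\<lambda>k. rightray (- b (2 * n - 2 - k))) c"
proof -
  have r: "- z \<in> leftray t \<longleftrightarrow> z \<in> rightray (- t)" for t
    by (auto simp: leftray_def rightray_def algebra_simps)
  have fc: "fan_color c0 (2 * n - 2 - k) = fan_color c0 k" if "k < 2 * n - 1" for k
    using that by (auto simp: fan_color_def)
  have "- z \<in> fan n c0 (\<lambda>k. leftray (b k)) c \<longleftrightarrow> z \<in> fan n c0 (\<lambda>k. rightray (- b (2 * n - 2 - k))) c"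
  proof
    assume "- z \<in> fan n c0 (\<lambda>k. leftray (b k)) c"
    then obtain k where k: "k < 2 * n - 1" "fan_color c0 k = c" "z \<in> rightray (- b k)" using r by (auto simp: fan_def)
    define l where "l = 2 * n - 2 - k"
    have "l < 2 * n - 1" "2 * n - 2 - l = k" "fan_color c0 l = c" using k fc[of k] by (auto simp: l_def)
    then show "z \<in> fan n c0 (\<lambda>k. rightray (- b (2 * n - 2 - k))) c" using k(3) unfolding fan_def by blast
  next
    assume "z \<in> fan n c0 (\<lambda>k. rightray (- b (2 * n - 2 - k))) c"
    then obtain k where k: "k < 2 * n - 1" "fan_color c0 k = c" "z \<in> rightray (- b (2 * n - 2 - k))" by (auto simp: fan_def)
    define l where "l = 2 * n - 2 - k"
    have "l < 2 * n - 1" "fan_color c0 l = c" using k fc[of k] n by (auto simp: l_def)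
    then show "- z \<in> fan n c0 (\<lambda>k. leftray (b k)) c" using k(3) r unfolding fan_def l_def by blast
  qed
  moreover have "- z \<in> axis c0 c \<longleftrightarrow> z \<in> axis c0 c" by (simp add: axis_def axis_eq)
  ultimately show ?thesis by blast
qed

lemma fan_side:
  "z \<in> fan n c0 (\<lambda>k. leftray (a k)) c \<Longrightarrow> Re z \<le> -1"
  "z \<in> fan n c0 (\<lambda>k. rightray (a k)) c \<Longrightarrow> Re z \<ge> 1"
  by (auto simp: fan_def leftray_def rightray_def)

text \<open>The right end is treated by applying \<open>left_fan\<close> to the diagram turned by
  \<open>z \<mapsto> - z\<close>, with which \<open>push\<close> commutes. Between the ends a
  neighbourhood is obtained by removing the rest of the diagram, a closed set.\<close>

lemma initial_state:
  assumes D: "polygonal_diagram n D" and n: "n \<ge> 1" and v: "-1 \<in> verts D" "1 \<in> verts D"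
    and e: "(c0, closed_segment (-1) 1) \<in> edges D"
  shows "\<exists>f a a' U. plane_homeo f \<and> fan_state n c0 (map_diagram f D) a a' U"
proof -
  let ?m = "\<lambda>z::complex. - z"
  let ?e = "closed_segment (-1) (1::complex)"
  have Dm: "polygonal_diagram n (map_diagram ?m D)" by (intro polygonal_map plane_homeo_uminus pw_affine_uminus D)
  have vm: "-1 \<in> verts (map_diagram ?m D)" using v(2) by simp
  obtain M1 M2 where M12: "M1 \<ge> 0" "M2 \<ge> 0" "\<And>M. M \<ge> M1 \<Longrightarrow> leftgoing (map_diagram (push M) D)"
    "\<And>M. M \<ge> M2 \<Longrightarrow> leftgoing (map_diagram (push M) (map_diagram ?m D))"
    using push_leftgoing[OF D v(1)] push_leftgoing[OF Dm vm] by blast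
  define M where "M = max M1 M2"
  have M: "M \<ge> 0" "leftgoing (map_diagram (push M) D)" "leftgoing (map_diagram (push M) (map_diagram ?m D))"
    using M12 by (simp_all add: M_def)
  have ph: "plane_homeo (push M)" by (rule push_homeo[OF M(1)])
  define D1 where "D1 = map_diagram (push M) D"
  have D1: "polygonal_diagram n D1" unfolding D1_def by (intro polygonal_map ph push_pw_affine D)
  have pe: "push M ` ?e = ?e"
  proof -
    have "push M ` ?e = (\<lambda>z. z) ` ?e" by (intro image_cong refl push_real) (auto simp: axis_eq)
    then show ?thesis by simp
  qed
  have e1: "(c0, ?e) \<in> edges D1" using edges_map[OF e, of "push M"] pe by (simp add: D1_def)
  have v1: "-1 \<in> verts D1" "1 \<in> verts D1"
    using imageI[OF v(1), of "push M"] imageI[OF v(2), of "push M"] push_real[of "-1" M] push_real[of 1 M]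
    by (simp_all add: D1_def)
  define D2 where "D2 = map_diagram ?m D1"
  have D2: "polygonal_diagram n D2" unfolding D2_def by (intro polygonal_map plane_homeo_uminus pw_affine_uminus D1)
  have D2eq: "D2 = map_diagram (push M) (map_diagram ?m D)"
    unfolding D2_def D1_def map_diagram_comp by (rule map_diagram_cong) (simp add: push_neg)
  have e2: "(c0, ?e) \<in> edges D2" using edges_map[OF e1, of ?m] uminus_segment by (simp add: D2_def)
  have v2: "-1 \<in> verts D2" using v1(2) by (simp add: D2_def)
  obtain \<epsilon>1 a where f1: "0 < \<epsilon>1" "\<epsilon>1 \<le> 1" "strict_mono_on {..<2 * n - 1} a"
    "\<And>c. strands D1 c \<inter> ball (-1) \<epsilon>1 = (axis c0 c \<union> fan n c0 (\<lambda>k. leftray (a k)) c) \<inter> ball (-1) \<epsilon>1"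
    using left_fan[OF D1 v1(1) n e1] M(2) D1_def by metis
  obtain \<epsilon>2 b where f2: "0 < \<epsilon>2" "\<epsilon>2 \<le> 1" "strict_mono_on {..<2 * n - 1} b"
    "\<And>c. strands D2 c \<inter> ball (-1) \<epsilon>2 = (axis c0 c \<union> fan n c0 (\<lambda>k. leftray (b k)) c) \<inter> ball (-1) \<epsilon>2"
    using left_fan[OF D2 v2 n e2] M(3) D2eq by metis
  define a' where "a' k = - b (2 * n - 2 - k)" for k
  have a': "strict_mono_on {..<2 * n - 1} a'"
  proof (rule strict_mono_onI)
    fix k l assume "k \<in> {..<2 * n - 1}" "l \<in> {..<2 * n - 1}" "k < l"
    then have "b (2 * n - 2 - l) < b (2 * n - 2 - k)" by (intro strict_mono_onD[OF f2(3)]) auto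
    then show "a' k < a' l" by (simp add: a'_def)
  qed
  have f2': "z \<in> strands D1 c \<longleftrightarrow> z \<in> axis c0 c \<union> fan n c0 (\<lambda>k. rightray (a' k)) c" if "z \<in> ball 1 \<epsilon>2" for z c
  proof -
    have "- z \<in> ball (-1) \<epsilon>2" using that by (simp add: dist_minus[of "1" z, simplified])
    moreover have "z \<in> strands D1 c \<longleftrightarrow> - z \<in> strands D2 c" by (auto simp: D2_def strands_map)
    ultimately have "z \<in> strands D1 c \<longleftrightarrow> - z \<in> axis c0 c \<union> fan n c0 (\<lambda>k. leftray (b k)) c" using f2(4)[of c] by blast
    then show ?thesis using fan_reflect[OF n] unfolding a'_def by simp
  qed
  note d = polygonal_diagramD[OF D1]
  obtain d1 where d1: "d1 > 0" "\<And>x. x \<in> verts D1 \<Longrightarrow> x \<noteq> -1 \<Longrightarrow> d1 \<le> dist (-1) x"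
    using finite_set_avoid[OF d(1), of "-1"] by metis
  obtain d2 where d2: "d2 > 0" "\<And>x. x \<in> verts D1 \<Longrightarrow> x \<noteq> 1 \<Longrightarrow> d2 \<le> dist 1 x"
    using finite_set_avoid[OF d(1), of 1] by metis
  \<comment> \<open>Radii at most \<open>1\<close> keep the two balls on different sides of the
    imaginary axis, so each of them sees only its own fan.\<close>
  define B1 where "B1 = ball (-1::complex) (min \<epsilon>1 d1)"
  define B2 where "B2 = ball (1::complex) (min \<epsilon>2 d2)"
  have B1: "open B1" "-1 \<in> B1" "verts D1 \<inter> B1 \<subseteq> {-1}" "B1 \<subseteq> ball (-1) \<epsilon>1" "\<And>z. z \<in> B1 \<Longrightarrow> Re z < 0"
  proof -
    show "verts D1 \<inter> B1 \<subseteq> {-1}" using d1(2) by (force simp: B1_def)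
    show "Re z < 0" if "z \<in> B1" for z
    proof -
      have "cmod (z - (-1)) < 1" using that f1(2) by (simp add: B1_def dist_norm norm_minus_commute)
      then show ?thesis using complex_Re_le_cmod[of "z - (-1)"] by simp
    qed
  qed (use f1(1) d1(1) in \<open>auto simp: B1_def\<close>)
  have B2: "open B2" "1 \<in> B2" "verts D1 \<inter> B2 \<subseteq> {1}" "B2 \<subseteq> ball 1 \<epsilon>2" "\<And>z. z \<in> B2 \<Longrightarrow> Re z > 0"
  proof -
    show "verts D1 \<inter> B2 \<subseteq> {1}" using d2(2) by (force simp: B2_def)
    show "Re z > 0" if "z \<in> B2" for z
    proof -
      have "cmod (1 - z) < 1" using that f2(2) by (simp add: B2_def dist_norm)
      then show ?thesis using complex_Re_le_cmod[of "1 - z"] by simp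
    qed
  qed (use f2(1) d2(1) in \<open>auto simp: B2_def\<close>)
  \<comment> \<open>Everything except the edge: a closed set that meets the edge only in vertices,
    hence at most in \<open>-1\<close> and \<open>1\<close>.\<close>
  define R where "R = \<Union>(snd ` (edges D1 \<union> circles D1 - {(c0, ?e)}))"
  have cR: "closed R"
  proof -
    have "closed (snd x)" if "x \<in> edges D1 \<union> circles D1" for x
      using that d(5,7) polygonal_closed by (cases x) auto
    then show ?thesis unfolding R_def using d(2,3) by (intro closed_Union) auto
  qed
  have Re': "R \<inter> ?e \<subseteq> verts D1" unfolding R_def using d(8)[of _ "(c0, ?e)"] e1 by fastforce
  have Ve: "verts D1 \<inter> ?e = {-1, 1}"
  proof -
    obtain g where "?e \<inter> verts D1 = {pathstart g, pathfinish g}" using d(4)[OF e1] is_edgeE by metis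
    moreover have "-1 \<in> ?e \<inter> verts D1" "1 \<in> ?e \<inter> verts D1" using v1 by auto
    ultimately have "?e \<inter> verts D1 = {-1, 1}" by (metis doubleton_eq_iff insertE one_neq_neg_one singletonD)
    then show ?thesis by (simp add: Int_commute)
  qed
  define U3 where "U3 = {z. -1 < Re z \<and> Re z < 1} \<inter> - R \<inter> - verts D1"
  have oU3: "open U3" unfolding U3_def
    using cR finite_imp_closed[OF d(1)] open_Collect_conj[OF open_halfspace_Re_gt[of "-1"] open_halfspace_Re_lt[of 1]]
    by (intro open_Int open_Compl) auto
  define U where "U = B1 \<union> B2 \<union> U3"
  have "open U" unfolding U_def by (intro open_Un B1(1) B2(1) oU3)
  moreover have "?e \<subseteq> U"
  proof
    fix z :: complex assume z: "z \<in> ?e"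
    show "z \<in> U"
    proof (cases "z \<in> verts D1")
      case True
      then have "z \<in> {-1, 1}" using Ve z by blast
      then show ?thesis using B1(2) B2(2) by (auto simp: U_def)
    next
      case False
      then have "z \<noteq> -1" "z \<noteq> 1" "z \<notin> R" using v1 z Re' by auto
      then have "-1 < Re z" "Re z < 1" using z unfolding axis_eq by (auto simp: complex_eq_iff abs_le_iff)
      then show ?thesis using False \<open>z \<notin> R\<close> by (simp add: U_def U3_def)
    qed
  qed
  moreover have "verts D1 \<inter> U = {-1, 1}"
    using B1(2,3) B2(2,3) v1 by (auto simp: U_def U3_def)
  moreover have "strands D1 c \<inter> U = two_fans n c0 a a' c \<inter> U" for c
  proof -
    have 1: "z \<in> strands D1 c \<longleftrightarrow> z \<in> two_fans n c0 a a' c" if "z \<in> B1" for z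
      using f1(4)[of c] that B1(4,5) fan_side(2)[of z n c0 a' c] unfolding two_fans_def by force
    have 2: "z \<in> strands D1 c \<longleftrightarrow> z \<in> two_fans n c0 a a' c" if "z \<in> B2" for z
      using f2'[of z c] that B2(4,5) fan_side(1)[of z n c0 a c] unfolding two_fans_def by force
    have 3: "z \<in> strands D1 c \<longleftrightarrow> z \<in> two_fans n c0 a a' c" if z: "z \<in> U3" for z
    proof
      assume "z \<in> strands D1 c"
      then obtain A where A: "(c, A) \<in> edges D1 \<union> circles D1" "z \<in> A" unfolding strands_def by blast
      then have "(c, A) = (c0, ?e)" using z unfolding U3_def R_def by force
      then show "z \<in> two_fans n c0 a a' c" using A(2) by (simp add: two_fans_def axis_def)
    next
      assume "z \<in> two_fans n c0 a a' c"
      then have "z \<in> axis c0 c" using z fan_side[of z] unfolding two_fans_def U3_def by force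
      then show "z \<in> strands D1 c" using e1 unfolding axis_def strands_def by (auto split: if_splits)
    qed
    show ?thesis using 1 2 3 unfolding U_def by blast
  qed
  ultimately have "fan_state n c0 D1 a a' U" unfolding fan_state_def using D1 f1(3) a' by blast
  then show ?thesis using ph D1_def by blast
qed

text \<open>Only the union of the two image fans is compared with the new fans, so that a map
  exchanging left and right, such as a reflection, is covered.\<close>

lemma fan_state_map:
  assumes s: "fan_state n c0 D a a' U" and h: "plane_homeo h" "pw_affine h"
    and ax: "h ` closed_segment (-1) 1 = closed_segment (-1) 1" "h ` {-1, 1} = {-1, 1}"
    and l: "\<And>k. k < 2 * n - 1 \<Longrightarrow> h ` leftray (a k) = L k"
    and r: "\<And>k. k < 2 * n - 1 \<Longrightarrow> h ` rightray (a' k) = R k"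
    and LR: "\<And>c. fan n c0 L c \<union> fan n c0 R c = fan n c0 (\<lambda>k. leftray (b k)) c \<union> fan n c0 (\<lambda>k. rightray (b' k)) c"
    and m: "strict_mono_on {..<2 * n - 1} b" "strict_mono_on {..<2 * n - 1} b'"
  shows "fan_state n c0 (map_diagram h D) b b' (h ` U)"
proof -
  have inj: "inj h" using bij_is_inj[OF plane_homeo_bij[OF h(1)]] .
  have s': "polygonal_diagram n D" "open U" "closed_segment (-1) 1 \<subseteq> U" "verts D \<inter> U = {-1, 1}"
    "\<And>c. strands D c \<inter> U = two_fans n c0 a a' c \<inter> U" using s unfolding fan_state_def by blast+
  have "h ` two_fans n c0 a a' c = two_fans n c0 b b' c" for c
  proof -
    have "h ` axis c0 c = axis c0 c" using ax(1) by (simp add: axis_def)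
    moreover have "h ` fan n c0 (\<lambda>k. leftray (a k)) c = fan n c0 L c"
      unfolding fan_def image_UN by (intro SUP_cong refl) (simp add: l)
    moreover have "h ` fan n c0 (\<lambda>k. rightray (a' k)) c = fan n c0 R c"
      unfolding fan_def image_UN by (intro SUP_cong refl) (simp add: r)
    ultimately show ?thesis using LR[of c] unfolding two_fans_def image_Un by (simp add: Un_assoc)
  qed
  then have "strands (map_diagram h D) c \<inter> h ` U = two_fans n c0 b b' c \<inter> h ` U" for c
    using s'(5)[of c] unfolding strands_map by (metis image_Int[OF inj])
  moreover have "verts (map_diagram h D) \<inter> h ` U = {-1, 1}"
    using s'(4) ax(2) by (metis image_Int[OF inj] verts_map)
  moreover have "closed_segment (-1) 1 \<subseteq> h ` U" using s'(3) ax(1) by (metis image_mono)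
  ultimately show ?thesis unfolding fan_state_def
    using m polygonal_map[OF h s'(1)] plane_homeo_open[OF h(1) s'(2)] by blast
qed

section \<open>Adjusting the slopes of a fan\<close>

lemma plane_homeo_vertical:
  assumes pw: "pw_affine \<phi>" and k: "\<kappa> < 1" and m: "\<And>z s. s \<ge> 0 \<Longrightarrow> \<phi> (z + s *\<^sub>R \<i>) \<ge> \<phi> z - \<kappa> * s"
  shows "plane_homeo (\<lambda>z. z + \<phi> z *\<^sub>R \<i>)" "pw_affine (\<lambda>z. z + \<phi> z *\<^sub>R \<i>)"
  by (rule plane_homeo_shift[OF pw_affine_continuous[OF pw] k m], assumption)
    (intro pw_affine_add pw_affine_id pw_affine_scaleR pw)

text \<open>Changing the height by a multiple of the horizontal distance from \<open>-1\<close>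
  affects nothing but the slope of a ray.\<close>

lemma vertical_leftray:
  assumes "\<And>z. z \<in> leftray a \<Longrightarrow> \<phi> z = (b - a) * (-1 - Re z)"
  shows "(\<lambda>z. z + \<phi> z *\<^sub>R \<i>) ` leftray a = leftray b"
proof
  show "(\<lambda>z. z + \<phi> z *\<^sub>R \<i>) ` leftray a \<subseteq> leftray b"
  proof
    fix w assume "w \<in> (\<lambda>z. z + \<phi> z *\<^sub>R \<i>) ` leftray a"
    then obtain z where z: "z \<in> leftray a" "w = z + \<phi> z *\<^sub>R \<i>" by blast
    then have "Re w = Re z" "Im w = Im z + (b - a) * (-1 - Re z)" using assms by simp_all
    then show "w \<in> leftray b" using z(1) by (simp add: leftray_def algebra_simps)
  qed
  show "leftray b \<subseteq> (\<lambda>z. z + \<phi> z *\<^sub>R \<i>) ` leftray a"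
  proof
    fix w assume w: "w \<in> leftray b"
    define z where "z = Complex (Re w) (a * (-1 - Re w))"
    have "z \<in> leftray a" using w by (simp add: z_def leftray_def)
    moreover have "w = z + \<phi> z *\<^sub>R \<i>" unfolding assms[OF \<open>z \<in> leftray a\<close>]
      using w by (simp add: complex_eq_iff z_def leftray_def algebra_simps)
    ultimately show "w \<in> (\<lambda>z. z + \<phi> z *\<^sub>R \<i>) ` leftray a" by blast
  qed
qed

lemma vertical_id:
  assumes "\<And>z. z \<in> X \<Longrightarrow> \<phi> z = 0"
  shows "(\<lambda>z. z + \<phi> z *\<^sub>R \<i>) ` X = X"
proof -
  have "(\<lambda>z. z + \<phi> z *\<^sub>R \<i>) ` X = (\<lambda>z. z) ` X" using assms by (intro image_cong) auto
  then show ?thesis by simp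
qed

lemma vertical_state:
  assumes s: "fan_state n c0 D a a' U" and pw: "pw_affine \<phi>" and k: "\<kappa> < 1"
    and m: "\<And>z s. s \<ge> 0 \<Longrightarrow> \<phi> (z + s *\<^sub>R \<i>) \<ge> \<phi> z - \<kappa> * s"
    and ax: "\<And>z. z \<in> closed_segment (-1) 1 \<Longrightarrow> \<phi> z = 0"
    and l: "\<And>k z. k < 2 * n - 1 \<Longrightarrow> z \<in> leftray (a k) \<Longrightarrow> \<phi> z = (b k - a k) * (-1 - Re z)"
    and r: "\<And>k z. k < 2 * n - 1 \<Longrightarrow> z \<in> rightray (a' k) \<Longrightarrow> \<phi> z = 0"
    and b: "strict_mono_on {..<2 * n - 1} b"
  shows "\<exists>f U'. plane_homeo f \<and> fan_state n c0 (map_diagram f D) b a' U'"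
proof -
  let ?h = "\<lambda>z. z + \<phi> z *\<^sub>R \<i>"
  have h: "plane_homeo ?h" "pw_affine ?h" using plane_homeo_vertical[OF pw k m] by blast+
  have "fan_state n c0 (map_diagram ?h D) b a' (?h ` U)"
  proof (rule fan_state_map[OF s h])
    show "?h ` closed_segment (-1) 1 = closed_segment (-1) 1" by (rule vertical_id[OF ax])
    show "?h ` {-1, 1} = {-1, 1}" by (rule vertical_id) (use ax in auto)
    show "?h ` leftray (a k) = leftray (b k)" if "k < 2 * n - 1" for k by (rule vertical_leftray[OF l[OF that]])
    show "?h ` rightray (a' k) = rightray (a' k)" if "k < 2 * n - 1" for k by (rule vertical_id[OF r[OF that]])
    show "strict_mono_on {..<2 * n - 1} a'" using s unfolding fan_state_def by blast
  qed (use b in auto)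
  then show ?thesis using h(1) by blast
qed

lemma shear_state:
  assumes s: "fan_state n c0 D a a' U"
  shows "\<exists>f U'. plane_homeo f \<and> fan_state n c0 (map_diagram f D) (\<lambda>k. a k + t) a' U'"
proof (rule vertical_state[OF s, where \<phi> = "\<lambda>z. t * max 0 (-1 - Re z)" and \<kappa> = 0])
  show "pw_affine (\<lambda>z. t * max 0 (-1 - Re z))"
    by (intro pw_affine_mult pw_affine_max pw_affine_const pw_affine_diff pw_affine_Re)
  show "strict_mono_on {..<2 * n - 1} (\<lambda>k. a k + t)"
    using s unfolding fan_state_def by (auto simp: strict_mono_on_def)
qed (auto simp: leftray_def rightray_def axis_eq abs_le_iff)

text \<open>Slopes up to \<open>c\<close> are kept and the excess over \<open>c\<close> is
  multiplied by \<open>\<alpha>\<close>: the region above the ray of slope \<open>c\<close> is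
  stretched vertically. To the right of \<open>-1\<close> this region starts above a line so steep
  that the edge and the right fan lie on or below it.\<close>

lemma stretch_state:
  assumes s: "fan_state n c0 D a a' U" and \<alpha>: "\<alpha> > 0"
  shows "\<exists>f U'. plane_homeo f \<and> fan_state n c0 (map_diagram f D) (\<lambda>k. a k + (\<alpha> - 1) * max 0 (a k - c)) a' U'"
proof -
  \<comment> \<open>At least as steep as every right ray and nonnegative; used as the slope of the
    dividing line through \<open>-1\<close>.\<close>
  define L where "L = (\<Sum>k<2 * n - 1. \<bar>a' k\<bar>)"
  have L: "L \<ge> 0" "a' k \<le> L" if "k < 2 * n - 1" for k
  proof -
    show "L \<ge> 0" unfolding L_def by (intro sum_nonneg) auto
    have "\<bar>a' k\<bar> \<le> L" unfolding L_def using that by (intro member_le_sum) auto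
    then show "a' k \<le> L" by linarith
  qed
  have L0: "L \<ge> 0" unfolding L_def by (intro sum_nonneg) auto
  let ?u = "\<lambda>z. Im z - c * max 0 (-1 - Re z) - L * max 0 (Re z + 1)"
  show ?thesis
  \<comment> \<open>For \<open>\<alpha> < 1\<close> the shift decreases upwards at rate at most
    \<open>1 - \<alpha>\<close>; for \<open>\<alpha> \<ge> 1\<close> it does not decrease.\<close>
  proof (rule vertical_state[OF s, where \<phi> = "\<lambda>z. (\<alpha> - 1) * max 0 (?u z)" and \<kappa> = "1 - min \<alpha> 1"])
    show "pw_affine (\<lambda>z. (\<alpha> - 1) * max 0 (?u z))"
      by (intro pw_affine_mult pw_affine_max pw_affine_const pw_affine_diff pw_affine_add pw_affine_Re pw_affine_Im)
    show "1 - min \<alpha> 1 < 1" using \<alpha> by simp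
    fix z :: complex and t :: real assume t: "t \<ge> 0"
    have u: "max 0 (?u (z + t *\<^sub>R \<i>)) \<ge> max 0 (?u z)" "max 0 (?u (z + t *\<^sub>R \<i>)) \<le> max 0 (?u z) + t" using t by auto
    show "(\<alpha> - 1) * max 0 (?u (z + t *\<^sub>R \<i>)) \<ge> (\<alpha> - 1) * max 0 (?u z) - (1 - min \<alpha> 1) * t"
    proof (cases "\<alpha> \<ge> 1")
      case True
      then have "(\<alpha> - 1) * max 0 (?u z) \<le> (\<alpha> - 1) * max 0 (?u (z + t *\<^sub>R \<i>))" by (intro mult_left_mono u(1)) simp
      then show ?thesis using True by simp
    next
      case False
      then have "(1 - \<alpha>) * max 0 (?u (z + t *\<^sub>R \<i>)) \<le> (1 - \<alpha>) * (max 0 (?u z) + t)" by (intro mult_left_mono u(2)) simp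
      then show ?thesis using False by (simp add: algebra_simps)
    qed
  next
    fix z :: complex assume "z \<in> closed_segment (-1) 1"
    then have "Im z = 0" "-1 - Re z \<le> 0" "Re z + 1 \<ge> 0" unfolding axis_eq by (auto simp: abs_le_iff)
    moreover then have "max 0 (-1 - Re z) = 0" "max 0 (Re z + 1) = Re z + 1" by simp_all
    moreover have "L * (Re z + 1) \<ge> 0" using L0 calculation(3) by simp
    ultimately have "?u z \<le> 0" by simp
    then show "(\<alpha> - 1) * max 0 (?u z) = 0" by simp
  next
    fix k z assume "k < 2 * n - 1" "z \<in> leftray (a k)"
    then have z: "Re z \<le> -1" "Im z = a k * (-1 - Re z)" by (auto simp: leftray_def)
    have "?u z = (a k - c) * (-1 - Re z)" using z by (simp add: algebra_simps)
    moreover have "max 0 ((a k - c) * (-1 - Re z)) = max 0 (a k - c) * (-1 - Re z)"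
      using z(1) by (simp add: max_def mult_le_0_iff zero_le_mult_iff)
    ultimately show "(\<alpha> - 1) * max 0 (?u z) = (a k + (\<alpha> - 1) * max 0 (a k - c) - a k) * (-1 - Re z)" by simp
  next
    fix k z assume k: "k < 2 * n - 1" "z \<in> rightray (a' k)"
    then have z: "Re z \<ge> 1" "Im z = a' k * (Re z - 1)" by (auto simp: rightray_def)
    have "a' k * (Re z - 1) \<le> L * (Re z - 1)" using L(2)[OF k(1)] z(1) by (intro mult_right_mono) auto
    also have "\<dots> \<le> L * (Re z + 1)" using L0 by (intro mult_left_mono) auto
    finally show "(\<alpha> - 1) * max 0 (?u z) = 0" using z by simp
  next
    show "strict_mono_on {..<2 * n - 1} (\<lambda>k. a k + (\<alpha> - 1) * max 0 (a k - c))"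
    proof (rule strict_mono_onI)
      fix k l assume kl: "k \<in> {..<2 * n - 1}" "l \<in> {..<2 * n - 1}" "k < l"
      then have "a k < a l" using s strict_mono_onD unfolding fan_state_def by metis
      then have m: "max 0 (a k - c) \<le> max 0 (a l - c)" "max 0 (a l - c) - max 0 (a k - c) \<le> a l - a k" by auto
      have "0 < a l - a k + (\<alpha> - 1) * (max 0 (a l - c) - max 0 (a k - c))"
      proof (cases "\<alpha> \<ge> 1")
        case True
        then have "0 \<le> (\<alpha> - 1) * (max 0 (a l - c) - max 0 (a k - c))" using m by simp
        then show ?thesis using \<open>a k < a l\<close> by linarith
      next
        case False
        have "(1 - \<alpha>) * (max 0 (a l - c) - max 0 (a k - c)) \<le> (1 - \<alpha>) * (a l - a k)"
          using False m by (intro mult_left_mono) auto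
        moreover have "(1 - \<alpha>) * (a l - a k) < a l - a k" using \<alpha> \<open>a k < a l\<close> by simp
        ultimately show ?thesis by (simp add: algebra_simps)
      qed
      then show "a k + (\<alpha> - 1) * max 0 (a k - c) < a l + (\<alpha> - 1) * max 0 (a l - c)" by (simp add: algebra_simps)
    qed
  qed
qed

lemma two_fans_cong:
  assumes "\<And>k. k < 2 * n - 1 \<Longrightarrow> a k = b k" "\<And>k. k < 2 * n - 1 \<Longrightarrow> a' k = b' k"
  shows "two_fans n c0 a a' c = two_fans n c0 b b' c"
  unfolding two_fans_def fan_def using assms by (intro arg_cong2[where f = "(\<union>)"] refl SUP_cong) auto

text \<open>The slopes are corrected from the lowest upwards: a shear sets the first one, and
  stretching above a slope that is already correct sets the next one without disturbing those
  below.\<close>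

lemma normalise_left:
  assumes s: "fan_state n c0 D a a' U" and b: "strict_mono_on {..<2 * n - 1} b"
  shows "\<exists>f U'. plane_homeo f \<and> fan_state n c0 (map_diagram f D) b a' U'"
proof -
  have step: "\<exists>f U' a1. plane_homeo f \<and> fan_state n c0 (map_diagram f D) a1 a' U' \<and> (\<forall>k<j. a1 k = b k)" if "j \<le> 2 * n - 1" for j
    using that
  proof (induction j)
    case 0
    have "map_diagram (\<lambda>z. z) D = D" by (rule map_diagram_id) simp
    moreover have "plane_homeo (\<lambda>z. z)" using plane_homeo_affine[of 1 0] by simp
    ultimately show ?case using s by (intro exI[of _ "\<lambda>z. z"] exI[of _ U] exI[of _ a]) simp
  next
    case (Suc j)
    then obtain f U' a1 where f: "plane_homeo f" "fan_state n c0 (map_diagram f D) a1 a' U'" "\<forall>k<j. a1 k = b k" by auto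
    have a1: "strict_mono_on {..<2 * n - 1} a1" using f(2) unfolding fan_state_def by blast
    have "\<exists>g U'' a2. plane_homeo g \<and> fan_state n c0 (map_diagram g (map_diagram f D)) a2 a' U'' \<and> (\<forall>k<Suc j. a2 k = b k)"
    proof (cases j)
      case 0
      obtain g U'' where "plane_homeo g" "fan_state n c0 (map_diagram g (map_diagram f D)) (\<lambda>k. a1 k + (b 0 - a1 0)) a' U''"
        using shear_state[OF f(2)] by blast
      then show ?thesis using 0 by (intro exI[of _ g] exI[of _ U''] exI[of _ "\<lambda>k. a1 k + (b 0 - a1 0)"]) simp
    next
      case (Suc i)
      have ij: "i < j" "j < 2 * n - 1" using Suc Suc.prems by auto
      \<comment> \<open>The factor that takes the excess of \<open>a1 j\<close> over
        \<open>b i\<close> to the excess of \<open>b j\<close>; it is positive because both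
        sequences of slopes increase.\<close>
      define \<alpha> where "\<alpha> = (b j - b i) / (a1 j - b i)"
      have ai: "a1 i = b i" using f(3) ij by simp
      have lt: "b i < a1 j" "b i < b j" using strict_mono_onD[OF a1, of i j] strict_mono_onD[OF b, of i j] ij ai by auto
      then have al: "\<alpha> > 0" by (simp add: \<alpha>_def)
      obtain g U'' where g: "plane_homeo g" "fan_state n c0 (map_diagram g (map_diagram f D)) (\<lambda>k. a1 k + (\<alpha> - 1) * max 0 (a1 k - b i)) a' U''"
        using stretch_state[OF f(2) al] by blast
      have "a1 k + (\<alpha> - 1) * max 0 (a1 k - b i) = b k" if k: "k < Suc j" for k
      proof (cases "k = j")
        case True
        have "\<alpha> * (a1 j - b i) = b j - b i" using lt by (simp add: \<alpha>_def)
        then show ?thesis using True lt by (simp add: algebra_simps)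
      next
        case False
        then have kj: "k < j" "k \<le> i" using k Suc by auto
        have "b k \<le> b i"
        proof (cases "k = i")
          case False then show ?thesis using strict_mono_onD[OF b, of k i] kj ij by auto
        qed simp
        then show ?thesis using f(3) kj by simp
      qed
      then show ?thesis using g by (intro exI[of _ g] exI[of _ U''] exI[of _ "\<lambda>k. a1 k + (\<alpha> - 1) * max 0 (a1 k - b i)"]) simp
    qed
    then obtain g U'' a2 where g: "plane_homeo g" "fan_state n c0 (map_diagram g (map_diagram f D)) a2 a' U''" "\<forall>k<Suc j. a2 k = b k" by blast
    then show ?case using plane_homeo_comp[OF g(1) f(1)] unfolding map_diagram_comp by blast
  qed
  obtain f U' a1 where f: "plane_homeo f" "fan_state n c0 (map_diagram f D) a1 a' U'" "\<forall>k<2 * n - 1. a1 k = b k"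
    using step[of "2 * n - 1"] by auto
  have "two_fans n c0 a1 a' c = two_fans n c0 b a' c" for c using f(3) by (intro two_fans_cong) auto
  then have "fan_state n c0 (map_diagram f D) b a' U'" using f(2) b unfolding fan_state_def by simp
  then show ?thesis using f(1) by blast
qed

lemma plane_homeo_reflect: "plane_homeo (\<lambda>z. Complex (- Re z) (Im z))"
  and pw_affine_reflect: "pw_affine (\<lambda>z. Complex (- Re z) (Im z))"
proof -
  show "pw_affine (\<lambda>z. Complex (- Re z) (Im z))" by (intro pw_affine_Complex pw_affine_minus pw_affine_Re pw_affine_Im)
  then have "continuous_on UNIV (\<lambda>z. Complex (- Re z) (Im z))" by (rule pw_affine_continuous)
  then show "plane_homeo (\<lambda>z. Complex (- Re z) (Im z))"
    by (rule plane_homeoI) (auto simp: inj_def complex_eq_iff intro: exI[of _ "Complex (- Re _) (Im _)"])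
qed

lemma reflect_state:
  assumes s: "fan_state n c0 D a a' U"
  shows "\<exists>f U'. plane_homeo f \<and> fan_state n c0 (map_diagram f D) a' a U'"
proof -
  let ?h = "\<lambda>z. Complex (- Re z) (Im z)"
  have im: "?h ` X = {w. ?h w \<in> X}" for X
    by (auto simp: image_iff complex_eq_iff intro!: bexI[of _ "?h _"])
  have "fan_state n c0 (map_diagram ?h D) a' a (?h ` U)"
  proof (rule fan_state_map[OF s plane_homeo_reflect pw_affine_reflect])
    show "?h ` closed_segment (-1) 1 = closed_segment (-1) 1" unfolding im by (simp add: axis_eq)
    show "?h ` {-1, 1} = {-1, 1}" by (auto simp: complex_eq_iff)
    show "?h ` leftray (a k) = rightray (a k)" for k unfolding im by (auto simp: leftray_def rightray_def)
    show "?h ` rightray (a' k) = leftray (a' k)" for k unfolding im by (auto simp: leftray_def rightray_def)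
    show "strict_mono_on {..<2 * n - 1} a" "strict_mono_on {..<2 * n - 1} a'" using s unfolding fan_state_def by blast+
  qed auto
  then show ?thesis using plane_homeo_reflect by blast
qed

text \<open>Left fan, reflection in the imaginary axis, left fan again. The reflection need not be
  undone, as both fans end up with the same slopes.\<close>

lemma normalise_fans:
  assumes s: "fan_state n c0 D a a' U" and b: "strict_mono_on {..<2 * n - 1} b"
  shows "\<exists>f U'. plane_homeo f \<and> fan_state n c0 (map_diagram f D) b b U'"
proof -
  obtain f1 U1 where f1: "plane_homeo f1" "fan_state n c0 (map_diagram f1 D) b a' U1" using normalise_left[OF s b] by blast
  obtain f2 U2 where f2: "plane_homeo f2" "fan_state n c0 (map_diagram f2 (map_diagram f1 D)) a' b U2" using reflect_state[OF f1(2)] by blast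
  obtain f3 U3 where f3: "plane_homeo f3" "fan_state n c0 (map_diagram f3 (map_diagram f2 (map_diagram f1 D))) b b U3" using normalise_left[OF f2(2) b] by blast
  have "plane_homeo (f3 \<circ> (f2 \<circ> f1))" by (intro plane_homeo_comp f1 f2 f3)
  then show ?thesis using f3(2) unfolding map_diagram_comp by blast
qed

lemma Int_eq_subset: "X \<inter> B = Y \<inter> B \<Longrightarrow> F \<subseteq> B \<Longrightarrow> X \<inter> F = Y \<inter> F"
  by blast

lemma image_eq_by_inverse:
  assumes "\<And>z. z \<in> X \<Longrightarrow> h z \<in> Y" "\<And>w. w \<in> Y \<Longrightarrow> k w \<in> X" "\<And>w. w \<in> Y \<Longrightarrow> h (k w) = w"
  shows "h ` X = Y"
  using assms by (metis (no_types, lifting) image_eqI image_subsetI subsetI subset_antisym)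

text \<open>The inverse map \<open>k\<close> contracts the plane towards the edge: the displacement
  of a point from \<open>cl (Re z)\<close> on the edge is multiplied by \<open>\<delta>\<close>. The
  edge is fixed pointwise and each ray goes to itself, so \<open>h\<close> blows up the unknown
  neighbourhood \<open>U\<close> until it contains a given square.\<close>

lemma compress_state:
  assumes s: "fan_state n c0 D a a' U"
  shows "\<exists>f U'. plane_homeo f \<and> fan_state n c0 (map_diagram f D) a a' U' \<and> {z. \<bar>Re z\<bar> \<le> L \<and> \<bar>Im z\<bar> \<le> L} \<subseteq> U'"
proof -
  have U: "open U" "closed_segment (-1) 1 \<subseteq> U" using s unfolding fan_state_def by blast+
  obtain e where e: "e > 0" "{x. infdist x (closed_segment (-1) 1) \<le> e} \<subseteq> U"
    using compact_in_open_separated[OF _ compact_segment U] by (metis ends_in_segment(1) empty_iff)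
  \<comment> \<open>Small enough for the contracted square to lie within distance \<open>e\<close>
    of the edge.\<close>
  define \<delta> where "\<delta> = min (1/2) (e / (2 * (1 + \<bar>L\<bar>)))"
  have \<delta>: "0 < \<delta>" "\<delta> < 1" "\<delta> * \<bar>L\<bar> \<le> e / 2"
  proof -
    have p: "0 < 1 + \<bar>L\<bar>" by simp
    show "0 < \<delta>" using e(1) p by (simp add: \<delta>_def)
    show "\<delta> < 1" by (simp add: \<delta>_def)
    have "\<delta> * \<bar>L\<bar> \<le> \<delta> * (1 + \<bar>L\<bar>)" using \<open>0 < \<delta>\<close> by simp
    also have "\<dots> \<le> e / (2 * (1 + \<bar>L\<bar>)) * (1 + \<bar>L\<bar>)" using p by (intro mult_right_mono) (auto simp: \<delta>_def)
    also have "\<dots> = e / 2" using p by (simp add: divide_simps)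
    finally show "\<delta> * \<bar>L\<bar> \<le> e / 2" .
  qed
  define cl where "cl x = max (-1) (min x 1)" for x :: real
  have cll: "cl x = -1" if "x \<le> -1" for x using that by (simp add: cl_def)
  have clr: "cl x = 1" if "x \<ge> 1" for x using that by (simp add: cl_def)
  have clm: "cl x = x" if "\<bar>x\<bar> \<le> 1" for x using that by (simp add: cl_def)
  have cl: "cl (\<delta> * x + (1 - \<delta>) * cl x) = cl x" for x
  proof -
    consider "x \<le> -1" | "\<bar>x\<bar> \<le> 1" | "x \<ge> 1" by linarith
    then show ?thesis
    proof cases
      case 1
      then have "\<delta> * x \<le> \<delta> * (-1)" using \<delta> by (intro mult_left_mono) auto
      then have "\<delta> * x + (1 - \<delta>) * (-1) \<le> -1" by (simp add: algebra_simps)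
      then show ?thesis using cll cll[OF 1] by metis
    next
      case 2
      then have "cl x = x" by (simp add: cl_def max_def min_def abs_le_iff)
      then show ?thesis by (simp add: algebra_simps)
    next
      case 3
      then have "\<delta> * 1 \<le> \<delta> * x" using \<delta> by (intro mult_left_mono) auto
      then have "\<delta> * x + (1 - \<delta>) * 1 \<ge> 1" by (simp add: algebra_simps)
      then show ?thesis using clr clr[OF 3] by metis
    qed
  qed
  define h1 where "h1 z = z + (- ((1 - \<delta>) * cl (Re z))) *\<^sub>R 1" for z :: complex
  have pw: "pw_affine (\<lambda>z. - ((1 - \<delta>) * cl (Re z)))" unfolding cl_def
    by (intro pw_affine_minus pw_affine_mult pw_affine_max pw_affine_min pw_affine_const pw_affine_Re)
  have h1: "plane_homeo h1" unfolding h1_def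
  proof (rule plane_homeo_shift[OF pw_affine_continuous[OF pw]])
    show "1 - \<delta> < 1" using \<delta> by simp
    fix z :: complex and t :: real assume "0 \<le> t"
    then have "cl (Re z + t) \<le> cl (Re z) + t" by (auto simp: cl_def max_def min_def)
    then have "cl (Re (z + t *\<^sub>R 1)) \<le> cl (Re z) + t" by simp
    then have "(1 - \<delta>) * cl (Re (z + t *\<^sub>R 1)) \<le> (1 - \<delta>) * (cl (Re z) + t)" using \<delta> by (intro mult_left_mono) auto
    then show "- ((1 - \<delta>) * cl (Re z)) - (1 - \<delta>) * t \<le> - ((1 - \<delta>) * cl (Re (z + t *\<^sub>R 1)))"
      by (simp add: algebra_simps)
  qed
  define h where "h z = of_real (1 / \<delta>) * h1 z" for z
  have hc: "Re (h z) = (Re z - (1 - \<delta>) * cl (Re z)) / \<delta>" "Im (h z) = Im z / \<delta>" for z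
    by (simp_all add: h_def h1_def)
  have "plane_homeo ((\<lambda>z. of_real (1 / \<delta>) * z + 0) \<circ> h1)"
    by (intro plane_homeo_comp h1 plane_homeo_affine) (use \<delta> in auto)
  moreover have "(\<lambda>z. of_real (1 / \<delta>) * z + 0) \<circ> h1 = h" by (simp add: fun_eq_iff h_def)
  ultimately have ph: "plane_homeo h" by metis
  have "pw_affine h1" unfolding h1_def by (intro pw_affine_add pw_affine_id pw_affine_scaleR pw)
  moreover have "linear (\<lambda>w. complex_of_real (1 / \<delta>) * w)" by (rule bounded_linear.linear[OF bounded_linear_mult_right])
  ultimately have "pw_affine (\<lambda>z. complex_of_real (1 / \<delta>) * h1 z)" by (rule pw_affine_linear_comp[rotated])
  then have pwh: "pw_affine h" by (simp only: h_def[abs_def])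
  define k where "k w = Complex (\<delta> * Re w + (1 - \<delta>) * cl (Re w)) (\<delta> * Im w)" for w
  have hk: "h (k w) = w" for w using \<delta> by (simp add: complex_eq_iff hc k_def cl)
  have st: "fan_state n c0 (map_diagram h D) a a' (h ` U)"
  proof (rule fan_state_map[OF s ph pwh])
    show "h ` closed_segment (-1) 1 = closed_segment (-1) 1"
    proof (rule image_eq_by_inverse[where h = h and k = k])
      fix z :: complex assume "z \<in> closed_segment (-1) 1"
      then have z: "Im z = 0" "\<bar>Re z\<bar> \<le> 1" by (auto simp: axis_eq)
      have "Re z - (1 - \<delta>) * Re z = \<delta> * Re z" by (simp add: algebra_simps)
      then show "h z \<in> closed_segment (-1) 1" unfolding axis_eq using z \<delta> by (simp add: hc clm)
    next
      fix w :: complex assume "w \<in> closed_segment (-1) 1"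
      then have z: "Im w = 0" "\<bar>Re w\<bar> \<le> 1" by (auto simp: axis_eq)
      have "\<delta> * Re w + (1 - \<delta>) * Re w = Re w" by (simp add: algebra_simps)
      then show "k w \<in> closed_segment (-1) 1" unfolding axis_eq using z by (simp add: k_def clm)
    qed (rule hk)
    have "h (-1) = -1" "h 1 = 1" using \<delta> by (simp_all add: complex_eq_iff hc cll clr field_simps)
    then show "h ` {-1, 1} = {-1, 1}" by simp
    show "h ` leftray t = leftray t" for t
    proof (rule image_eq_by_inverse[where h = h and k = k])
      fix z assume "z \<in> leftray t"
      then have z: "Re z \<le> -1" "Im z = t * (-1 - Re z)" by (auto simp: leftray_def)
      have r: "Re (h z) = -1 - (-1 - Re z) / \<delta>" using \<delta> by (simp add: hc cll[OF z(1)] field_simps)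
      have "(-1 - Re z) / \<delta> \<ge> 0" using z \<delta> by simp
      then show "h z \<in> leftray t" unfolding leftray_def using r z by (simp add: hc(2))
    next
      fix w assume "w \<in> leftray t"
      then have w: "Re w \<le> -1" "Im w = t * (-1 - Re w)" by (auto simp: leftray_def)
      have "\<delta> * Re w \<le> \<delta> * (-1)" using \<delta> w by (intro mult_left_mono) auto
      moreover have "Re (k w) = \<delta> * Re w - (1 - \<delta>)" "Im (k w) = \<delta> * (t * (-1 - Re w))"
        by (simp_all add: k_def cll[OF w(1)] w(2))
      moreover have "\<delta> * (t * (-1 - Re w)) = t * (-1 - (\<delta> * Re w - (1 - \<delta>)))" by (simp add: algebra_simps)
      ultimately show "k w \<in> leftray t" unfolding leftray_def by simp
    qed (rule hk)
    show "h ` rightray t = rightray t" for t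
    proof (rule image_eq_by_inverse[where h = h and k = k])
      fix z assume "z \<in> rightray t"
      then have z: "Re z \<ge> 1" "Im z = t * (Re z - 1)" by (auto simp: rightray_def)
      have r: "Re (h z) = 1 + (Re z - 1) / \<delta>" using \<delta> by (simp add: hc clr[OF z(1)] field_simps)
      have "(Re z - 1) / \<delta> \<ge> 0" using z \<delta> by simp
      then show "h z \<in> rightray t" unfolding rightray_def using r z by (simp add: hc(2))
    next
      fix w assume "w \<in> rightray t"
      then have w: "Re w \<ge> 1" "Im w = t * (Re w - 1)" by (auto simp: rightray_def)
      have "\<delta> * 1 \<le> \<delta> * Re w" using \<delta> w by (intro mult_left_mono) auto
      moreover have "Re (k w) = \<delta> * Re w + (1 - \<delta>)" "Im (k w) = \<delta> * (t * (Re w - 1))"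
        by (simp_all add: k_def clr[OF w(1)] w(2))
      moreover have "\<delta> * (t * (Re w - 1)) = t * (\<delta> * Re w + (1 - \<delta>) - 1)" by (simp add: algebra_simps)
      ultimately show "k w \<in> rightray t" unfolding rightray_def by simp
    qed (rule hk)
    show "strict_mono_on {..<2 * n - 1} a" "strict_mono_on {..<2 * n - 1} a'" using s unfolding fan_state_def by blast+
  qed auto
  have "{z. \<bar>Re z\<bar> \<le> L \<and> \<bar>Im z\<bar> \<le> L} \<subseteq> h ` U"
  proof
    fix w assume "w \<in> {z. \<bar>Re z\<bar> \<le> L \<and> \<bar>Im z\<bar> \<le> L}"
    then have w: "\<bar>Re w\<bar> \<le> \<bar>L\<bar>" "\<bar>Im w\<bar> \<le> \<bar>L\<bar>" by auto
    have "\<delta> * \<bar>Re w\<bar> \<le> e / 2" "\<delta> * \<bar>Im w\<bar> \<le> e / 2"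
      using \<delta> mult_left_mono[OF w(1), of \<delta>] mult_left_mono[OF w(2), of \<delta>] by linarith+
    then have dw: "\<bar>\<delta> * Re w\<bar> \<le> e / 2" "\<bar>\<delta> * Im w\<bar> \<le> e / 2" using \<delta>(1) by (simp_all add: abs_mult)
    define p where "p = complex_of_real (cl (\<delta> * Re w + (1 - \<delta>) * cl (Re w)))"
    have "\<bar>cl (Re w)\<bar> \<le> 1" by (auto simp: cl_def max_def min_def abs_le_iff)
    then have "\<bar>(1 - \<delta>) * cl (Re w)\<bar> \<le> 1 * 1" unfolding abs_mult using \<delta> by (intro mult_mono) auto
    moreover have "\<bar>d + t - cl (d + t)\<bar> \<le> \<bar>d\<bar>" if "\<bar>t\<bar> \<le> 1" for d t
      using that unfolding cl_def by (smt (verit))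
    ultimately have "\<bar>Re (k w) - Re p\<bar> \<le> \<bar>\<delta> * Re w\<bar>" by (simp add: k_def p_def)
    then have "\<bar>Re (k w) - Re p\<bar> \<le> e / 2" using dw(1) by linarith
    moreover have "cmod (k w - p) \<le> \<bar>Re (k w - p)\<bar> + \<bar>Im (k w - p)\<bar>" by (rule cmod_le)
    ultimately have "dist (k w) p \<le> e" using dw(2) by (simp add: dist_norm k_def p_def)
    moreover have "p \<in> closed_segment (-1) 1" unfolding axis_eq p_def by (simp add: cl_def abs_le_iff)
    ultimately have "infdist (k w) (closed_segment (-1) 1) \<le> e" by (meson infdist_le order_trans)
    then have "k w \<in> U" using e(2) by blast
    then show "w \<in> h ` U" using hk[of w] by (metis imageI)
  qed
  then show ?thesis using ph st by blast
qed

section \<open>The standard picture in a rectangle\<close>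

definition upper_strands :: "real \<Rightarrow> nat \<Rightarrow> complex set" where
  "upper_strands \<eta> j = {z. Im z \<ge> 0 \<and> \<bar>Re z\<bar> = max (1 - Im z / real j) (\<eta> * (1 + (2 - 1 / real j) * Im z))}"

definition lower_strands :: "nat \<Rightarrow> complex set" where
  "lower_strands i = {z. \<bar>Re z\<bar> \<ge> 1 \<and> Im z = - real i * (\<bar>Re z\<bar> - 1)}"

text \<open>Slope \<open>- i\<close> belongs to the fan index \<open>n - 1 - i\<close>; the index
  \<open>n + 1 + i\<close> has the same parity and avoids subtraction.\<close>

definition lower_part :: "nat \<Rightarrow> gen \<Rightarrow> gen \<Rightarrow> complex set" where
  "lower_part n c0 c = axis c0 c \<union> (\<Union>i\<in>{i. i < n \<and> fan_color c0 (n + 1 + i) = c}. lower_strands i)"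

definition cut_color :: "gen \<Rightarrow> nat \<Rightarrow> gen" where
  "cut_color c0 j = (if odd j then other c0 else c0)"

definition frame :: "nat \<Rightarrow> complex set" where
  "frame n = {z. \<bar>Re z\<bar> < 3 \<and> \<bar>Im z\<bar> < 3 * real n}"

text \<open>The lower slopes are the integers from \<open>1 - n\<close> to \<open>0\<close>. The
  upper ones are indexed by \<open>j = 2 * n - 1 - k\<close>, counted from the edge, and chosen so
  that moving points towards the imaginary axis by twice their height turns the ray into the line
  from the vertex to height \<open>j\<close> on that axis: on the ray
  \<open>\<bar>Re z\<bar> = 1 + (2 - 1 / j) * Im z\<close>, and \<open>1 - Im z / j\<close>
  remains.\<close>

definition normal_slope :: "nat \<Rightarrow> nat \<Rightarrow> real" where
  "normal_slope n k = (if k < n then real k - (real n - 1) else 1 / (2 - 1 / real (2 * n - 1 - k)))"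

lemma normal_slope_mono: "strict_mono_on {..<2 * n - 1} (normal_slope n)"
proof (rule strict_mono_onI)
  fix k l assume kl: "k \<in> {..<2 * n - 1}" "l \<in> {..<2 * n - 1}" "k < l"
  have pos: "0 < 2 - 1 / real j" if "j \<ge> 1" for j :: nat using that by (simp add: field_simps)
  consider "l < n" | "k < n" "n \<le> l" | "n \<le> k" using kl by linarith
  then show "normal_slope n k < normal_slope n l"
  proof cases
    case 1 then show ?thesis using kl by (simp add: normal_slope_def)
  next
    case 2
    have "0 < normal_slope n l" using 2 kl pos[of "2 * n - 1 - l"] by (simp add: normal_slope_def)
    moreover have "normal_slope n k \<le> 0" using 2 by (simp add: normal_slope_def)
    ultimately show ?thesis by linarith
  next
    case 3
    define i j where "i = 2 * n - 1 - k" and "j = 2 * n - 1 - l"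
    have ij: "1 \<le> j" "j < i" using kl by (auto simp: i_def j_def)
    then have "1 / real i < 1 / real j" by (simp add: frac_less2)
    then have "1 / (2 - 1 / real i) < 1 / (2 - 1 / real j)" using pos[of i] pos[of j] ij by (intro frac_less2) auto
    then show ?thesis using 3 kl by (simp add: normal_slope_def i_def j_def)
  qed
qed

text \<open>Points above the real line move horizontally towards the imaginary axis by twice their
  height, but at most by the fraction \<open>1 - \<eta>\<close> of their distance from it. The first
  rule produces the slanted legs of the strands, the second their nearly vertical parts close to the
  axis.\<close>

definition bend :: "real \<Rightarrow> complex \<Rightarrow> complex" where
  "bend \<eta> z = z + max (- (2 * max 0 (Im z))) (min (2 * max 0 (Im z)) ((\<eta> - 1) * Re z)) *\<^sub>R 1"

lemma bend_homeo:
  assumes "0 < \<eta>" "\<eta> < 1" shows "plane_homeo (bend \<eta>)" "pw_affine (bend \<eta>)"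
proof -
  let ?\<phi> = "\<lambda>z. max (- (2 * max 0 (Im z))) (min (2 * max 0 (Im z)) ((\<eta> - 1) * Re z))"
  have pw: "pw_affine ?\<phi>"
    by (intro pw_affine_max pw_affine_min pw_affine_minus pw_affine_mult pw_affine_const pw_affine_Im pw_affine_Re)
  show "pw_affine (bend \<eta>)" unfolding bend_def by (intro pw_affine_add pw_affine_id pw_affine_scaleR pw)
  show "plane_homeo (bend \<eta>)" unfolding bend_def
  proof (rule plane_homeo_shift[OF pw_affine_continuous[OF pw]])
    show "1 - \<eta> < 1" using assms by simp
    fix z :: complex and t :: real assume t: "0 \<le> t"
    have "(\<eta> - 1) * Re (z + t *\<^sub>R 1) = (\<eta> - 1) * Re z - (1 - \<eta>) * t" by (simp add: algebra_simps)
    moreover have "0 \<le> (1 - \<eta>) * t" using assms t by simp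
    moreover have "Im (z + t *\<^sub>R 1) = Im z" by simp
    ultimately show "?\<phi> (z + t *\<^sub>R 1) \<ge> ?\<phi> z - (1 - \<eta>) * t" by (smt (verit))
  qed
qed

lemma bend_lower: "Im z \<le> 0 \<Longrightarrow> bend \<eta> z = z"
  by (simp add: bend_def max_def)

lemma bend_upper:
  assumes "0 < \<eta>" "\<eta> < 1" "j \<ge> 1"
  shows "bend \<eta> ` (leftray (1 / (2 - 1 / real j)) \<union> rightray (1 / (2 - 1 / real j))) = upper_strands \<eta> j"
proof -
  define r where "r = 2 - 1 / real j"
  have r: "0 < r" "r = 2 - 1 / real j" using assms(3) by (auto simp: r_def field_simps)
  have "t = (1 / r) * u \<longleftrightarrow> u = r * t" "u = r * t \<Longrightarrow> 0 \<le> u \<longleftrightarrow> 0 \<le> t" for t u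
    using r(1) by (auto simp: field_simps zero_le_mult_iff)
  note e = this
  have Lr: "leftray (1 / r) = {z. Im z \<ge> 0 \<and> Re z = -1 - r * Im z}"
    using e(2)[of "-1 - Re _" "Im _"] unfolding leftray_def e(1) by (intro Collect_cong) (smt (verit))
  have Rr: "rightray (1 / r) = {z. Im z \<ge> 0 \<and> Re z = 1 + r * Im z}"
    using e(2)[of "Re _ - 1" "Im _"] unfolding rightray_def e(1) by (intro Collect_cong) (smt (verit))
  \<comment> \<open>The maximum that defines the strand is the distance before bending minus the
    smaller of the two displacements.\<close>
  have eqx: "max (1 - y / real j) (\<eta> * (1 + r * y)) = 1 + r * y - min (2 * y) ((1 - \<eta>) * (1 + r * y))" for y
  proof -
    have "1 - y / real j = 1 + r * y - 2 * y" by (simp add: r(2) algebra_simps)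
    moreover have "\<eta> * (1 + r * y) = 1 + r * y - (1 - \<eta>) * (1 + r * y)" by (simp add: algebra_simps)
    ultimately show ?thesis by (simp add: max_def min_def)
  qed
  have nn: "0 \<le> (1 - \<eta>) * (1 + r * y)" if "y \<ge> 0" for y using assms(2) r(1) that by simp
  have bl: "bend \<eta> (Complex (-1 - r * y) y) = Complex (- max (1 - y / real j) (\<eta> * (1 + r * y))) y" if y: "y \<ge> 0" for y
  proof -
    have "(\<eta> - 1) * (-1 - r * y) = (1 - \<eta>) * (1 + r * y)" by (simp add: algebra_simps)
    then have "max (- (2 * y)) (min (2 * y) ((\<eta> - 1) * (-1 - r * y))) = min (2 * y) ((1 - \<eta>) * (1 + r * y))"
      using nn[OF y] y by (simp add: max_def min_def)
    then show ?thesis unfolding eqx using y by (simp add: bend_def complex_eq_iff)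
  qed
  have br: "bend \<eta> (Complex (1 + r * y) y) = Complex (max (1 - y / real j) (\<eta> * (1 + r * y))) y" if y: "y \<ge> 0" for y
  proof -
    have "(\<eta> - 1) * (1 + r * y) = - ((1 - \<eta>) * (1 + r * y))" by (simp add: algebra_simps)
    then have "max (- (2 * y)) (min (2 * y) ((\<eta> - 1) * (1 + r * y))) = - min (2 * y) ((1 - \<eta>) * (1 + r * y))"
      using nn[OF y] y by (simp add: max_def min_def)
    then show ?thesis unfolding eqx using y by (simp add: bend_def complex_eq_iff)
  qed
  have pos: "max (1 - y / real j) (\<eta> * (1 + r * y)) \<ge> 0" if "y \<ge> 0" for y
    using assms(1) r(1) that by (simp add: le_max_iff_disj)
  show ?thesis unfolding r_def[symmetric]
  proof
    show "bend \<eta> ` (leftray (1 / r) \<union> rightray (1 / r)) \<subseteq> upper_strands \<eta> j"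
    proof
      fix w assume "w \<in> bend \<eta> ` (leftray (1 / r) \<union> rightray (1 / r))"
      then obtain z where z: "w = bend \<eta> z" "Im z \<ge> 0" "z = Complex (-1 - r * Im z) (Im z) \<or> z = Complex (1 + r * Im z) (Im z)"
        unfolding Lr Rr by (auto simp: complex_eq_iff)
      then have "Im w = Im z \<and> \<bar>Re w\<bar> = max (1 - Im z / real j) (\<eta> * (1 + r * Im z))"
        using bl[OF z(2)] br[OF z(2)] pos[OF z(2)] by (metis abs_minus_cancel abs_of_nonneg complex.sel)
      then show "w \<in> upper_strands \<eta> j" using z(2) by (simp add: upper_strands_def r(2))
    qed
    show "upper_strands \<eta> j \<subseteq> bend \<eta> ` (leftray (1 / r) \<union> rightray (1 / r))"
    proof
      fix w assume w: "w \<in> upper_strands \<eta> j"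
      define y where "y = Im w"
      have y: "y \<ge> 0" "\<bar>Re w\<bar> = max (1 - y / real j) (\<eta> * (1 + r * y))" using w by (auto simp: upper_strands_def r(2) y_def)
      then have "Re w = - max (1 - y / real j) (\<eta> * (1 + r * y)) \<or> Re w = max (1 - y / real j) (\<eta> * (1 + r * y))" by linarith
      then have "w = bend \<eta> (Complex (-1 - r * y) y) \<or> w = bend \<eta> (Complex (1 + r * y) y)"
        unfolding bl[OF y(1)] br[OF y(1)] by (auto simp: complex_eq_iff y_def)
      moreover have "Complex (-1 - r * y) y \<in> leftray (1 / r)" "Complex (1 + r * y) y \<in> rightray (1 / r)"
        unfolding Lr Rr using y by auto
      ultimately show "w \<in> bend \<eta> ` (leftray (1 / r) \<union> rightray (1 / r))" by blast
    qed
  qed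
qed

text \<open>Left and right rays of the same index are treated together. The lower indices turn into
  \<open>i = n - 1 - k\<close>, where \<open>bend\<close> is the identity, and the upper ones into
  \<open>j = 2 * n - 1 - k\<close>.\<close>

lemma bend_two_fans:
  assumes \<eta>: "0 < \<eta>" "\<eta> < 1" and n: "n \<ge> 1"
  shows "bend \<eta> ` two_fans n c0 (normal_slope n) (normal_slope n) c =
    lower_part n c0 c \<union> (\<Union>j\<in>{j. 1 \<le> j \<and> j < n \<and> cut_color c0 j = c}. upper_strands \<eta> j)"
proof -
  let ?R = "\<lambda>k. leftray (normal_slope n k) \<union> rightray (normal_slope n k)"
  have low: "bend \<eta> ` ?R k = lower_strands (n - 1 - k)" if k: "k < n" for k
  proof -
    define i where "i = n - 1 - k"
    have sl: "normal_slope n k = - real i" using k by (simp add: normal_slope_def i_def of_nat_diff)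
    have "?R k = lower_strands i" unfolding sl
    proof (intro set_eqI)
      fix z :: complex
      consider "Re z \<le> -1" | "Re z \<ge> 1" | "\<bar>Re z\<bar> < 1" by linarith
      then show "z \<in> leftray (- real i) \<union> rightray (- real i) \<longleftrightarrow> z \<in> lower_strands i"
        by cases (auto simp: leftray_def rightray_def lower_strands_def)
    qed
    moreover have "Im z \<le> 0" if "z \<in> lower_strands i" for z
      using that by (auto simp: lower_strands_def mult_nonneg_nonneg)
    then have "bend \<eta> ` lower_strands i = (\<lambda>z. z) ` lower_strands i" by (intro image_cong refl bend_lower)
    ultimately show ?thesis by (simp add: i_def)
  qed
  have up: "bend \<eta> ` ?R k = upper_strands \<eta> (2 * n - 1 - k)" if k: "n \<le> k" "k < 2 * n - 1" for k
    using bend_upper[OF \<eta>, of "2 * n - 1 - k"] k by (simp add: normal_slope_def)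
  have ax: "bend \<eta> ` axis c0 c = axis c0 c"
  proof -
    have "bend \<eta> ` axis c0 c = (\<lambda>z. z) ` axis c0 c"
      by (intro image_cong refl bend_lower) (auto simp: axis_def axis_eq split: if_splits)
    then show ?thesis by simp
  qed
  have "two_fans n c0 (normal_slope n) (normal_slope n) c = axis c0 c \<union> (\<Union>k\<in>{k. k < 2 * n - 1 \<and> fan_color c0 k = c}. ?R k)"
    unfolding two_fans_def fan_def by blast
  then have "bend \<eta> ` two_fans n c0 (normal_slope n) (normal_slope n) c = axis c0 c \<union> (\<Union>k\<in>{k. k < 2 * n - 1 \<and> fan_color c0 k = c}. bend \<eta> ` ?R k)"
    by (simp only: image_Un image_UN ax)
  also have "(\<Union>k\<in>{k. k < 2 * n - 1 \<and> fan_color c0 k = c}. bend \<eta> ` ?R k)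
     = (\<Union>i\<in>{i. i < n \<and> fan_color c0 (n + 1 + i) = c}. lower_strands i) \<union>
       (\<Union>j\<in>{j. 1 \<le> j \<and> j < n \<and> cut_color c0 j = c}. upper_strands \<eta> j)" (is "?L = ?M")
  proof
    show "?L \<subseteq> ?M"
    proof (rule UN_least)
      fix k assume k: "k \<in> {k. k < 2 * n - 1 \<and> fan_color c0 k = c}"
      show "bend \<eta> ` ?R k \<subseteq> ?M"
      proof (cases "k < n")
        case True
        have "n - 1 - k < n" "fan_color c0 (n + 1 + (n - 1 - k)) = c" using k n True by (auto simp: fan_color_def)
        then show ?thesis unfolding low[OF True] by blast
      next
        case False
        have "1 \<le> 2 * n - 1 - k" "2 * n - 1 - k < n" "cut_color c0 (2 * n - 1 - k) = c"
          using k False n by (auto simp: fan_color_def cut_color_def)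
        moreover have "bend \<eta> ` ?R k = upper_strands \<eta> (2 * n - 1 - k)" using up[of k] False k by simp
        ultimately show ?thesis by blast
      qed
    qed
    show "?M \<subseteq> ?L"
    proof (rule Un_least; rule UN_least)
      fix i assume i: "i \<in> {i. i < n \<and> fan_color c0 (n + 1 + i) = c}"
      define k where "k = n - 1 - i"
      have "k < n" "n - 1 - k = i" "k < 2 * n - 1" "fan_color c0 k = c" using i by (auto simp: k_def fan_color_def)
      moreover then have "bend \<eta> ` ?R k = lower_strands i" using low[of k] by simp
      ultimately show "lower_strands i \<subseteq> ?L" by blast
    next
      fix j assume j: "j \<in> {j. 1 \<le> j \<and> j < n \<and> cut_color c0 j = c}"
      define k where "k = 2 * n - 1 - j"
      have "n \<le> k" "2 * n - 1 - k = j" "k < 2 * n - 1" "fan_color c0 k = c" using j by (auto simp: k_def fan_color_def cut_color_def)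
      moreover then have "bend \<eta> ` ?R k = upper_strands \<eta> j" using up[of k] by simp
      ultimately show "upper_strands \<eta> j \<subseteq> ?L" by blast
    qed
  qed
  finally show ?thesis by (simp add: lower_part_def Un_assoc)
qed

lemma normal_form:
  assumes D: "polygonal_diagram n D" and n: "n \<ge> 2" and ne: "verts D \<noteq> {}" and \<eta>: "0 < \<eta>" "\<eta> < 1"
  shows "\<exists>f c0. plane_homeo f \<and> polygonal_diagram n (map_diagram f D) \<and> verts (map_diagram f D) \<inter> frame n = {-1, 1} \<and>
    (\<forall>c. strands (map_diagram f D) c \<inter> frame n =
      (lower_part n c0 c \<union> (\<Union>j\<in>{j. 1 \<le> j \<and> j < n \<and> cut_color c0 j = c}. upper_strands \<eta> j)) \<inter> frame n)"
proof -
  have n1: "n \<ge> 1" using n by simp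
  obtain c0 A where A: "(c0, A) \<in> edges D" "\<And>v. A \<inter> verts D \<noteq> {v}" using nonloop_edge_exists[OF D n ne] by blast
  obtain g where g: "simple_path g" "path_image g = A" "A \<inter> verts D = {pathstart g, pathfinish g}"
      "pathstart g \<in> verts D" "pathfinish g \<in> verts D"
    using polygonal_diagramD(4)[OF D A(1)] is_edgeE by metis
  have "pathstart g \<noteq> pathfinish g" using A(2) g(3) by auto
  then have "arc g" using g(1) by (simp add: arc_simple_path)
  then obtain k where k: "polyarc (Suc k) (pathstart g) (pathfinish g) A"
    using arc_polyarc[of g] polygonal_diagramD(5)[OF D A(1)] g(2) by metis
  obtain f0 where f0: "plane_homeo f0" "polygonal_diagram n (map_diagram f0 D)" "f0 (pathstart g) = -1"
    "f0 (pathfinish g) = 1" "f0 ` A = closed_segment (-1) 1"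
    using straighten_edge[OF D A(1) k] by blast
  define D0 where "D0 = map_diagram f0 D"
  have D0: "polygonal_diagram n D0" "-1 \<in> verts D0" "1 \<in> verts D0" "(c0, closed_segment (-1) 1) \<in> edges D0"
    using f0(2) imageI[OF g(4), of f0] imageI[OF g(5), of f0] f0(3,4) edges_map[OF A(1), of f0] f0(5)
    by (simp_all add: D0_def)
  obtain f1 a a' U1 where f1: "plane_homeo f1" "fan_state n c0 (map_diagram f1 D0) a a' U1"
    using initial_state[OF D0(1) n1 D0(2-4)] by blast
  let ?b = "normal_slope n"
  obtain f2 U2 where f2: "plane_homeo f2" "fan_state n c0 (map_diagram f2 (map_diagram f1 D0)) ?b ?b U2"
    using normalise_fans[OF f1(2) normal_slope_mono] by blast
  \<comment> \<open>\<open>bend\<close> moves points horizontally by at most twice their height,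
    which is below \<open>6 * n\<close> in the frame; this square therefore contains the preimage of
    \<open>frame n\<close>.\<close>
  obtain f3 U3 where f3: "plane_homeo f3" "fan_state n c0 (map_diagram f3 (map_diagram f2 (map_diagram f1 D0))) ?b ?b U3"
    "{z. \<bar>Re z\<bar> \<le> 3 + 6 * real n \<and> \<bar>Im z\<bar> \<le> 3 + 6 * real n} \<subseteq> U3"
    using compress_state[OF f2(2)] by blast
  define D3 where "D3 = map_diagram f3 (map_diagram f2 (map_diagram f1 D0))"
  have D3: "polygonal_diagram n D3" "verts D3 \<inter> U3 = {-1, 1}" "\<And>c. strands D3 c \<inter> U3 = two_fans n c0 ?b ?b c \<inter> U3"
    using f3(2) unfolding fan_state_def D3_def by blast+
  note b = bend_homeo[OF \<eta>]
  have inj: "inj (bend \<eta>)" using bij_is_inj[OF plane_homeo_bij[OF b(1)]] .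
  have fr: "frame n \<subseteq> bend \<eta> ` U3"
  proof
    fix w assume w: "w \<in> frame n"
    have "surj (bend \<eta>)" using plane_homeo_bij[OF b(1)] bij_is_surj by blast
    then obtain z where z: "w = bend \<eta> z" by (metis surjD)
    have iz: "Im w = Im z" by (simp add: z bend_def)
    have "\<bar>Re w - Re z\<bar> \<le> 2 * max 0 (Im z)" by (simp add: z bend_def max_def min_def)
    moreover have "\<bar>Re w\<bar> < 3" "\<bar>Im z\<bar> < 3 * real n" using w iz by (simp_all add: frame_def)
    ultimately have "\<bar>Re z\<bar> \<le> 3 + 6 * real n" "\<bar>Im z\<bar> \<le> 3 + 6 * real n" by linarith+
    then have "z \<in> U3" using f3(3) by blast
    then show "w \<in> bend \<eta> ` U3" using z by blast
  qed
  define f where "f = bend \<eta> \<circ> (f3 \<circ> (f2 \<circ> (f1 \<circ> f0)))"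
  have f: "plane_homeo f" unfolding f_def by (intro plane_homeo_comp b f0 f1 f2 f3)
  have fD: "map_diagram f D = map_diagram (bend \<eta>) D3" by (simp add: f_def D3_def D0_def map_diagram_comp)
  have "verts (map_diagram (bend \<eta>) D3) \<inter> bend \<eta> ` U3 = bend \<eta> ` {-1, 1}"
    using D3(2) by (metis image_Int[OF inj] verts_map)
  also have "bend \<eta> ` {-1, 1} = {-1, 1}" by (simp add: bend_lower)
  finally have v: "verts (map_diagram (bend \<eta>) D3) \<inter> frame n = {-1, 1}"
    using fr n by (auto simp: frame_def)
  have s: "strands (map_diagram (bend \<eta>) D3) c \<inter> frame n =
      (lower_part n c0 c \<union> (\<Union>j\<in>{j. 1 \<le> j \<and> j < n \<and> cut_color c0 j = c}. upper_strands \<eta> j)) \<inter> frame n" for c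
  proof -
    have "strands (map_diagram (bend \<eta>) D3) c \<inter> bend \<eta> ` U3 = bend \<eta> ` two_fans n c0 ?b ?b c \<inter> bend \<eta> ` U3"
      unfolding strands_map using D3(3)[of c] by (metis image_Int[OF inj])
    then show ?thesis unfolding bend_two_fans[OF \<eta> n1] using fr by (rule Int_eq_subset)
  qed
  have "polygonal_diagram n (map_diagram (bend \<eta>) D3)" by (intro polygonal_map b D3)
  then show ?thesis using f v s unfolding fD[symmetric] by blast
qed

subsection \<open>The bridge and cancellation moves\<close>

lemma arc_across_edge:
  assumes "arc_across K p q A" "A \<inter> X = {p, q}"
  shows "is_edge X A" "p \<noteq> q" "A \<subseteq> K" "A \<inter> frontier K = {p, q}"
proof -
  obtain g where g: "arc g" "path_image g = A" "pathstart g = p" "pathfinish g = q"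
    using assms(1) unfolding arc_across_def by blast
  show "is_edge X A" unfolding is_edge_def using g assms(2) arc_imp_simple_path by (intro exI[of _ g]) auto
  show "p \<noteq> q" using g arc_distinct_ends by blast
  show "A \<subseteq> K" "A \<inter> frontier K = {p, q}" using assms(1) unfolding arc_across_def by blast+
qed

lemma deg_eq_one:
  assumes "finite E" "A \<in> E" "y \<in> A" "A \<inter> X \<noteq> {y}" "\<And>B. B \<in> E \<Longrightarrow> B \<noteq> A \<Longrightarrow> y \<notin> B"
  shows "deg X E y = 1"
proof -
  have "deg X E y = ends X A y + (\<Sum>B\<in>E - {A}. ends X B y)" unfolding deg_def using assms(1,2) by (rule sum.remove)
  moreover have "(\<Sum>B\<in>E - {A}. ends X B y) = 0" using assms(5) by (intro sum.neutral) (auto simp: ends_def)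
  ultimately show ?thesis using assms(3,4) by (simp add: ends_def)
qed

text \<open>Each of the four boundary points is an end of exactly one old and of exactly one new
  arc, as \<open>replace_diagram\<close> requires. No other strand meets the frontier, because the
  disc contains only the two arcs.\<close>

lemma bridge_exists:
  assumes D: "polygonal_diagram n D" and K: "closed_disc K" "closed K"
    and A: "arc_across K p q A" and B: "arc_across K r s B" and AB: "A \<inter> B = {}"
    and A': "arc_across K q r A'" and B': "arc_across K s p B'" and AB': "A' \<inter> B' = {}"
    and V: "verts D \<inter> K = {}" and S: "strands D c \<inter> K = A \<union> B" "strands D (other c) \<inter> K = {}"
    and pol: "polygonal A'" "polygonal B'"
  shows "\<exists>D'. polygonal_diagram n D' \<and> bridge_move D D' \<and> verts D' = verts D \<and>
     strands D' c = (strands D c - K) \<union> (A' \<union> B') \<and> strands D' (other c) = strands D (other c)"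
proof -
  have fK: "frontier K \<subseteq> K" using K(2) by (simp add: frontier_subset_eq)
  have co: "c \<noteq> other c" "d = c \<or> d = other c" for d by (cases c; cases d; simp)+
  define Y where "Y d = (if d = c then {p, q, r, s} else {})" for d
  define old where "old d = (if d = c then {A, B} else {})" for d
  define new where "new d = (if d = c then {A', B'} else {})" for d
  have fr: "C \<subseteq> K" "C \<inter> frontier K = {x, y}" if "arc_across K x y C" for x y C
    using that unfolding arc_across_def by simp_all
  have sub: "A \<subseteq> K" "B \<subseteq> K" "A' \<subseteq> K" "B' \<subseteq> K"
    by (rule fr(1)[OF A], rule fr(1)[OF B], rule fr(1)[OF A'], rule fr(1)[OF B'])
  have fi: "A \<inter> frontier K = {p, q}" "B \<inter> frontier K = {r, s}" "A' \<inter> frontier K = {q, r}" "B' \<inter> frontier K = {s, p}"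
    by (rule fr(2)[OF A], rule fr(2)[OF B], rule fr(2)[OF A'], rule fr(2)[OF B'])
  have Yf: "{p, q, r, s} \<subseteq> frontier K" using fi(1,2) by blast
  have AX: "A \<inter> (verts D \<union> {p, q, r, s}) = {p, q}" "B \<inter> (verts D \<union> {p, q, r, s}) = {r, s}"
    "A' \<inter> {p, q, r, s} = {q, r}" "B' \<inter> {p, q, r, s} = {s, p}"
  proof -
    have sec: "C \<inter> (V' \<union> {p, q, r, s}) = P"
      if "C \<inter> frontier K = P" "C \<subseteq> K" "V' \<inter> K = {}" "P \<subseteq> {p, q, r, s}" for C P V'
      using that Yf by blast
    show "A \<inter> (verts D \<union> {p, q, r, s}) = {p, q}" by (rule sec[OF fi(1) sub(1) V]) simp
    show "B \<inter> (verts D \<union> {p, q, r, s}) = {r, s}" by (rule sec[OF fi(2) sub(2) V]) simp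
    show "A' \<inter> {p, q, r, s} = {q, r}" using sec[OF fi(3) sub(3), of "{}"] by simp
    show "B' \<inter> {p, q, r, s} = {s, p}" using sec[OF fi(4) sub(4), of "{}"] by simp
  qed
  note eA = arc_across_edge[OF A AX(1)] and eB = arc_across_edge[OF B AX(2)]
    and eA' = arc_across_edge[OF A' AX(3)] and eB' = arc_across_edge[OF B' AX(4)]
  have "\<exists>D'. polygonal_diagram n D' \<and> verts D' = verts D - K \<and>
           (\<forall>d. strands D' d = (strands D d - K) \<union> \<Union>(new d))"
  proof (rule replace_diagram[OF D K(2), where Y = Y and old = old])
    show "Y d = strands D d \<inter> frontier K" for d
      using co(2)[of d] S fi fK co(1) by (auto simp: Y_def)
    show "finite (Y d)" "finite (old d)" "finite (new d)" for d by (simp_all add: Y_def old_def new_def)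
    show "verts D \<inter> frontier K = {}" using V fK by blast
    show "is_edge (verts D \<union> Y d) C" if "C \<in> old d" for d C
      using that eA(1) eB(1) by (auto simp: old_def Y_def split: if_splits)
    show "C \<inter> C' \<subseteq> verts D \<union> Y d" if "C \<in> old d" "C' \<in> old d" "C \<noteq> C'" for d C C'
      using that AB by (auto simp: old_def split: if_splits)
    show "strands D d \<inter> K = \<Union>(old d)" for d using co(2)[of d] S co(1) by (auto simp: old_def)
    show "deg (verts D \<union> Y d) (old d) y = 1" if y: "y \<in> Y d" for d y
    proof -
      have dc: "d = c" using y by (auto simp: Y_def split: if_splits)
      have X: "verts D \<union> Y d = verts D \<union> {p, q, r, s}" "old d = {A, B}" by (simp_all add: Y_def old_def dc)
      show ?thesis
      proof (cases "y \<in> {p, q}")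
        case True
        then show ?thesis unfolding X using AX(1) eA(2) AB by (intro deg_eq_one[of _ A]) auto
      next
        case False
        then have "y \<in> {r, s}" using y dc by (auto simp: Y_def)
        then show ?thesis unfolding X using AX(2) eB(2) AB by (intro deg_eq_one[of _ B]) auto
      qed
    qed
    show "is_edge (Y d) C" if "C \<in> new d" for d C
      using that eA'(1) eB'(1) by (auto simp: new_def Y_def split: if_splits)
    show "C \<subseteq> K" if "C \<in> new d" for d C using that sub by (auto simp: new_def split: if_splits)
    show "C \<inter> C' \<subseteq> Y d" if "C \<in> new d" "C' \<in> new d" "C \<noteq> C'" for d C C'
      using that AB' by (auto simp: new_def split: if_splits)
    show "deg (Y d) (new d) y = 1" if y: "y \<in> Y d" for d y
    proof -
      have dc: "d = c" using y by (auto simp: Y_def split: if_splits)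
      have X: "Y d = {p, q, r, s}" "new d = {A', B'}" by (simp_all add: Y_def new_def dc)
      show ?thesis
      proof (cases "y \<in> {q, r}")
        case True
        then show ?thesis unfolding X using AX(3) eA'(2) AB' by (intro deg_eq_one[of _ A']) auto
      next
        case False
        then have "y \<in> {s, p}" using y dc by (auto simp: Y_def)
        then show ?thesis unfolding X using AX(4) eB'(2) AB' by (intro deg_eq_one[of _ B']) auto
      qed
    qed
    show "polygonal C" if "C \<in> new d" for d C using that pol by (auto simp: new_def split: if_splits)
    show "\<Union>(new G1) \<inter> \<Union>(new G2) = {}" by (cases c) (auto simp: new_def)
  qed
  then obtain D' where D': "polygonal_diagram n D'" "verts D' = verts D - K"
     "\<And>d. strands D' d = (strands D d - K) \<union> \<Union>(new d)" by blast
  have v: "verts D' = verts D" using D'(2) V by blast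
  have sc: "strands D' c = (strands D c - K) \<union> (A' \<union> B')" using D'(3)[of c] by (simp add: new_def)
  have so: "strands D' (other c) = strands D (other c)" using D'(3)[of "other c"] S(2) co(1) by (auto simp: new_def)
  have so': "same_outside K D D'" unfolding same_outside_def
  proof (intro conjI allI)
    show "verts D - K = verts D' - K" using v by simp
    show "strands D d - K = strands D' d - K" for d using co(2)[of d] sc so sub by auto
  qed
  have sk: "strands D' c \<inter> K = A' \<union> B'" "verts D' \<inter> K = {}" "strands D' (other c) \<inter> K = {}"
    using sc sub v V so S(2) by auto
  note facts = K(1) so' A B AB A' B' AB' V S sk
  have "bridge_move D D'" unfolding bridge_move_def
    apply (rule exI[of _ K], rule exI[of _ c])
    apply (rule exI[of _ p], rule exI[of _ q], rule exI[of _ r], rule exI[of _ s])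
    apply (rule exI[of _ A], rule exI[of _ B], rule exI[of _ A'], rule exI[of _ B'])
    by (intro conjI) (fact facts)+
  then show ?thesis using D'(1) v sc so by blast
qed

section \<open>The model rectangle and its pieces\<close>

lemma unit_segment:
  "closed_segment (Complex a s) (Complex b (s + 1)) = {z. s \<le> Im z \<and> Im z \<le> s + 1 \<and> Re z = a + (Im z - s) * (b - a)}"
proof (intro set_eqI iffI)
  fix z assume "z \<in> closed_segment (Complex a s) (Complex b (s + 1))"
  then obtain u where u: "0 \<le> u" "u \<le> 1" "z = (1 - u) *\<^sub>R Complex a s + u *\<^sub>R Complex b (s + 1)"
    unfolding closed_segment_def by blast
  have "Im z = s + u" "Re z = a + u * (b - a)" unfolding u(3) by (simp_all add: algebra_simps)
  then show "z \<in> {z. s \<le> Im z \<and> Im z \<le> s + 1 \<and> Re z = a + (Im z - s) * (b - a)}" using u by simp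
next
  fix z assume z: "z \<in> {z. s \<le> Im z \<and> Im z \<le> s + 1 \<and> Re z = a + (Im z - s) * (b - a)}"
  have "z = (1 - (Im z - s)) *\<^sub>R Complex a s + (Im z - s) *\<^sub>R Complex b (s + 1)"
    using z by (simp add: complex_eq_iff algebra_simps)
  then show "z \<in> closed_segment (Complex a s) (Complex b (s + 1))"
    using z unfolding closed_segment_def by (intro CollectI exI[of _ "Im z - s"]) auto
qed

lemma vertical_segment:
  assumes "s \<le> t" shows "closed_segment (Complex a s) (Complex a t) = {z. s \<le> Im z \<and> Im z \<le> t \<and> Re z = a}"
  using closed_segment_same_Re[of "Complex a s" "Complex a t"] assms by (auto simp: closed_segment_eq_real_ivl)

lemma model_rect_frontier:
  "frontier (model_rect n) = {z \<in> model_rect n. Re z = 0 \<or> Re z = real n + 1 \<or> Im z = 0 \<or> Im z = 4}"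
proof -
  have eq: "model_rect n = cbox 0 (Complex (real n + 1) 4)"
    by (auto simp: model_rect_def in_cbox_complex_iff)
  then show ?thesis
    by (auto simp: frontier_cbox eq model_rect_def in_cbox_complex_iff in_box_complex_iff)
qed

lemma strand_ends_frontier:
  assumes "i \<le> n"
  shows "Complex (real i) 0 \<in> frontier (model_rect n)" "Complex (real i) 4 \<in> frontier (model_rect n)"
  unfolding model_rect_frontier using assms by (simp_all add: model_rect_def)

definition foot :: "nat \<Rightarrow> nat \<Rightarrow> complex set" where
  "foot n i = closed_segment (Complex (real i) 0) (lower_vertex n)"

definition head :: "nat \<Rightarrow> nat \<Rightarrow> complex set" where
  "head n i = closed_segment (upper_vertex n) (Complex (real i) 4)"

definition waist :: "nat \<Rightarrow> nat \<Rightarrow> complex set" where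
  "waist n i = closed_segment (lower_vertex n) (Complex (real i) 2) \<union> closed_segment (Complex (real i) 2) (upper_vertex n)"

lemma foot_eq: "foot n i = {z. 0 \<le> Im z \<and> Im z \<le> 1 \<and> Re z = real i + Im z * ((real n + 1) / 2 - real i)}"
  unfolding foot_def lower_vertex_def using unit_segment[of "real i" 0 "(real n + 1) / 2"] by simp

lemma head_eq: "head n i = {z. 3 \<le> Im z \<and> Im z \<le> 4 \<and> Re z = real i + (4 - Im z) * ((real n + 1) / 2 - real i)}"
proof -
  have "m + (y - 3) * (k - m) = k + (4 - y) * (m - k)" for y k m :: real by (simp add: algebra_simps)
  then show ?thesis unfolding head_def upper_vertex_def using unit_segment[of "(real n + 1) / 2" 3 "real i"] by simp
qed

lemma waist_eq: "waist n i = {z. 1 \<le> Im z \<and> Im z \<le> 3 \<and> Re z = real i + \<bar>Im z - 2\<bar> * ((real n + 1) / 2 - real i)}"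
proof -
  have 1: "closed_segment (lower_vertex n) (Complex (real i) 2) = {z. 1 \<le> Im z \<and> Im z \<le> 2 \<and> Re z = real i + (2 - Im z) * ((real n + 1) / 2 - real i)}"
  proof -
    have "m + (y - 1) * (k - m) = k + (2 - y) * (m - k)" for y k m :: real by (simp add: algebra_simps)
    then show ?thesis unfolding lower_vertex_def using unit_segment[of "(real n + 1) / 2" 1 "real i"] by simp
  qed
  have 2: "closed_segment (Complex (real i) 2) (upper_vertex n) = {z. 2 \<le> Im z \<and> Im z \<le> 3 \<and> Re z = real i + (Im z - 2) * ((real n + 1) / 2 - real i)}"
    unfolding upper_vertex_def using unit_segment[of "real i" 2 "(real n + 1) / 2"] by simp
  show ?thesis unfolding waist_def 1 2 by (auto simp: abs_if)
qed

lemma pair_picture_eq: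
  "pair_picture n c d = (\<Union>i\<in>{i \<in> {1..n}. strand_color c i = d}. foot n i \<union> head n i) \<union>
     (\<Union>i\<in>{i \<in> {1..n}. other (strand_color c i) = d}. waist n i)"
  unfolding pair_picture_def foot_def head_def waist_def ..

text \<open>The expression is the convex combination \<open>(1 - t) * i + t * ((n + 1) / 2)\<close>,
  and both of its points lie between \<open>1\<close> and \<open>n\<close>.\<close>

lemma convex_comb_bounds:
  assumes "1 \<le> i" "i \<le> n" "0 \<le> t" "t \<le> (1::real)"
  shows "0 < real i + t * ((real n + 1) / 2 - real i)" "real i + t * ((real n + 1) / 2 - real i) < real n + 1"
proof -
  have eq: "real i + t * ((real n + 1) / 2 - real i) = (1 - t) * real i + t * ((real n + 1) / 2)" by (simp add: algebra_simps)
  have "1 - t \<le> (1 - t) * real i" "t \<le> t * ((real n + 1) / 2)"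
    using mult_left_mono[of 1 "real i" "1 - t"] mult_left_mono[of 1 "(real n + 1) / 2" t] assms by simp_all
  then show "0 < real i + t * ((real n + 1) / 2 - real i)" unfolding eq by linarith
  have "(1 - t) * real i \<le> (1 - t) * real n" "t * ((real n + 1) / 2) \<le> t * real n"
    using mult_left_mono[of "real i" "real n" "1 - t"] mult_left_mono[of "(real n + 1) / 2" "real n" t] assms by simp_all
  moreover have "(1 - t) * real n + t * real n = real n" by (simp add: algebra_simps)
  ultimately show "real i + t * ((real n + 1) / 2 - real i) < real n + 1" unfolding eq by linarith
qed

lemma pieces_in_rect:
  assumes "1 \<le> i" "i \<le> n"
  shows "foot n i \<subseteq> model_rect n" "head n i \<subseteq> model_rect n" "waist n i \<subseteq> model_rect n"
    "foot n i \<inter> frontier (model_rect n) = {Complex (real i) 0}"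
    "head n i \<inter> frontier (model_rect n) = {Complex (real i) 4}"
    "waist n i \<inter> frontier (model_rect n) = {}"
proof -
  have f: "0 < Re z \<and> Re z < real n + 1" if "z \<in> foot n i" for z
    using convex_comb_bounds[OF assms, of "Im z"] that by (auto simp: foot_eq)
  have h: "0 < Re z \<and> Re z < real n + 1" if "z \<in> head n i" for z
    using convex_comb_bounds[OF assms, of "4 - Im z"] that by (auto simp: head_eq)
  have w: "0 < Re z \<and> Re z < real n + 1" if "z \<in> waist n i" for z
    using convex_comb_bounds[OF assms, of "\<bar>Im z - 2\<bar>"] that by (auto simp: waist_eq abs_le_iff)
  show s: "foot n i \<subseteq> model_rect n" "head n i \<subseteq> model_rect n" "waist n i \<subseteq> model_rect n"
    using f h w by (auto simp: model_rect_def foot_eq head_eq waist_eq less_imp_le)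
  show "waist n i \<inter> frontier (model_rect n) = {}"
  proof -
    have False if "z \<in> waist n i" "z \<in> frontier (model_rect n)" for z
      using w[OF that(1)] that unfolding model_rect_frontier by (auto simp: waist_eq)
    then show ?thesis by blast
  qed
  show "foot n i \<inter> frontier (model_rect n) = {Complex (real i) 0}"
  proof -
    have "z = Complex (real i) 0" if "z \<in> foot n i" "z \<in> frontier (model_rect n)" for z
      using f[OF that(1)] that unfolding model_rect_frontier by (auto simp: foot_eq complex_eq_iff)
    moreover have "Complex (real i) 0 \<in> foot n i" by (simp add: foot_eq)
    ultimately show ?thesis using strand_ends_frontier(1)[OF assms(2)] by blast
  qed
  show "head n i \<inter> frontier (model_rect n) = {Complex (real i) 4}"
  proof -
    have "z = Complex (real i) 4" if "z \<in> head n i" "z \<in> frontier (model_rect n)" for z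
      using h[OF that(1)] that unfolding model_rect_frontier by (auto simp: head_eq complex_eq_iff)
    moreover have "Complex (real i) 4 \<in> head n i" by (simp add: head_eq)
    ultimately show ?thesis using strand_ends_frontier(2)[OF assms(2)] by blast
  qed
qed

lemma segment_is_edge:
  assumes "a \<noteq> b" "closed_segment a b \<inter> X = {a, b}"
  shows "is_edge X (closed_segment a b)"
  unfolding is_edge_def using assms
  by (intro exI[of _ "linepath a b"]) (auto simp: arc_imp_simple_path)

text \<open>Here the disc is the model rectangle itself. Feet and heads carry the boundary points,
  waists join the two vertices inside, and different pieces meet only in the vertices; these are the
  old edges, to be exchanged for vertical lines.\<close>

lemma cancel_exists:
  assumes D: "polygonal_diagram n D" and n: "n \<ge> 2" and V: "verts D \<inter> model_rect n = {lower_vertex n, upper_vertex n}"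
    and S: "\<And>d. strands D d \<inter> model_rect n = pair_picture n c d"
  shows "\<exists>D'. polygonal_diagram n D' \<and> cancel_move n D D' \<and> verts D' = verts D - {lower_vertex n, upper_vertex n}"
proof -
  let ?K = "model_rect n" let ?L = "lower_vertex n" let ?U = "upper_vertex n"
  define I where "I d = {i \<in> {1..n}. strand_color c i = d}" for d
  define J where "J d = {i \<in> {1..n}. other (strand_color c i) = d}" for d
  have In: "1 \<le> i" "i \<le> n" if "i \<in> I d \<or> i \<in> J d" for i d using that by (auto simp: I_def J_def)
  have fin: "finite (I d)" "finite (J d)" for d by (simp_all add: I_def J_def)
  define Y where "Y d = (\<lambda>i. Complex (real i) 0) ` I d \<union> (\<lambda>i. Complex (real i) 4) ` I d" for d
  define old where "old d = foot n ` I d \<union> head n ` I d \<union> waist n ` J d" for d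
  define line where "line i = closed_segment (Complex (real i) 0) (Complex (real i) 4)" for i :: nat
  define new where "new d = line ` I d" for d
  have line_eq: "line i = {z. 0 \<le> Im z \<and> Im z \<le> 4 \<and> Re z = real i}" for i
    unfolding line_def by (rule vertical_segment) simp
  have K: "closed ?K" "compact ?K"
  proof -
    have "?K = cbox 0 (Complex (real n + 1) 4)" by (auto simp: model_rect_def in_cbox_complex_iff)
    then show "closed ?K" "compact ?K" by (simp_all only: closed_cbox compact_cbox)
  qed
  have fK: "frontier ?K \<subseteq> ?K" using K(1) by (simp add: frontier_subset_eq)
  have LU: "?L \<noteq> ?U" "Im ?L = 1" "Im ?U = 3" "Re ?L = (real n + 1) / 2" "Re ?U = (real n + 1) / 2"
    by (simp_all add: lower_vertex_def upper_vertex_def)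
  have mem: "?L \<in> foot n i" "?U \<in> head n i" "?L \<in> waist n i" "?U \<in> waist n i" "?U \<notin> foot n i" "?L \<notin> head n i" for i
    by (simp_all add: foot_eq head_eq waist_eq LU)
  have YK: "Y d \<subseteq> frontier ?K" for d
    using In strand_ends_frontier[of _ n] unfolding Y_def by blast
  have VY: "C \<inter> (verts D \<union> Y d) = Q \<union> P" if "C \<subseteq> ?K" "C \<inter> Y d = P" "C \<inter> {?L, ?U} = Q" for C P Q d
  proof -
    have "C \<inter> verts D = Q" using V that(1,3) by blast
    then show ?thesis using that(2) by blast
  qed
  have Sfr: "Y d = strands D d \<inter> frontier ?K" for d
  proof -
    have "strands D d \<inter> frontier ?K = pair_picture n c d \<inter> frontier ?K" using S[of d] fK by blast
    also have "\<dots> = (\<Union>i\<in>I d. (foot n i \<inter> frontier ?K) \<union> (head n i \<inter> frontier ?K)) \<union> (\<Union>i\<in>J d. waist n i \<inter> frontier ?K)"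
      unfolding pair_picture_eq I_def J_def by blast
    also have "\<dots> = (\<Union>i\<in>I d. {Complex (real i) 0} \<union> {Complex (real i) 4}) \<union> (\<Union>i\<in>J d. {})"
    proof (intro arg_cong2[where f = "(\<union>)"] SUP_cong refl)
      show "foot n i \<inter> frontier ?K = {Complex (real i) 0}" "head n i \<inter> frontier ?K = {Complex (real i) 4}"
        if i: "i \<in> I d" for i
        by (rule pieces_in_rect(4)[OF In[OF disjI1[OF i]]], rule pieces_in_rect(5)[OF In[OF disjI1[OF i]]])
      show "waist n i \<inter> frontier ?K = {}" if i: "i \<in> J d" for i
        by (rule pieces_in_rect(6)[OF In[OF disjI2[OF i]]])
    qed
    finally show ?thesis unfolding Y_def by blast
  qed
  have footX: "foot n i \<inter> (verts D \<union> Y d) = {Complex (real i) 0, ?L}" if i: "i \<in> I d" for i d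
  proof -
    have n: "1 \<le> i" "i \<le> n" using In i by blast+
    have "foot n i \<inter> Y d \<subseteq> {Complex (real i) 0}" using YK[of d] pieces_in_rect(4)[OF n] by blast
    moreover have "Complex (real i) 0 \<in> foot n i \<inter> Y d" using i by (simp add: foot_eq Y_def)
    ultimately have a: "foot n i \<inter> Y d = {Complex (real i) 0}" by blast
    have b: "foot n i \<inter> {?L, ?U} = {?L}" using mem[of i] by blast
    show ?thesis using VY[OF pieces_in_rect(1)[OF n] a b] by (simp add: insert_commute)
  qed
  have headX: "head n i \<inter> (verts D \<union> Y d) = {?U, Complex (real i) 4}" if i: "i \<in> I d" for i d
  proof -
    have n: "1 \<le> i" "i \<le> n" using In i by blast+
    have "head n i \<inter> Y d \<subseteq> {Complex (real i) 4}" using YK[of d] pieces_in_rect(5)[OF n] by blast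
    moreover have "Complex (real i) 4 \<in> head n i \<inter> Y d" using i by (simp add: head_eq Y_def)
    ultimately have a: "head n i \<inter> Y d = {Complex (real i) 4}" by blast
    have b: "head n i \<inter> {?L, ?U} = {?U}" using mem[of i] by blast
    show ?thesis using VY[OF pieces_in_rect(2)[OF n] a b] by (simp add: insert_commute)
  qed
  have waistX: "waist n i \<inter> (verts D \<union> Y d) = {?L, ?U}" if i: "i \<in> J d" for i d
  proof -
    have n: "1 \<le> i" "i \<le> n" using In i by blast+
    have a: "waist n i \<inter> Y d = {}" using YK[of d] pieces_in_rect(6)[OF n] by blast
    have b: "waist n i \<inter> {?L, ?U} = {?L, ?U}" using mem[of i] by blast
    show ?thesis using VY[OF pieces_in_rect(3)[OF n] a b] by (simp add: insert_commute)
  qed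
  have lineK: "line i \<subseteq> ?K" if "i \<in> I d" for i d using In[of i d] that by (auto simp: line_eq model_rect_def)
  have lineY: "line i \<inter> Y d = {Complex (real i) 0, Complex (real i) 4}" if i: "i \<in> I d" for i d
    using i by (auto simp: line_eq Y_def complex_eq_iff)
  \<comment> \<open>At a common height two feet differ horizontally by
    \<open>(1 - Im z) * (i - j)\<close>, which vanishes only at the vertex. Heads and waists are
    compared in the same way.\<close>
  have footi: "foot n i \<inter> foot n j \<subseteq> {?L}" if "i \<noteq> j" for i j
  proof
    fix z assume "z \<in> foot n i \<inter> foot n j"
    then have z: "Re z = real i + Im z * ((real n + 1) / 2 - real i)" "Re z = real j + Im z * ((real n + 1) / 2 - real j)" by (auto simp: foot_eq)
    then have "(1 - Im z) * (real i - real j) = 0" by (simp add: algebra_simps)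
    then have "Im z = 1" using that by simp
    then show "z \<in> {?L}" using z by (simp add: complex_eq_iff LU)
  qed
  have headi: "head n i \<inter> head n j \<subseteq> {?U}" if "i \<noteq> j" for i j
  proof
    fix z assume "z \<in> head n i \<inter> head n j"
    then have z: "Re z = real i + (4 - Im z) * ((real n + 1) / 2 - real i)" "Re z = real j + (4 - Im z) * ((real n + 1) / 2 - real j)" by (auto simp: head_eq)
    then have "(Im z - 3) * (real i - real j) = 0" by (simp add: algebra_simps)
    then have "Im z = 3" using that by simp
    then show "z \<in> {?U}" using z by (simp add: complex_eq_iff LU)
  qed
  have waisti: "waist n i \<inter> waist n j \<subseteq> {?L, ?U}" if "i \<noteq> j" for i j
  proof
    fix z assume "z \<in> waist n i \<inter> waist n j"
    then have z: "Re z = real i + \<bar>Im z - 2\<bar> * ((real n + 1) / 2 - real i)" "Re z = real j + \<bar>Im z - 2\<bar> * ((real n + 1) / 2 - real j)" by (auto simp: waist_eq)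
    then have "(1 - \<bar>Im z - 2\<bar>) * (real i - real j) = 0" by (simp add: algebra_simps)
    then have a: "\<bar>Im z - 2\<bar> = 1" using that by simp
    then have "Re z = (real n + 1) / 2" using z(1) by simp
    moreover have "Im z = 1 \<or> Im z = 3" using a by linarith
    ultimately show "z \<in> {?L, ?U}" by (auto simp: complex_eq_iff LU)
  qed
  have fw: "foot n i \<inter> waist n j \<subseteq> {?L}" "head n i \<inter> waist n j \<subseteq> {?U}" "foot n i \<inter> head n j = {}" for i j
    by (auto simp: foot_eq waist_eq head_eq complex_eq_iff LU)
  have waist_arc: "is_edge X (waist n i)" if "waist n i \<inter> X = {?L, ?U}" for X i
  proof -
    let ?m = "Complex (real i) 2"
    let ?g = "linepath ?L ?m +++ linepath ?m ?U"
    have s1: "closed_segment ?L ?m \<subseteq> {z. Im z \<le> 2}" "closed_segment ?m ?U \<subseteq> {z. Im z \<ge> 2}"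
      using unit_segment[of "(real n + 1) / 2" 1 "real i"] unit_segment[of "real i" 2 "(real n + 1) / 2"]
      by (auto simp: lower_vertex_def upper_vertex_def)
    have "z = ?m" if "z \<in> closed_segment ?L ?m" "z \<in> closed_segment ?m ?U" for z
    proof -
      have "Im z = 2" using s1 that by force
      then show ?thesis using that(2) unit_segment[of "real i" 2 "(real n + 1) / 2"] by (auto simp: upper_vertex_def complex_eq_iff)
    qed
    then have "arc ?g" using LU by (intro arc_join arc_linepath) (auto simp: complex_eq_iff)
    then have "simple_path ?g" by (rule arc_imp_simple_path)
    moreover have "path_image ?g = waist n i" by (simp add: path_image_join waist_def)
    ultimately show ?thesis unfolding is_edge_def using that by (intro exI[of _ ?g]) auto
  qed
  have co: "c' = d \<or> c' = other d" for c' d by (cases c'; cases d; simp)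
  have "\<exists>D'. polygonal_diagram n D' \<and> verts D' = verts D - ?K \<and>
           (\<forall>d. strands D' d = (strands D d - ?K) \<union> \<Union>(new d))"
  proof (rule replace_diagram[OF D K(1), where Y = Y and old = old])
    show "Y d = strands D d \<inter> frontier ?K" for d by (rule Sfr)
    show "finite (Y d)" "finite (old d)" "finite (new d)" for d using fin by (simp_all add: Y_def old_def new_def)
    have "{?L, ?U} \<inter> frontier ?K = {}" unfolding model_rect_frontier using LU n by auto
    then show "verts D \<inter> frontier ?K = {}" using V fK by blast
    show "is_edge (verts D \<union> Y d) A" if Ao: "A \<in> old d" for d A
    proof -
      consider i where "i \<in> I d" "A = foot n i" | i where "i \<in> I d" "A = head n i" | i where "i \<in> J d" "A = waist n i"
        using Ao unfolding old_def by blast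
      then show ?thesis
      proof cases
        case 1 then show ?thesis using footX[OF 1(1)] segment_is_edge[of "Complex (real i) 0" ?L] LU by (auto simp: foot_def complex_eq_iff)
      next
        case 2 then show ?thesis using headX[OF 2(1)] segment_is_edge[of ?U "Complex (real i) 4"] LU by (auto simp: head_def complex_eq_iff)
      next
        case 3 then show ?thesis using waistX[OF 3(1)] waist_arc by simp
      qed
    qed
    show "A \<inter> B \<subseteq> verts D \<union> Y d" if "A \<in> old d" "B \<in> old d" "A \<noteq> B" for d A B
    proof -
      have cases: "(\<exists>i. C = foot n i) \<or> (\<exists>i. C = head n i) \<or> (\<exists>i. C = waist n i)" if "C \<in> old d" for C
        using that unfolding old_def by blast
      have ii: "foot n i \<noteq> foot n j \<Longrightarrow> foot n i \<inter> foot n j \<subseteq> {?L, ?U}"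
        "head n i \<noteq> head n j \<Longrightarrow> head n i \<inter> head n j \<subseteq> {?L, ?U}"
        "waist n i \<noteq> waist n j \<Longrightarrow> waist n i \<inter> waist n j \<subseteq> {?L, ?U}"
        "foot n i \<inter> head n j \<subseteq> {?L, ?U}" "head n j \<inter> foot n i \<subseteq> {?L, ?U}"
        "foot n i \<inter> waist n j \<subseteq> {?L, ?U}" "waist n j \<inter> foot n i \<subseteq> {?L, ?U}"
        "head n i \<inter> waist n j \<subseteq> {?L, ?U}" "waist n j \<inter> head n i \<subseteq> {?L, ?U}" for i j
        using footi[of i j] headi[of i j] waisti[of i j] fw[of i j] fw(2)[of i j] by blast+
      have "A \<inter> B \<subseteq> {?L, ?U}" using cases[OF that(1)] cases[OF that(2)] that(3)
        by (elim disjE exE) (simp_all only: ii not_False_eq_True)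
      then show ?thesis using V by blast
    qed
    show "strands D d \<inter> ?K = \<Union>(old d)" for d unfolding S pair_picture_eq old_def I_def J_def by blast
    show "deg (verts D \<union> Y d) (old d) y = 1" if y: "y \<in> Y d" for d y
    proof -
      have fo: "finite (old d)" using fin by (simp add: old_def)
      have nw: "y \<notin> waist n j" if "j \<in> J d" for j using pieces_in_rect(6)[of j n] In that YK y by blast
      consider i where "i \<in> I d" "y = Complex (real i) 0" | i where "i \<in> I d" "y = Complex (real i) 4"
        using y by (auto simp: Y_def)
      then show ?thesis
      proof cases
        case 1
        show ?thesis
        proof (rule deg_eq_one[OF fo, of "foot n i"])
          show "foot n i \<in> old d" "y \<in> foot n i" using 1 by (auto simp: old_def foot_eq)
          show "foot n i \<inter> (verts D \<union> Y d) \<noteq> {y}" using footX[OF 1(1)] 1(2) LU by (auto simp: complex_eq_iff doubleton_eq_iff)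
          show "y \<notin> B" if "B \<in> old d" "B \<noteq> foot n i" for B
            using that nw 1 unfolding old_def by (auto simp: foot_eq head_eq)
        qed
      next
        case 2
        show ?thesis
        proof (rule deg_eq_one[OF fo, of "head n i"])
          show "head n i \<in> old d" "y \<in> head n i" using 2 by (auto simp: old_def head_eq)
          show "head n i \<inter> (verts D \<union> Y d) \<noteq> {y}" using headX[OF 2(1)] 2(2) LU by (auto simp: complex_eq_iff doubleton_eq_iff)
          show "y \<notin> B" if "B \<in> old d" "B \<noteq> head n i" for B
            using that nw 2 unfolding old_def by (auto simp: foot_eq head_eq)
        qed
      qed
    qed
    show "is_edge (Y d) A" if "A \<in> new d" for d A
      using that lineY segment_is_edge by (auto simp: new_def line_def complex_eq_iff)
    show "A \<subseteq> ?K" if "A \<in> new d" for d A using that lineK by (auto simp: new_def)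
    show "A \<inter> B \<subseteq> Y d" if "A \<in> new d" "B \<in> new d" "A \<noteq> B" for d A B
      using that by (auto simp: new_def line_eq)
    show "deg (Y d) (new d) y = 1" if y: "y \<in> Y d" for d y
    proof -
      obtain i where i: "i \<in> I d" "y = Complex (real i) 0 \<or> y = Complex (real i) 4" using y by (auto simp: Y_def)
      show ?thesis
      proof (rule deg_eq_one[of _ "line i"])
        show "line i \<in> new d" "finite (new d)" "y \<in> line i" using i fin by (auto simp: new_def line_eq)
        show "line i \<inter> Y d \<noteq> {y}" using lineY[OF i(1)] by (auto simp: doubleton_eq_iff)
        show "y \<notin> B" if "B \<in> new d" "B \<noteq> line i" for B using that i by (auto simp: new_def line_eq)
      qed
    qed
    show "polygonal A" if "A \<in> new d" for d A using that by (auto simp: new_def line_def)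
    show "\<Union>(new G1) \<inter> \<Union>(new G2) = {}"
      by (auto simp: new_def line_eq I_def)
  qed
  then obtain D' where D': "polygonal_diagram n D'" "verts D' = verts D - ?K"
     "\<And>d. strands D' d = (strands D d - ?K) \<union> \<Union>(new d)" by blast
  have newK: "\<Union>(new d) \<subseteq> ?K" for d using lineK by (auto simp: new_def)
  have "cancel_move n D D'" unfolding cancel_move_def
  proof (intro exI conjI allI)
    show "homeomorphism ?K ?K (\<lambda>z. z) (\<lambda>z. z)" by (rule homeomorphism_ident)
    show "same_outside ?K D D'" unfolding same_outside_def using D'(2,3) newK by blast
    show "verts D \<inter> ?K = (\<lambda>z. z) ` {?L, ?U}" using V by simp
    show "strands D d \<inter> ?K = (\<lambda>z. z) ` pair_picture n c d" for d using S by simp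
    show "verts D' \<inter> ?K = {}" using D'(2) by blast
    have "\<Union>(new d) = parallel_picture n c d" for d unfolding parallel_picture_def new_def line_def I_def by blast
    then show "strands D' d \<inter> ?K = (\<lambda>z. z) ` parallel_picture n c d" for d using D'(3)[of d] newK[of d] by auto
  qed
  moreover have "verts D' = verts D - {?L, ?U}" using D'(2) V by blast
  ultimately show ?thesis using D'(1) by blast
qed

section \<open>Arcs across a disc, and trapezoids as discs\<close>

lemma homeomorphic_segment_arc:
  fixes e :: "real \<Rightarrow> complex"
  assumes "a < b" "continuous_on UNIV e" "inj e"
  shows "\<exists>g. arc g \<and> path_image g = e ` {a..b} \<and> pathstart g = e a \<and> pathfinish g = e b"
proof (intro exI conjI)
  let ?g = "\<lambda>t. e (a + t * (b - a))"
  have "continuous_on {0..1} ?g"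
    by (rule continuous_on_compose2[OF assms(2)]) (auto intro!: continuous_intros)
  moreover have "inj_on ?g {0..1}"
  proof (rule inj_onI)
    fix s t assume "?g s = ?g t"
    then have "a + s * (b - a) = a + t * (b - a)" by (rule injD[OF assms(3)])
    then show "s = t" using assms(1) by simp
  qed
  ultimately show "arc ?g" by (simp add: arc_def path_def)
  have "(\<lambda>t. a + t * (b - a)) ` {0..1} = {a..b}"
  proof (intro equalityI subsetI)
    fix x assume "x \<in> (\<lambda>t. a + t * (b - a)) ` {0..1}"
    then obtain t where t: "0 \<le> t" "t \<le> 1" "x = a + t * (b - a)" by auto
    have "0 \<le> t * (b - a)" "t * (b - a) \<le> 1 * (b - a)" using t(1,2) assms(1) by (intro mult_nonneg_nonneg mult_right_mono; simp)+
    then show "x \<in> {a..b}" unfolding t(3) by simp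
  next
    fix x assume x: "x \<in> {a..b}"
    have "x = a + (x - a) / (b - a) * (b - a)" using assms(1) by simp
    moreover have "(x - a) / (b - a) \<in> {0..1}" using x assms(1) by simp
    ultimately show "x \<in> (\<lambda>t. a + t * (b - a)) ` {0..1}" by blast
  qed
  then show "path_image ?g = e ` {a..b}" unfolding path_image_def by (metis image_image)
  show "pathstart ?g = e a" "pathfinish ?g = e b" by (simp_all add: pathstart_def pathfinish_def)
qed

lemma arc_across_image:
  fixes e :: "real \<Rightarrow> complex"
  assumes "a < b" "continuous_on UNIV e" "inj e" "e ` {a..b} \<subseteq> K"
    and "\<And>t. a \<le> t \<Longrightarrow> t \<le> b \<Longrightarrow> e t \<in> frontier K \<longleftrightarrow> t = a \<or> t = b"
  shows "arc_across K (e a) (e b) (e ` {a..b})" "arc_across K (e b) (e a) (e ` {a..b})"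
proof -
  obtain g where g: "arc g" "path_image g = e ` {a..b}" "pathstart g = e a" "pathfinish g = e b"
    using homeomorphic_segment_arc[OF assms(1-3)] by blast
  have f: "e ` {a..b} \<inter> frontier K = {e a, e b}" using assms(1,5) by auto
  show "arc_across K (e a) (e b) (e ` {a..b})" unfolding arc_across_def using f g assms(4) by blast
  have "arc (reversepath g)" "path_image (reversepath g) = e ` {a..b}" "pathstart (reversepath g) = e b" "pathfinish (reversepath g) = e a"
    using g by (simp_all add: arc_reversepath)
  then show "arc_across K (e b) (e a) (e ` {a..b})" unfolding arc_across_def using f assms(4) by (metis insert_commute)
qed

text \<open>The graph is the image of a horizontal segment under a piecewise affine map.\<close>

lemma polygonal_graph:
  assumes "pw_affine (\<lambda>z. f (Re z))" shows "polygonal ((\<lambda>x. Complex x (f x)) ` {a..b})"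
proof (cases "a \<le> b")
  case True
  have "pw_affine (\<lambda>z. Complex (Re z) (f (Re z)))" by (intro pw_affine_Complex pw_affine_Re assms)
  then have "polygonal ((\<lambda>z. Complex (Re z) (f (Re z))) ` closed_segment (Complex a 0) (Complex b 0))"
    by (rule polygonal_image) simp
  moreover have "closed_segment (Complex a 0) (Complex b 0) = (\<lambda>x. Complex x 0) ` {a..b}"
  proof -
    have "z = Complex (Re z) 0" if "Im z = 0" for z using that by (simp add: complex_eq_iff)
    then show ?thesis using closed_segment_same_Im[of "Complex a 0" "Complex b 0"] True
      by (fastforce simp: closed_segment_eq_real_ivl)
  qed
  ultimately show ?thesis by (simp add: image_image)
qed simp

definition trapezoid :: "real \<Rightarrow> real \<Rightarrow> real \<Rightarrow> real \<Rightarrow> complex set" where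
  "trapezoid lo hi \<eta> \<beta> = {z. lo \<le> Im z \<and> Im z \<le> hi \<and> \<bar>Re z\<bar> \<le> \<eta> + \<beta> * Im z}"

lemma interior_move:
  fixes z v :: complex
  assumes "z \<in> interior K" shows "\<exists>\<epsilon>>0. z + of_real \<epsilon> * v \<in> K"
proof -
  obtain e where e: "e > 0" "ball z e \<subseteq> K" using assms mem_interior by blast
  define \<epsilon> where "\<epsilon> = e / (2 * (1 + norm v))"
  have p: "1 + norm v > 0" using norm_ge_zero[of v] by linarith
  have "\<epsilon> > 0" using e(1) p by (simp add: \<epsilon>_def)
  have "norm v < 2 * (1 + norm v)" using p norm_ge_zero[of v] by argo
  then have "\<epsilon> * norm v < \<epsilon> * (2 * (1 + norm v))" using \<open>\<epsilon> > 0\<close> by (rule mult_strict_left_mono)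
  also have "\<dots> = e" using p by (simp add: \<epsilon>_def)
  finally have "norm (of_real \<epsilon> * v) < e" using \<open>\<epsilon> > 0\<close> by (simp add: norm_mult)
  then have "z + of_real \<epsilon> * v \<in> ball z e" by (simp add: dist_norm)
  then show ?thesis using e(2) \<open>\<epsilon> > 0\<close> by blast
qed

text \<open>A compact convex set with interior points is a disc. For the frontier, a point on one of
  the four sides can be pushed out of the set by a small step in one of the directions
  \<open>1\<close>, \<open>-1\<close>, \<open>\<i>\<close>, \<open>- \<i>\<close>.\<close>

lemma trapezoid_disc:
  assumes "lo < hi" "0 < \<eta>" "0 < \<beta>" "0 < lo"
  shows "closed (trapezoid lo hi \<eta> \<beta>)" "closed_disc (trapezoid lo hi \<eta> \<beta>)"
    "frontier (trapezoid lo hi \<eta> \<beta>) = {z \<in> trapezoid lo hi \<eta> \<beta>. Im z = lo \<or> Im z = hi \<or> \<bar>Re z\<bar> = \<eta> + \<beta> * Im z}"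
proof -
  let ?K = "trapezoid lo hi \<eta> \<beta>"
  let ?O = "{z. lo < Im z \<and> Im z < hi \<and> \<bar>Re z\<bar> < \<eta> + \<beta> * Im z}"
  have hs: "?K = {z. inner (Complex 0 (-1)) z \<le> - lo} \<inter> {z. inner (Complex 0 1) z \<le> hi} \<inter>
      {z. inner (Complex 1 (-\<beta>)) z \<le> \<eta>} \<inter> {z. inner (Complex (-1) (-\<beta>)) z \<le> \<eta>}"
    by (auto simp: trapezoid_def inner_complex_def abs_le_iff)
  have oO: "open ?O" by (intro open_Collect_conj open_Collect_less continuous_intros)
  show cl: "closed ?K" unfolding hs by (intro closed_Int closed_halfspace_le)
  have cv: "convex ?K" unfolding hs by (intro convex_Int convex_halfspace_le)
  have "?K \<subseteq> cbox (Complex (- (\<eta> + \<beta> * hi)) lo) (Complex (\<eta> + \<beta> * hi) hi)"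
  proof
    fix z assume z: "z \<in> ?K"
    then have "\<beta> * Im z \<le> \<beta> * hi" using assms(3) by (intro mult_left_mono) (auto simp: trapezoid_def)
    then show "z \<in> cbox (Complex (- (\<eta> + \<beta> * hi)) lo) (Complex (\<eta> + \<beta> * hi) hi)"
      using z by (auto simp: trapezoid_def in_cbox_complex_iff abs_le_iff)
  qed
  then have "bounded ?K" by (rule bounded_subset[OF bounded_cbox])
  then have cp: "compact ?K" using cl by (simp add: compact_eq_bounded_closed)
  have OK: "?O \<subseteq> interior ?K" using oO by (intro interior_maximal) (auto simp: trapezoid_def)
  have "0 < \<eta> + \<beta> * ((lo + hi) / 2)" using assms by (intro add_pos_pos mult_pos_pos) auto
  then have "Complex 0 ((lo + hi) / 2) \<in> ?O" using assms by (simp add: field_simps)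
  then have ne: "interior ?K \<noteq> {}" using OK by blast
  show "closed_disc ?K" unfolding closed_disc_def
    by (rule homeomorphic_convex_compact_cball[OF cv cp ne]) simp
  have notin: "z \<notin> interior ?K" if z: "z \<in> ?K" "Im z = lo \<or> Im z = hi \<or> \<bar>Re z\<bar> = \<eta> + \<beta> * Im z" for z
  proof
    assume i: "z \<in> interior ?K"
    consider "Im z = lo" | "Im z = hi" | "\<bar>Re z\<bar> = \<eta> + \<beta> * Im z" "Re z \<ge> 0" | "\<bar>Re z\<bar> = \<eta> + \<beta> * Im z" "Re z < 0"
      using z(2) by linarith
    then show False
    proof cases
      case 1 then show False using interior_move[OF i, of "- \<i>"] by (auto simp: trapezoid_def)
    next
      case 2 then show False using interior_move[OF i, of "\<i>"] by (auto simp: trapezoid_def)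
    next
      case 3 then show False using interior_move[OF i, of 1] by (auto simp: trapezoid_def)
    next
      case 4 then show False using interior_move[OF i, of "- 1"] by (auto simp: trapezoid_def)
    qed
  qed
  have int: "interior ?K = ?O"
  proof (intro equalityI OK subsetI)
    fix z assume z: "z \<in> interior ?K"
    then have "z \<in> ?K" using interior_subset by blast
    then show "z \<in> ?O" using notin[OF \<open>z \<in> ?K\<close>] z unfolding trapezoid_def by force
  qed
  show "frontier ?K = {z \<in> ?K. Im z = lo \<or> Im z = hi \<or> \<bar>Re z\<bar> = \<eta> + \<beta> * Im z}"
    unfolding frontier_def closure_closed[OF cl] int by (auto simp: trapezoid_def)
qed

section \<open>Reconnecting two prongs to a tent and a cap\<close>

definition tent :: "real \<Rightarrow> complex set" where
  "tent h = {z. \<bar>Re z\<bar> \<le> 1 \<and> Im z = h * (1 - \<bar>Re z\<bar>)}"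

text \<open>A horizontal segment at height \<open>h\<close> whose ends are continued upwards along
  the outer parts \<open>\<bar>Re z\<bar> = \<eta> + b * Im z\<close> of the prongs.\<close>

definition cap :: "real \<Rightarrow> real \<Rightarrow> real \<Rightarrow> complex set" where
  "cap h \<eta> b = {z. Im z = max h ((\<bar>Re z\<bar> - \<eta>) / b)}"

definition prongs :: "real \<Rightarrow> real \<Rightarrow> real \<Rightarrow> complex set" where
  "prongs h \<eta> b = {z. 0 \<le> Im z \<and> \<bar>Re z\<bar> = max (1 - Im z / h) (\<eta> + b * Im z)}"

text \<open>The left and right prongs meet the trapezoid in two arcs; reconnecting them inside the
  trapezoid turns the prongs into a tent below and a cap above.\<close>

lemma trapezoid_bridge:
  assumes h: "0 < h" "h < h'" "h' < hi" and lo: "0 < lo" "lo < y" and pos: "0 < \<eta>" "0 < b" "b < \<beta>"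
    and y: "\<eta> + \<beta> * y = 1 - y / h"
  defines "K \<equiv> trapezoid lo hi \<eta> \<beta>"
  shows "\<exists>p q r s A B A' B'. arc_across K p q A \<and> arc_across K r s B \<and> A \<inter> B = {} \<and>
     arc_across K q r A' \<and> arc_across K s p B' \<and> A' \<inter> B' = {} \<and> polygonal A' \<and> polygonal B' \<and>
     prongs h \<eta> b \<inter> K = A \<union> B \<and> (tent h \<union> cap h' \<eta> b) \<inter> K = A' \<union> B'" (is ?ex)
    "prongs h \<eta> b - K = (tent h \<union> cap h' \<eta> b) - K"
proof -
  define F where "F t = max (1 - t / h) (\<eta> + b * t)" for t
  have \<beta>: "0 < \<beta>" using pos by linarith
  have y0: "0 < y" using lo by linarith
  \<comment> \<open>At height \<open>y\<close> the sides of the trapezoid cross the slanted legs, at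
    distance \<open>X\<close> from the axis. These are the two lower boundary points; the upper two,
    at distance \<open>Z\<close>, lie on the top side.\<close>
  define X where "X = 1 - y / h"
  have X: "X = \<eta> + \<beta> * y" using y by (simp add: X_def)
  have X0: "0 < X" unfolding X using pos \<beta> y0 by (intro add_pos_pos mult_pos_pos)
  have "y / h < 1" using X0 by (simp add: X_def)
  then have yh: "y < h" using h(1) by (simp add: divide_simps)
  have yX: "y = h * (1 - X)" using h(1) by (simp add: X_def)
  have hi0: "y < hi" "lo < hi" "h < hi" "0 < hi" using yh h lo by linarith+
  define Z where "Z = \<eta> + b * hi"
  have Z0: "0 < Z" unfolding Z_def using pos hi0 by (intro add_pos_pos mult_pos_pos)
  note tr = trapezoid_disc[OF hi0(2) pos(1) \<beta> lo(1), folded K_def]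
  have memK: "z \<in> K \<longleftrightarrow> lo \<le> Im z \<and> Im z \<le> hi \<and> \<bar>Re z\<bar> \<le> \<eta> + \<beta> * Im z" for z by (simp add: K_def trapezoid_def)
  have fr: "z \<in> frontier K \<longleftrightarrow> z \<in> K \<and> (Im z = lo \<or> Im z = hi \<or> \<bar>Re z\<bar> = \<eta> + \<beta> * Im z)" for z using tr(3) by blast
  \<comment> \<open>The half-width of the trapezoid minus that of the legs is affine in the height
    with zero \<open>y\<close>, so the legs are inside exactly above \<open>y\<close>.\<close>
  have gap: "\<eta> + \<beta> * t - (1 - t / h) = (\<beta> + 1 / h) * (t - y)" for t
  proof -
    have "(\<beta> + 1 / h) * (t - y) = \<beta> * t + t / h - (\<beta> * y + y / h)" by (simp add: algebra_simps diff_divide_distrib)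
    then show ?thesis using y by linarith
  qed
  have sl: "0 < \<beta> + 1 / h" using \<beta> h(1) by (intro add_pos_pos) simp_all
  have le_gap: "1 - t / h \<le> \<eta> + \<beta> * t \<longleftrightarrow> y \<le> t" "1 - t / h < \<eta> + \<beta> * t \<longleftrightarrow> y < t" for t
  proof -
    have "0 \<le> (\<beta> + 1 / h) * (t - y) \<longleftrightarrow> y \<le> t" "0 < (\<beta> + 1 / h) * (t - y) \<longleftrightarrow> y < t"
      using sl by (simp_all add: zero_le_mult_iff zero_less_mult_iff)
    then show "1 - t / h \<le> \<eta> + \<beta> * t \<longleftrightarrow> y \<le> t" "1 - t / h < \<eta> + \<beta> * t \<longleftrightarrow> y < t" using gap[of t] by linarith+
  qed
  have b\<beta>: "b * t < \<beta> * t" if "0 < t" for t using that pos by simp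
  have Fle: "F t \<le> \<eta> + \<beta> * t \<longleftrightarrow> y \<le> t" "F t < \<eta> + \<beta> * t \<longleftrightarrow> y < t" if "0 < t" for t
    using le_gap[of t] b\<beta>[OF that] unfolding F_def by auto
  have F0: "0 < F t" if "0 \<le> t" for t
  proof -
    have "0 < \<eta> + b * t" using pos that by (intro add_pos_nonneg) simp_all
    then show ?thesis by (simp add: F_def)
  qed
  have Fy: "F y = X" using b\<beta>[OF y0] X by (simp add: F_def X_def[symmetric])
  have Fbig: "F t = \<eta> + b * t" if "h \<le> t" for t
  proof -
    have "1 - t / h \<le> 0" using that h(1) by simp
    moreover have "0 \<le> \<eta> + b * t" using pos h(1) that by (intro add_nonneg_nonneg mult_nonneg_nonneg) linarith+
    ultimately show ?thesis by (simp add: F_def)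
  qed
  have Fsmall: "F t = 1 - t / h" if "0 \<le> t" "t \<le> y" for t
  proof -
    have "b * t \<le> \<beta> * t" using that(1) pos by (intro mult_right_mono) linarith+
    moreover have "\<eta> + \<beta> * t \<le> 1 - t / h" using le_gap(2)[of t] that(2) by linarith
    ultimately show ?thesis by (simp add: F_def)
  qed
  have Fhi: "F hi = Z" using Fbig[of hi] hi0 by (simp add: Z_def)
  have cF: "continuous_on UNIV F" unfolding F_def by (intro continuous_intros) (use h in auto)
  \<comment> \<open>The prongs cross \<open>K\<close> in \<open>A\<close> and \<open>B\<close>, from
    the sides at height \<open>y\<close> to the top. The arcs \<open>A'\<close> and
    \<open>B'\<close> join the same four points the other way: the upper two along the cap, the
    lower two along the tent.\<close>
  define A where "A = (\<lambda>t. Complex (- F t) t) ` {y..hi}"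
  define B where "B = (\<lambda>t. Complex (F t) t) ` {y..hi}"
  define C where "C x = max h' ((\<bar>x\<bar> - \<eta>) / b)" for x
  define A' where "A' = (\<lambda>x. Complex x (C x)) ` {-Z..Z}"
  define B' where "B' = (\<lambda>x. Complex x (h * (1 - \<bar>x\<bar>))) ` {-X..X}"
  have side: "s \<in> K \<and> (s \<in> frontier K \<longleftrightarrow> t = y \<or> t = hi)" if t: "y \<le> t" "t \<le> hi" and s: "\<bar>Re s\<bar> = F t" "Im s = t" for s t
  proof -
    have t0: "0 < t" "lo < t" using t y0 lo by linarith+
    have "F t \<le> \<eta> + \<beta> * t" "F t = \<eta> + \<beta> * t \<longleftrightarrow> t = y" using Fle[OF t0(1)] t by linarith+
    then show ?thesis unfolding fr unfolding memK s using t t0 by auto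
  qed
  have AK: "arc_across K (Complex (- X) y) (Complex (- Z) hi) A"
  proof -
    have "Complex (- F t) t \<in> K" "Complex (- F t) t \<in> frontier K \<longleftrightarrow> t = y \<or> t = hi" if "y \<le> t" "t \<le> hi" for t
      using side[OF that, of "Complex (- F t) t"] F0[of t] that y0 by simp_all
    moreover have "continuous_on UNIV (\<lambda>t. Complex (- F t) t)" by (intro continuous_intros cF)
    moreover have "inj (\<lambda>t. Complex (- F t) t)" by (rule injI) simp
    ultimately show ?thesis using arc_across_image(1)[of y hi "\<lambda>t. Complex (- F t) t" K] hi0(1)
      unfolding A_def Fy Fhi image_subset_iff by simp
  qed
  have BK: "arc_across K (Complex Z hi) (Complex X y) B"
  proof -
    have "Complex (F t) t \<in> K" "Complex (F t) t \<in> frontier K \<longleftrightarrow> t = y \<or> t = hi" if "y \<le> t" "t \<le> hi" for t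
      using side[OF that, of "Complex (F t) t"] F0[of t] that y0 by simp_all
    moreover have "continuous_on UNIV (\<lambda>t. Complex (F t) t)" by (intro continuous_intros cF)
    moreover have "inj (\<lambda>t. Complex (F t) t)" by (rule injI) simp
    ultimately show ?thesis using arc_across_image(2)[of y hi "\<lambda>t. Complex (F t) t" K] hi0(1)
      unfolding B_def Fy Fhi image_subset_iff by simp
  qed
  have AB: "A \<inter> B = {}"
  proof -
    have False if z: "z \<in> A" "z \<in> B" for z
    proof -
      have "Re z < 0" using z(1) F0 y0 unfolding A_def by force
      moreover have "0 < Re z" using z(2) F0 y0 unfolding B_def by force
      ultimately show False by simp
    qed
    then show ?thesis by blast
  qed
  have capC: "s \<in> K \<and> (s \<in> frontier K \<longleftrightarrow> \<bar>x\<bar> = Z)" if x: "\<bar>x\<bar> \<le> Z" and s: "Re s = x" "Im s = C x" for s x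
  proof -
    have c1: "(\<bar>x\<bar> - \<eta>) / b \<le> hi" "(\<bar>x\<bar> - \<eta>) / b = hi \<longleftrightarrow> \<bar>x\<bar> = Z"
      using x pos(2) by (auto simp: Z_def divide_simps algebra_simps)
    have c: "h' \<le> C x" "C x \<le> hi" "C x = hi \<longleftrightarrow> \<bar>x\<bar> = Z" using c1 h unfolding C_def by auto
    have "0 < C x" "lo < C x" using c h yh lo by linarith+
    have "(\<bar>x\<bar> - \<eta>) / b \<le> C x" by (simp add: C_def)
    then have "\<bar>x\<bar> \<le> \<eta> + b * C x" using pos(2) by (simp add: divide_simps algebra_simps)
    then have "\<bar>x\<bar> < \<eta> + \<beta> * C x" using b\<beta>[OF \<open>0 < C x\<close>] by linarith
    then show ?thesis unfolding fr unfolding memK s using c \<open>lo < C x\<close> by auto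
  qed
  have tentC: "s \<in> K \<and> (s \<in> frontier K \<longleftrightarrow> \<bar>x\<bar> = X)" if x: "\<bar>x\<bar> \<le> X" and s: "Re s = x" "Im s = h * (1 - \<bar>x\<bar>)" for s x
  proof -
    let ?t = "h * (1 - \<bar>x\<bar>)"
    have xt: "\<bar>x\<bar> = 1 - ?t / h" using h(1) by simp
    have t1: "y \<le> ?t" unfolding yX using x h(1) by (intro mult_left_mono) auto
    have t2: "?t = y \<longleftrightarrow> \<bar>x\<bar> = X" unfolding yX using h(1) by simp
    have t3: "?t \<le> h" using h(1) by (simp add: mult_le_cancel_left1)
    have "\<bar>x\<bar> \<le> \<eta> + \<beta> * ?t" "\<bar>x\<bar> = \<eta> + \<beta> * ?t \<longleftrightarrow> ?t = y" using le_gap[of ?t] t1 xt by linarith+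
    then show ?thesis unfolding fr unfolding memK s using t1 t2 t3 lo hi0 by auto
  qed
  have ends: "C Z = hi" "C (- Z) = hi" "h * (1 - \<bar>X\<bar>) = y" "h * (1 - \<bar>- X\<bar>) = y"
    using pos(2) h Z0 X0 yX by (simp_all add: C_def Z_def)
  have cC: "continuous_on UNIV C" unfolding C_def by (intro continuous_intros) (use pos in auto)
  have AK': "arc_across K (Complex (- Z) hi) (Complex Z hi) A'"
  proof -
    have "Complex x (C x) \<in> K" "Complex x (C x) \<in> frontier K \<longleftrightarrow> x = - Z \<or> x = Z" if "- Z \<le> x" "x \<le> Z" for x
      using capC[of x "Complex x (C x)"] that Z0 by (auto simp: abs_if)
    moreover have "continuous_on UNIV (\<lambda>x. Complex x (C x))" by (intro continuous_intros cC)
    moreover have "inj (\<lambda>x. Complex x (C x))" by (rule injI) simp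
    ultimately show ?thesis using arc_across_image(1)[of "- Z" Z "\<lambda>x. Complex x (C x)" K] Z0
      unfolding A'_def ends image_subset_iff by simp
  qed
  have BK': "arc_across K (Complex X y) (Complex (- X) y) B'"
  proof -
    have "Complex x (h * (1 - \<bar>x\<bar>)) \<in> K" "Complex x (h * (1 - \<bar>x\<bar>)) \<in> frontier K \<longleftrightarrow> x = - X \<or> x = X"
      if "- X \<le> x" "x \<le> X" for x
      using tentC[of x "Complex x (h * (1 - \<bar>x\<bar>))"] that X0 by (auto simp: abs_if)
    moreover have "continuous_on UNIV (\<lambda>x. Complex x (h * (1 - \<bar>x\<bar>)))" by (intro continuous_intros)
    moreover have "inj (\<lambda>x. Complex x (h * (1 - \<bar>x\<bar>)))" by (rule injI) simp
    ultimately show ?thesis using arc_across_image(2)[of "- X" X "\<lambda>x. Complex x (h * (1 - \<bar>x\<bar>))" K] X0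
      unfolding B'_def ends image_subset_iff by simp
  qed
  have AB': "A' \<inter> B' = {}"
  proof -
    have "h * (1 - \<bar>x\<bar>) \<le> h" "h' \<le> C x" for x using h(1) by (simp_all add: mult_le_cancel_left1 C_def)
    then have ne: "C u \<noteq> h * (1 - \<bar>x\<bar>)" for x u using h(2) by (metis not_le order_trans)
    have False if z: "z \<in> A'" "z \<in> B'" for z
      using z(1) z(2) ne[of "Re z" "Re z"] unfolding A'_def B'_def by auto
    then show ?thesis by blast
  qed
  have pol: "polygonal A'" "polygonal B'" unfolding A'_def B'_def C_def
    by (intro polygonal_graph pw_affine_max pw_affine_divide pw_affine_mult pw_affine_diff pw_affine_abs pw_affine_Re pw_affine_const)+
  have pr: "z \<in> prongs h \<eta> b \<longleftrightarrow> 0 \<le> Im z \<and> \<bar>Re z\<bar> = F (Im z)" for z by (simp add: prongs_def F_def)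
  have PK: "prongs h \<eta> b \<inter> K = A \<union> B"
  proof (intro equalityI subsetI)
    fix z assume z: "z \<in> prongs h \<eta> b \<inter> K"
    then have i: "0 < Im z" "Im z \<le> hi" "\<bar>Re z\<bar> = F (Im z)" "F (Im z) \<le> \<eta> + \<beta> * Im z" using lo by (auto simp: pr memK)
    then have "y \<le> Im z" using Fle(1) by blast
    moreover have "z = Complex (F (Im z)) (Im z) \<or> z = Complex (- F (Im z)) (Im z)" using i(3) by (auto simp: complex_eq_iff abs_if split: if_splits)
    moreover have "z \<in> B" if "z = Complex (F (Im z)) (Im z)" "y \<le> Im z"
      unfolding B_def by (rule image_eqI[where x = "Im z"], rule that(1)) (use that(2) i(2) in simp)
    moreover have "z \<in> A" if "z = Complex (- F (Im z)) (Im z)" "y \<le> Im z"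
      unfolding A_def by (rule image_eqI[where x = "Im z"], rule that(1)) (use that(2) i(2) in simp)
    ultimately show "z \<in> A \<union> B" by blast
  next
    fix z assume "z \<in> A \<union> B"
    then obtain t where t: "y \<le> t" "t \<le> hi" "z = Complex (F t) t \<or> z = Complex (- F t) t" unfolding A_def B_def by auto
    have "\<bar>Re z\<bar> = F t" "Im z = t" using t(3) F0[of t] t(1) y0 by auto
    then show "z \<in> prongs h \<eta> b \<inter> K" using side[OF t(1,2)] t(1) y0 by (simp add: pr)
  qed
  have tK: "z \<in> tent h \<and> \<bar>Re z\<bar> \<le> X" if "z \<in> tent h" "y \<le> Im z" for z
  proof -
    have "h * (1 - X) \<le> h * (1 - \<bar>Re z\<bar>)" using that yX by (simp add: tent_def)
    then show ?thesis using that(1) h(1) by simp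
  qed
  have tB: "tent h \<inter> K = B'"
  proof (intro equalityI subsetI)
    fix z assume z: "z \<in> tent h \<inter> K"
    then have "\<bar>Re z\<bar> = 1 - Im z / h" using h(1) by (simp add: tent_def)
    then have "y \<le> Im z" using z le_gap(1)[of "Im z"] by (simp add: memK)
    then have "\<bar>Re z\<bar> \<le> X" using tK z by blast
    moreover have e: "z = Complex (Re z) (h * (1 - \<bar>Re z\<bar>))" using z by (simp add: tent_def complex_eq_iff)
    ultimately show "z \<in> B'" unfolding B'_def by (intro image_eqI[where x = "Re z"], intro e) (simp add: abs_le_iff)
  next
    fix z assume "z \<in> B'"
    then obtain x where x: "\<bar>x\<bar> \<le> X" "z = Complex x (h * (1 - \<bar>x\<bar>))" unfolding B'_def by auto
    have "z \<in> K" using tentC[OF x(1)] x(2) by simp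
    moreover have "X \<le> 1" using y0 h(1) by (simp add: X_def)
    ultimately show "z \<in> tent h \<inter> K" using x by (simp add: tent_def)
  qed
  have cA: "cap h' \<eta> b \<inter> K = A'"
  proof (intro equalityI subsetI)
    fix z assume z: "z \<in> cap h' \<eta> b \<inter> K"
    then have "Im z = max h' ((\<bar>Re z\<bar> - \<eta>) / b)" and "z \<in> K" unfolding cap_def by blast+
    then have "Im z = max h' ((\<bar>Re z\<bar> - \<eta>) / b)" and "Im z \<le> hi" unfolding memK by blast+
    then have "(\<bar>Re z\<bar> - \<eta>) / b \<le> hi" by (metis max.cobounded2 order_trans)
    then have "\<bar>Re z\<bar> \<le> Z" using pos(2) by (simp add: Z_def divide_simps algebra_simps)
    moreover have e: "z = Complex (Re z) (C (Re z))" using z by (simp add: cap_def C_def complex_eq_iff)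
    ultimately show "z \<in> A'" unfolding A'_def by (intro image_eqI[where x = "Re z"], intro e) (simp add: abs_le_iff)
  next
    fix z assume "z \<in> A'"
    then obtain x where x: "\<bar>x\<bar> \<le> Z" "z = Complex x (C x)" unfolding A'_def by auto
    have "z \<in> K" using capC[OF x(1)] x(2) by simp
    then show "z \<in> cap h' \<eta> b \<inter> K" using x by (simp add: cap_def C_def)
  qed
  have "(tent h \<union> cap h' \<eta> b) \<inter> K = A' \<union> B'" using tB cA by blast
  then show ?ex using AK BK AB AK' BK' AB' pol PK by blast
  show "prongs h \<eta> b - K = (tent h \<union> cap h' \<eta> b) - K"
  proof (intro equalityI subsetI)
    fix z assume z: "z \<in> prongs h \<eta> b - K"
    then have i: "0 \<le> Im z" "\<bar>Re z\<bar> = F (Im z)" by (auto simp: pr)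
    show "z \<in> (tent h \<union> cap h' \<eta> b) - K"
    proof (cases "y \<le> Im z")
      case True
      then have "0 < Im z" "lo \<le> Im z" using y0 lo by linarith+
      then have "hi < Im z" using z Fle(1)[of "Im z"] True i(2) by (auto simp: memK)
      then have "\<bar>Re z\<bar> = \<eta> + b * Im z" using Fbig[of "Im z"] i(2) hi0(3) by simp
      then have "(\<bar>Re z\<bar> - \<eta>) / b = Im z" using pos(2) by simp
      then have "z \<in> cap h' \<eta> b" using \<open>hi < Im z\<close> h by (simp add: cap_def)
      then show ?thesis using z by blast
    next
      case False
      then have "\<bar>Re z\<bar> = 1 - Im z / h" using Fsmall[of "Im z"] i by simp
      then have "z \<in> tent h" using i(1) h(1) by (simp add: tent_def)
      then show ?thesis using z by blast
    qed
  next
    fix z assume z: "z \<in> (tent h \<union> cap h' \<eta> b) - K"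
    then consider "z \<in> tent h" | "z \<in> cap h' \<eta> b" by blast
    then have "z \<in> prongs h \<eta> b"
    proof cases
      case 1
      have "\<not> y \<le> Im z"
      proof
        assume "y \<le> Im z"
        then have "\<bar>Re z\<bar> \<le> X" using tK 1 by blast
        then show False using tentC[of "Re z" z] 1 z by (simp add: tent_def)
      qed
      moreover have "0 \<le> Im z" using 1 h(1) by (simp add: tent_def)
      moreover have "\<bar>Re z\<bar> = 1 - Im z / h" using 1 h(1) by (simp add: tent_def)
      ultimately show ?thesis using Fsmall[of "Im z"] by (simp add: pr)
    next
      case 2
      have "\<not> \<bar>Re z\<bar> \<le> Z" using capC[of "Re z" z] 2 z by (auto simp: cap_def C_def)
      then have "hi < (\<bar>Re z\<bar> - \<eta>) / b" using pos(2) by (simp add: Z_def divide_simps algebra_simps)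
      then have i: "Im z = (\<bar>Re z\<bar> - \<eta>) / b" "hi < Im z" using 2 h by (auto simp: cap_def)
      then have "\<bar>Re z\<bar> = \<eta> + b * Im z" using pos(2) by simp
      then show ?thesis using Fbig[of "Im z"] i(2) hi0 by (simp add: pr)
    qed
    then show "z \<in> prongs h \<eta> b - K" using z by blast
  qed
qed

section \<open>The sequence of bridge moves\<close>

definition stage :: "nat \<Rightarrow> real \<Rightarrow> gen \<Rightarrow> nat \<Rightarrow> gen \<Rightarrow> complex set" where
  "stage n \<eta> c0 i c = lower_part n c0 c \<union>
     (\<Union>j\<in>{j. 1 \<le> j \<and> j \<le> i \<and> cut_color c0 j = c}. tent (real j) \<union> cap (2 * real n - real j) \<eta> (\<eta> * (2 - 1 / real j))) \<union>
     (\<Union>j\<in>{j. i < j \<and> j < n \<and> cut_color c0 j = c}. upper_strands \<eta> j)"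

lemma upper_strands_eq_prongs: "upper_strands \<eta> j = prongs (real j) \<eta> (\<eta> * (2 - 1 / real j))"
  by (simp add: upper_strands_def prongs_def algebra_simps)

lemma lower_part_below: "z \<in> lower_part n c0 c \<Longrightarrow> Im z \<le> 0"
  by (auto simp: lower_part_def axis_def axis_eq lower_strands_def split: if_splits)

text \<open>The innermost pair not yet joined is number \<open>Suc i\<close>. Below it are the
  finished tents, of height at most \<open>i\<close>; above it the finished caps, at height at least
  \<open>2 * n - i\<close>; outside it the prongs of larger index. The trapezoid passes between all
  of them.\<close>

lemma bridge_step:
  assumes D: "polygonal_diagram n D" and V: "verts D \<inter> frame n = {-1, 1}"
    and S: "\<And>c. strands D c \<inter> frame n = stage n \<eta> c0 i c \<inter> frame n"
    and i: "Suc i < n" and \<eta>: "\<eta> = 1 / (4 * (real n)\<^sup>2)"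
  shows "\<exists>D'. polygonal_diagram n D' \<and> bridge_move D D' \<and> verts D' = verts D \<and>
    (\<forall>c. strands D' c \<inter> frame n = stage n \<eta> c0 (Suc i) c \<inter> frame n)"
proof -
  define h where "h = real (Suc i)"
  define c where "c = cut_color c0 (Suc i)"
  define b where "b = \<eta> * (2 - 1 / h)"
  \<comment> \<open>The spread at the fictitious index \<open>h + 1/2\<close>: the sides of the
    trapezoid lie outside the nearly vertical parts of index \<open>h\<close> and inside those of
    index \<open>h + 1\<close> and more.\<close>
  define \<beta> where "\<beta> = \<eta> * (2 - 1 / (h + 1 / 2))"
  \<comment> \<open>The bounds \<open>lo\<close> and \<open>hi\<close> lie half a unit above height
    \<open>h - 1\<close>, which no finished tent exceeds, and half a unit below height
    \<open>2 * n - h + 1\<close>, which no finished cap undercuts.\<close>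
  define lo where "lo = h - 1 / 2"
  define hi where "hi = 2 * real n - h + 1 / 2"
  define K where "K = trapezoid lo hi \<eta> \<beta>"
  define y where "y = (1 - \<eta>) / (1 / h + \<beta>)"
  define U where "U = prongs h \<eta> b"
  define T where "T = tent h \<union> cap (2 * real n - h) \<eta> b"
  have h1: "1 \<le> h" "h + 1 \<le> real n" using i by (simp_all add: h_def)
  have n0: "0 < real n" using h1 by linarith
  have \<eta>0: "0 < \<eta>" using n0 by (simp add: \<eta>)
  have inv: "0 < 1 / h" "1 / h \<le> 1" "0 < 1 / (h + 1 / 2)" "1 / (h + 1 / 2) < 1 / h"
    using h1 by (simp_all add: divide_simps)
  have b: "0 < b" "b < \<beta>" unfolding b_def \<beta>_def
    using \<eta>0 inv by (intro mult_pos_pos mult_strict_left_mono; linarith)+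
  have \<beta>2: "\<beta> < 2 * \<eta>"
  proof -
    have "\<eta> * (2 - 1 / (h + 1 / 2)) < \<eta> * 2" using \<eta>0 inv by (intro mult_strict_left_mono) linarith+
    then show ?thesis by (simp add: \<beta>_def)
  qed
  have den: "0 < 1 / h + \<beta>" using inv b by linarith
  have yeq: "\<eta> + \<beta> * y = 1 - y / h"
  proof -
    have "y * (1 / h + \<beta>) = 1 - \<eta>" using den by (simp add: y_def)
    then show ?thesis by (simp add: algebra_simps)
  qed
  \<comment> \<open>Here the value of \<open>\<eta>\<close> is used: at height \<open>lo\<close> the
    legs are at distance \<open>1 / (2 * h)\<close> from the axis, and this must exceed the
    half-width of the trapezoid there, which is below \<open>2 * h * \<eta>\<close>.\<close>
  have \<eta>h: "2 * h * \<eta> < 1 / (2 * h)"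
  proof -
    have "h * h < real n * real n" using h1 by (intro mult_strict_mono) linarith+
    then have "4 * (h * h) * \<eta> < 1" using n0 by (simp add: \<eta> divide_simps power2_eq_square)
    then show ?thesis using h1 by (simp add: divide_simps algebra_simps)
  qed
  have loy: "lo < y"
  proof -
    have "lo * \<beta> \<le> lo * (2 * \<eta>)" using \<beta>2 h1 by (intro mult_left_mono) (auto simp: lo_def)
    moreover have "lo * (2 * \<eta>) = 2 * h * \<eta> - \<eta>" by (simp add: lo_def algebra_simps)
    moreover have "lo * (1 / h) = 1 - 1 / (2 * h)" using h1 by (simp add: lo_def diff_divide_distrib)
    ultimately have "lo * (1 / h + \<beta>) < 1 - \<eta>" unfolding distrib_left using \<eta>h by linarith
    then show ?thesis using den by (simp add: y_def pos_less_divide_eq)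
  qed
  have lo0: "0 < lo" "lo < hi" using h1 by (simp_all add: lo_def hi_def)
  have hh: "0 < h" "h < 2 * real n - h" "2 * real n - h < hi" using h1 by (simp_all add: hi_def)
  obtain p q r s A B A' B' where br: "arc_across K p q A" "arc_across K r s B" "A \<inter> B = {}"
     "arc_across K q r A'" "arc_across K s p B'" "A' \<inter> B' = {}" "polygonal A'" "polygonal B'"
     "U \<inter> K = A \<union> B" "T \<inter> K = A' \<union> B'"
    using trapezoid_bridge(1)[OF hh lo0(1) loy \<eta>0 b yeq, folded K_def U_def T_def] by (elim exE conjE)
  have UT: "U - K = T - K" using trapezoid_bridge(2)[OF hh lo0(1) loy \<eta>0 b yeq] by (simp add: K_def U_def T_def)
  have \<beta>0: "0 < \<beta>" using b by linarith
  note disc = trapezoid_disc[OF lo0(2) \<eta>0 \<beta>0 lo0(1), folded K_def]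
  have memK: "z \<in> K \<longleftrightarrow> lo \<le> Im z \<and> Im z \<le> hi \<and> \<bar>Re z\<bar> \<le> \<eta> + \<beta> * Im z" for z by (simp add: K_def trapezoid_def)
  have KF: "K \<subseteq> frame n"
  proof
    fix z assume "z \<in> K"
    then have z: "lo \<le> Im z" "Im z \<le> hi" "\<bar>Re z\<bar> \<le> \<eta> + \<beta> * Im z" by (simp_all add: memK)
    have im: "\<bar>Im z\<bar> < 3 * real n" using z(1,2) lo0(1) h1 by (simp add: hi_def)
    have n2: "2 \<le> real n" using h1 by linarith
    have "\<beta> * Im z \<le> (2 * \<eta>) * (3 * real n)" using \<beta>2 \<beta>0 im n0 z(1) lo0 by (intro mult_mono) linarith+
    moreover have "\<eta> * real n \<le> 1 / 8" using n2 by (simp add: \<eta> power2_eq_square divide_simps)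
    moreover have "\<eta> \<le> \<eta> * real n" using n2 \<eta>0 by simp
    ultimately have "\<bar>Re z\<bar> < 3" using z(3) by linarith
    then show "z \<in> frame n" using im by (simp add: frame_def)
  qed
  define R where "R d = lower_part n c0 d \<union>
     (\<Union>j\<in>{j. 1 \<le> j \<and> j \<le> i \<and> cut_color c0 j = d}. tent (real j) \<union> cap (2 * real n - real j) \<eta> (\<eta> * (2 - 1 / real j))) \<union>
     (\<Union>j\<in>{j. Suc i < j \<and> j < n \<and> cut_color c0 j = d}. upper_strands \<eta> j)" for d
  have st: "stage n \<eta> c0 i d = R d \<union> (if d = c then U else {})" for d
  proof -
    have "{j. i < j \<and> j < n \<and> cut_color c0 j = d} = {j. Suc i < j \<and> j < n \<and> cut_color c0 j = d} \<union> (if d = c then {Suc i} else {})"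
      using i by (auto simp: c_def less_Suc_eq Suc_less_eq dest: Suc_lessI)
    then show ?thesis unfolding stage_def R_def
      by (simp add: U_def b_def h_def upper_strands_eq_prongs Un_ac)
  qed
  have st': "stage n \<eta> c0 (Suc i) d = R d \<union> (if d = c then T else {})" for d
  proof -
    have "{j. 1 \<le> j \<and> j \<le> Suc i \<and> cut_color c0 j = d} = {j. 1 \<le> j \<and> j \<le> i \<and> cut_color c0 j = d} \<union> (if d = c then {Suc i} else {})"
      by (auto simp: c_def le_Suc_eq)
    then show ?thesis unfolding stage_def R_def
      by (simp add: T_def b_def h_def Un_ac)
  qed
  have RK: "R d \<inter> K = {}" for d
  proof -
    have False if z: "z \<in> R d" "z \<in> K" for z
    proof -
      have k: "h - 1 / 2 \<le> Im z" "Im z \<le> 2 * real n - h + 1 / 2" "\<bar>Re z\<bar> \<le> \<eta> + \<beta> * Im z" "0 < Im z"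
        using z(2) lo0 by (auto simp: memK lo_def hi_def)
      consider "z \<in> lower_part n c0 d" | j where "j \<le> i" "z \<in> tent (real j)"
        | j where "j \<le> i" "z \<in> cap (2 * real n - real j) \<eta> (\<eta> * (2 - 1 / real j))"
        | j where "Suc i < j" "z \<in> upper_strands \<eta> j"
        using z(1) unfolding R_def by blast
      then show False
      proof cases
        case 1 then show False using lower_part_below k by fastforce
      next
        case 2
        then have "real j \<le> h - 1" by (simp add: h_def)
        moreover have "Im z \<le> real j" using 2(2) by (auto simp: tent_def intro: mult_left_le)
        ultimately show False using k(1) by linarith
      next
        case 3
        then have "real j \<le> h - 1" by (simp add: h_def)
        moreover have "2 * real n - real j \<le> Im z" using 3(2) by (simp add: cap_def)
        ultimately show False using k(2) by linarith
      next
        case 4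
        \<comment> \<open>A prong is at least as far from the axis as its nearly vertical part
          prescribes, and for a larger index this is already outside the trapezoid.\<close>
        have j: "h + 1 \<le> real j" using 4(1) by (simp add: h_def)
        then have "1 / real j < 1 / (h + 1 / 2)" using h1 by (intro divide_strict_left_mono mult_pos_pos) linarith+
        then have "\<beta> < \<eta> * (2 - 1 / real j)" unfolding \<beta>_def using \<eta>0 by (intro mult_strict_left_mono) linarith+
        then have "\<beta> * Im z < \<eta> * (2 - 1 / real j) * Im z" using k(4) by (intro mult_strict_right_mono)
        moreover have "\<eta> + \<eta> * (2 - 1 / real j) * Im z \<le> \<bar>Re z\<bar>" using 4(2) by (simp add: upper_strands_eq_prongs prongs_def)
        ultimately show False using k(3) by linarith
      qed
    qed
    then show ?thesis by blast
  qed
  have co: "c \<noteq> other c" "d = c \<or> d = other c" for d by (cases c; cases d; simp)+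
  have sK: "strands D d \<inter> K = (if d = c then A \<union> B else {})" for d
  proof -
    have "strands D d \<inter> K = stage n \<eta> c0 i d \<inter> K" using S[of d] KF by blast
    also have "\<dots> = (if d = c then U \<inter> K else {})" unfolding st using RK[of d] by auto
    finally show ?thesis using br(9) by simp
  qed
  have "Im z < lo" if "z \<in> {-1, 1}" for z using that lo0 by auto
  then have "{-1, 1} \<inter> K = {}" using memK by force
  then have VK: "verts D \<inter> K = {}" using V KF by blast
  obtain D' where D': "polygonal_diagram n D'" "bridge_move D D'" "verts D' = verts D"
     "strands D' c = (strands D c - K) \<union> (A' \<union> B')" "strands D' (other c) = strands D (other c)"
    using bridge_exists[OF D disc(2,1) br(1-6) VK, of c] sK[of c] sK[of "other c"] co(1) br(7,8) by auto
  have "strands D' d \<inter> frame n = stage n \<eta> c0 (Suc i) d \<inter> frame n" for d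
  proof (cases "d = c")
    case True
    have "stage n \<eta> c0 (Suc i) c = (R c - K) \<union> (T - K) \<union> (T \<inter> K)" unfolding st' using RK[of c] by auto
    also have "\<dots> = (stage n \<eta> c0 i c - K) \<union> (A' \<union> B')" unfolding st UT[symmetric] br(10) by auto
    finally have e: "stage n \<eta> c0 (Suc i) c = (stage n \<eta> c0 i c - K) \<union> (A' \<union> B')" .
    show ?thesis unfolding True D'(4) e using S[of c] by blast
  next
    case False
    then show ?thesis using co(2)[of d] S[of d] D'(5) unfolding st st' by auto
  qed
  then show ?thesis using D'(1-3) by blast
qed

lemma all_bridges:
  assumes D: "polygonal_diagram n D" and V: "verts D \<inter> frame n = {-1, 1}"
    and S: "\<And>c. strands D c \<inter> frame n = stage n \<eta> c0 0 c \<inter> frame n"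
    and i: "i < n" and \<eta>: "\<eta> = 1 / (4 * (real n)\<^sup>2)"
  shows "\<exists>D'. polygonal_diagram n D' \<and> (null_homotopic n D' \<longrightarrow> null_homotopic n D) \<and> verts D' = verts D \<and>
    (\<forall>c. strands D' c \<inter> frame n = stage n \<eta> c0 i c \<inter> frame n)"
  using i
proof (induction i)
  case 0
  then show ?case using D S by blast
next
  case (Suc i)
  then obtain D1 where D1: "polygonal_diagram n D1" "null_homotopic n D1 \<Longrightarrow> null_homotopic n D" "verts D1 = verts D"
    "\<And>c. strands D1 c \<inter> frame n = stage n \<eta> c0 i c \<inter> frame n" by (metis Suc_lessD)
  have "verts D1 \<inter> frame n = {-1, 1}" using V D1(3) by simp
  then obtain D2 where D2: "polygonal_diagram n D2" "bridge_move D1 D2" "verts D2 = verts D1"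
    "\<And>c. strands D2 c \<inter> frame n = stage n \<eta> c0 (Suc i) c \<inter> frame n"
    using bridge_step[OF D1(1) _ D1(4) Suc.prems \<eta>] by blast
  have "move n D1 D2" unfolding move_def using D1(1) D2(1,2) polygonal_is_diagram by blast
  then have "null_homotopic n D" if "null_homotopic n D2" using null_homotopic_move that D1(2) by blast
  then show ?case using D2 D1(3) by metis
qed

text \<open>The coordinates are exchanged, which makes the edge vertical, and then sheared by
  \<open>(n - 1) / 2\<close> times the distance from its middle. The tent of height
  \<open>j\<close>, with the edge as \<open>j = 0\<close>, thereby becomes the middle edge through
  \<open>(j + 1, 2)\<close>, and a lower half-edge of slope \<open>- k\<close> reaches the boundary
  at \<open>n - k\<close>, because \<open>1 - k + 2 * ((n - 1) / 2) = n - k\<close>.\<close>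

definition to_model :: "nat \<Rightarrow> complex \<Rightarrow> complex" where
  "to_model n z = Complex (Im z + 1 + (real n - 1) / 2 * \<bar>Re z\<bar>) (Re z + 2)"

definition from_model :: "nat \<Rightarrow> complex \<Rightarrow> complex" where
  "from_model n w = Complex (Im w - 2) (Re w - 1 - (real n - 1) / 2 * \<bar>Im w - 2\<bar>)"

lemma to_model_from_model: "to_model n (from_model n w) = w" "from_model n (to_model n z) = z"
  by (simp_all add: to_model_def from_model_def complex_eq_iff)

lemma to_model: "pw_affine (to_model n)" "plane_homeo (to_model n)"
proof -
  show p: "pw_affine (to_model n)" unfolding to_model_def[abs_def]
    by (intro pw_affine_Complex pw_affine_add pw_affine_mult pw_affine_abs pw_affine_Re pw_affine_Im pw_affine_const)
  show "plane_homeo (to_model n)"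
  proof (rule plane_homeoI)
    show "continuous_on UNIV (to_model n)" using p by (rule pw_affine_continuous)
    show "inj (to_model n)" by (rule inj_on_inverseI[where g = "from_model n"]) (simp add: to_model_from_model)
    show "\<exists>z. to_model n z = w" for w using to_model_from_model(1) by blast
  qed
qed

text \<open>Points of the model rectangle correspond to points of height at most \<open>n\<close>,
  whereas the caps lie at height \<open>n + 1\<close> or more. So only the edge, the tents and the
  lower half-edges are seen, and each is matched by comparing affine equations.\<close>

lemma from_model_pieces:
  assumes w: "w \<in> model_rect n" and n: "n \<ge> 1"
  shows "from_model n w \<in> closed_segment (-1) 1 \<longleftrightarrow> w \<in> waist n 1"
    "from_model n w \<in> tent (real j) \<longleftrightarrow> w \<in> waist n (Suc j)"
    "k < n \<Longrightarrow> from_model n w \<in> lower_strands k \<longleftrightarrow> w \<in> foot n (n - k) \<union> head n (n - k)"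
    "j < n \<Longrightarrow> from_model n w \<notin> cap (2 * real n - real j) \<eta> b"
    "from_model n w \<in> frame n"
proof -
  let ?X = "Im w - 2" let ?Y = "Re w - 1 - (real n - 1) / 2 * \<bar>Im w - 2\<bar>"
  have r: "0 \<le> Re w" "Re w \<le> real n + 1" "0 \<le> Im w" "Im w \<le> 4" using w by (simp_all add: model_rect_def)
  have n1: "1 \<le> real n" using n by simp
  have co: "Re (from_model n w) = ?X" "Im (from_model n w) = ?Y" by (simp_all add: from_model_def)
  have m: "0 \<le> (real n - 1) / 2 * \<bar>?X\<bar>" "(real n - 1) / 2 * \<bar>?X\<bar> \<le> real n - 1"
  proof -
    show "0 \<le> (real n - 1) / 2 * \<bar>?X\<bar>" using n1 by simp
    have "(real n - 1) / 2 * \<bar>?X\<bar> \<le> (real n - 1) / 2 * 2" using n1 r by (intro mult_left_mono) auto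
    then show "(real n - 1) / 2 * \<bar>?X\<bar> \<le> real n - 1" by simp
  qed
  have half: "(real n + 1) / 2 - real i = (real n - 1) / 2 + 1 - real i" for i by (simp add: field_simps)
  show "from_model n w \<in> closed_segment (-1) 1 \<longleftrightarrow> w \<in> waist n 1"
    unfolding axis_eq waist_eq mem_Collect_eq co half by (auto simp: algebra_simps abs_le_iff)
  show "from_model n w \<in> tent (real j) \<longleftrightarrow> w \<in> waist n (Suc j)"
    unfolding tent_def waist_eq mem_Collect_eq co half by (auto simp: algebra_simps abs_le_iff)
  show "from_model n w \<notin> cap (2 * real n - real j) \<eta> b" if "j < n"
  proof
    assume "from_model n w \<in> cap (2 * real n - real j) \<eta> b"
    then have "2 * real n - real j \<le> ?Y" unfolding cap_def mem_Collect_eq co by linarith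
    moreover have "real j + 1 \<le> real n" using that by simp
    ultimately show False using r m by linarith
  qed
  show "from_model n w \<in> frame n" unfolding frame_def mem_Collect_eq co using r m n1 by linarith
  show "from_model n w \<in> lower_strands k \<longleftrightarrow> w \<in> foot n (n - k) \<union> head n (n - k)" if "k < n"
  proof -
    have nk: "real (n - k) = real n - real k" using that by simp
    consider "Im w \<le> 1" | "1 < Im w" "Im w < 3" | "3 \<le> Im w" by linarith
    then show ?thesis
    proof cases
      case 1
      then have a: "\<bar>?X\<bar> = 2 - Im w" by simp
      show ?thesis unfolding lower_strands_def foot_eq head_eq mem_Collect_eq Un_iff co a nk using 1 r
        by (auto simp: algebra_simps add_divide_distrib diff_divide_distrib)
    next
      case 2
      then have "\<bar>?X\<bar> < 1" by linarith
      then show ?thesis unfolding lower_strands_def foot_eq head_eq mem_Collect_eq Un_iff co using 2 by simp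
    next
      case 3
      then have a: "\<bar>?X\<bar> = Im w - 2" by simp
      show ?thesis unfolding lower_strands_def foot_eq head_eq mem_Collect_eq Un_iff co a nk using 3 r
        by (auto simp: algebra_simps add_divide_distrib diff_divide_distrib)
    qed
  qed
qed

text \<open>The edge of color \<open>c0\<close> becomes the first middle edge, so the leftmost
  strand has the opposite color.\<close>

lemma model_colors:
  shows "k < n \<Longrightarrow> fan_color c0 (n + 1 + k) = strand_color (other c0) (n - k)"
    "other (strand_color (other c0) (Suc j)) = cut_color c0 j"
proof -
  show "fan_color c0 (n + 1 + k) = strand_color (other c0) (n - k)" if "k < n"
  proof -
    have "even (n + 1 + k) \<longleftrightarrow> odd (n - k)" using that by (simp add: even_diff_nat)
    then show ?thesis by (cases c0) (simp_all add: fan_color_def strand_color_def)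
  qed
  show "other (strand_color (other c0) (Suc j)) = cut_color c0 j"
    by (cases c0) (simp_all add: strand_color_def cut_color_def)
qed

lemma stage_model:
  assumes w: "w \<in> model_rect n" and n: "n \<ge> 2"
  shows "from_model n w \<in> stage n \<eta> c0 (n - 1) d \<longleftrightarrow> w \<in> pair_picture n (other c0) d"
proof -
  have n1: "n \<ge> 1" using n by simp
  note P = from_model_pieces[OF w n1]
  have 1: "from_model n w \<in> axis c0 d \<longleftrightarrow> d = c0 \<and> w \<in> waist n (Suc 0)" using P(1) by (simp add: axis_def)
  have 2: "(\<exists>k<n. fan_color c0 (n + 1 + k) = d \<and> from_model n w \<in> lower_strands k) \<longleftrightarrow>
    (\<exists>i\<in>{1..n}. strand_color (other c0) i = d \<and> w \<in> foot n i \<union> head n i)" (is "?l \<longleftrightarrow> ?r")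
  proof
    assume ?l
    then obtain k where "k < n" "fan_color c0 (n + 1 + k) = d" "from_model n w \<in> lower_strands k" by blast
    then show ?r using P(3) model_colors(1) by (intro bexI[of _ "n - k"]) auto
  next
    assume ?r
    then obtain i where i: "1 \<le> i" "i \<le> n" "strand_color (other c0) i = d" "w \<in> foot n i \<union> head n i" by auto
    have k: "n - i < n" "n - (n - i) = i" using i(1,2) by simp_all
    show ?l using P(3)[OF k(1)] model_colors(1)[OF k(1), of c0] i k by (intro exI[of _ "n - i"]) simp
  qed
  have 3: "(\<exists>j. 1 \<le> j \<and> j \<le> n - 1 \<and> cut_color c0 j = d \<and> from_model n w \<in> tent (real j) \<union> cap (2 * real n - real j) \<eta> (\<eta> * (2 - 1 / real j)))
     \<longleftrightarrow> (\<exists>j. 1 \<le> j \<and> j < n \<and> cut_color c0 j = d \<and> w \<in> waist n (Suc j))"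
  proof -
    have "from_model n w \<in> tent (real j) \<union> cap (2 * real n - real j) \<eta> (\<eta> * (2 - 1 / real j)) \<longleftrightarrow> w \<in> waist n (Suc j)"
      if "j < n" for j using P(2)[of j] P(4)[OF that] by simp
    moreover have "j \<le> n - 1 \<longleftrightarrow> j < n" for j using n1 by linarith
    ultimately show ?thesis by (intro ex_cong1) auto
  qed
  \<comment> \<open>Waist \<open>1\<close> is the edge and waist \<open>j + 1\<close> the tent of
    height \<open>j\<close>; as \<open>cut_color c0 0 = c0\<close>, the edge is covered as the case
    \<open>j = 0\<close>.\<close>
  have 4: "(\<exists>i\<in>{1..n}. other (strand_color (other c0) i) = d \<and> w \<in> waist n i) \<longleftrightarrow>
     (d = c0 \<and> w \<in> waist n (Suc 0)) \<or> (\<exists>j. 1 \<le> j \<and> j < n \<and> cut_color c0 j = d \<and> w \<in> waist n (Suc j))" (is "?l \<longleftrightarrow> ?r")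
  proof
    assume ?l
    then obtain i where i: "1 \<le> i" "i \<le> n" "other (strand_color (other c0) i) = d" "w \<in> waist n i" by auto
    obtain j where j: "i = Suc j" using i(1) by (cases i) auto
    have c: "cut_color c0 j = d" using i(3) model_colors(2)[of c0 j] j by simp
    show ?r
    proof (cases "j = 0")
      case True then show ?thesis using c i(4) j by (simp add: cut_color_def)
    next
      case False then show ?thesis using c i j by (intro disjI2 exI[of _ j]) simp
    qed
  next
    assume ?r
    then obtain j where j: "j < n" "cut_color c0 j = d" "w \<in> waist n (Suc j)"
    proof
      assume "d = c0 \<and> w \<in> waist n (Suc 0)"
      then show ?thesis using n by (intro that[of 0]) (simp_all add: cut_color_def)
    next
      assume "\<exists>j. 1 \<le> j \<and> j < n \<and> cut_color c0 j = d \<and> w \<in> waist n (Suc j)"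
      then show ?thesis using that by blast
    qed
    then show ?l using model_colors(2)[of c0 j] by (intro bexI[of _ "Suc j"]) auto
  qed
  have "from_model n w \<in> stage n \<eta> c0 (n - 1) d \<longleftrightarrow> from_model n w \<in> axis c0 d \<or>
    (\<exists>k<n. fan_color c0 (n + 1 + k) = d \<and> from_model n w \<in> lower_strands k) \<or>
    (\<exists>j. 1 \<le> j \<and> j \<le> n - 1 \<and> cut_color c0 j = d \<and> from_model n w \<in> tent (real j) \<union> cap (2 * real n - real j) \<eta> (\<eta> * (2 - 1 / real j)))"
  proof -
    have "{j. n - 1 < j \<and> j < n \<and> cut_color c0 j = d} = {}" by auto
    then show ?thesis unfolding stage_def lower_part_def by (simp del: Un_iff add: Un_iff[of _ "_ \<union> _"] Un_iff[of _ "axis _ _"]) blast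
  qed
  moreover have "w \<in> pair_picture n (other c0) d \<longleftrightarrow>
    (\<exists>i\<in>{1..n}. strand_color (other c0) i = d \<and> w \<in> foot n i \<union> head n i) \<or>
    (\<exists>i\<in>{1..n}. other (strand_color (other c0) i) = d \<and> w \<in> waist n i)"
    unfolding pair_picture_eq by blast
  ultimately show ?thesis unfolding 1 2 3 4 by blast
qed

text \<open>With all \<open>n - 1\<close> pairs joined, the edge and the tents are the
  \<open>n\<close> parallel edges of the model picture, and the lower half-edges at the two vertices
  are its outer strands.\<close>

lemma cancel_stage:
  assumes D: "polygonal_diagram n D" and V: "verts D \<inter> frame n = {-1, 1}" and n: "n \<ge> 2"
    and S: "\<And>c. strands D c \<inter> frame n = stage n \<eta> c0 (n - 1) c \<inter> frame n"
  shows "\<exists>D'. polygonal_diagram n D' \<and> (null_homotopic n D' \<longrightarrow> null_homotopic n D) \<and> card (verts D') < card (verts D)"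
proof -
  let ?f = "to_model n" and ?g = "from_model n" and ?c = "other c0"
  let ?E = "map_diagram ?f D"
  have n1: "n \<ge> 1" using n by simp
  have inv: "?f z = w \<longleftrightarrow> z = ?g w" for z w using to_model_from_model by metis
  have im: "w \<in> ?f ` X \<longleftrightarrow> ?g w \<in> X" for w X
    using to_model_from_model by (metis image_iff)
  have E: "polygonal_diagram n ?E" using polygonal_map[OF to_model(2,1) D] .
  have ends: "?f (-1) = lower_vertex n" "?f 1 = upper_vertex n"
    by (simp_all add: to_model_def lower_vertex_def upper_vertex_def complex_eq_iff field_simps)
  have LU: "{lower_vertex n, upper_vertex n} \<subseteq> model_rect n" by (simp add: lower_vertex_def upper_vertex_def model_rect_def field_simps)
  have VE: "verts ?E \<inter> model_rect n = {lower_vertex n, upper_vertex n}"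
  proof -
    have "w \<in> verts ?E \<longleftrightarrow> w \<in> {lower_vertex n, upper_vertex n}" if "w \<in> model_rect n" for w
    proof -
      have "w \<in> verts ?E \<longleftrightarrow> ?g w \<in> verts D \<inter> frame n" using from_model_pieces(5)[OF that n1] by (simp add: im)
      also have "\<dots> \<longleftrightarrow> w \<in> ?f ` {-1, 1}" unfolding V im ..
      finally show ?thesis by (simp add: ends)
    qed
    then show ?thesis using LU by blast
  qed
  have pp: "pair_picture n ?c d \<subseteq> model_rect n" for d
    unfolding pair_picture_eq using pieces_in_rect(1-3) by fastforce
  have SE: "strands ?E d \<inter> model_rect n = pair_picture n ?c d" for d
  proof -
    have "w \<in> strands ?E d \<longleftrightarrow> w \<in> pair_picture n ?c d" if "w \<in> model_rect n" for w
    proof -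
      have "w \<in> strands ?E d \<longleftrightarrow> ?g w \<in> strands D d \<inter> frame n" using from_model_pieces(5)[OF that n1] by (simp add: strands_map im)
      also have "\<dots> \<longleftrightarrow> ?g w \<in> stage n \<eta> c0 (n - 1) d" unfolding S using from_model_pieces(5)[OF that n1] by simp
      finally show ?thesis using stage_model[OF that n] by simp
    qed
    then show ?thesis using pp[of d] by blast
  qed
  obtain D' where D': "polygonal_diagram n D'" "cancel_move n ?E D'" "verts D' = verts ?E - {lower_vertex n, upper_vertex n}"
    using cancel_exists[OF E n VE SE] by blast
  have "move n ?E D'" unfolding move_def using E D'(1,2) polygonal_is_diagram by blast
  then have "null_homotopic n D" if "null_homotopic n D'"
    using null_homotopic_move null_homotopic_map[OF to_model(2)] that by blast
  moreover have "card (verts D') < card (verts D)"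
  proof -
    have f: "finite (verts D)" using polygonal_diagramD(1)[OF D] .
    have "verts D' \<subset> verts ?E" using D'(3) VE by blast
    then have "card (verts D') < card (verts ?E)" using f by (intro psubset_card_mono) simp_all
    also have "\<dots> \<le> card (verts D)" using card_image_le[OF f] by simp
    finally show ?thesis .
  qed
  ultimately show ?thesis using D'(1) by blast
qed

section \<open>Induction on the number of vertices\<close>

lemma polygonal_null_homotopic:
  assumes "n \<ge> 2" "polygonal_diagram n D" shows "null_homotopic n D"
  using assms(2)
proof (induction "card (verts D)" arbitrary: D rule: less_induct)
  case less
  show ?case
  proof (cases "verts D = {}")
    case True
    then show ?thesis using null_homotopic_no_verts less.prems by blast
  next
    case False
    define \<eta> where "\<eta> = 1 / (4 * (real n)\<^sup>2)"
    have "1 \<le> (real n)\<^sup>2" using assms(1) by simp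
    then have "1 < 4 * (real n)\<^sup>2" by linarith
    then have \<eta>: "0 < \<eta>" "\<eta> < 1" using assms(1) by (simp_all add: \<eta>_def pos_divide_less_eq)
    obtain f c0 where f: "plane_homeo f" "polygonal_diagram n (map_diagram f D)" "verts (map_diagram f D) \<inter> frame n = {-1, 1}"
      "\<And>c. strands (map_diagram f D) c \<inter> frame n =
         (lower_part n c0 c \<union> (\<Union>j\<in>{j. 1 \<le> j \<and> j < n \<and> cut_color c0 j = c}. upper_strands \<eta> j)) \<inter> frame n"
      using normal_form[OF less.prems assms(1) False \<eta>] by blast
    have s0: "strands (map_diagram f D) c \<inter> frame n = stage n \<eta> c0 0 c \<inter> frame n" for c
      unfolding f(4) stage_def by (simp add: Suc_le_eq)
    have "n - 1 < n" using assms(1) by simp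
    then obtain D1 where D1: "polygonal_diagram n D1" "null_homotopic n D1 \<Longrightarrow> null_homotopic n (map_diagram f D)"
        "verts D1 = verts (map_diagram f D)" "\<And>c. strands D1 c \<inter> frame n = stage n \<eta> c0 (n - 1) c \<inter> frame n"
      using all_bridges[OF f(2,3) s0 _ \<eta>_def] by blast
    have "verts D1 \<inter> frame n = {-1, 1}" using D1(3) f(3) by simp
    then obtain D2 where D2: "polygonal_diagram n D2" "null_homotopic n D2 \<Longrightarrow> null_homotopic n D1" "card (verts D2) < card (verts D1)"
      using cancel_stage[OF D1(1) _ assms(1) D1(4)] by blast
    have "card (verts D1) \<le> card (verts D)" using D1(3) card_image_le[OF polygonal_diagramD(1)[OF less.prems]] by simp
    then have "null_homotopic n D2" using less.hyps D2(1,3) by simp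
    then show ?thesis using D1(2) D2(2) null_homotopic_map[OF f(1)] by blast
  qed
qed

theorem corollary3p1:
  fixes n :: nat and D :: diagram
  assumes "n \<ge> 2" and "is_diagram n D"
  shows "homotopic n D empty_diagram"
proof -
  obtain f f' P where P: "homeomorphism UNIV UNIV f f'" "polygonal_diagram n P" "D = map_diagram f P"
    using assms(2) unfolding is_diagram_def by blast
  have "plane_homeo f" using P(1) unfolding plane_homeo_def by blast
  \<comment> \<open>The homeomorphism that relates an arbitrary drawing to a polygonal one carries
    the whole null-homotopy along and fixes the empty diagram.\<close>
  then have "homotopic n (map_diagram f P) (map_diagram f empty_diagram)"
    using map_homotopic polygonal_null_homotopic[OF assms(1) P(2)] by blast
  then show ?thesis by (simp add: P(3))
qed

end
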